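(* Let $\underline H$ be a homogeneously finite Hopf $G$-coalgebra, and $A$ a right $G$-$\underline H$-comodule algebra. Then the left dual graded ring $R=\bigoplus_{\alpha\in G}{}_A\mathrm{Hom}(A\otimes H_{\alpha^{-1}},A)$ of the $G$-$A$-coring $A\otimes\underline H$ is isomorphic to $K^{\mathrm{op}}\#A$ as a $G$-graded $A$-ring. Consequently, the categories $\mathcal M_A^{G,\underline H}$ and $\mathcal M^G_{K^{\mathrm{op}}\#A}$ are isomorphic.
   Context: $G$ is a group with unit $e$, $k$ a commutative ring, $\otimes=\otimes_k$. A $G$-coalgebra is a family $\underline H=(H_\alpha)_{\alpha\in G}$ of $k$-modules with $k$-linear maps $\Delta_{\alpha,\beta}:H_{\alpha\beta}\to H_\alpha\otimes H_\beta$, $\Delta_{\alpha,\beta}(h)=h_{(1,\alpha)}\otimes h_{(2,\beta)}$, and $\epsilon:H_e\to k$ satisfying $(\Delta_{\alpha,\beta}\otimes H_\gamma)\Delta_{\alpha\beta,\gamma}=(H_\alpha\otimes\Delta_{\beta,\gamma})\Delta_{\alpha,\beta\gamma}$ and $(H_\alpha\otimes\epsilon)\Delta_{\alpha,e}=H_\alpha=(\epsilon\otimes H_\alpha)\Delta_{e,\alpha}$. A Hopf $G$-coalgebra is a $G$-coalgebra in which every $H_\alpha$ is a $k$-algebra, all $\Delta_{\alpha,\beta}$ and $\epsilon$ are algebra maps, and there are maps $S_\alpha:H_{\alpha^{-1}}\to H_\alpha$ with $S_\alpha(h_{(1,\alpha^{-1})})h_{(2,\alpha)}=h_{(1,\alpha)}S_\alpha(h_{(2,\alpha^{-1})})=\epsilon(h)1_{H_\alpha}$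 for $h\in H_e$. It is homogeneously finite if every $H_\alpha$ is a finitely generated projective $k$-module. A right $G$-$\underline H$-comodule algebra is a $k$-algebra $A$ with $k$-linear maps $\rho_\alpha:A\to A\otimes H_\alpha$, $\rho_\alpha(a)=a_{[0]}\otimes a_{[1,\alpha]}$, satisfying $(A\otimes\Delta_{\alpha,\beta})\rho_{\alpha\beta}=(\rho_\alpha\otimes H_\beta)\rho_\beta$, $(A\otimes\epsilon)\rho_e=A$, $\rho_\alpha(ab)=a_{[0]}b_{[0]}\otimes a_{[1,\alpha]}b_{[1,\alpha]}$, $\rho_\alpha(1_A)=1_A\otimes1_{H_\alpha}$. $A\otimes\underline H=(\mathcal C_\alpha)_\alpha$, $\mathcal C_\alpha=A\otimes H_\alpha$, has $A$-bimodule structure $a'(b\otimes h)a=a'ba_{[0]}\otimes ha_{[1,\alpha]}$ ($h\in H_\alpha$), comultiplication $\Delta_{\alpha,\beta}(a\otimes h)=(a\otimes h_{(1,\alpha)})\otimes_A(1_A\otimes h_{(2,\beta)})$ and counit $\varepsilon=A\otimes\epsilon$. $R=\bigoplus_\alpha R_\alpha$, $R_\alpha={}_A\mathrm{Hom}(\mathcal C_{\alpha^{-1}},A)$ (left $A$-linear maps), is a $G$-graded ring with $(f\#g)(c)=g(c_{(1,\beta^{-1})}f(c_{(2,\alpha^{-1})}))$ for $f\in R_\alpha$, $g\in R_\beta$, $c\in\mathcal C_{(\alpha\beta)^{-1}}$, unit $\varepsilon$, and ring morphism $A\to R_e$, $a\mapsto(c\mapsto\varepsilon(c)a)$. A $G$-graded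 $A$-ring is a $G$-graded ring $R$ with a ring morphism $A\to R_e$; isomorphisms are graded ring isomorphisms compatible with the morphisms from $A$. $K=\bigoplus_{\alpha\in G}K_\alpha$, $K_\alpha=H_{\alpha^{-1}}^*=\mathrm{Hom}(H_{\alpha^{-1}},k)$, with convolution product $\langle k^* * h^*,h\rangle=\langle k^*,h_{(1,\beta^{-1})}\rangle\langle h^*,h_{(2,\alpha^{-1})}\rangle$ for $k^*\in K_\beta$, $h^*\in K_\alpha$, $h\in H_{(\alpha\beta)^{-1}}$ (so $k^* * h^*\in K_{\alpha\beta}$), unit $\epsilon$, and each $K_\alpha$ the coalgebra dual to the algebra $H_{\alpha^{-1}}$, i.e. $\langle k^*,hh'\rangle=\langle k^*_{(1)},h\rangle\langle k^*_{(2)},h'\rangle$; $K$ is a Hopf algebra. $A$ is a left $K$-module algebra via $h^*\cdot a=\langle h^*,a_{[1,\alpha^{-1}]}\rangle a_{[0]}$ for $h^*\in K_\alpha$. $K^{\mathrm{op}}\#A$ is $K\otimes A$ with multiplication $(h^*\#a)(k^*\#b)=k^*_{(1)}*h^*\#(k^*_{(2)}\cdot a)b$, degree-$\alpha$ component $K_\alpha\otimes A$, and ring morphism $A\to K^{\mathrm{op}}\#A$, $a\mapsto\epsilon\#a$. $\mathcal M_A^{G,\underline H}$: objects are families $(M_\alpha)_{\alpha\in G}$ of right $A$-modules with $k$-linear maps $\rho_{\alpha,\beta}:M_{\alpha\beta}\to M_\alpha\otimes H_\beta$, $\rho_{\alpha,\beta}(m)=m_{[0,\alpha]}\otimes m_{[1,\beta]}$,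 such that $(M_\alpha\otimes\Delta_{\beta,\gamma})\rho_{\alpha,\beta\gamma}=(\rho_{\alpha,\beta}\otimes H_\gamma)\rho_{\alpha\beta,\gamma}$, $(M_\alpha\otimes\epsilon)\rho_{\alpha,e}=M_\alpha$ and $\rho_{\alpha,\beta}(ma)=m_{[0,\alpha]}a_{[0]}\otimes m_{[1,\beta]}a_{[1,\beta]}$; morphisms are families of right $A$-linear maps compatible with the $\rho_{\alpha,\beta}$. $\mathcal M^G_{K^{\mathrm{op}}\#A}$ is the category of $G$-graded right $K^{\mathrm{op}}\#A$-modules. *)

theory Defs
  imports "HOL-Algebra.Module" "HOL-Algebra.QuotRing" "HOL-Algebra.Free_Abelian_Groups"
begin

text \<open>
  Abelian groups are \<open>ring\<close> records of which only the additive part is used; \<open>k\<close>-modules and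
  \<open>k\<close>-algebras are \<open>module\<close> records over \<open>k\<close>.  Actions of noncommutative rings are separate
  functions, because the library locale \<open>module\<close> presupposes a commutative ring of scalars.
  Likewise the library locale \<open>algebra\<close> only covers commutative algebras.
\<close>

locale k_algebra = module k A + ring A for k (structure) and A (structure) +
  assumes smult_mult_left:
      "\<lbrakk>c \<in> carrier k; x \<in> carrier A; y \<in> carrier A\<rbrakk>
        \<Longrightarrow> (c \<odot>\<^bsub>A\<^esub> x) \<otimes>\<^bsub>A\<^esub> y = c \<odot>\<^bsub>A\<^esub> (x \<otimes>\<^bsub>A\<^esub> y)"
    and smult_mult_right:
      "\<lbrakk>c \<in> carrier k; x \<in> carrier A; y \<in> carrier A\<rbrakk>
        \<Longrightarrow> x \<otimes>\<^bsub>A\<^esub> (c \<odot>\<^bsub>A\<^esub> y) = c \<odot>\<^bsub>A\<^esub> (x \<otimes>\<^bsub>A\<^esub> y)"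

definition linear_maps ::
  "('k, 'z) ring_scheme \<Rightarrow> ('k, 'm, 'x) module_scheme \<Rightarrow> ('k, 'n, 'y) module_scheme \<Rightarrow> ('m \<Rightarrow> 'n) set"
  where "linear_maps k M N =
    {f \<in> carrier M \<rightarrow> carrier N.
       (\<forall>x\<in>carrier M. \<forall>y\<in>carrier M. f (x \<oplus>\<^bsub>M\<^esub> y) = f x \<oplus>\<^bsub>N\<^esub> f y) \<and>
       (\<forall>c\<in>carrier k. \<forall>x\<in>carrier M. f (c \<odot>\<^bsub>M\<^esub> x) = c \<odot>\<^bsub>N\<^esub> f x)}"

definition base_module :: "('k, 'z) ring_scheme \<Rightarrow> ('k, 'k) module"
  where "base_module k =
    \<lparr>carrier = carrier k, monoid.mult = monoid.mult k, monoid.one = monoid.one k,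
     ring.zero = ring.zero k, ring.add = ring.add k, smult = monoid.mult k\<rparr>"

definition free_module :: "('k, 'z) ring_scheme \<Rightarrow> nat \<Rightarrow> ('k, nat \<Rightarrow> 'k) module"
  where "free_module k n =
    \<lparr>carrier = (\<Pi>\<^sub>E i\<in>{..<n}. carrier k), monoid.mult = undefined, monoid.one = undefined,
     ring.zero = (\<lambda>i\<in>{..<n}. \<zero>\<^bsub>k\<^esub>), ring.add = (\<lambda>x y. \<lambda>i\<in>{..<n}. x i \<oplus>\<^bsub>k\<^esub> y i),
     smult = (\<lambda>c x. \<lambda>i\<in>{..<n}. c \<otimes>\<^bsub>k\<^esub> x i)\<rparr>"

text \<open>Finitely generated projective: a direct summand of some \<open>k\<^sup>n\<close>, with inclusion \<open>i\<close> and projection \<open>p\<close>.\<close>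

definition fg_projective :: "('k, 'z) ring_scheme \<Rightarrow> ('k, 'm, 'x) module_scheme \<Rightarrow> bool"
  where "fg_projective k P \<longleftrightarrow> module k P \<and>
    (\<exists>n. \<exists>i\<in>linear_maps k P (free_module k n). \<exists>p\<in>linear_maps k (free_module k n) P.
       \<forall>x\<in>carrier P. p (i x) = x)"


section \<open>Tensor products\<close>

text \<open>
  The tensor product over \<open>R\<close> of a right module \<open>M\<close> (action \<open>ra\<close>) and a left module \<open>N\<close>
  (action \<open>la\<close>) is the free abelian group on pairs modulo the biadditivity and balancing relations;
  its elements are cosets.
\<close>

definition tensor_relations ::
  "('r, 'z) ring_scheme \<Rightarrow> ('m, 'x) ring_scheme \<Rightarrow> ('m \<Rightarrow> 'r \<Rightarrow> 'm) \<Rightarrow>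
   ('n, 'y) ring_scheme \<Rightarrow> ('r \<Rightarrow> 'n \<Rightarrow> 'n) \<Rightarrow> ('m \<times> 'n \<Rightarrow>\<^sub>0 int) set"
  where "tensor_relations R M ra N la = generate (free_Abelian_group (carrier M \<times> carrier N))
    ({frag_of (m \<oplus>\<^bsub>M\<^esub> m', n) - frag_of (m, n) - frag_of (m', n) | m m' n.
        m \<in> carrier M \<and> m' \<in> carrier M \<and> n \<in> carrier N} \<union>
     {frag_of (m, n \<oplus>\<^bsub>N\<^esub> n') - frag_of (m, n) - frag_of (m, n') | m n n'.
        m \<in> carrier M \<and> n \<in> carrier N \<and> n' \<in> carrier N} \<union>
     {frag_of (ra m r, n) - frag_of (m, la r n) | m r n.
        m \<in> carrier M \<and> r \<in> carrier R \<and> n \<in> carrier N})"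

definition balanced_tensor ::
  "('r, 'z) ring_scheme \<Rightarrow> ('m, 'x) ring_scheme \<Rightarrow> ('m \<Rightarrow> 'r \<Rightarrow> 'm) \<Rightarrow>
   ('n, 'y) ring_scheme \<Rightarrow> ('r \<Rightarrow> 'n \<Rightarrow> 'n) \<Rightarrow> ('m \<times> 'n \<Rightarrow>\<^sub>0 int) set ring"
  where "balanced_tensor R M ra N la =
    (let Q = free_Abelian_group (carrier M \<times> carrier N) Mod tensor_relations R M ra N la
     in \<lparr>carrier = carrier Q, monoid.mult = undefined, monoid.one = undefined,
         ring.zero = monoid.one Q, ring.add = monoid.mult Q\<rparr>)"

definition balanced_pure ::
  "('r, 'z) ring_scheme \<Rightarrow> ('m, 'x) ring_scheme \<Rightarrow> ('m \<Rightarrow> 'r \<Rightarrow> 'm) \<Rightarrow>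
   ('n, 'y) ring_scheme \<Rightarrow> ('r \<Rightarrow> 'n \<Rightarrow> 'n) \<Rightarrow> 'm \<Rightarrow> 'n \<Rightarrow> ('m \<times> 'n \<Rightarrow>\<^sub>0 int) set"
  where "balanced_pure R M ra N la m n =
    tensor_relations R M ra N la #>\<^bsub>free_Abelian_group (carrier M \<times> carrier N)\<^esub> frag_of (m, n)"

text \<open>
  For a balanced biadditive \<open>b\<close> with values in \<open>P\<close>, the homomorphism that sends the pure tensor of
  \<open>m\<close> and \<open>n\<close> to \<open>b (m, n)\<close>.  It serves as Sweedler notation: if \<open>t\<close> is the tensor written
  \<open>t\<^sub>1 \<otimes> t\<^sub>2\<close>, then \<open>tensor_lift P b t\<close> is \<open>b (t\<^sub>1, t\<^sub>2)\<close>, summation understood in \<open>P\<close>.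
\<close>

definition tensor_lift ::
  "('p, 'x) ring_scheme \<Rightarrow> ('m \<times> 'n \<Rightarrow> 'p) \<Rightarrow> ('m \<times> 'n \<Rightarrow>\<^sub>0 int) set \<Rightarrow> 'p"
  where "tensor_lift P b t =
    (let c = (SOME c. c \<in> t)
     in \<Oplus>\<^bsub>P\<^esub>p\<in>Poly_Mapping.keys c. [Poly_Mapping.lookup c p] \<cdot>\<^bsub>P\<^esub> b p)"

definition pure ::
  "('k, 'z) ring_scheme \<Rightarrow> ('k, 'm, 'x) module_scheme \<Rightarrow> ('k, 'n, 'y) module_scheme \<Rightarrow>
   'm \<Rightarrow> 'n \<Rightarrow> ('m \<times> 'n \<Rightarrow>\<^sub>0 int) set"
  where "pure k M N = balanced_pure k M (\<lambda>m c. c \<odot>\<^bsub>M\<^esub> m) N (smult N)"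

text \<open>
  The tensor product over \<open>k\<close>, with the tensor product algebra structure; its multiplicative part
  is meaningful only when \<open>M\<close> and \<open>N\<close> are algebras.
\<close>

definition tensor ::
  "('k, 'z) ring_scheme \<Rightarrow> ('k, 'm, 'x) module_scheme \<Rightarrow> ('k, 'n, 'y) module_scheme \<Rightarrow>
   ('k, ('m \<times> 'n \<Rightarrow>\<^sub>0 int) set) module"
  where "tensor k M N =
    (let T = balanced_tensor k M (\<lambda>m c. c \<odot>\<^bsub>M\<^esub> m) N (smult N)
     in \<lparr>carrier = carrier T,
         monoid.mult = (\<lambda>s t. tensor_lift T (\<lambda>(m, n). tensor_lift T (\<lambda>(m', n').
                   pure k M N (m \<otimes>\<^bsub>M\<^esub> m') (n \<otimes>\<^bsub>N\<^esub> n')) t) s),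
         monoid.one = pure k M N \<one>\<^bsub>M\<^esub> \<one>\<^bsub>N\<^esub>,
         ring.zero = ring.zero T,
         ring.add = ring.add T,
         smult = (\<lambda>c. tensor_lift T (\<lambda>(m, n). pure k M N (c \<odot>\<^bsub>M\<^esub> m) n))\<rparr>)"

definition tensor_map ::
  "('k, 'z) ring_scheme \<Rightarrow> ('k, 'm, 'x) module_scheme \<Rightarrow> ('k, 'n, 'y) module_scheme \<Rightarrow>
   ('p \<Rightarrow> 'm) \<Rightarrow> ('q \<Rightarrow> 'n) \<Rightarrow> ('p \<times> 'q \<Rightarrow>\<^sub>0 int) set \<Rightarrow> ('m \<times> 'n \<Rightarrow>\<^sub>0 int) set"
  where "tensor_map k M N f g = tensor_lift (tensor k M N) (\<lambda>(p, q). pure k M N (f p) (g q))"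

text \<open>The associativity isomorphism from \<open>L \<otimes> (M \<otimes> N)\<close> to \<open>(L \<otimes> M) \<otimes> N\<close>.\<close>

definition tensor_assoc ::
  "('k, 'z) ring_scheme \<Rightarrow> ('k, 'l, 'w) module_scheme \<Rightarrow> ('k, 'm, 'x) module_scheme \<Rightarrow>
   ('k, 'n, 'y) module_scheme \<Rightarrow> ('l \<times> ('m \<times> 'n \<Rightarrow>\<^sub>0 int) set \<Rightarrow>\<^sub>0 int) set \<Rightarrow>
   (('l \<times> 'm \<Rightarrow>\<^sub>0 int) set \<times> 'n \<Rightarrow>\<^sub>0 int) set"
  where "tensor_assoc k L M N =
    (let T = tensor k (tensor k L M) N
     in tensor_lift T (\<lambda>(l, t). tensor_lift T
          (\<lambda>(m, n). pure k (tensor k L M) N (pure k L M l m) n) t))"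


section \<open>Hopf group coalgebras and comodule algebras\<close>

locale group_coalgebra = group G + cring k
  for G :: "('g, 'x) monoid_scheme" (structure) and k :: "('k, 'z) ring_scheme" (structure) +
  fixes H :: "'g \<Rightarrow> ('k, 'h) module"
    and \<Delta> :: "'g \<Rightarrow> 'g \<Rightarrow> 'h \<Rightarrow> ('h \<times> 'h \<Rightarrow>\<^sub>0 int) set"
    and \<epsilon> :: "'h \<Rightarrow> 'k"
  assumes H_module: "\<alpha> \<in> carrier G \<Longrightarrow> module k (H \<alpha>)"
    and comult_linear: "\<lbrakk>\<alpha> \<in> carrier G; \<beta> \<in> carrier G\<rbrakk>
      \<Longrightarrow> \<Delta> \<alpha> \<beta> \<in> linear_maps k (H (\<alpha> \<otimes>\<^bsub>G\<^esub> \<beta>)) (tensor k (H \<alpha>) (H \<beta>))"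
    and counit_linear: "\<epsilon> \<in> linear_maps k (H \<one>\<^bsub>G\<^esub>) (base_module k)"
    and coassoc:
      "\<lbrakk>\<alpha> \<in> carrier G; \<beta> \<in> carrier G; \<gamma> \<in> carrier G; h \<in> carrier (H (\<alpha> \<otimes>\<^bsub>G\<^esub> \<beta> \<otimes>\<^bsub>G\<^esub> \<gamma>))\<rbrakk> \<Longrightarrow>
       tensor_map k (tensor k (H \<alpha>) (H \<beta>)) (H \<gamma>) (\<Delta> \<alpha> \<beta>) id (\<Delta> (\<alpha> \<otimes>\<^bsub>G\<^esub> \<beta>) \<gamma> h) =
       tensor_assoc k (H \<alpha>) (H \<beta>) (H \<gamma>)
         (tensor_map k (H \<alpha>) (tensor k (H \<beta>) (H \<gamma>)) id (\<Delta> \<beta> \<gamma>) (\<Delta> \<alpha> (\<beta> \<otimes>\<^bsub>G\<^esub> \<gamma>) h))"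
    and counit_right: "\<lbrakk>\<alpha> \<in> carrier G; h \<in> carrier (H \<alpha>)\<rbrakk> \<Longrightarrow>
       tensor_lift (H \<alpha>) (\<lambda>(x, y). \<epsilon> y \<odot>\<^bsub>H \<alpha>\<^esub> x) (\<Delta> \<alpha> \<one>\<^bsub>G\<^esub> h) = h"
    and counit_left: "\<lbrakk>\<alpha> \<in> carrier G; h \<in> carrier (H \<alpha>)\<rbrakk> \<Longrightarrow>
       tensor_lift (H \<alpha>) (\<lambda>(x, y). \<epsilon> x \<odot>\<^bsub>H \<alpha>\<^esub> y) (\<Delta> \<one>\<^bsub>G\<^esub> \<alpha> h) = h"

locale hopf_group_coalgebra = group_coalgebra +
  fixes S :: "'b \<Rightarrow> 'd \<Rightarrow> 'd"
  assumes H_algebra: "\<alpha> \<in> carrier G \<Longrightarrow> k_algebra k (H \<alpha>)"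
    and comult_hom: "\<lbrakk>\<alpha> \<in> carrier G; \<beta> \<in> carrier G\<rbrakk>
      \<Longrightarrow> \<Delta> \<alpha> \<beta> \<in> ring_hom (H (\<alpha> \<otimes>\<^bsub>G\<^esub> \<beta>)) (tensor k (H \<alpha>) (H \<beta>))"
    and counit_hom: "\<epsilon> \<in> ring_hom (H \<one>\<^bsub>G\<^esub>) k"
    and antipode_linear: "\<alpha> \<in> carrier G \<Longrightarrow> S \<alpha> \<in> linear_maps k (H (inv\<^bsub>G\<^esub> \<alpha>)) (H \<alpha>)"
    and antipode_left: "\<lbrakk>\<alpha> \<in> carrier G; h \<in> carrier (H \<one>\<^bsub>G\<^esub>)\<rbrakk> \<Longrightarrow>
       tensor_lift (H \<alpha>) (\<lambda>(x, y). S \<alpha> x \<otimes>\<^bsub>H \<alpha>\<^esub> y) (\<Delta> (inv\<^bsub>G\<^esub> \<alpha>) \<alpha> h) = \<epsilon> h \<odot>\<^bsub>H \<alpha>\<^esub> \<one>\<^bsub>H \<alpha>\<^esub>"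
    and antipode_right: "\<lbrakk>\<alpha> \<in> carrier G; h \<in> carrier (H \<one>\<^bsub>G\<^esub>)\<rbrakk> \<Longrightarrow>
       tensor_lift (H \<alpha>) (\<lambda>(x, y). x \<otimes>\<^bsub>H \<alpha>\<^esub> S \<alpha> y) (\<Delta> \<alpha> (inv\<^bsub>G\<^esub> \<alpha>) h) = \<epsilon> h \<odot>\<^bsub>H \<alpha>\<^esub> \<one>\<^bsub>H \<alpha>\<^esub>"

definition homogeneously_finite ::
  "('g, 'x) monoid_scheme \<Rightarrow> ('k, 'z) ring_scheme \<Rightarrow> ('g \<Rightarrow> ('k, 'h) module) \<Rightarrow> bool"
  where "homogeneously_finite G k H \<longleftrightarrow> (\<forall>\<alpha>\<in>carrier G. fg_projective k (H \<alpha>))"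

locale comodule_algebra = hopf_group_coalgebra G k H \<Delta> \<epsilon> S + k_algebra k A
  for G :: "('g, 'x) monoid_scheme" (structure) and k :: "('k, 'z) ring_scheme" (structure)
    and H :: "'g \<Rightarrow> ('k, 'h) module" and \<Delta> \<epsilon> S
    and A :: "('k, 'a) module" (structure) +
  fixes \<rho> :: "'g \<Rightarrow> 'a \<Rightarrow> ('a \<times> 'h \<Rightarrow>\<^sub>0 int) set"
  assumes coact_linear: "\<alpha> \<in> carrier G \<Longrightarrow> \<rho> \<alpha> \<in> linear_maps k A (tensor k A (H \<alpha>))"
    and coact_coassoc:
      "\<lbrakk>\<alpha> \<in> carrier G; \<beta> \<in> carrier G; a \<in> carrier A\<rbrakk> \<Longrightarrow>
       tensor_assoc k A (H \<alpha>) (H \<beta>)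
         (tensor_map k A (tensor k (H \<alpha>) (H \<beta>)) id (\<Delta> \<alpha> \<beta>) (\<rho> (\<alpha> \<otimes>\<^bsub>G\<^esub> \<beta>) a)) =
       tensor_map k (tensor k A (H \<alpha>)) (H \<beta>) (\<rho> \<alpha>) id (\<rho> \<beta> a)"
    and coact_counit: "a \<in> carrier A \<Longrightarrow>
       tensor_lift A (\<lambda>(b, h). \<epsilon> h \<odot>\<^bsub>A\<^esub> b) (\<rho> \<one>\<^bsub>G\<^esub> a) = a"
    and coact_mult: "\<lbrakk>\<alpha> \<in> carrier G; a \<in> carrier A; b \<in> carrier A\<rbrakk> \<Longrightarrow>
       \<rho> \<alpha> (a \<otimes>\<^bsub>A\<^esub> b) = \<rho> \<alpha> a \<otimes>\<^bsub>tensor k A (H \<alpha>)\<^esub> \<rho> \<alpha> b"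
    and coact_one: "\<alpha> \<in> carrier G \<Longrightarrow> \<rho> \<alpha> \<one>\<^bsub>A\<^esub> = pure k A (H \<alpha>) \<one>\<^bsub>A\<^esub> \<one>\<^bsub>H \<alpha>\<^esub>"


section \<open>Direct sums and graded rings\<close>

definition direct_sum ::
  "('g, 'x) monoid_scheme \<Rightarrow> ('g \<Rightarrow> ('c, 'y) ring_scheme) \<Rightarrow> ('g \<Rightarrow> 'c) ring"
  where "direct_sum G C =
    (let D = sum_group (carrier G) (\<lambda>\<alpha>. add_monoid (C \<alpha>))
     in \<lparr>carrier = carrier D, monoid.mult = undefined, monoid.one = undefined,
         ring.zero = monoid.one D, ring.add = monoid.mult D\<rparr>)"

definition homogeneous ::
  "('g, 'x) monoid_scheme \<Rightarrow> ('g \<Rightarrow> ('c, 'y) ring_scheme) \<Rightarrow> 'g \<Rightarrow> ('g \<Rightarrow> 'c) set"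
  where "homogeneous G C \<alpha> =
    {f \<in> carrier (direct_sum G C). \<forall>\<beta>\<in>carrier G. \<beta> \<noteq> \<alpha> \<longrightarrow> f \<beta> = \<zero>\<^bsub>C \<beta>\<^esub>}"

definition inclusion ::
  "('g, 'x) monoid_scheme \<Rightarrow> ('g \<Rightarrow> ('c, 'y) ring_scheme) \<Rightarrow> 'g \<Rightarrow> 'c \<Rightarrow> 'g \<Rightarrow> 'c"
  where "inclusion G C \<alpha> x = (\<lambda>\<beta>\<in>carrier G. if \<beta> = \<alpha> then x else \<zero>\<^bsub>C \<beta>\<^esub>)"

record ('g, 'a, 'r) graded_ring = "'r ring" +
  component :: "'g \<Rightarrow> 'r set"
  from_base :: "'a \<Rightarrow> 'r"

locale graded_A_ring = group G + A: ring A + R: ring R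
  for G :: "('g, 'x) monoid_scheme" (structure) and A :: "('a, 'y) ring_scheme" (structure)
    and R :: "('g, 'a, 'r) graded_ring" (structure) +
  assumes component_subgroup: "\<alpha> \<in> carrier G \<Longrightarrow> additive_subgroup (component R \<alpha>) R"
    and decomposition: "r \<in> carrier R \<Longrightarrow>
      \<exists>!f. f \<in> (\<Pi>\<^sub>E \<alpha>\<in>carrier G. component R \<alpha>) \<and> finite {\<alpha> \<in> carrier G. f \<alpha> \<noteq> \<zero>\<^bsub>R\<^esub>} \<and>
           r = (\<Oplus>\<^bsub>R\<^esub>\<alpha>\<in>{\<alpha> \<in> carrier G. f \<alpha> \<noteq> \<zero>\<^bsub>R\<^esub>}. f \<alpha>)"
    and component_mult: "\<lbrakk>\<alpha> \<in> carrier G; \<beta> \<in> carrier G; r \<in> component R \<alpha>; s \<in> component R \<beta>\<rbrakk>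
      \<Longrightarrow> r \<otimes>\<^bsub>R\<^esub> s \<in> component R (\<alpha> \<otimes>\<^bsub>G\<^esub> \<beta>)"
    and component_one: "\<one>\<^bsub>R\<^esub> \<in> component R \<one>\<^bsub>G\<^esub>"
    and from_base_hom: "from_base R \<in> ring_hom A R"
    and from_base_degree: "a \<in> carrier A \<Longrightarrow> from_base R a \<in> component R \<one>\<^bsub>G\<^esub>"

definition graded_A_ring_isomorphic ::
  "('g, 'x) monoid_scheme \<Rightarrow> ('a, 'y) ring_scheme \<Rightarrow> ('g, 'a, 'r) graded_ring \<Rightarrow>
   ('g, 'a, 's) graded_ring \<Rightarrow> bool"
  where "graded_A_ring_isomorphic G A R R' \<longleftrightarrow> graded_A_ring G A R \<and> graded_A_ring G A R' \<and>
    (\<exists>\<phi>\<in>ring_iso R R'.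
       (\<forall>\<alpha>\<in>carrier G. \<phi> ` component R \<alpha> = component R' \<alpha>) \<and>
       (\<forall>a\<in>carrier A. \<phi> (from_base R a) = from_base R' a))"

text \<open>
  The graded ring with components \<open>C \<alpha>\<close>, given multiplications
  \<open>\<mu> \<alpha> \<beta> : C \<alpha> \<times> C \<beta> \<rightarrow> C (\<alpha> \<beta>)\<close>, a unit \<open>u\<close> in \<open>C e\<close> and a map \<open>\<iota> : A \<rightarrow> C e\<close>.
\<close>

definition graded_ring_of ::
  "('g, 'x) monoid_scheme \<Rightarrow> ('g \<Rightarrow> ('c, 'y) ring_scheme) \<Rightarrow> ('g \<Rightarrow> 'g \<Rightarrow> 'c \<Rightarrow> 'c \<Rightarrow> 'c) \<Rightarrow>
   'c \<Rightarrow> ('a \<Rightarrow> 'c) \<Rightarrow> ('g, 'a, 'g \<Rightarrow> 'c) graded_ring"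
  where "graded_ring_of G C \<mu> u \<iota> =
    \<lparr>carrier = carrier (direct_sum G C),
     monoid.mult = (\<lambda>f g. \<lambda>\<gamma>\<in>carrier G.
       \<Oplus>\<^bsub>C \<gamma>\<^esub>p\<in>{(\<alpha>, \<beta>). \<alpha> \<in> carrier G \<and> \<beta> \<in> carrier G \<and> \<alpha> \<otimes>\<^bsub>G\<^esub> \<beta> = \<gamma> \<and>
                     f \<alpha> \<noteq> \<zero>\<^bsub>C \<alpha>\<^esub> \<and> g \<beta> \<noteq> \<zero>\<^bsub>C \<beta>\<^esub>}.
         \<mu> (fst p) (snd p) (f (fst p)) (g (snd p))),
     monoid.one = inclusion G C \<one>\<^bsub>G\<^esub> u,
     ring.zero = ring.zero (direct_sum G C),
     ring.add = ring.add (direct_sum G C),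
     component = homogeneous G C,
     from_base = (\<lambda>a. inclusion G C \<one>\<^bsub>G\<^esub> (\<iota> a))\<rparr>"


section \<open>The group coring of a comodule algebra and its left dual\<close>

text \<open>The data of a \<open>G\<close>-\<open>A\<close>-coring: \<open>A\<close>-bimodules with comultiplications into \<open>\<otimes>\<^sub>A\<close> and a counit.\<close>

record ('g, 'a, 'c) group_coring =
  cgroup :: "'g \<Rightarrow> 'c ring"
  lact :: "'g \<Rightarrow> 'a \<Rightarrow> 'c \<Rightarrow> 'c"
  ract :: "'g \<Rightarrow> 'c \<Rightarrow> 'a \<Rightarrow> 'c"
  comult :: "'g \<Rightarrow> 'g \<Rightarrow> 'c \<Rightarrow> ('c \<times> 'c \<Rightarrow>\<^sub>0 int) set"
  counit :: "'c \<Rightarrow> 'a"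

definition left_hom ::
  "('a, 'y) ring_scheme \<Rightarrow> ('c, 'z) ring_scheme \<Rightarrow> ('a \<Rightarrow> 'c \<Rightarrow> 'c) \<Rightarrow> ('c \<Rightarrow> 'a) ring"
  where "left_hom A C la =
    \<lparr>carrier = {f \<in> carrier C \<rightarrow>\<^sub>E carrier A.
       (\<forall>x\<in>carrier C. \<forall>y\<in>carrier C. f (x \<oplus>\<^bsub>C\<^esub> y) = f x \<oplus>\<^bsub>A\<^esub> f y) \<and>
       (\<forall>a\<in>carrier A. \<forall>x\<in>carrier C. f (la a x) = a \<otimes>\<^bsub>A\<^esub> f x)},
     monoid.mult = undefined, monoid.one = undefined,
     ring.zero = (\<lambda>c\<in>carrier C. \<zero>\<^bsub>A\<^esub>), ring.add = (\<lambda>f g. \<lambda>c\<in>carrier C. f c \<oplus>\<^bsub>A\<^esub> g c)\<rparr>"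

definition left_dual_ring ::
  "('g, 'x) monoid_scheme \<Rightarrow> ('a, 'y) ring_scheme \<Rightarrow> ('g, 'a, 'c) group_coring \<Rightarrow>
   ('g, 'a, 'g \<Rightarrow> 'c \<Rightarrow> 'a) graded_ring"
  where "left_dual_ring G A C = graded_ring_of G
    (\<lambda>\<alpha>. left_hom A (cgroup C (inv\<^bsub>G\<^esub> \<alpha>)) (lact C (inv\<^bsub>G\<^esub> \<alpha>)))
    (\<lambda>\<alpha> \<beta> f g. \<lambda>c\<in>carrier (cgroup C (inv\<^bsub>G\<^esub> (\<alpha> \<otimes>\<^bsub>G\<^esub> \<beta>))).
       tensor_lift A (\<lambda>(x, y). g (ract C (inv\<^bsub>G\<^esub> \<beta>) x (f y)))
         (comult C (inv\<^bsub>G\<^esub> \<beta>) (inv\<^bsub>G\<^esub> \<alpha>) c))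
    (\<lambda>c\<in>carrier (cgroup C \<one>\<^bsub>G\<^esub>). counit C c)
    (\<lambda>a. \<lambda>c\<in>carrier (cgroup C \<one>\<^bsub>G\<^esub>). counit C c \<otimes>\<^bsub>A\<^esub> a)"

definition comodule_algebra_coring ::
  "('k, 'z) ring_scheme \<Rightarrow> ('g \<Rightarrow> ('k, 'h) module) \<Rightarrow>
   ('g \<Rightarrow> 'g \<Rightarrow> 'h \<Rightarrow> ('h \<times> 'h \<Rightarrow>\<^sub>0 int) set) \<Rightarrow> ('h \<Rightarrow> 'k) \<Rightarrow> ('k, 'a) module \<Rightarrow>
   ('g \<Rightarrow> 'a \<Rightarrow> ('a \<times> 'h \<Rightarrow>\<^sub>0 int) set) \<Rightarrow> ('g, 'a, ('a \<times> 'h \<Rightarrow>\<^sub>0 int) set) group_coring"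
  where "comodule_algebra_coring k H \<Delta> \<epsilon> A \<rho> =
    (let C = (\<lambda>\<alpha>. tensor k A (H \<alpha>));
         la = (\<lambda>\<alpha> a. tensor_lift (C \<alpha>) (\<lambda>(b, h). pure k A (H \<alpha>) (a \<otimes>\<^bsub>A\<^esub> b) h));
         ra = (\<lambda>\<alpha> c a. tensor_lift (C \<alpha>) (\<lambda>(b, h). tensor_lift (C \<alpha>)
                 (\<lambda>(a', h'). pure k A (H \<alpha>) (b \<otimes>\<^bsub>A\<^esub> a') (h \<otimes>\<^bsub>H \<alpha>\<^esub> h')) (\<rho> \<alpha> a)) c)
     in \<lparr>cgroup = (\<lambda>\<alpha>. ring.truncate (C \<alpha>)),
         lact = la,
         ract = ra,
         comult = (\<lambda>\<alpha> \<beta>. let T = balanced_tensor A (C \<alpha>) (ra \<alpha>) (C \<beta>) (la \<beta>)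
           in tensor_lift T (\<lambda>(a, h). tensor_lift T
                (\<lambda>(x, y). balanced_pure A (C \<alpha>) (ra \<alpha>) (C \<beta>) (la \<beta>)
                   (pure k A (H \<alpha>) a x) (pure k A (H \<beta>) \<one>\<^bsub>A\<^esub> y)) (\<Delta> \<alpha> \<beta> h))),
         counit = tensor_lift A (\<lambda>(a, h). \<epsilon> h \<odot>\<^bsub>A\<^esub> a)\<rparr>)"


section \<open>The smash product\<close>

definition dual :: "('k, 'z) ring_scheme \<Rightarrow> ('k, 'm, 'x) module_scheme \<Rightarrow> ('k, 'm \<Rightarrow> 'k) module"
  where "dual k M =
    \<lparr>carrier = linear_maps k M (base_module k) \<inter> extensional (carrier M),
     monoid.mult = undefined, monoid.one = undefined,
     ring.zero = (\<lambda>x\<in>carrier M. \<zero>\<^bsub>k\<^esub>), ring.add = (\<lambda>f g. \<lambda>x\<in>carrier M. f x \<oplus>\<^bsub>k\<^esub> g x),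
     smult = (\<lambda>c f. \<lambda>x\<in>carrier M. c \<otimes>\<^bsub>k\<^esub> f x)\<rparr>"

text \<open>The comultiplication dual to the product of \<open>B\<close>; the tensor is unique for \<open>B\<close> finitely generated projective.\<close>

definition dual_comult ::
  "('k, 'z) ring_scheme \<Rightarrow> ('k, 'm, 'x) module_scheme \<Rightarrow> ('m \<Rightarrow> 'k) \<Rightarrow>
   (('m \<Rightarrow> 'k) \<times> ('m \<Rightarrow> 'k) \<Rightarrow>\<^sub>0 int) set"
  where "dual_comult k B f =
    (THE t. t \<in> carrier (tensor k (dual k B) (dual k B)) \<and>
       (\<forall>h\<in>carrier B. \<forall>h'\<in>carrier B.
          f (h \<otimes>\<^bsub>B\<^esub> h') = tensor_lift k (\<lambda>(u, v). u h \<otimes>\<^bsub>k\<^esub> v h') t))"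

definition dual_component ::
  "('g, 'x) monoid_scheme \<Rightarrow> ('k, 'z) ring_scheme \<Rightarrow> ('g \<Rightarrow> ('k, 'h) module) \<Rightarrow> 'g \<Rightarrow> ('k, 'h \<Rightarrow> 'k) module"
  where "dual_component G k H \<alpha> = dual k (H (inv\<^bsub>G\<^esub> \<alpha>))"

definition convolution ::
  "('g, 'x) monoid_scheme \<Rightarrow> ('k, 'z) ring_scheme \<Rightarrow> ('g \<Rightarrow> ('k, 'h) module) \<Rightarrow>
   ('g \<Rightarrow> 'g \<Rightarrow> 'h \<Rightarrow> ('h \<times> 'h \<Rightarrow>\<^sub>0 int) set) \<Rightarrow> 'g \<Rightarrow> 'g \<Rightarrow> ('h \<Rightarrow> 'k) \<Rightarrow> ('h \<Rightarrow> 'k) \<Rightarrow> 'h \<Rightarrow> 'k"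
  where "convolution G k H \<Delta> \<beta> \<alpha> f g =
    (\<lambda>h\<in>carrier (H (inv\<^bsub>G\<^esub> (\<alpha> \<otimes>\<^bsub>G\<^esub> \<beta>))).
       tensor_lift k (\<lambda>(x, y). f x \<otimes>\<^bsub>k\<^esub> g y) (\<Delta> (inv\<^bsub>G\<^esub> \<beta>) (inv\<^bsub>G\<^esub> \<alpha>) h))"

definition dual_action ::
  "('g, 'x) monoid_scheme \<Rightarrow> ('k, 'a) module \<Rightarrow> ('g \<Rightarrow> 'a \<Rightarrow> ('a \<times> 'h \<Rightarrow>\<^sub>0 int) set) \<Rightarrow>
   'g \<Rightarrow> ('h \<Rightarrow> 'k) \<Rightarrow> 'a \<Rightarrow> 'a"
  where "dual_action G A \<rho> \<alpha> f a = tensor_lift A (\<lambda>(b, h). f h \<odot>\<^bsub>A\<^esub> b) (\<rho> (inv\<^bsub>G\<^esub> \<alpha>) a)"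

text \<open>
  \<open>K\<^sup>o\<^sup>p # A\<close>.  Since \<open>K\<close> is the direct sum of the \<open>K\<^sub>\<alpha>\<close>, the module \<open>K \<otimes> A\<close> is realised as the
  direct sum of the \<open>K\<^sub>\<alpha> \<otimes> A\<close>.  In the product of \<open>h # a\<close> and \<open>f # b\<close> of degrees \<open>\<alpha>\<close> and \<open>\<beta>\<close>, the
  convolution \<open>f\<^sub>1 * h\<close> lies in \<open>K\<^sub>\<alpha>\<^sub>\<beta>\<close>.
\<close>

definition smash_product ::
  "('g, 'x) monoid_scheme \<Rightarrow> ('k, 'z) ring_scheme \<Rightarrow> ('g \<Rightarrow> ('k, 'h) module) \<Rightarrow>
   ('g \<Rightarrow> 'g \<Rightarrow> 'h \<Rightarrow> ('h \<times> 'h \<Rightarrow>\<^sub>0 int) set) \<Rightarrow> ('h \<Rightarrow> 'k) \<Rightarrow> ('k, 'a) module \<Rightarrow>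
   ('g \<Rightarrow> 'a \<Rightarrow> ('a \<times> 'h \<Rightarrow>\<^sub>0 int) set) \<Rightarrow>
   ('g, 'a, 'g \<Rightarrow> (('h \<Rightarrow> 'k) \<times> 'a \<Rightarrow>\<^sub>0 int) set) graded_ring"
  where "smash_product G k H \<Delta> \<epsilon> A \<rho> =
    (let K = dual_component G k H;
         \<eta> = (\<lambda>h\<in>carrier (H \<one>\<^bsub>G\<^esub>). \<epsilon> h)
     in graded_ring_of G (\<lambda>\<alpha>. tensor k (K \<alpha>) A)
       (\<lambda>\<alpha> \<beta> s t. let T = tensor k (K (\<alpha> \<otimes>\<^bsub>G\<^esub> \<beta>)) A in
          tensor_lift T (\<lambda>(h, a). tensor_lift T (\<lambda>(f, b). tensor_lift T (\<lambda>(f1, f2).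
            pure k (K (\<alpha> \<otimes>\<^bsub>G\<^esub> \<beta>)) A (convolution G k H \<Delta> \<beta> \<alpha> f1 h)
              (dual_action G A \<rho> \<beta> f2 a \<otimes>\<^bsub>A\<^esub> b))
            (dual_comult k (H (inv\<^bsub>G\<^esub> \<beta>)) f)) t) s)
       (pure k (K \<one>\<^bsub>G\<^esub>) A \<eta> \<one>\<^bsub>A\<^esub>)
       (\<lambda>a. pure k (K \<one>\<^bsub>G\<^esub>) A \<eta> a))"


section \<open>Categories\<close>

record ('o, 'f) category =
  Obj :: "'o set"
  Hom :: "'o \<Rightarrow> 'o \<Rightarrow> 'f set"
  Ident :: "'o \<Rightarrow> 'f"
  Comp :: "'o \<Rightarrow> 'o \<Rightarrow> 'o \<Rightarrow> 'f \<Rightarrow> 'f \<Rightarrow> 'f"  \<comment> \<open>\<open>Comp C X Y Z g f\<close> is \<open>g \<circ> f : X \<rightarrow> Y \<rightarrow> Z\<close>\<close>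

locale category =
  fixes C :: "('o, 'f) category"
  assumes Ident_closed: "X \<in> Obj C \<Longrightarrow> Ident C X \<in> Hom C X X"
    and Comp_closed: "\<lbrakk>X \<in> Obj C; Y \<in> Obj C; Z \<in> Obj C; f \<in> Hom C X Y; g \<in> Hom C Y Z\<rbrakk>
      \<Longrightarrow> Comp C X Y Z g f \<in> Hom C X Z"
    and Ident_left: "\<lbrakk>X \<in> Obj C; Y \<in> Obj C; f \<in> Hom C X Y\<rbrakk> \<Longrightarrow> Comp C X Y Y (Ident C Y) f = f"
    and Ident_right: "\<lbrakk>X \<in> Obj C; Y \<in> Obj C; f \<in> Hom C X Y\<rbrakk> \<Longrightarrow> Comp C X X Y f (Ident C X) = f"
    and Comp_assoc: "\<lbrakk>W \<in> Obj C; X \<in> Obj C; Y \<in> Obj C; Z \<in> Obj C;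
        f \<in> Hom C W X; g \<in> Hom C X Y; h \<in> Hom C Y Z\<rbrakk>
      \<Longrightarrow> Comp C W Y Z h (Comp C W X Y g f) = Comp C W X Z (Comp C X Y Z h g) f"

locale covariant_functor = C: category C + D: category D
  for C :: "('o, 'f) category" and D :: "('p, 'g) category" +
  fixes F :: "'o \<Rightarrow> 'p" and F\<^sub>1 :: "'o \<Rightarrow> 'o \<Rightarrow> 'f \<Rightarrow> 'g"
  assumes Obj_closed: "X \<in> Obj C \<Longrightarrow> F X \<in> Obj D"
    and Hom_closed: "\<lbrakk>X \<in> Obj C; Y \<in> Obj C; f \<in> Hom C X Y\<rbrakk> \<Longrightarrow> F\<^sub>1 X Y f \<in> Hom D (F X) (F Y)"
    and preserves_Ident: "X \<in> Obj C \<Longrightarrow> F\<^sub>1 X X (Ident C X) = Ident D (F X)"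
    and preserves_Comp: "\<lbrakk>X \<in> Obj C; Y \<in> Obj C; Z \<in> Obj C; f \<in> Hom C X Y; g \<in> Hom C Y Z\<rbrakk>
      \<Longrightarrow> F\<^sub>1 X Z (Comp C X Y Z g f) = Comp D (F X) (F Y) (F Z) (F\<^sub>1 Y Z g) (F\<^sub>1 X Y f)"

definition isomorphic_categories :: "('o, 'f) category \<Rightarrow> ('p, 'g) category \<Rightarrow> bool"
  where "isomorphic_categories C D \<longleftrightarrow>
    (\<exists>F F\<^sub>1 E E\<^sub>1. covariant_functor C D F F\<^sub>1 \<and> covariant_functor D C E E\<^sub>1 \<and>
       (\<forall>X\<in>Obj C. E (F X) = X) \<and> (\<forall>Y\<in>Obj D. F (E Y) = Y) \<and>
       (\<forall>X\<in>Obj C. \<forall>X'\<in>Obj C. \<forall>f\<in>Hom C X X'. E\<^sub>1 (F X) (F X') (F\<^sub>1 X X' f) = f) \<and>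
       (\<forall>Y\<in>Obj D. \<forall>Y'\<in>Obj D. \<forall>g\<in>Hom D Y Y'. F\<^sub>1 (E Y) (E Y') (E\<^sub>1 Y Y' g) = g))"

text \<open>
  Isomorphism of categories refers to equality of objects, so the functions that make up an object
  have the value \<open>undefined\<close> outside their domain, and so do the unused multiplicative
  fields of the underlying abelian groups.
\<close>

definition extensional2 :: "'u set \<Rightarrow> 'v set \<Rightarrow> ('u \<Rightarrow> 'v \<Rightarrow> 'w) \<Rightarrow> bool"
  where "extensional2 U V f \<longleftrightarrow> (\<forall>u v. \<not> (u \<in> U \<and> v \<in> V) \<longrightarrow> f u v = undefined)"

definition plain_abelian_group :: "'m ring \<Rightarrow> bool"
  where "plain_abelian_group M \<longleftrightarrow> abelian_group M \<and> extensional2 (carrier M) (carrier M) (ring.add M) \<and>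
    monoid.mult M = undefined \<and> monoid.one M = undefined"

locale right_module = R: ring R + M: abelian_group M
  for R :: "('r, 'x) ring_scheme" (structure) and M :: "('m, 'y) ring_scheme" (structure) +
  fixes act :: "'m \<Rightarrow> 'r \<Rightarrow> 'm"
  assumes act_closed: "\<lbrakk>m \<in> carrier M; r \<in> carrier R\<rbrakk> \<Longrightarrow> act m r \<in> carrier M"
    and act_add_left: "\<lbrakk>m \<in> carrier M; n \<in> carrier M; r \<in> carrier R\<rbrakk>
      \<Longrightarrow> act (m \<oplus>\<^bsub>M\<^esub> n) r = act m r \<oplus>\<^bsub>M\<^esub> act n r"
    and act_add_right: "\<lbrakk>m \<in> carrier M; r \<in> carrier R; s \<in> carrier R\<rbrakk>
      \<Longrightarrow> act m (r \<oplus>\<^bsub>R\<^esub> s) = act m r \<oplus>\<^bsub>M\<^esub> act m s"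
    and act_mult: "\<lbrakk>m \<in> carrier M; r \<in> carrier R; s \<in> carrier R\<rbrakk>
      \<Longrightarrow> act m (r \<otimes>\<^bsub>R\<^esub> s) = act (act m r) s"
    and act_one: "m \<in> carrier M \<Longrightarrow> act m \<one>\<^bsub>R\<^esub> = m"

definition right_linear_maps ::
  "('r, 'x) ring_scheme \<Rightarrow> ('m, 'y) ring_scheme \<Rightarrow> ('m \<Rightarrow> 'r \<Rightarrow> 'm) \<Rightarrow>
   ('n, 'z) ring_scheme \<Rightarrow> ('n \<Rightarrow> 'r \<Rightarrow> 'n) \<Rightarrow> ('m \<Rightarrow> 'n) set"
  where "right_linear_maps R M act N act' =
    {f \<in> carrier M \<rightarrow>\<^sub>E carrier N.
       (\<forall>x\<in>carrier M. \<forall>y\<in>carrier M. f (x \<oplus>\<^bsub>M\<^esub> y) = f x \<oplus>\<^bsub>N\<^esub> f y) \<and>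
       (\<forall>x\<in>carrier M. \<forall>r\<in>carrier R. f (act x r) = act' (f x) r)}"

subsection \<open>Graded modules\<close>

text \<open>
  A \<open>G\<close>-graded right \<open>R\<close>-module is the direct sum of a family of abelian groups together with
  an \<open>R\<close>-module structure on this direct sum that is compatible with the degrees.
\<close>

record ('g, 'r, 'm) graded_module =
  gm_group :: "'g \<Rightarrow> 'm ring"
  gm_act :: "('g \<Rightarrow> 'm) \<Rightarrow> 'r \<Rightarrow> 'g \<Rightarrow> 'm"

definition graded_modules ::
  "('g, 'x) monoid_scheme \<Rightarrow> ('g, 'a, 'r) graded_ring \<Rightarrow> ('g, 'r, 'm) graded_module set"
  where "graded_modules G R =
    {M. gm_group M \<in> extensional (carrier G) \<and>
        (\<forall>\<alpha>\<in>carrier G. plain_abelian_group (gm_group M \<alpha>)) \<and>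
        extensional2 (carrier (direct_sum G (gm_group M))) (carrier R) (gm_act M) \<and>
        right_module R (direct_sum G (gm_group M)) (gm_act M) \<and>
        (\<forall>\<alpha>\<in>carrier G. \<forall>\<beta>\<in>carrier G. \<forall>m\<in>homogeneous G (gm_group M) \<alpha>. \<forall>r\<in>component R \<beta>.
           gm_act M m r \<in> homogeneous G (gm_group M) (\<alpha> \<otimes>\<^bsub>G\<^esub> \<beta>))}"

definition graded_module_category ::
  "('g, 'x) monoid_scheme \<Rightarrow> ('g, 'a, 'r) graded_ring \<Rightarrow>
   (('g, 'r, 'm) graded_module, ('g \<Rightarrow> 'm) \<Rightarrow> 'g \<Rightarrow> 'm) category"
  where "graded_module_category G R =
    (let D = (\<lambda>M. direct_sum G (gm_group M))
     in \<lparr>Obj = graded_modules G R,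
         Hom = (\<lambda>M N. {f \<in> right_linear_maps R (D M) (gm_act M) (D N) (gm_act N).
           \<forall>\<alpha>\<in>carrier G. f ` homogeneous G (gm_group M) \<alpha> \<subseteq> homogeneous G (gm_group N) \<alpha>}),
         Ident = (\<lambda>M. \<lambda>m\<in>carrier (D M). m),
         Comp = (\<lambda>L M N g f. compose (carrier (D L)) g f)\<rparr>)"

subsection \<open>Relative Hopf modules\<close>

record ('g, 'a, 'h, 'm) hopf_module =
  hm_group :: "'g \<Rightarrow> 'm ring"
  hm_act :: "'g \<Rightarrow> 'm \<Rightarrow> 'a \<Rightarrow> 'm"
  hm_coact :: "'g \<Rightarrow> 'g \<Rightarrow> 'm \<Rightarrow> ('m \<times> 'h \<Rightarrow>\<^sub>0 int) set"

text \<open>The \<open>k\<close>-module underlying a right \<open>A\<close>-module: \<open>k\<close> acts through \<open>c \<mapsto> c 1\<^sub>A\<close>.\<close>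

definition underlying_module ::
  "('k, 'a) module \<Rightarrow> 'm ring \<Rightarrow> ('m \<Rightarrow> 'a \<Rightarrow> 'm) \<Rightarrow> ('k, 'm) module"
  where "underlying_module A M act = ring.extend M \<lparr>smult = (\<lambda>c m. act m (c \<odot>\<^bsub>A\<^esub> \<one>\<^bsub>A\<^esub>))\<rparr>"

abbreviation hm_module ::
  "('k, 'a) module \<Rightarrow> ('g, 'a, 'h, 'm) hopf_module \<Rightarrow> 'g \<Rightarrow> ('k, 'm) module"
  where "hm_module A M \<alpha> \<equiv> underlying_module A (hm_group M \<alpha>) (hm_act M \<alpha>)"

definition hopf_modules ::
  "('g, 'x) monoid_scheme \<Rightarrow> ('k, 'z) ring_scheme \<Rightarrow> ('g \<Rightarrow> ('k, 'h) module) \<Rightarrow>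
   ('g \<Rightarrow> 'g \<Rightarrow> 'h \<Rightarrow> ('h \<times> 'h \<Rightarrow>\<^sub>0 int) set) \<Rightarrow> ('h \<Rightarrow> 'k) \<Rightarrow> ('k, 'a) module \<Rightarrow>
   ('g \<Rightarrow> 'a \<Rightarrow> ('a \<times> 'h \<Rightarrow>\<^sub>0 int) set) \<Rightarrow> ('g, 'a, 'h, 'm) hopf_module set"
  where "hopf_modules G k H \<Delta> \<epsilon> A \<rho> =
    {M. hm_group M \<in> extensional (carrier G) \<and>
        hm_act M \<in> extensional (carrier G) \<and>
        extensional2 (carrier G) (carrier G) (hm_coact M) \<and>
        (\<forall>\<alpha>\<in>carrier G. plain_abelian_group (hm_group M \<alpha>) \<and>
           extensional2 (carrier (hm_group M \<alpha>)) (carrier A) (hm_act M \<alpha>) \<and>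
           right_module A (hm_group M \<alpha>) (hm_act M \<alpha>)) \<and>
        (\<forall>\<alpha>\<in>carrier G. \<forall>\<beta>\<in>carrier G.
           hm_coact M \<alpha> \<beta> \<in> extensional (carrier (hm_group M (\<alpha> \<otimes>\<^bsub>G\<^esub> \<beta>))) \<and>
           hm_coact M \<alpha> \<beta> \<in> linear_maps k (hm_module A M (\<alpha> \<otimes>\<^bsub>G\<^esub> \<beta>))
                              (tensor k (hm_module A M \<alpha>) (H \<beta>))) \<and>
        (\<forall>\<alpha>\<in>carrier G. \<forall>\<beta>\<in>carrier G. \<forall>\<gamma>\<in>carrier G.
           \<forall>m\<in>carrier (hm_group M (\<alpha> \<otimes>\<^bsub>G\<^esub> \<beta> \<otimes>\<^bsub>G\<^esub> \<gamma>)).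
           tensor_assoc k (hm_module A M \<alpha>) (H \<beta>) (H \<gamma>)
             (tensor_map k (hm_module A M \<alpha>) (tensor k (H \<beta>) (H \<gamma>)) id (\<Delta> \<beta> \<gamma>)
               (hm_coact M \<alpha> (\<beta> \<otimes>\<^bsub>G\<^esub> \<gamma>) m)) =
           tensor_map k (tensor k (hm_module A M \<alpha>) (H \<beta>)) (H \<gamma>) (hm_coact M \<alpha> \<beta>) id
             (hm_coact M (\<alpha> \<otimes>\<^bsub>G\<^esub> \<beta>) \<gamma> m)) \<and>
        (\<forall>\<alpha>\<in>carrier G. \<forall>m\<in>carrier (hm_group M \<alpha>).
           tensor_lift (hm_module A M \<alpha>) (\<lambda>(n, h). \<epsilon> h \<odot>\<^bsub>hm_module A M \<alpha>\<^esub> n)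
             (hm_coact M \<alpha> \<one>\<^bsub>G\<^esub> m) = m) \<and>
        (\<forall>\<alpha>\<in>carrier G. \<forall>\<beta>\<in>carrier G. \<forall>m\<in>carrier (hm_group M (\<alpha> \<otimes>\<^bsub>G\<^esub> \<beta>)). \<forall>a\<in>carrier A.
           hm_coact M \<alpha> \<beta> (hm_act M (\<alpha> \<otimes>\<^bsub>G\<^esub> \<beta>) m a) =
           (let T = tensor k (hm_module A M \<alpha>) (H \<beta>)
            in tensor_lift T (\<lambda>(n, h). tensor_lift T
                 (\<lambda>(b, h'). pure k (hm_module A M \<alpha>) (H \<beta>) (hm_act M \<alpha> n b) (h \<otimes>\<^bsub>H \<beta>\<^esub> h'))
                 (\<rho> \<beta> a)) (hm_coact M \<alpha> \<beta> m)))}"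

definition hopf_module_category ::
  "('g, 'x) monoid_scheme \<Rightarrow> ('k, 'z) ring_scheme \<Rightarrow> ('g \<Rightarrow> ('k, 'h) module) \<Rightarrow>
   ('g \<Rightarrow> 'g \<Rightarrow> 'h \<Rightarrow> ('h \<times> 'h \<Rightarrow>\<^sub>0 int) set) \<Rightarrow> ('h \<Rightarrow> 'k) \<Rightarrow> ('k, 'a) module \<Rightarrow>
   ('g \<Rightarrow> 'a \<Rightarrow> ('a \<times> 'h \<Rightarrow>\<^sub>0 int) set) \<Rightarrow>
   (('g, 'a, 'h, 'm) hopf_module, 'g \<Rightarrow> 'm \<Rightarrow> 'm) category"
  where "hopf_module_category G k H \<Delta> \<epsilon> A \<rho> =
    \<lparr>Obj = hopf_modules G k H \<Delta> \<epsilon> A \<rho>,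
     Hom = (\<lambda>M N.
       {f \<in> (\<Pi>\<^sub>E \<alpha>\<in>carrier G.
               right_linear_maps A (hm_group M \<alpha>) (hm_act M \<alpha>) (hm_group N \<alpha>) (hm_act N \<alpha>)).
          \<forall>\<alpha>\<in>carrier G. \<forall>\<beta>\<in>carrier G. \<forall>m\<in>carrier (hm_group M (\<alpha> \<otimes>\<^bsub>G\<^esub> \<beta>)).
            hm_coact N \<alpha> \<beta> (f (\<alpha> \<otimes>\<^bsub>G\<^esub> \<beta>) m) =
            tensor_map k (hm_module A N \<alpha>) (H \<beta>) (f \<alpha>) id (hm_coact M \<alpha> \<beta> m)}),
     Ident = (\<lambda>M. \<lambda>\<alpha>\<in>carrier G. \<lambda>m\<in>carrier (hm_group M \<alpha>). m),
     Comp = (\<lambda>L M N g f. \<lambda>\<alpha>\<in>carrier G. compose (carrier (hm_group L \<alpha>)) (g \<alpha>) (f \<alpha>))\<rparr>"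

end

theory Submission
  imports Defs
begin

text \<open>
  Both claims pass through one graded ring, a convolution ring in the style of Koppinen, whose component
  of degree \<open>\<alpha>\<close> consists of the \<open>k\<close>-linear maps \<open>H\<^sub>\<beta> \<rightarrow> A\<close> for \<open>\<beta> = \<alpha>\<^sup>-\<^sup>1\<close>.  In Sweedler notation its product is
  \<open>(f # g)(h) = f(h\<^sub>2)\<^sub>0 g(h\<^sub>1 f(h\<^sub>2)\<^sub>1)\<close>, where \<open>a\<^sub>0 \<otimes> a\<^sub>1\<close> is the coaction on \<open>A\<close>
  (\<open>hom_mult\<close>, \<open>hom_ring_data\<close>).

  A left \<open>A\<close>-linear map on \<open>A \<otimes> H\<^sub>\<alpha>\<close> amounts to its restriction to \<open>1 \<otimes> H\<^sub>\<alpha>\<close>, an arbitrary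
  \<open>k\<close>-linear map, and restriction turns the product of the left dual ring into the convolution product
  (\<open>left_dual_ring_isomorphic\<close>).  For a finitely generated projective module \<open>H\<^sub>\<alpha>\<close> a dual basis shows that
  \<open>u \<otimes> a \<mapsto> (h \<mapsto> u(h) a)\<close> is a bijection from \<open>H\<^sub>\<alpha>\<^sup>* \<otimes> A\<close> to the same maps.  It is multiplicative
  because the comultiplication of the dual turns \<open>f\<^sub>1(x) f\<^sub>2(y)\<close> into \<open>f(x y)\<close>
  (\<open>smash_product_isomorphic\<close>).

  A relative Hopf module is a graded module over the convolution ring by \<open>m f = m\<^sub>0 f(m\<^sub>1)\<close>.
  Conversely, the degree \<open>e\<close> part of the ring contains \<open>A\<close>, and the coaction is recovered from a dual basis as
  \<open>m \<mapsto> \<Sum> m e\<^sub>i\<^sup>* \<otimes> e\<^sub>i\<close>.  Contractions with functionals separate the elements of \<open>M \<otimes> H\<^sub>\<alpha>\<close>, so the axioms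
  on the two sides translate into each other, and so do the morphisms
  (\<open>hopf_modules_graded_modules\<close>).  Restriction of scalars along the second ring isomorphism
  then replaces the convolution ring by the smash product.

  Graded rings and modules are handled through their homogeneous components, and elements of tensor
  products through the linear maps out of them.
\<close>

text \<open>Almost every hypothesis is a membership in a carrier, so it gets a short infix.\<close>

abbreviation element_of (infix "\<Colon>" 50) where "x \<Colon> M \<equiv> x \<in> carrier M"

text \<open>The curried form makes \<open>lift P (\<lambda>x y. e) t\<close> readable as Sweedler notation for
  \<open>e\<close> summed over \<open>t\<close>.\<close>

abbreviation "lift P b \<equiv> tensor_lift P (case_prod b)"

section \<open>Universal property of the tensor product\<close>

text \<open>The extension of \<open>b\<close> to the free abelian group, by the formula that
  \<open>tensor_lift\<close> applies to a representative.\<close>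

definition frag_ext :: "('p, 'x) ring_scheme \<Rightarrow> ('i \<Rightarrow> 'p) \<Rightarrow> ('i \<Rightarrow>\<^sub>0 int) \<Rightarrow> 'p" where
  "frag_ext P b c = (\<Oplus>\<^bsub>P\<^esub>p\<in>Poly_Mapping.keys c. [Poly_Mapping.lookup c p] \<cdot>\<^bsub>P\<^esub> b p)"

lemma (in abelian_group) int_multiple_closed: "x \<Colon> G \<Longrightarrow> [(i::int)] \<cdot> x \<Colon> G"
  unfolding add_pow_def using group.int_pow_closed[OF a_group] by simp

lemma (in abelian_group) int_multiple_add:
  "x \<Colon> G \<Longrightarrow> [((i::int) + j)] \<cdot> x = [i] \<cdot> x \<oplus> [j] \<cdot> x"
  unfolding add_pow_def using group.int_pow_mult[OF a_group, of x i j] by simp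

lemma (in abelian_group) int_multiple_simps:
  "[(0::int)] \<cdot> x = \<zero>" "x \<Colon> G \<Longrightarrow> [(1::int)] \<cdot> x = x"
  unfolding add_pow_def using group.int_pow_1[OF a_group] by simp_all

lemma (in abelian_group) frag_ext_superset:
  assumes "finite S" "Poly_Mapping.keys c \<subseteq> S" "b \<in> S \<rightarrow> carrier G"
  shows "frag_ext G b c = (\<Oplus>p\<in>S. [Poly_Mapping.lookup c p] \<cdot> b p)"
  unfolding frag_ext_def
  by (rule add.finprod_mono_neutral_cong_left)
    (use assms in \<open>auto simp: in_keys_iff Pi_iff int_multiple_simps intro!: int_multiple_closed\<close>)

lemma (in abelian_group) frag_ext_closed:
  assumes "b \<in> S \<rightarrow> carrier G" "Poly_Mapping.keys c \<subseteq> S"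
  shows "frag_ext G b c \<Colon> G"
  unfolding frag_ext_def using assms by (intro finsum_closed) (auto intro!: int_multiple_closed)

lemma (in abelian_group) frag_ext_add:
  assumes "b \<in> S \<rightarrow> carrier G" "Poly_Mapping.keys c \<subseteq> S" "Poly_Mapping.keys d \<subseteq> S"
  shows "frag_ext G b (c + d) = frag_ext G b c \<oplus> frag_ext G b d"
proof -
  let ?K = "Poly_Mapping.keys c \<union> Poly_Mapping.keys d"
  have b: "b \<in> ?K \<rightarrow> carrier G" using assms by auto
  have "frag_ext G b (c + d) = (\<Oplus>p\<in>?K. [Poly_Mapping.lookup (c+d) p] \<cdot> b p)"
    by (rule frag_ext_superset) (use b keys_add[of c d] in auto)
  also have "\<dots> = (\<Oplus>p\<in>?K. [Poly_Mapping.lookup c p] \<cdot> b p \<oplus> [Poly_Mapping.lookup d p] \<cdot> b p)"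
    by (rule add.finprod_cong') (use b in \<open>auto simp: lookup_add int_multiple_add Pi_iff intro!: int_multiple_closed\<close>)
  also have "\<dots> = (\<Oplus>p\<in>?K. [Poly_Mapping.lookup c p] \<cdot> b p) \<oplus> (\<Oplus>p\<in>?K. [Poly_Mapping.lookup d p] \<cdot> b p)"
    by (rule finsum_addf) (use b in \<open>auto simp: Pi_iff intro!: int_multiple_closed\<close>)
  also have "\<dots> = frag_ext G b c \<oplus> frag_ext G b d"
    by (simp add: frag_ext_superset[OF _ _ b, of c] frag_ext_superset[OF _ _ b, of d])
  finally show ?thesis .
qed

lemma (in abelian_group) frag_ext_of:
  assumes "b p \<Colon> G"
  shows "frag_ext G b (frag_of p) = b p"
  using assms by (simp add: frag_ext_def int_multiple_simps)

lemma (in abelian_group) frag_ext_zero: "frag_ext G b 0 = \<zero>"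
  by (simp add: frag_ext_def)

lemma (in abelian_group) frag_ext_minus:
  assumes "b \<in> S \<rightarrow> carrier G" "Poly_Mapping.keys c \<subseteq> S"
  shows "frag_ext G b (- c) = \<ominus> frag_ext G b c"
proof -
  have "frag_ext G b (- c) \<oplus> frag_ext G b c = \<zero>"
    using frag_ext_add[OF assms(1), of "-c" c] assms by (simp add: frag_ext_zero)
  moreover have "frag_ext G b (- c) \<Colon> G" "frag_ext G b c \<Colon> G"
    by (rule frag_ext_closed[OF assms(1)], simp add: assms)+
  ultimately show ?thesis
    using minus_equality by simp
qed

lemma (in abelian_group) frag_ext_diff:
  fixes b :: "'c \<Rightarrow> 'a" and c d :: "'c \<Rightarrow>\<^sub>0 int"
  assumes "b \<in> S \<rightarrow> carrier G" "Poly_Mapping.keys c \<subseteq> S" "Poly_Mapping.keys d \<subseteq> S"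
  shows "frag_ext G b (c - d) = frag_ext G b c \<ominus> frag_ext G b d"
  using frag_ext_add[OF assms(1), of c "-d"] frag_ext_minus[OF assms(1,3)] assms
  by (simp add: a_minus_def)

text \<open>The actions are plain functions, so that tensor products over \<open>k\<close> and tensor products over \<open>A\<close>
  have the same universal property.\<close>

locale tensor_factors = M: abelian_group M + N: abelian_group N
  for M :: "('m, 'x) ring_scheme" and N :: "('n, 'y) ring_scheme" +
  fixes R :: "('r, 'z) ring_scheme" and ra :: "'m \<Rightarrow> 'r \<Rightarrow> 'm" and la :: "'r \<Rightarrow> 'n \<Rightarrow> 'n"
  assumes ra_closed: "\<lbrakk>m \<Colon> M; r \<Colon> R\<rbrakk> \<Longrightarrow> ra m r \<Colon> M"
    and la_closed: "\<lbrakk>n \<Colon> N; r \<Colon> R\<rbrakk> \<Longrightarrow> la r n \<Colon> N"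
begin

abbreviation "F \<equiv> free_Abelian_group (carrier M \<times> carrier N)"
abbreviation "rels \<equiv> tensor_relations R M ra N la"
abbreviation "T \<equiv> balanced_tensor R M ra N la"
abbreviation "bpure \<equiv> balanced_pure R M ra N la"

definition balanced where
  "balanced P b \<longleftrightarrow> abelian_group P \<and>
    (\<forall>m\<in>carrier M. \<forall>n\<in>carrier N. b m n \<Colon> P) \<and>
    (\<forall>m\<in>carrier M. \<forall>m'\<in>carrier M. \<forall>n\<in>carrier N. b (m \<oplus>\<^bsub>M\<^esub> m') n = b m n \<oplus>\<^bsub>P\<^esub> b m' n) \<and>
    (\<forall>m\<in>carrier M. \<forall>n\<in>carrier N. \<forall>n'\<in>carrier N. b m (n \<oplus>\<^bsub>N\<^esub> n') = b m n \<oplus>\<^bsub>P\<^esub> b m n') \<and>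
    (\<forall>m\<in>carrier M. \<forall>r\<in>carrier R. \<forall>n\<in>carrier N. b (ra m r) n = b m (la r n))"

lemma rels_generators: "rels = generate F
    ({frag_of (m \<oplus>\<^bsub>M\<^esub> m', n) - frag_of (m, n) - frag_of (m', n) | m m' n.
        m \<Colon> M \<and> m' \<Colon> M \<and> n \<Colon> N} \<union>
     {frag_of (m, n \<oplus>\<^bsub>N\<^esub> n') - frag_of (m, n) - frag_of (m, n') | m n n'.
        m \<Colon> M \<and> n \<Colon> N \<and> n' \<Colon> N} \<union>
     {frag_of (ra m r, n) - frag_of (m, la r n) | m r n.
        m \<Colon> M \<and> r \<Colon> R \<and> n \<Colon> N})" (is "_ = generate F ?X")
  by (simp add: tensor_relations_def)

lemma generators_closed: "
    ({frag_of (m \<oplus>\<^bsub>M\<^esub> m', n) - frag_of (m, n) - frag_of (m', n) | m m' n.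
        m \<Colon> M \<and> m' \<Colon> M \<and> n \<Colon> N} \<union>
     {frag_of (m, n \<oplus>\<^bsub>N\<^esub> n') - frag_of (m, n) - frag_of (m, n') | m n n'.
        m \<Colon> M \<and> n \<Colon> N \<and> n' \<Colon> N} \<union>
     {frag_of (ra m r, n) - frag_of (m, la r n) | m r n.
        m \<Colon> M \<and> r \<Colon> R \<and> n \<Colon> N}) \<subseteq> carrier F" (is "?X \<subseteq> _")
proof -
  have d: "Poly_Mapping.keys (a - b) \<subseteq> S" if "Poly_Mapping.keys a \<subseteq> S" "Poly_Mapping.keys b \<subseteq> S"
    for a b :: "'m \<times> 'n \<Rightarrow>\<^sub>0 int" and S
    using keys_diff[of a b] that by blast
  show ?thesis
    by (intro Un_least subsetI; clarify; unfold carrier_free_Abelian_group_iff; intro d)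
      (simp_all add: ra_closed la_closed)
qed

lemma F_comm: "comm_group F" by (rule abelian_free_Abelian_group)

lemma normal_rels: "normal rels F"
  unfolding rels_generators
  by (rule comm_group.normal_iff_subgroup[THEN iffD2, OF F_comm group.generate_is_subgroup])
    (use generators_closed in auto)

lemma rels_closed: "c \<in> rels \<Longrightarrow> Poly_Mapping.keys c \<subseteq> carrier M \<times> carrier N"
  using subgroup.mem_carrier[OF normal_imp_subgroup[OF normal_rels]] by simp

text \<open>A balanced map kills the generators of the relations, and therefore the subgroup that they generate.\<close>

lemma frag_ext_rels:
  assumes "balanced P b" "c \<in> rels"
  shows "frag_ext P (\<lambda>(m, n). b m n) c = \<zero>\<^bsub>P\<^esub>"
proof -
  interpret P: abelian_group P using assms by (simp add: balanced_def)
  have b: "(\<lambda>(m, n). b m n) \<in> carrier M \<times> carrier N \<rightarrow> carrier P"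
    using assms by (auto simp: balanced_def)
  have cancel: "\<lbrakk>x \<Colon> P; y \<Colon> P\<rbrakk> \<Longrightarrow> x \<oplus>\<^bsub>P\<^esub> y \<ominus>\<^bsub>P\<^esub> x \<ominus>\<^bsub>P\<^esub> y = \<zero>\<^bsub>P\<^esub>" for x y
    by (simp add: P.minus_eq P.a_assoc P.a_comm[of x y] P.r_neg P.r_neg2)
  have cancel2: "x \<Colon> P \<Longrightarrow> x \<ominus>\<^bsub>P\<^esub> x = \<zero>\<^bsub>P\<^esub>" for x by (simp add: P.minus_eq P.r_neg)
  note d = P.frag_ext_diff[OF b] and c = P.frag_ext_closed[OF b]
  have kd: "Poly_Mapping.keys (a - b) \<subseteq> S" if "Poly_Mapping.keys a \<subseteq> S" "Poly_Mapping.keys b \<subseteq> S"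
    for a b :: "'m \<times> 'n \<Rightarrow>\<^sub>0 int" and S
    using keys_diff[of a b] that by blast
  have fo: "frag_ext P (\<lambda>(m, n). b m n) (frag_of (m, n)) = b m n" "b m n \<Colon> P"
    if "m \<Colon> M" "n \<Colon> N" for m n
    using that b by (auto simp: Pi_iff P.frag_ext_of)
  show ?thesis
    using assms(2) unfolding rels_generators
  proof (induction rule: generate.induct)
    case one
    then show ?case by (simp add: P.frag_ext_zero)
  next
    case (incl h)
    then show ?case using assms(1)
      by (auto simp: d kd fo balanced_def ra_closed la_closed cancel cancel2)
  next
    case (inv h)
    have h: "h \<Colon> F" by (rule subsetD[OF generators_closed inv])
    have "frag_ext P (\<lambda>(m, n). b m n) h = \<zero>\<^bsub>P\<^esub>" using inv assms(1)
      by (auto simp: d kd fo balanced_def ra_closed la_closed cancel cancel2)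
    then show ?case using h by (simp add: P.frag_ext_minus[OF b])
  next
    case (eng h1 h2)
    then have "h1 \<in> rels" "h2 \<in> rels" by (simp_all add: rels_generators)
    with eng show ?case by (simp add: P.frag_ext_add[OF b] rels_closed)
  qed
qed

lemma T_carrier: "carrier T = rcosets\<^bsub>F\<^esub> rels"
  and T_zero: "\<zero>\<^bsub>T\<^esub> = rels"
  and T_add: "s \<oplus>\<^bsub>T\<^esub> t = s <#>\<^bsub>F\<^esub> t"
  by (simp_all add: balanced_tensor_def FactGroup_def Let_def)

lemma abelian_T: "abelian_group T"
proof -
  have "comm_group (F Mod rels)"
    by (rule comm_group.abelian_FactGroup[OF F_comm normal_imp_subgroup[OF normal_rels]])
  moreover have "add_monoid T = \<lparr>carrier = carrier (F Mod rels), monoid.mult = monoid.mult (F Mod rels),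
     monoid.one = monoid.one (F Mod rels), \<dots> = undefined\<rparr>"
    by (simp add: balanced_tensor_def Let_def)
  ultimately show ?thesis
    by (intro comm_group_abelian_groupI) (simp add: FactGroup_def)
qed

sublocale T: abelian_group T by (rule abelian_T)

lemma coset_mem: "t \<Colon> T \<Longrightarrow> \<exists>c. Poly_Mapping.keys c \<subseteq> carrier M \<times> carrier N \<and> t = rels #>\<^bsub>F\<^esub> c"
  unfolding T_carrier RCOSETS_def by (erule UN_E, drule singletonD, rule exI, rule conjI) simp_all

lemma coset_add: "\<lbrakk>Poly_Mapping.keys c \<subseteq> carrier M \<times> carrier N; Poly_Mapping.keys d \<subseteq> carrier M \<times> carrier N\<rbrakk> \<Longrightarrow>
   (rels #>\<^bsub>F\<^esub> c) \<oplus>\<^bsub>T\<^esub> (rels #>\<^bsub>F\<^esub> d) = rels #>\<^bsub>F\<^esub> (c + d)"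
  using normal.rcos_sum[OF normal_rels, of c d] by (simp add: T_add)

lemma coset_closed: "Poly_Mapping.keys c \<subseteq> carrier M \<times> carrier N \<Longrightarrow> rels #>\<^bsub>F\<^esub> c \<Colon> T"
  unfolding T_carrier RCOSETS_def by (rule UN_I[of c]) simp_all

text \<open>Representatives of a coset differ by a relation, so the choice made in \<open>tensor_lift\<close> does
  not affect the value.\<close>

lemma lift_coset:
  assumes "balanced P b" "Poly_Mapping.keys c \<subseteq> carrier M \<times> carrier N"
  shows "lift P b (rels #>\<^bsub>F\<^esub> c) = frag_ext P (\<lambda>(m, n). b m n) c"
proof -
  interpret P: abelian_group P using assms by (simp add: balanced_def)
  have b: "(\<lambda>(m, n). b m n) \<in> carrier M \<times> carrier N \<rightarrow> carrier P"
    using assms by (auto simp: balanced_def)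
  have "c \<in> rels #>\<^bsub>F\<^esub> c"
    using group.rcos_self[OF group_free_Abelian_group, of c _ rels] normal_imp_subgroup[OF normal_rels] assms(2)
    by simp
  then have "(SOME d. d \<in> rels #>\<^bsub>F\<^esub> c) \<in> rels #>\<^bsub>F\<^esub> c" by (rule someI)
  then obtain r where "r \<in> rels" "(SOME d. d \<in> rels #>\<^bsub>F\<^esub> c) = r + c"
    by (auto simp: r_coset_def)
  then show ?thesis
    using frag_ext_rels[OF assms(1)] P.frag_ext_add[OF b _ assms(2), of r] P.frag_ext_closed[OF b assms(2)]
    by (simp add: tensor_lift_def Let_def frag_ext_def[symmetric] rels_closed)
qed

lemma lift_pure:
  assumes "balanced P b" "m \<Colon> M" "n \<Colon> N"
  shows "lift P b (bpure m n) = b m n"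
proof -
  interpret P: abelian_group P using assms by (simp add: balanced_def)
  have "b m n \<Colon> P" using assms by (simp add: balanced_def)
  then show ?thesis
    unfolding balanced_pure_def using assms by (simp add: lift_coset[OF assms(1)] P.frag_ext_of)
qed

lemma lift_add:
  assumes "balanced P b" "s \<Colon> T" "t \<Colon> T"
  shows "lift P b (s \<oplus>\<^bsub>T\<^esub> t) =
    lift P b s \<oplus>\<^bsub>P\<^esub> lift P b t"
proof -
  interpret P: abelian_group P using assms by (simp add: balanced_def)
  have b: "(\<lambda>(m, n). b m n) \<in> carrier M \<times> carrier N \<rightarrow> carrier P"
    using assms by (auto simp: balanced_def)
  obtain c d where cd: "Poly_Mapping.keys c \<subseteq> carrier M \<times> carrier N" "s = rels #>\<^bsub>F\<^esub> c"
    "Poly_Mapping.keys d \<subseteq> carrier M \<times> carrier N" "t = rels #>\<^bsub>F\<^esub> d"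
    using coset_mem[OF assms(2)] coset_mem[OF assms(3)] by blast
  moreover have "Poly_Mapping.keys (c + d) \<subseteq> carrier M \<times> carrier N"
    using cd keys_add[of c d] by blast
  ultimately show ?thesis
    using P.frag_ext_add[OF b] by (simp add: coset_add lift_coset[OF assms(1)])
qed

lemma lift_closed:
  assumes "balanced P b" "t \<Colon> T"
  shows "lift P b t \<Colon> P"
proof -
  interpret P: abelian_group P using assms by (simp add: balanced_def)
  have b: "(\<lambda>(m, n). b m n) \<in> carrier M \<times> carrier N \<rightarrow> carrier P"
    using assms by (auto simp: balanced_def)
  obtain c where c: "Poly_Mapping.keys c \<subseteq> carrier M \<times> carrier N" "t = rels #>\<^bsub>F\<^esub> c"
    using coset_mem[OF assms(2)] by blast
  show ?thesis unfolding c(2) lift_coset[OF assms(1) c(1)] by (rule P.frag_ext_closed[OF b c(1)])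
qed

lemma lift_cong:
  assumes "t \<Colon> T" and "\<And>m n. \<lbrakk>m \<Colon> M; n \<Colon> N\<rbrakk> \<Longrightarrow> b m n = b' m n"
    and "\<And>m n. \<lbrakk>m \<Colon> M; n \<Colon> N\<rbrakk> \<Longrightarrow> b' m n \<Colon> P" and "abelian_group P"
  shows "lift P b t = lift P b' t"
proof -
  interpret P: abelian_group P by (rule assms(4))
  obtain c where c: "Poly_Mapping.keys c \<subseteq> carrier M \<times> carrier N" "t = rels #>\<^bsub>F\<^esub> c"
    using coset_mem[OF assms(1)] by blast
  have "c \<in> t"
    using group.rcos_self[OF group_free_Abelian_group, of c _ rels] normal_imp_subgroup[OF normal_rels] c
    by simp
  then have "(SOME d. d \<in> t) \<in> t" by (rule someI)
  then obtain r where r: "r \<in> rels" "(SOME d. d \<in> t) = r + c"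
    using c by (auto simp: r_coset_def)
  have "Poly_Mapping.keys (r + c) \<subseteq> carrier M \<times> carrier N"
    using r c rels_closed[of r] keys_add[of r c] by blast
  then show ?thesis
    unfolding tensor_lift_def Let_def r(2)
    by (intro P.finsum_cong') (use assms in \<open>auto intro!: P.int_multiple_closed\<close>)
qed

lemma bpure_closed: "\<lbrakk>m \<Colon> M; n \<Colon> N\<rbrakk> \<Longrightarrow> bpure m n \<Colon> T"
  unfolding balanced_pure_def by (rule coset_closed) simp

lemma coset_eq:
  fixes c d :: "'m \<times> 'n \<Rightarrow>\<^sub>0 int"
  assumes "Poly_Mapping.keys c \<subseteq> carrier M \<times> carrier N" "Poly_Mapping.keys d \<subseteq> carrier M \<times> carrier N" "c - d \<in> rels"
  shows "rels #>\<^bsub>F\<^esub> c = rels #>\<^bsub>F\<^esub> d"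
proof -
  have "c = (c - d) + d" by simp
  then have "c \<in> rels #>\<^bsub>F\<^esub> d"
    unfolding r_coset_def mult_free_Abelian_group using assms(3) by (intro UN_I[of "c - d"]) simp_all
  then show ?thesis
    by (intro group.repr_independence[OF group_free_Abelian_group, symmetric] normal_imp_subgroup[OF normal_rels])
      (simp_all add: assms)
qed

lemma bpure_add_left:
  assumes "m \<Colon> M" "m' \<Colon> M" "n \<Colon> N"
  shows "bpure (m \<oplus>\<^bsub>M\<^esub> m') n = bpure m n \<oplus>\<^bsub>T\<^esub> bpure m' n"
proof -
  have "frag_of (m \<oplus>\<^bsub>M\<^esub> m', n) - (frag_of (m, n) + frag_of (m', n)) =
    frag_of (m \<oplus>\<^bsub>M\<^esub> m', n) - frag_of (m, n) - frag_of (m', n)" by (rule diff_diff_eq[symmetric])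
  also have "\<dots> \<in> rels" unfolding rels_generators using assms by (intro generate.incl) blast
  finally have "rels #>\<^bsub>F\<^esub> frag_of (m \<oplus>\<^bsub>M\<^esub> m', n) = rels #>\<^bsub>F\<^esub> (frag_of (m, n) + frag_of (m', n))"
    using assms by (intro coset_eq order.trans[OF keys_add]) simp_all
  then show ?thesis
    unfolding balanced_pure_def using assms by (subst coset_add) simp_all
qed

lemma bpure_add_right:
  assumes "m \<Colon> M" "n \<Colon> N" "n' \<Colon> N"
  shows "bpure m (n \<oplus>\<^bsub>N\<^esub> n') = bpure m n \<oplus>\<^bsub>T\<^esub> bpure m n'"
proof -
  have "frag_of (m, n \<oplus>\<^bsub>N\<^esub> n') - (frag_of (m, n) + frag_of (m, n')) =
    frag_of (m, n \<oplus>\<^bsub>N\<^esub> n') - frag_of (m, n) - frag_of (m, n')" by (rule diff_diff_eq[symmetric])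
  also have "\<dots> \<in> rels" unfolding rels_generators using assms by (intro generate.incl) blast
  finally have "rels #>\<^bsub>F\<^esub> frag_of (m, n \<oplus>\<^bsub>N\<^esub> n') = rels #>\<^bsub>F\<^esub> (frag_of (m, n) + frag_of (m, n'))"
    using assms by (intro coset_eq order.trans[OF keys_add]) simp_all
  then show ?thesis
    unfolding balanced_pure_def using assms by (subst coset_add) simp_all
qed

lemma bpure_balanced:
  assumes "m \<Colon> M" "r \<Colon> R" "n \<Colon> N"
  shows "bpure (ra m r) n = bpure m (la r n)"
proof -
  have "frag_of (ra m r, n) - frag_of (m, la r n) \<in> rels"
    unfolding rels_generators using assms by (intro generate.incl) blast
  then show ?thesis
    unfolding balanced_pure_def using assms by (intro coset_eq) (simp_all add: ra_closed la_closed)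
qed

lemma bpure_zero_left: "n \<Colon> N \<Longrightarrow> bpure \<zero>\<^bsub>M\<^esub> n = \<zero>\<^bsub>T\<^esub>"
  using bpure_add_left[of "\<zero>\<^bsub>M\<^esub>" "\<zero>\<^bsub>M\<^esub>" n] bpure_closed[of "\<zero>\<^bsub>M\<^esub>" n] by simp

text \<open>Zero and negatives are absorbed into the left factor, so that sums of pure tensors exhaust the tensor
  product.\<close>

lemma tensor_induct [consumes 1, case_names pure add]:
  assumes "t \<Colon> T"
    and pure: "\<And>m n. \<lbrakk>m \<Colon> M; n \<Colon> N\<rbrakk> \<Longrightarrow> Q (bpure m n)"
    and add: "\<And>s t. \<lbrakk>s \<Colon> T; t \<Colon> T; Q s; Q t\<rbrakk> \<Longrightarrow> Q (s \<oplus>\<^bsub>T\<^esub> t)"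
  shows "Q t"
proof -
  obtain c where c: "Poly_Mapping.keys c \<subseteq> carrier M \<times> carrier N" "t = rels #>\<^bsub>F\<^esub> c"
    using coset_mem[OF assms(1)] by blast
  have z: "rels #>\<^bsub>F\<^esub> 0 = \<zero>\<^bsub>T\<^esub>"
    using group.coset_mult_one[OF group_free_Abelian_group subgroup.subset[OF normal_imp_subgroup[OF normal_rels]]]
    by (simp add: T_zero)
  have "Q (rels #>\<^bsub>F\<^esub> c) \<and> Q (rels #>\<^bsub>F\<^esub> (-c))"
    using c(1)
  proof (rule free_Abelian_group_induct, goal_cases)
    case 1
    then show ?case
      using pure[of "\<zero>\<^bsub>M\<^esub>" "\<zero>\<^bsub>N\<^esub>"] bpure_zero_left[of "\<zero>\<^bsub>N\<^esub>"] by (simp add: z)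
  next
    case (2 x y)
    then show ?case
      using add[of "rels #>\<^bsub>F\<^esub> x" "rels #>\<^bsub>F\<^esub> (-y)"] add[of "rels #>\<^bsub>F\<^esub> (-x)" "rels #>\<^bsub>F\<^esub> y"]
      by (simp add: coset_add coset_closed)
  next
    case (3 a)
    obtain m n where a: "a = (m, n)" by (cases a)
    have mn: "m \<Colon> M" "n \<Colon> N" using 3 a by auto
    have "bpure (\<ominus>\<^bsub>M\<^esub> m) n = rels #>\<^bsub>F\<^esub> (- frag_of a)"
    proof -
      have "bpure (\<ominus>\<^bsub>M\<^esub> m) n \<oplus>\<^bsub>T\<^esub> bpure m n = \<zero>\<^bsub>T\<^esub>"
        using mn bpure_add_left[of "\<ominus>\<^bsub>M\<^esub> m" m n] by (simp add: M.l_neg bpure_zero_left)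
      moreover have "(rels #>\<^bsub>F\<^esub> (- frag_of a)) \<oplus>\<^bsub>T\<^esub> bpure m n = \<zero>\<^bsub>T\<^esub>"
        using mn by (simp add: balanced_pure_def coset_add a z)
      ultimately show ?thesis
        using mn T.add.inv_equality[of "bpure (\<ominus>\<^bsub>M\<^esub> m) n" "bpure m n"]
          T.add.inv_equality[of "rels #>\<^bsub>F\<^esub> (- frag_of a)" "bpure m n"]
        by (simp add: bpure_closed coset_closed a)
    qed
    then show ?case
      using pure[OF mn] pure[of "\<ominus>\<^bsub>M\<^esub> m" n] mn by (simp add: balanced_pure_def a)
  qed
  then show ?thesis using c by simp
qed

end

section \<open>Linear and bilinear maps\<close>

text \<open>The module hypotheses are part of linearity, so that composing such facts keeps them available.\<close>

definition lin where
  "lin k M N f \<longleftrightarrow> module k M \<and> module k N \<and> f \<in> linear_maps k M N"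

text \<open>Linearity in each variable separately lets the calculus of linear maps prove bilinearity.\<close>

definition bil where
  "bil k M N P b \<longleftrightarrow> module k M \<and> module k N \<and> module k P \<and>
    (\<forall>m\<in>carrier M. lin k N P (b m)) \<and> (\<forall>n\<in>carrier N. lin k M P (\<lambda>m. b m n))"

lemma linI:
  assumes "module k M" "module k N"
    and "\<And>x. x \<Colon> M \<Longrightarrow> f x \<Colon> N"
    and "\<And>x y. \<lbrakk>x \<Colon> M; y \<Colon> M\<rbrakk> \<Longrightarrow> f (x \<oplus>\<^bsub>M\<^esub> y) = f x \<oplus>\<^bsub>N\<^esub> f y"
    and "\<And>c x. \<lbrakk>c \<Colon> k; x \<Colon> M\<rbrakk> \<Longrightarrow> f (c \<odot>\<^bsub>M\<^esub> x) = c \<odot>\<^bsub>N\<^esub> f x"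
  shows "lin k M N f"
  using assms by (auto simp: lin_def linear_maps_def)

lemma linD:
  assumes "lin k M N f"
  shows lin_dom: "module k M" and lin_cod: "module k N"
    and lin_closed: "x \<Colon> M \<Longrightarrow> f x \<Colon> N"
    and lin_add: "\<lbrakk>x \<Colon> M; y \<Colon> M\<rbrakk> \<Longrightarrow> f (x \<oplus>\<^bsub>M\<^esub> y) = f x \<oplus>\<^bsub>N\<^esub> f y"
    and lin_smult: "\<lbrakk>c \<Colon> k; x \<Colon> M\<rbrakk> \<Longrightarrow> f (c \<odot>\<^bsub>M\<^esub> x) = c \<odot>\<^bsub>N\<^esub> f x"
  using assms by (auto simp: lin_def linear_maps_def)

lemma lin_zero: "lin k M N f \<Longrightarrow> f \<zero>\<^bsub>M\<^esub> = \<zero>\<^bsub>N\<^esub>"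
proof -
  assume f: "lin k M N f"
  interpret M: module k M by (rule lin_dom[OF f])
  interpret N: module k N by (rule lin_cod[OF f])
  show ?thesis
    using lin_smult[OF f, of "\<zero>\<^bsub>k\<^esub>" "\<zero>\<^bsub>M\<^esub>"] lin_closed[OF f, of "\<zero>\<^bsub>M\<^esub>"] by simp
qed

lemma lin_cong:
  assumes "lin k M N f" "\<And>x. x \<Colon> M \<Longrightarrow> g x = f x"
  shows "lin k M N g"
proof -
  interpret M: module k M by (rule lin_dom[OF assms(1)])
  show ?thesis
    by (rule linI) (auto simp: assms(2) linD[OF assms(1)])
qed

lemma bilI:
  assumes "module k M" "module k N" "module k P"
    and "\<And>m. m \<Colon> M \<Longrightarrow> lin k N P (\<lambda>n. b m n)" "\<And>n. n \<Colon> N \<Longrightarrow> lin k M P (\<lambda>m. b m n)"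
  shows "bil k M N P b"
  using assms by (auto simp: bil_def)

lemma bilD:
  assumes "bil k M N P b"
  shows "module k M" "module k N" "module k P"
    and bil_right: "m \<Colon> M \<Longrightarrow> lin k N P (\<lambda>n. b m n)" and bil_left: "n \<Colon> N \<Longrightarrow> lin k M P (\<lambda>m. b m n)"
    and bil_closed: "\<lbrakk>m \<Colon> M; n \<Colon> N\<rbrakk> \<Longrightarrow> b m n \<Colon> P"
  using assms by (auto simp: bil_def lin_closed)

text \<open>The map induced on a tensor product sees only the additive structure of its target.\<close>

lemma same_addition:
  assumes "carrier P = carrier Q" "\<And>x y. x \<oplus>\<^bsub>P\<^esub> y = x \<oplus>\<^bsub>Q\<^esub> y" "\<zero>\<^bsub>P\<^esub> = \<zero>\<^bsub>Q\<^esub>"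
  shows same_finsum: "finsum P f I = finsum Q f I" and same_add_pow: "[(i::int)] \<cdot>\<^bsub>P\<^esub> x = [i] \<cdot>\<^bsub>Q\<^esub> x"
    and same_tensor_lift: "tensor_lift P b t = tensor_lift Q b t"
proof -
  have "(\<oplus>\<^bsub>P\<^esub>) = (\<oplus>\<^bsub>Q\<^esub>)" using assms(2) by (intro ext)
  note assms = assms(1) this assms(3)
  have a: "[(i::int)] \<cdot>\<^bsub>P\<^esub> x = [i] \<cdot>\<^bsub>Q\<^esub> x" for i x
    using assms by (simp add: add_pow_def int_pow_def nat_pow_def m_inv_def Let_def)
  show "finsum P f I = finsum Q f I" "[(i::int)] \<cdot>\<^bsub>P\<^esub> x = [i] \<cdot>\<^bsub>Q\<^esub> x"
    using assms a by (simp_all add: finsum_def finprod_def)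
  show "tensor_lift P b t = tensor_lift Q b t"
    using assms by (simp add: tensor_lift_def Let_def finsum_def finprod_def a)
qed

lemma base_module_simps [simp]:
  "carrier (base_module k) = carrier k" "x \<oplus>\<^bsub>base_module k\<^esub> y = x \<oplus>\<^bsub>k\<^esub> y" "\<zero>\<^bsub>base_module k\<^esub> = \<zero>\<^bsub>k\<^esub>"
  "c \<odot>\<^bsub>base_module k\<^esub> y = c \<otimes>\<^bsub>k\<^esub> y" "x \<otimes>\<^bsub>base_module k\<^esub> y = x \<otimes>\<^bsub>k\<^esub> y" "\<one>\<^bsub>base_module k\<^esub> = \<one>\<^bsub>k\<^esub>"
  by (simp_all add: base_module_def)

lemma module_base: "cring k \<Longrightarrow> module k (base_module k)"
proof -
  assume "cring k" then interpret cring k .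
  have "abelian_group (base_module k)"
    by (rule abelian_groupI) (auto simp: a_ac intro!: exI[of _ "\<ominus>\<^bsub>k\<^esub> _"] bexI[of _ "\<ominus>\<^bsub>k\<^esub> _"] l_neg)
  then show ?thesis
    by (intro moduleI) (auto simp: l_distr r_distr m_assoc \<open>cring k\<close>)
qed

lemma tensor_lift_base: "tensor_lift k b t = tensor_lift (base_module k) b t"
  by (rule same_tensor_lift) simp_all

subsection \<open>The tensor product as a module\<close>

locale module_pair = M: module k M + N: module k N for k :: "('k, 'z) ring_scheme"
  and M :: "('k, 'm, 'x) module_scheme" and N :: "('k, 'n, 'y) module_scheme"
begin

sublocale tensor_factors M N k "\<lambda>m c. c \<odot>\<^bsub>M\<^esub> m" "smult N"
  by unfold_locales simp_all

lemma tensor_simps: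
  "carrier (tensor k M N) = carrier T" "s \<oplus>\<^bsub>tensor k M N\<^esub> t = s \<oplus>\<^bsub>T\<^esub> t" "\<zero>\<^bsub>tensor k M N\<^esub> = \<zero>\<^bsub>T\<^esub>"
  "pure k M N = bpure"
  "c \<odot>\<^bsub>tensor k M N\<^esub> t = lift T (\<lambda>m n. pure k M N (c \<odot>\<^bsub>M\<^esub> m) n) t"
  by (simp_all add: tensor_def pure_def Let_def)

lemma lift_T: "tensor_lift (tensor k M N) b t = tensor_lift T b t"
  by (rule same_tensor_lift) (simp_all add: tensor_simps)

lemma balanced_smult: "c \<Colon> k \<Longrightarrow> balanced T (\<lambda>m n. pure k M N (c \<odot>\<^bsub>M\<^esub> m) n)"
  unfolding balanced_def
  by (intro conjI ballI abelian_T)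
    (simp_all add: tensor_simps(4) M.smult_r_distr bpure_closed bpure_add_left bpure_add_right
      bpure_balanced[symmetric] M.smult_assoc1[symmetric] M.m_comm)

lemma smult_pure: "\<lbrakk>c \<Colon> k; m \<Colon> M; n \<Colon> N\<rbrakk> \<Longrightarrow>
  c \<odot>\<^bsub>tensor k M N\<^esub> pure k M N m n = pure k M N (c \<odot>\<^bsub>M\<^esub> m) n"
  using lift_pure[OF balanced_smult] by (simp add: tensor_simps)

lemma smult_add: "\<lbrakk>c \<Colon> k; s \<Colon> T; t \<Colon> T\<rbrakk> \<Longrightarrow>
  c \<odot>\<^bsub>tensor k M N\<^esub> (s \<oplus>\<^bsub>T\<^esub> t) = c \<odot>\<^bsub>tensor k M N\<^esub> s \<oplus>\<^bsub>T\<^esub> c \<odot>\<^bsub>tensor k M N\<^esub> t"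
  using lift_add[OF balanced_smult] by (simp add: tensor_simps)

lemma smult_closed: "\<lbrakk>c \<Colon> k; t \<Colon> T\<rbrakk> \<Longrightarrow> c \<odot>\<^bsub>tensor k M N\<^esub> t \<Colon> T"
  using lift_closed[OF balanced_smult] by (simp add: tensor_simps)

lemma tensor_module: "module k (tensor k M N)"
proof (rule moduleI)
  show "cring k" by (rule M.R.is_cring)
  show "abelian_group (tensor k M N)"
  proof (rule abelian_groupI)
    fix x assume "x \<Colon> tensor k M N"
    then show "\<exists>y\<in>carrier (tensor k M N). y \<oplus>\<^bsub>tensor k M N\<^esub> x = \<zero>\<^bsub>tensor k M N\<^esub>"
      unfolding tensor_simps(1-3) by (intro bexI[of _ "\<ominus>\<^bsub>T\<^esub> x"]) (simp_all add: T.l_neg)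
  qed (simp_all add: tensor_simps(1-3) T.a_ac)
next
  fix a b x assume a: "a \<Colon> k" "b \<Colon> k" and "x \<Colon> tensor k M N"
  then have x: "x \<Colon> T" by (simp add: tensor_simps)
  show "(a \<oplus>\<^bsub>k\<^esub> b) \<odot>\<^bsub>tensor k M N\<^esub> x = a \<odot>\<^bsub>tensor k M N\<^esub> x \<oplus>\<^bsub>tensor k M N\<^esub> b \<odot>\<^bsub>tensor k M N\<^esub> x"
    using x
  proof (induction x rule: tensor_induct)
    case (pure m n)
    then show ?case using a smult_pure[of _ m n] M.smult_l_distr by (simp add: tensor_simps(1-4) bpure_add_left)
  next
    case (add s t)
    then show ?case using a by (simp add: smult_add smult_closed tensor_simps(1-4) T.a_ac)
  qed
  show "(a \<otimes>\<^bsub>k\<^esub> b) \<odot>\<^bsub>tensor k M N\<^esub> x = a \<odot>\<^bsub>tensor k M N\<^esub> (b \<odot>\<^bsub>tensor k M N\<^esub> x)"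
    using x
  proof (induction x rule: tensor_induct)
    case (pure m n)
    then show ?case using a smult_pure[of _ m n] smult_pure[of _ "b \<odot>\<^bsub>M\<^esub> m" n] M.smult_assoc1 by (simp add: tensor_simps(1-4))
  next
    case (add s t)
    then show ?case using a by (simp add: smult_add smult_closed tensor_simps(1-4) T.a_ac)
  qed
next
  fix x assume "x \<Colon> tensor k M N"
  then have x: "x \<Colon> T" by (simp add: tensor_simps)
  show "\<one>\<^bsub>k\<^esub> \<odot>\<^bsub>tensor k M N\<^esub> x = x" using x
  proof (induction x rule: tensor_induct)
    case (pure m n)
    then show ?case using smult_pure[of _ m n] by (simp add: tensor_simps(1-4))
  next
    case (add s t)
    then show ?case by (simp add: smult_add smult_closed tensor_simps(1-4))
  qed
qed (simp_all add: tensor_simps(1-4) smult_add smult_closed)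

lemma bil_pure: "bil k M N (tensor k M N) (pure k M N)"
  by (intro bilI linI tensor_module M.module_axioms N.module_axioms)
    (simp_all add: smult_pure, simp_all add: tensor_simps(1-4) bpure_closed bpure_add_left bpure_add_right bpure_balanced)

lemma bil_balanced:
  assumes b: "bil k M N P b"
  shows "balanced P b"
  unfolding balanced_def
proof (intro conjI ballI)
  show "abelian_group P" using bilD(3)[OF b] by (rule module.axioms(2))
  fix m m' assume m: "m \<Colon> M" "m' \<Colon> M"
  fix n assume n: "n \<Colon> N"
  show "b m n \<Colon> P" by (rule bil_closed[OF b m(1) n])
  show "b (m \<oplus>\<^bsub>M\<^esub> m') n = b m n \<oplus>\<^bsub>P\<^esub> b m' n" by (rule lin_add[OF bil_left[OF b n] m])
next
  fix m assume m: "m \<Colon> M"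
  fix n n' assume n: "n \<Colon> N" "n' \<Colon> N"
  show "b m (n \<oplus>\<^bsub>N\<^esub> n') = b m n \<oplus>\<^bsub>P\<^esub> b m n'" by (rule lin_add[OF bil_right[OF b m] n])
next
  fix m c n assume m: "m \<Colon> M" and c: "c \<Colon> k" and n: "n \<Colon> N"
  show "b (c \<odot>\<^bsub>M\<^esub> m) n = b m (c \<odot>\<^bsub>N\<^esub> n)"
    by (simp add: lin_smult[OF bil_left[OF b n] c m] lin_smult[OF bil_right[OF b m] c n])
qed

lemma module_tensor_induct:
  assumes "t \<Colon> tensor k M N"
    and "\<And>m n. \<lbrakk>m \<Colon> M; n \<Colon> N\<rbrakk> \<Longrightarrow> Q (pure k M N m n)"
    and "\<And>s t. \<lbrakk>s \<Colon> tensor k M N; t \<Colon> tensor k M N; Q s; Q t\<rbrakk> \<Longrightarrow> Q (s \<oplus>\<^bsub>tensor k M N\<^esub> t)"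
  shows "Q t"
  using assms unfolding tensor_simps(1-4) by (rule tensor_induct)

lemma balanced_lift_pure: "\<lbrakk>balanced P b; m \<Colon> M; n \<Colon> N\<rbrakk> \<Longrightarrow>
    lift P b (pure k M N m n) = b m n"
  unfolding tensor_simps(4) by (rule lift_pure)

lemma balanced_lift_add: "\<lbrakk>balanced P b; s \<Colon> tensor k M N; t \<Colon> tensor k M N\<rbrakk> \<Longrightarrow>
   lift P b (s \<oplus>\<^bsub>tensor k M N\<^esub> t) = lift P b s \<oplus>\<^bsub>P\<^esub> lift P b t"
  unfolding tensor_simps(1,2) by (rule lift_add)

lemma balanced_lift_closed: "\<lbrakk>balanced P b; t \<Colon> tensor k M N\<rbrakk> \<Longrightarrow> lift P b t \<Colon> P"
  unfolding tensor_simps(1) by (rule lift_closed)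

end

lemma module_pairI: "bil k M N P b \<Longrightarrow> module_pair k M N"
  by (simp add: module_pair_def bilD)

lemma tensor_is_module: "\<lbrakk>module k M; module k N\<rbrakk> \<Longrightarrow> module k (tensor k M N)"
  using module_pair.tensor_module module_pair.intro by blast

lemma pure_bil: "\<lbrakk>module k M; module k N\<rbrakk> \<Longrightarrow> bil k M N (tensor k M N) (pure k M N)"
  using module_pair.bil_pure module_pair.intro by blast

lemma pure_closed: "\<lbrakk>module k M; module k N; m \<Colon> M; n \<Colon> N\<rbrakk> \<Longrightarrow> pure k M N m n \<Colon> tensor k M N"
  using bil_closed[OF pure_bil] by metis

lemma k_tensor_induct [consumes 3, case_names pure add]:
  assumes "module k M" "module k N" "t \<Colon> tensor k M N"
    and "\<And>m n. \<lbrakk>m \<Colon> M; n \<Colon> N\<rbrakk> \<Longrightarrow> Q (pure k M N m n)"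
    and "\<And>s t. \<lbrakk>s \<Colon> tensor k M N; t \<Colon> tensor k M N; Q s; Q t\<rbrakk> \<Longrightarrow> Q (s \<oplus>\<^bsub>tensor k M N\<^esub> t)"
  shows "Q t"
  using module_pair.module_tensor_induct[OF module_pair.intro[OF assms(1,2)], of t Q] assms(3-) by blast

lemma lift_pure:
  assumes "bil k M N P b" "m \<Colon> M" "n \<Colon> N"
  shows "lift P b (pure k M N m n) = b m n"
  by (rule module_pair.balanced_lift_pure[OF module_pairI[OF assms(1)] module_pair.bil_balanced[OF module_pairI[OF assms(1)] assms(1)] assms(2-)])

lemma lift_closed:
  assumes "bil k M N P b" "t \<Colon> tensor k M N"
  shows "lift P b t \<Colon> P"
  by (rule module_pair.balanced_lift_closed[OF module_pairI[OF assms(1)] module_pair.bil_balanced[OF module_pairI[OF assms(1)] assms(1)] assms(2-)])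

lemma lift_add:
  assumes "bil k M N P b" "s \<Colon> tensor k M N" "t \<Colon> tensor k M N"
  shows "lift P b (s \<oplus>\<^bsub>tensor k M N\<^esub> t) = lift P b s \<oplus>\<^bsub>P\<^esub> lift P b t"
  by (rule module_pair.balanced_lift_add[OF module_pairI[OF assms(1)] module_pair.bil_balanced[OF module_pairI[OF assms(1)] assms(1)] assms(2-)])

lemma lift_cong:
  assumes "bil k M N P b" "t \<Colon> tensor k M N"
    and "\<And>m n. \<lbrakk>m \<Colon> M; n \<Colon> N\<rbrakk> \<Longrightarrow> b' m n = b m n"
  shows "lift P b' t = lift P b t"
proof -
  interpret module_pair k M N by (rule module_pairI[OF assms(1)])
  show ?thesis
    by (rule lift_cong[OF assms(2)[unfolded tensor_simps(1)]])
      (simp_all add: assms(3) bil_closed[OF assms(1)] module.axioms(2)[OF bilD(3)[OF assms(1)]])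
qed

subsection \<open>Calculus of linear maps\<close>

lemma lin_lift: "bil k M N P b \<Longrightarrow> lin k (tensor k M N) P (\<lambda>t. lift P b t)"
proof -
  assume b: "bil k M N P b"
  note mods = bilD(1-3)[OF b]
  interpret T: module k "tensor k M N" using mods by (intro tensor_is_module)
  interpret P: module k P by (rule mods)
  show ?thesis
  proof (rule linI)
    fix c t assume c: "c \<Colon> k" and t: "t \<Colon> tensor k M N"
    show "lift P b (c \<odot>\<^bsub>tensor k M N\<^esub> t) = c \<odot>\<^bsub>P\<^esub> lift P b t"
      using mods(1,2) t
    proof (induction t rule: k_tensor_induct)
      case (pure m n)
      note pl = bil_left[OF pure_bil[OF mods(1,2)] pure(2)]
      show ?case
        using c pure lin_smult[OF pl c pure(1)] lin_smult[OF bil_left[OF b pure(2)] c pure(1)]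
        by (simp add: lift_pure[OF b] lin_closed[OF pl] flip: lin_smult[OF pl] )
           (simp add: lift_pure[OF b] linD(1)[OF pl, THEN module.smult_closed])
    next
      case (add s t)
      then show ?case using c
        by (simp add: T.smult_r_distr lift_add[OF b] P.smult_r_distr lift_closed[OF b])
    qed
  qed (use mods in \<open>simp_all add: tensor_is_module lift_closed[OF b] lift_add[OF b]\<close>)
qed

lemma lin_tensor_eqI:
  assumes "lin k (tensor k M N) P f" "lin k (tensor k M N) P g" "module k M" "module k N"
    and "\<And>m n. \<lbrakk>m \<Colon> M; n \<Colon> N\<rbrakk> \<Longrightarrow> f (pure k M N m n) = g (pure k M N m n)"
    and "t \<Colon> tensor k M N"
  shows "f t = g t"
  using assms(3,4,6)
  by (induction t rule: k_tensor_induct) (simp_all add: assms(5) lin_add[OF assms(1)] lin_add[OF assms(2)])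

lemma lin_id: "module k M \<Longrightarrow> lin k M M (\<lambda>x. x)"
  by (rule linI) auto

lemma lin_comp: "\<lbrakk>lin k N P f; lin k M N g\<rbrakk> \<Longrightarrow> lin k M P (\<lambda>x. f (g x))"
  by (rule linI) (simp_all add: lin_dom lin_cod lin_closed lin_add lin_smult)

lemma lin_sum:
  assumes f: "lin k M N f" and g: "lin k M N g" shows "lin k M N (\<lambda>x. f x \<oplus>\<^bsub>N\<^esub> g x)"
proof -
  interpret N: module k N by (rule lin_cod[OF f])
  show ?thesis
    by (rule linI) (simp_all add: lin_dom[OF f] lin_cod[OF f] linD(3-)[OF f] linD(3-)[OF g] N.a_ac N.smult_r_distr)
qed

lemma lin_scale:
  assumes f: "lin k M N f" and c: "c \<Colon> k" shows "lin k M N (\<lambda>x. c \<odot>\<^bsub>N\<^esub> f x)"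
proof -
  interpret N: module k N by (rule lin_cod[OF f])
  show ?thesis using c
    by (intro linI) (simp_all add: lin_dom[OF f] lin_cod[OF f] linD(3-)[OF f] N.smult_r_distr flip: N.smult_assoc1, simp add: N.R.m_comm)
qed

lemma lin_coeff:
  assumes f: "lin k M (base_module k) f" and N: "module k N" "n \<Colon> N" shows "lin k M N (\<lambda>x. f x \<odot>\<^bsub>N\<^esub> n)"
proof -
  interpret N: module k N by (rule N)
  show ?thesis using N lin_closed[OF f]
    by (intro linI) (simp_all add: lin_dom[OF f] linD(4-)[OF f] N.smult_l_distr flip: N.smult_assoc1)
qed

lemma base_mult_left: "\<lbrakk>lin k M (base_module k) f; c \<Colon> k\<rbrakk> \<Longrightarrow> lin k M (base_module k) (\<lambda>x. c \<otimes>\<^bsub>k\<^esub> f x)"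
  using lin_scale[of k M "base_module k" f c] by simp

lemma base_mult_right: "\<lbrakk>lin k M (base_module k) f; c \<Colon> k\<rbrakk> \<Longrightarrow> lin k M (base_module k) (\<lambda>x. f x \<otimes>\<^bsub>k\<^esub> c)"
  using lin_coeff[of k M f "base_module k" c] by (simp add: lin_cod)

lemma lin_pure_left: "\<lbrakk>lin k X M f; module k N; n \<Colon> N\<rbrakk> \<Longrightarrow> lin k X (tensor k M N) (\<lambda>x. pure k M N (f x) n)"
  by (rule lin_comp[OF bil_left[OF pure_bil]]) (simp_all add: lin_cod)

lemma lin_pure_right: "\<lbrakk>lin k X N f; module k M; m \<Colon> M\<rbrakk> \<Longrightarrow> lin k X (tensor k M N) (\<lambda>x. pure k M N m (f x))"
  by (rule lin_comp[OF bil_right[OF pure_bil]]) (simp_all add: lin_cod)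

lemma lin_lift_arg: "\<lbrakk>lin k X (tensor k M N) t; bil k M N P b\<rbrakk> \<Longrightarrow> lin k X P (\<lambda>x. lift P b (t x))"
  by (rule lin_comp[OF lin_lift])

text \<open>Linearity in a parameter of the summand.  With \<open>lin_lift_arg\<close> it handles nested Sweedler
  sums.\<close>

lemma lin_lift_param:
  assumes X: "module k X" and t: "t \<Colon> tensor k M N"
    and b: "\<And>x. x \<Colon> X \<Longrightarrow> bil k M N P (\<lambda>m n. b x m n)"
    and l: "\<And>m n. \<lbrakk>m \<Colon> M; n \<Colon> N\<rbrakk> \<Longrightarrow> lin k X P (\<lambda>x. b x m n)"
  shows "lin k X P (\<lambda>x. lift P (\<lambda>m n. b x m n) t)"
proof -
  interpret X: module k X by fact
  have mods: "module k M" "module k N" using b[of "\<zero>\<^bsub>X\<^esub>"] by (simp_all add: bilD)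
  show ?thesis using mods t
  proof (induction t rule: k_tensor_induct)
    case (pure m n)
    show ?case by (rule lin_cong[OF l[OF pure]]) (simp add: lift_pure[OF b] pure)
  next
    case (add s t)
    show ?case by (rule lin_cong[OF lin_sum[OF add(3,4)]]) (simp add: lift_add[OF b] add)
  qed
qed

lemma lin_of_lift:
  assumes "lin k P Q f" "bil k M N P b" "t \<Colon> tensor k M N"
  shows "f (lift P b t) = lift Q (\<lambda>m n. f (b m n)) t"
proof -
  have b': "bil k M N Q (\<lambda>m n. f (b m n))"
    by (rule bilI) (use assms in \<open>auto simp: bilD lin_cod intro: lin_comp[OF assms(1)] bil_left bil_right\<close>)
  show ?thesis
    by (rule lin_tensor_eqI[OF lin_comp[OF assms(1) lin_lift[OF assms(2)]] lin_lift[OF b']])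
      (use assms in \<open>simp_all add: bilD lift_pure[OF b'] lift_pure[OF assms(2)]\<close>)
qed

text \<open>Independent Sweedler sums commute, because both sides are bilinear in the two tensors.\<close>

lemma lift_swap:
  assumes s: "s \<Colon> tensor k M N" and t: "t \<Colon> tensor k M' N'"
    and mods: "module k M" "module k N" "module k M'" "module k N'"
    and b1: "\<And>m n. \<lbrakk>m \<Colon> M; n \<Colon> N\<rbrakk> \<Longrightarrow> bil k M' N' P (\<lambda>m' n'. b m n m' n')"
    and b2: "\<And>m' n'. \<lbrakk>m' \<Colon> M'; n' \<Colon> N'\<rbrakk> \<Longrightarrow> bil k M N P (\<lambda>m n. b m n m' n')"
  shows "lift P (\<lambda>m n. lift P (\<lambda>m' n'. b m n m' n') t) s =
    lift P (\<lambda>m' n'. lift P (\<lambda>m n. b m n m' n') s) t"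
proof -
  interpret M: module k M by (rule mods)
  interpret N: module k N by (rule mods)
  have P: "module k P" using b1[of "\<zero>\<^bsub>M\<^esub>" "\<zero>\<^bsub>N\<^esub>"] by (simp add: bilD)
  have L: "bil k M N P (\<lambda>m n. lift P (\<lambda>m' n'. b m n m' n') t)"
    by (intro bilI mods P lin_lift_param[OF _ t] b1 bil_left[OF b2] bil_right[OF b2])
  have R: "bil k M' N' P (\<lambda>m' n'. lift P (\<lambda>m n. b m n m' n') s)" if "s \<Colon> tensor k M N" for s
    by (intro bilI mods P lin_lift_param[OF _ that] b2 bil_left[OF b1] bil_right[OF b1])
  have "lin k (tensor k M N) P (\<lambda>s. lift P (\<lambda>m' n'. lift P (\<lambda>m n. b m n m' n') s) t)"
    by (rule lin_lift_param[OF tensor_is_module[OF mods(1,2)] t R lin_lift[OF b2]])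
  note l = this
  show ?thesis
  proof (rule lin_tensor_eqI[OF lin_lift[OF L] l mods(1,2) _ s])
    fix m n assume mn: "m \<Colon> M" "n \<Colon> N"
    have "lift P (\<lambda>m' n'. lift P (\<lambda>m n. b m n m' n') (pure k M N m n)) t =
        lift P (\<lambda>m' n'. b m n m' n') t"
      by (rule lift_cong[OF b1[OF mn] t]) (simp add: lift_pure[OF b2] mn)
    then show "lift P (\<lambda>m n. lift P (\<lambda>m' n'. b m n m' n') t) (pure k M N m n) =
        lift P (\<lambda>m' n'. lift P (\<lambda>m n. b m n m' n') (pure k M N m n)) t"
      by (simp add: lift_pure[OF L] mn)
  qed
qed

subsection \<open>Tensor products of maps and associativity\<close>

lemma bil_comp:
  assumes "bil k M N P b" "lin k X M f" "lin k Y N g"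
  shows "bil k X Y P (\<lambda>x y. b (f x) (g y))"
  by (intro bilI lin_comp[OF bil_right[OF assms(1)] assms(3)] lin_comp[OF bil_left[OF assms(1)] assms(2)])
    (use assms in \<open>simp_all add: bilD lin_dom lin_closed\<close>)

lemma lin_tensor_map:
  assumes "lin k P M f" "lin k Q N g"
  shows "lin k (tensor k P Q) (tensor k M N) (\<lambda>t. tensor_map k M N f g t)"
  unfolding tensor_map_def
  by (rule lin_lift[OF bil_comp[OF pure_bil assms]]) (simp_all add: assms[THEN lin_cod])

lemma tensor_map_pure:
  assumes "lin k P M f" "lin k Q N g" "p \<Colon> P" "q \<Colon> Q"
  shows "tensor_map k M N f g (pure k P Q p q) = pure k M N (f p) (g q)"
  unfolding tensor_map_def
  by (rule lift_pure[OF bil_comp[OF pure_bil assms(1,2)]]) (use assms in \<open>simp_all add: lin_cod\<close>)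

lemma lift_tensor_map:
  assumes "lin k P M f" "lin k Q N g" "bil k M N X b" "t \<Colon> tensor k P Q"
  shows "lift X b (tensor_map k M N f g t) = lift X (\<lambda>p q. b (f p) (g q)) t"
  by (rule lin_tensor_eqI[OF lin_lift_arg[OF lin_tensor_map[OF assms(1,2)] assms(3)]
        lin_lift[OF bil_comp[OF assms(3,1,2)]] _ _ _ assms(4)])
    (use assms in \<open>simp_all add: lin_dom tensor_map_pure lift_pure[OF assms(3)] lin_closed lift_pure[OF bil_comp[OF assms(3,1,2)]]\<close>)

lemma bil_assoc_right:
  assumes "module k L" "module k M" "module k N"
    and "bil k (tensor k L M) N X b" "l \<Colon> L"
  shows "bil k M N X (\<lambda>m n. b (pure k L M l m) n)"
  by (intro bilI lin_comp[OF bil_left[OF assms(4)]] lin_pure_right bil_right[OF assms(4)] pure_closed lin_id)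
    (use assms in \<open>simp_all add: bilD\<close>)

lemma bil_assoc:
  assumes "module k L" "module k M" "module k N"
    and "bil k (tensor k L M) N X b"
  shows "bil k L (tensor k M N) X (\<lambda>l u. lift X (\<lambda>m n. b (pure k L M l m) n) u)"
proof (intro bilI tensor_is_module assms(1-3) bilD(3)[OF assms(4)])
  show "lin k (tensor k M N) X (lift X (\<lambda>m n. b (pure k L M l m) n))" if "l \<Colon> L" for l
    by (intro lin_lift bil_assoc_right assms that)
  show "lin k L X (\<lambda>l. lift X (\<lambda>m n. b (pure k L M l m) n) u)" if "u \<Colon> tensor k M N" for u
    by (intro lin_lift_param[OF assms(1) that] bil_assoc_right assms lin_comp[OF bil_left[OF assms(4)]] lin_pure_left lin_id)
qed

lemma tensor_assoc_lin:
  assumes "module k L" "module k M" "module k N"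
  shows "lin k (tensor k L (tensor k M N)) (tensor k (tensor k L M) N) (\<lambda>t. tensor_assoc k L M N t)"
  unfolding tensor_assoc_def Let_def
  by (intro lin_lift bil_assoc pure_bil tensor_is_module assms)

lemma lift_tensor_assoc:
  assumes mods: "module k L" "module k M" "module k N"
    and b: "bil k (tensor k L M) N X b" and t: "t \<Colon> tensor k L (tensor k M N)"
  shows "lift X b (tensor_assoc k L M N t) =
    lift X (\<lambda>l u. lift X (\<lambda>m n. b (pure k L M l m) n) u) t"
proof -
  let ?p = "pure k (tensor k L M) N"
  have p: "bil k (tensor k L M) N (tensor k (tensor k L M) N) ?p" by (intro pure_bil tensor_is_module mods)
  have "lift X b (tensor_assoc k L M N t) =
    lift X (\<lambda>l u. lift X b (lift (tensor k (tensor k L M) N) (\<lambda>m n. ?p (pure k L M l m) n) u)) t"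
    unfolding tensor_assoc_def Let_def
    by (rule lin_of_lift[OF lin_lift[OF b] bil_assoc[OF mods p] t])
  also have "\<dots> = lift X (\<lambda>l u. lift X (\<lambda>m n. b (pure k L M l m) n) u) t"
  proof (rule lift_cong[OF bil_assoc[OF mods b] t])
    fix l u assume l: "l \<Colon> L" and u: "u \<Colon> tensor k M N"
    have "lift X b (lift (tensor k (tensor k L M) N) (\<lambda>m n. ?p (pure k L M l m) n) u) =
      lift X (\<lambda>m n. lift X b (?p (pure k L M l m) n)) u" (is "?l = _")
      by (rule lin_of_lift[OF lin_lift[OF b] bil_assoc_right[OF mods p l] u])
    also have "\<dots> = lift X (\<lambda>m n. b (pure k L M l m) n) u"
      by (rule lift_cong[OF bil_assoc_right[OF mods b l] u]) (simp add: lift_pure[OF b] pure_closed l mods)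
    finally show "?l = \<dots>" .
  qed
  finally show ?thesis .
qed

section \<open>Dual modules\<close>

lemma dual_simps:
  "carrier (dual k M) = linear_maps k M (base_module k) \<inter> extensional (carrier M)"
  "f \<oplus>\<^bsub>dual k M\<^esub> g = (\<lambda>x\<in>carrier M. f x \<oplus>\<^bsub>k\<^esub> g x)"
  "\<zero>\<^bsub>dual k M\<^esub> = (\<lambda>x\<in>carrier M. \<zero>\<^bsub>k\<^esub>)"
  "c \<odot>\<^bsub>dual k M\<^esub> f = (\<lambda>x\<in>carrier M. c \<otimes>\<^bsub>k\<^esub> f x)"
  by (simp_all add: dual_def)

lemma dual_lin: "\<lbrakk>f \<Colon> dual k M; module k M\<rbrakk> \<Longrightarrow> lin k M (base_module k) f"
  by (simp add: dual_simps lin_def module_base module.axioms(1))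

lemma lin_dual: "lin k M (base_module k) f \<Longrightarrow> restrict f (carrier M) \<Colon> dual k M"
proof -
  assume f: "lin k M (base_module k) f"
  interpret module k M by (rule lin_dom[OF f])
  have "lin k M (base_module k) (restrict f (carrier M))" by (rule lin_cong[OF f]) simp
  then show ?thesis by (simp add: dual_simps lin_def)
qed

lemma dual_value: "\<lbrakk>f \<Colon> dual k M; x \<Colon> M\<rbrakk> \<Longrightarrow> f x \<Colon> k"
  by (auto simp: dual_simps linear_maps_def Pi_iff)

lemma dual_eqI:
  "\<lbrakk>f \<Colon> dual k M; g \<Colon> dual k M; \<And>x. x \<Colon> M \<Longrightarrow> f x = g x\<rbrakk> \<Longrightarrow> f = g"
  by (auto simp: dual_simps intro: extensionalityI)

lemma dual_module:
  assumes M: "module k M"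
  shows "module k (dual k M)"
proof -
  interpret M: module k M by fact
  have k: "module k (base_module k)" by (rule module_base[OF M.R.is_cring])
  interpret K: module k "base_module k" by fact
  have add: "f \<oplus>\<^bsub>dual k M\<^esub> g \<Colon> dual k M" if "f \<Colon> dual k M" "g \<Colon> dual k M" for f g
    using lin_dual[OF lin_sum[OF dual_lin[OF that(1) M] dual_lin[OF that(2) M]]] by (simp add: dual_simps)
  have smult: "c \<odot>\<^bsub>dual k M\<^esub> f \<Colon> dual k M" if "f \<Colon> dual k M" "c \<Colon> k" for f c
    using lin_dual[OF lin_scale[OF dual_lin[OF that(1) M] that(2)]] by (simp add: dual_simps)
  have zero: "\<zero>\<^bsub>dual k M\<^esub> \<Colon> dual k M"
    by (auto simp: dual_simps linear_maps_def)
  note v = dual_value[of _ k M]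
  show ?thesis
  proof (intro moduleI abelian_groupI)
    show "cring k" by (rule M.R.is_cring)
    fix f assume f: "f \<Colon> dual k M"
    show "\<exists>g\<in>carrier (dual k M). g \<oplus>\<^bsub>dual k M\<^esub> f = \<zero>\<^bsub>dual k M\<^esub>"
    proof (rule bexI[OF _ smult[OF f, of "\<ominus>\<^bsub>k\<^esub> \<one>\<^bsub>k\<^esub>"]])
      show "(\<ominus>\<^bsub>k\<^esub> \<one>\<^bsub>k\<^esub>) \<odot>\<^bsub>dual k M\<^esub> f \<oplus>\<^bsub>dual k M\<^esub> f = \<zero>\<^bsub>dual k M\<^esub>"
        using v[OF f] by (auto simp: dual_simps M.R.l_minus M.R.l_neg intro!: restrict_ext)
    qed simp
    show "\<zero>\<^bsub>dual k M\<^esub> \<oplus>\<^bsub>dual k M\<^esub> f = f"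
      by (rule dual_eqI[OF add[OF zero f] f]) (simp add: dual_simps(2,3) v f)
    show "\<one>\<^bsub>k\<^esub> \<odot>\<^bsub>dual k M\<^esub> f = f"
      by (rule dual_eqI[OF smult[OF f] f]) (simp_all add: dual_simps(4) v f)
    fix g assume g: "g \<Colon> dual k M"
    show "f \<oplus>\<^bsub>dual k M\<^esub> g = g \<oplus>\<^bsub>dual k M\<^esub> f"
      using v[OF f] v[OF g] by (auto simp: dual_simps M.R.a_comm intro!: restrict_ext)
    fix h assume h: "h \<Colon> dual k M"
    show "f \<oplus>\<^bsub>dual k M\<^esub> g \<oplus>\<^bsub>dual k M\<^esub> h = f \<oplus>\<^bsub>dual k M\<^esub> (g \<oplus>\<^bsub>dual k M\<^esub> h)"
      using v[OF f] v[OF g] v[OF h] by (auto simp: dual_simps M.R.a_assoc intro!: restrict_ext)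
  next
    fix a b f assume ab: "a \<Colon> k" "b \<Colon> k" and f: "f \<Colon> dual k M"
    show "(a \<oplus>\<^bsub>k\<^esub> b) \<odot>\<^bsub>dual k M\<^esub> f = a \<odot>\<^bsub>dual k M\<^esub> f \<oplus>\<^bsub>dual k M\<^esub> b \<odot>\<^bsub>dual k M\<^esub> f"
      using v[OF f] ab by (auto simp: dual_simps M.R.l_distr intro!: restrict_ext)
    show "a \<otimes>\<^bsub>k\<^esub> b \<odot>\<^bsub>dual k M\<^esub> f = a \<odot>\<^bsub>dual k M\<^esub> (b \<odot>\<^bsub>dual k M\<^esub> f)"
      using v[OF f] ab by (auto simp: dual_simps M.R.m_assoc intro!: restrict_ext)
  next
    fix a f g assume a: "a \<Colon> k" and f: "f \<Colon> dual k M" and g: "g \<Colon> dual k M"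
    show "a \<odot>\<^bsub>dual k M\<^esub> (f \<oplus>\<^bsub>dual k M\<^esub> g) = a \<odot>\<^bsub>dual k M\<^esub> f \<oplus>\<^bsub>dual k M\<^esub> a \<odot>\<^bsub>dual k M\<^esub> g"
      using v[OF f] v[OF g] a by (auto simp: dual_simps M.R.r_distr intro!: restrict_ext)
  qed (auto intro: add smult zero)
qed

lemma lin_eval: "\<lbrakk>module k M; x \<Colon> M\<rbrakk> \<Longrightarrow> lin k (dual k M) (base_module k) (\<lambda>f. f x)"
  by (rule linI) (auto simp: dual_module module_base module.axioms(1) dual_value, simp_all add: dual_simps)

lemma lin_dual_family:
  assumes X: "module k X" and M: "module k M"
    and "\<And>x. x \<Colon> X \<Longrightarrow> f x \<Colon> dual k M"
    and "\<And>m. m \<Colon> M \<Longrightarrow> lin k X (base_module k) (\<lambda>x. f x m)"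
  shows "lin k X (dual k M) f"
proof (rule linI)
  interpret X: module k X by (rule X)
  interpret D: module k "dual k M" by (rule dual_module[OF M])
  show "f (x \<oplus>\<^bsub>X\<^esub> y) = f x \<oplus>\<^bsub>dual k M\<^esub> f y" if x: "x \<Colon> X" and y: "y \<Colon> X" for x y
  proof (rule dual_eqI[OF assms(3)[OF X.a_closed[OF x y]] D.a_closed[OF assms(3)[OF x] assms(3)[OF y]]])
    fix m assume m: "m \<Colon> M"
    show "f (x \<oplus>\<^bsub>X\<^esub> y) m = (f x \<oplus>\<^bsub>dual k M\<^esub> f y) m"
      using lin_add[OF assms(4)[OF m] x y] m by (simp add: dual_simps)
  qed
  show "f (c \<odot>\<^bsub>X\<^esub> x) = c \<odot>\<^bsub>dual k M\<^esub> f x" if c: "c \<Colon> k" and x: "x \<Colon> X" for c x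
  proof (rule dual_eqI[OF assms(3)[OF X.smult_closed[OF c x]] D.smult_closed[OF c assms(3)[OF x]]])
    fix m assume m: "m \<Colon> M"
    show "f (c \<odot>\<^bsub>X\<^esub> x) m = (c \<odot>\<^bsub>dual k M\<^esub> f x) m"
      using lin_smult[OF assms(4)[OF m] c x] m by (simp add: dual_simps)
  qed
qed (simp_all add: X dual_module[OF M] assms(3))

lemma bil_coeff:
  assumes "module k M" "module k N" "x \<Colon> M"
  shows "bil k (dual k M) N N (\<lambda>f n. f x \<odot>\<^bsub>N\<^esub> n)"
  by (intro bilI lin_scale lin_coeff lin_eval lin_id dual_module) (use assms in \<open>simp_all add: dual_value\<close>)

text \<open>The element \<open>\<Sum> e\<^sub>i\<^sup>* \<otimes> e\<^sub>i\<close> of a dual basis, characterised by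
  the expansion of vectors.\<close>

definition dual_basis where
  "dual_basis k P = (SOME t. t \<Colon> tensor k (dual k P) P \<and>
     (\<forall>x\<in>carrier P. lift P (\<lambda>f e. f x \<odot>\<^bsub>P\<^esub> e) t = x))"

text \<open>The unit vectors of \<open>k\<^sup>n\<close> projected to \<open>P\<close>, together with the coordinates
  of the inclusion, form a dual basis.  The sum grows by one index at a time, and \<open>trunc j\<close>
  keeps the first \<open>j\<close> coordinates.\<close>

lemma dual_basis_exists:
  assumes "fg_projective k P"
  shows "\<exists>t. t \<Colon> tensor k (dual k P) P \<and>
     (\<forall>x\<in>carrier P. lift P (\<lambda>f e. f x \<odot>\<^bsub>P\<^esub> e) t = x)"
proof -
  from assms obtain n i p where P: "module k P"
    and i: "i \<in> linear_maps k P (free_module k n)" and p: "p \<in> linear_maps k (free_module k n) P"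
    and pi: "\<And>x. x \<Colon> P \<Longrightarrow> p (i x) = x"
    unfolding fg_projective_def by blast
  interpret P: module k P by fact
  define d where "d j = (\<lambda>l\<in>{..<n}. if l = j then \<one>\<^bsub>k\<^esub> else \<zero>\<^bsub>k\<^esub>)" for j
  define trunc where "trunc j y = (\<lambda>l\<in>{..<n}. if l < j then y l else \<zero>\<^bsub>k\<^esub>)" for j and y :: "nat \<Rightarrow> _"
  have free_simps: "carrier (free_module k n) = (\<Pi>\<^sub>E i\<in>{..<n}. carrier k)"
    "x \<oplus>\<^bsub>free_module k n\<^esub> y = (\<lambda>i\<in>{..<n}. x i \<oplus>\<^bsub>k\<^esub> y i)"
    "c \<odot>\<^bsub>free_module k n\<^esub> y = (\<lambda>i\<in>{..<n}. c \<otimes>\<^bsub>k\<^esub> y i)" for x y c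
    by (simp_all add: free_module_def)
  have d: "d j \<Colon> free_module k n" for j by (auto simp: free_simps d_def)
  have tr: "trunc j y \<Colon> free_module k n" if "y \<Colon> free_module k n" for j y
    using that by (simp add: free_simps(1) trunc_def PiE_iff)
  have i_simps: "i x \<Colon> free_module k n"
    "y \<Colon> P \<Longrightarrow> i (x \<oplus>\<^bsub>P\<^esub> y) = i x \<oplus>\<^bsub>free_module k n\<^esub> i y"
    "c \<Colon> k \<Longrightarrow> i (c \<odot>\<^bsub>P\<^esub> x) = c \<odot>\<^bsub>free_module k n\<^esub> i x" if "x \<Colon> P" for x y c
    using i that unfolding linear_maps_def by (simp_all add: Pi_iff)
  have p_simps: "p x \<Colon> P"
    "y \<Colon> free_module k n \<Longrightarrow> p (x \<oplus>\<^bsub>free_module k n\<^esub> y) = p x \<oplus>\<^bsub>P\<^esub> p y"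
    "c \<Colon> k \<Longrightarrow> p (c \<odot>\<^bsub>free_module k n\<^esub> x) = c \<odot>\<^bsub>P\<^esub> p x" if "x \<Colon> free_module k n" for x y c
    using p that unfolding linear_maps_def by (simp_all add: Pi_iff)
  note ic = i_simps(1) and pc = p_simps(1)
  have ik: "i x l \<Colon> k" if "x \<Colon> P" "l < n" for x l
    using ic[OF that(1)] that(2) by (simp add: free_simps(1) PiE_iff)
  define e where "e j = p (d j)" for j
  define e' where "e' j = (\<lambda>x\<in>carrier P. i x j)" for j
  have e': "e' j \<Colon> dual k P" if "j < n" for j
  proof -
    have "lin k P (base_module k) (\<lambda>x. i x j)"
      by (intro linI P module_base P.R.is_cring) (simp_all add: i_simps ik that free_simps(2,3))
    then show ?thesis unfolding e'_def by (rule lin_dual)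
  qed
  have e: "e j \<Colon> P" for j unfolding e_def by (intro pc d)
  note D = dual_module[OF P]
  have b: "bil k (dual k P) P P (\<lambda>f e. f x \<odot>\<^bsub>P\<^esub> e)" if "x \<Colon> P" for x
    by (rule bil_coeff[OF P P that])
  interpret T: module k "tensor k (dual k P) P" by (intro tensor_is_module D P)
  have "\<exists>t. t \<Colon> tensor k (dual k P) P \<and>
     (\<forall>x\<in>carrier P. lift P (\<lambda>f e. f x \<odot>\<^bsub>P\<^esub> e) t = p (trunc j (i x)))" if "j \<le> n" for j
    using that
  proof (induction j)
    case 0
    have "p (trunc 0 (i x)) = \<zero>\<^bsub>P\<^esub>" if x: "x \<Colon> P" for x
    proof -
      have "trunc 0 (i x) = \<zero>\<^bsub>k\<^esub> \<odot>\<^bsub>free_module k n\<^esub> trunc 0 (i x)"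
        unfolding free_simps(3) trunc_def by (intro restrict_ext) simp
      then have "p (trunc 0 (i x)) = \<zero>\<^bsub>k\<^esub> \<odot>\<^bsub>P\<^esub> p (trunc 0 (i x))"
        using p_simps(3)[OF tr[OF ic[OF x]]] by (metis P.R.zero_closed)
      then show ?thesis using P.smult_l_null[OF pc[OF tr[OF ic[OF x], of 0]]] by simp
    qed
    then show ?case
      by (intro exI[of _ "\<zero>\<^bsub>tensor k (dual k P) P\<^esub>"]) (simp add: lin_zero[OF lin_lift[OF b]])
  next
    case (Suc j)
    then obtain t where t: "t \<Colon> tensor k (dual k P) P"
      "\<And>x. x \<Colon> P \<Longrightarrow> lift P (\<lambda>f e. f x \<odot>\<^bsub>P\<^esub> e) t = p (trunc j (i x))"
      by auto
    have j: "j < n" using Suc by simp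
    let ?q = "pure k (dual k P) P (e' j) (e j)"
    have q: "?q \<Colon> tensor k (dual k P) P" by (intro pure_closed D P e e' j)
    have "lift P (\<lambda>f e. f x \<odot>\<^bsub>P\<^esub> e) (t \<oplus>\<^bsub>tensor k (dual k P) P\<^esub> ?q) = p (trunc (Suc j) (i x))"
      if x: "x \<Colon> P" for x
    proof -
      note k = ik[OF x]
      have step: "trunc (Suc j) (i x) = trunc j (i x) \<oplus>\<^bsub>free_module k n\<^esub> (i x j \<odot>\<^bsub>free_module k n\<^esub> d j)"
        unfolding free_simps(2,3) trunc_def d_def using k j by (intro restrict_ext) (simp add: less_Suc_eq)
      have "p (trunc (Suc j) (i x)) = p (trunc j (i x)) \<oplus>\<^bsub>P\<^esub> p (i x j \<odot>\<^bsub>free_module k n\<^esub> d j)"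
        unfolding step by (rule p_simps(2)[OF tr[OF ic[OF x]]]) (use k[OF j] d[of j] in \<open>simp add: free_simps(1,3) PiE_iff\<close>)
      also have "p (i x j \<odot>\<^bsub>free_module k n\<^esub> d j) = i x j \<odot>\<^bsub>P\<^esub> p (d j)"
        by (rule p_simps(3)[OF d k[OF j]])
      finally show ?thesis
        using x by (simp add: lift_add[OF b] q t lift_pure[OF b] e e' j) (simp add: e_def e'_def)
    qed
    then show ?case using t(1) q by blast
  qed
  from this[of n] obtain t where t: "t \<Colon> tensor k (dual k P) P"
      "\<And>x. x \<Colon> P \<Longrightarrow> lift P (\<lambda>f e. f x \<odot>\<^bsub>P\<^esub> e) t = p (trunc n (i x))"
    by auto
  have "trunc n (i x) = i x" if "x \<Colon> P" for x
    using ic[OF that] by (intro ext) (simp add: trunc_def free_simps(1) PiE_iff extensional_def)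
  then show ?thesis using t pi by auto
qed

lemma dual_basis:
  assumes "fg_projective k P"
  shows "dual_basis k P \<Colon> tensor k (dual k P) P"
    and "x \<Colon> P \<Longrightarrow> lift P (\<lambda>f e. f x \<odot>\<^bsub>P\<^esub> e) (dual_basis k P) = x"
  using someI_ex[OF dual_basis_exists[OF assms], folded dual_basis_def] by blast+

lemma fg_projective_module: "fg_projective k P \<Longrightarrow> module k P"
  by (simp add: fg_projective_def)

lemma lin_via_canonical:
  assumes P: "fg_projective k P" and f: "lin k P N f" and x: "x \<Colon> P"
  shows "lift N (\<lambda>u e. u x \<odot>\<^bsub>N\<^esub> f e) (dual_basis k P) = f x"
proof -
  note b = bil_coeff[OF fg_projective_module[OF P] fg_projective_module[OF P] x]
  have "f x = f (lift P (\<lambda>u e. u x \<odot>\<^bsub>P\<^esub> e) (dual_basis k P))"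
    by (simp add: dual_basis(2)[OF P x])
  also have "\<dots> = lift N (\<lambda>u e. f (u x \<odot>\<^bsub>P\<^esub> e)) (dual_basis k P)"
    by (rule lin_of_lift[OF f b dual_basis(1)[OF P]])
  also have "\<dots> = lift N (\<lambda>u e. u x \<odot>\<^bsub>N\<^esub> f e) (dual_basis k P)"
    by (rule lift_cong[OF bil_comp[OF bil_coeff[OF lin_dom[OF f] lin_cod[OF f] x] lin_id[OF dual_module[OF lin_dom[OF f]]] f]
        dual_basis(1)[OF P]]) (simp add: lin_smult[OF f] dual_value x)
  finally show ?thesis by simp
qed

lemma bil_contract:
  assumes "module k N" "module k P" "f \<Colon> dual k P"
  shows "bil k N P N (\<lambda>n h. f h \<odot>\<^bsub>N\<^esub> n)"
  by (intro bilI lin_coeff lin_scale lin_id dual_lin) (use assms in \<open>simp_all add: dual_value\<close>)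

lemma lin_contract_param:
  assumes N: "module k N" and P: "module k P" and t: "t \<Colon> tensor k N P"
  shows "lin k (dual k P) N (\<lambda>f. lift N (\<lambda>n h. f h \<odot>\<^bsub>N\<^esub> n) t)"
  by (intro lin_lift_param[OF dual_module[OF P] t bil_contract[OF N P]] lin_coeff lin_eval P N)

lemma bil_reconstruct:
  assumes N: "module k N" and P: "module k P" and t: "t \<Colon> tensor k N P"
  shows "bil k (dual k P) P (tensor k N P)
    (\<lambda>f e. pure k N P (lift N (\<lambda>n h. f h \<odot>\<^bsub>N\<^esub> n) t) e)"
  by (rule bil_comp[OF pure_bil[OF N P] lin_contract_param[OF N P t] lin_id[OF P]])

text \<open>The identity \<open>t = \<Sum> (id \<otimes> e\<^sub>i\<^sup>*)(t) \<otimes> e\<^sub>i\<close>, which on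
  a pure tensor is the expansion of its second factor.\<close>

lemma tensor_reconstruct:
  assumes P: "fg_projective k P" and N: "module k N" and t: "t \<Colon> tensor k N P"
  shows "lift (tensor k N P) (\<lambda>f e. pure k N P (lift N (\<lambda>n h. f h \<odot>\<^bsub>N\<^esub> n) t) e)
    (dual_basis k P) = t" (is "?F t = _")
proof (rule lin_tensor_eqI[OF _ lin_id[OF tensor_is_module] _ _ _ t])
  note PM = fg_projective_module[OF P] note c = dual_basis[OF P]
  show "module k N" "module k P" "module k N" "module k P" by (rule N PM)+
  show "lin k (tensor k N P) (tensor k N P) ?F"
    by (intro lin_lift_param[OF tensor_is_module[OF N PM] c(1)] bil_reconstruct N PM lin_pure_left lin_lift bil_contract)
  fix n h assume n: "n \<Colon> N" and h: "h \<Colon> P"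
  have p: "pure k N P n h \<Colon> tensor k N P" by (intro pure_closed N PM n h)
  have "?F (pure k N P n h) = lift (tensor k N P) (\<lambda>f e. f h \<odot>\<^bsub>tensor k N P\<^esub> pure k N P n e) (dual_basis k P)"
    by (rule lift_cong[OF bil_comp[OF bil_coeff[OF PM tensor_is_module[OF N PM] h] lin_id[OF dual_module[OF PM]]
       lin_pure_right[OF lin_id[OF PM] N n]] c(1)])
       (simp add: lift_pure[OF bil_contract[OF N PM]] n h lin_smult[OF lin_pure_left[OF lin_id[OF N] PM]] dual_value)
  also have "\<dots> = pure k N P n h"
    by (rule lin_via_canonical[OF P lin_pure_right[OF lin_id[OF PM] N n] h])
  finally show "?F (pure k N P n h) = pure k N P n h" .
qed

text \<open>Contractions with functionals determine a tensor, by its reconstruction from a dual basis.  Coactions are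
  compared in this way.\<close>

lemma tensor_dual_eqI:
  assumes P: "fg_projective k P" and N: "module k N"
    and s: "s \<Colon> tensor k N P" and t: "t \<Colon> tensor k N P"
    and eq: "\<And>f. f \<Colon> dual k P \<Longrightarrow>
      lift N (\<lambda>n h. f h \<odot>\<^bsub>N\<^esub> n) s = lift N (\<lambda>n h. f h \<odot>\<^bsub>N\<^esub> n) t"
  shows "s = t"
proof -
  note PM = fg_projective_module[OF P]
  have "lift (tensor k N P) (\<lambda>f e. pure k N P (lift N (\<lambda>n h. f h \<odot>\<^bsub>N\<^esub> n) s) e) (dual_basis k P)
    = lift (tensor k N P) (\<lambda>f e. pure k N P (lift N (\<lambda>n h. f h \<odot>\<^bsub>N\<^esub> n) t) e) (dual_basis k P)"
    by (rule lift_cong[OF bil_reconstruct[OF N PM t] dual_basis(1)[OF P]]) (simp add: eq)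
  then show ?thesis by (simp add: tensor_reconstruct[OF P N] s t)
qed

lemma tensor_dual_eqI2:
  assumes P: "fg_projective k P" and Q: "fg_projective k Q" and N: "module k N"
    and s: "s \<Colon> tensor k (tensor k N P) Q" and t: "t \<Colon> tensor k (tensor k N P) Q"
    and eq: "\<And>f g. \<lbrakk>f \<Colon> dual k P; g \<Colon> dual k Q\<rbrakk> \<Longrightarrow>
      lift N (\<lambda>u z. g z \<odot>\<^bsub>N\<^esub> lift N (\<lambda>n h. f h \<odot>\<^bsub>N\<^esub> n) u) s =
      lift N (\<lambda>u z. g z \<odot>\<^bsub>N\<^esub> lift N (\<lambda>n h. f h \<odot>\<^bsub>N\<^esub> n) u) t"
  shows "s = t"
proof -
  note PM = fg_projective_module[OF P] note QM = fg_projective_module[OF Q]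
  let ?T = "tensor k N P"
  have T: "module k ?T" by (intro tensor_is_module N PM)
  have c: "lift N (\<lambda>n h. f h \<odot>\<^bsub>N\<^esub> n) (lift ?T (\<lambda>u z. g z \<odot>\<^bsub>?T\<^esub> u) s) =
     lift N (\<lambda>u z. g z \<odot>\<^bsub>N\<^esub> lift N (\<lambda>n h. f h \<odot>\<^bsub>N\<^esub> n) u) s"
    if f: "f \<Colon> dual k P" and g: "g \<Colon> dual k Q" and s: "s \<Colon> tensor k ?T Q" for f g s
  proof -
    note l = lin_lift[OF bil_contract[OF N PM f]]
    have "lift N (\<lambda>n h. f h \<odot>\<^bsub>N\<^esub> n) (lift ?T (\<lambda>u z. g z \<odot>\<^bsub>?T\<^esub> u) s) =
      lift N (\<lambda>u z. lift N (\<lambda>n h. f h \<odot>\<^bsub>N\<^esub> n) (g z \<odot>\<^bsub>?T\<^esub> u)) s"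
      by (rule lin_of_lift[OF l bil_contract[OF T QM g] s])
    also have "\<dots> = lift N (\<lambda>u z. g z \<odot>\<^bsub>N\<^esub> lift N (\<lambda>n h. f h \<odot>\<^bsub>N\<^esub> n) u) s"
      by (rule lift_cong[OF bil_comp[OF bil_contract[OF N QM g] l lin_id[OF QM]] s])
         (simp add: lin_smult[OF l] dual_value[OF g])
    finally show ?thesis .
  qed
  show ?thesis
    by (rule tensor_dual_eqI[OF Q T s t], rule tensor_dual_eqI[OF P N])
      (simp_all add: c eq s t lift_closed[OF bil_contract[OF T QM]])
qed

subsection \<open>The comultiplication dual to a product\<close>

lemma lin_mult_left:
  assumes B: "k_algebra k B" and f: "lin k X B f" and b: "b \<Colon> B"
  shows "lin k X B (\<lambda>x. b \<otimes>\<^bsub>B\<^esub> f x)"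
proof -
  interpret B: k_algebra k B by (rule B)
  show ?thesis
    by (rule linI) (simp_all add: lin_dom[OF f] lin_cod[OF f] linD(3-)[OF f] b B.smult_mult_right B.r_distr)
qed

lemma lin_mult_right:
  assumes B: "k_algebra k B" and f: "lin k X B f" and b: "b \<Colon> B"
  shows "lin k X B (\<lambda>x. f x \<otimes>\<^bsub>B\<^esub> b)"
proof -
  interpret B: k_algebra k B by (rule B)
  show ?thesis
    by (rule linI) (simp_all add: lin_dom[OF f] lin_cod[OF f] linD(3-)[OF f] b B.smult_mult_left B.l_distr)
qed

lemma bil_evaluate:
  assumes B: "module k B" and C: "module k C" and h: "h \<Colon> B" "h' \<Colon> C"
  shows "bil k (dual k B) (dual k C) (base_module k) (\<lambda>u v. u h \<otimes>\<^bsub>k\<^esub> v h')"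
  by (intro bilI base_mult_left[OF lin_eval[OF C h(2)]] base_mult_right[OF lin_eval[OF B h(1)]]
      dual_module B C module_base module.axioms(1)[OF B])
    (simp_all add: dual_value h)

lemma dual_expand:
  assumes B: "fg_projective k B" and u: "u \<Colon> dual k B"
  shows "lift (dual k B) (\<lambda>f e. u e \<odot>\<^bsub>dual k B\<^esub> f) (dual_basis k B) = u"
proof -
  note BM = fg_projective_module[OF B] note D = dual_module[OF BM] and c = dual_basis(1)[OF B]
  have b: "bil k (dual k B) B (dual k B) (\<lambda>f e. u e \<odot>\<^bsub>dual k B\<^esub> f)"
    by (intro bilI lin_coeff[OF dual_lin[OF u BM]] lin_scale[OF lin_id] D BM dual_value[OF u])
  show ?thesis
  proof (rule dual_eqI[OF lift_closed[OF b c] u])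
    fix x assume x: "x \<Colon> B"
    have "lift (dual k B) (\<lambda>f e. u e \<odot>\<^bsub>dual k B\<^esub> f) (dual_basis k B) x =
      lift (base_module k) (\<lambda>f e. (u e \<odot>\<^bsub>dual k B\<^esub> f) x) (dual_basis k B)" (is "?l = _")
      by (rule lin_of_lift[OF lin_eval[OF BM x] b c])
    also have "\<dots> = lift (base_module k) (\<lambda>f e. f x \<odot>\<^bsub>base_module k\<^esub> u e) (dual_basis k B)"
    proof (rule lift_cong[OF bil_comp[OF bil_coeff[OF BM lin_cod[OF dual_lin[OF u BM]] x] lin_id[OF D] dual_lin[OF u BM]] c])
      fix f e assume "f \<Colon> dual k B" "e \<Colon> B"
      then show "(u e \<odot>\<^bsub>dual k B\<^esub> f) x = f x \<odot>\<^bsub>base_module k\<^esub> u e"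
        using x dual_value[OF u, of e] dual_value[of f k B x] cring.cring_simprules(14)[OF module.axioms(1)[OF BM]]
        by (simp add: dual_simps(4))
    qed
    also have "\<dots> = u x" by (rule lin_via_canonical[OF B dual_lin[OF u BM] x])
    finally show "?l = u x" .
  qed
qed

lemma tensor_of_duals_reconstruct:
  assumes B: "fg_projective k B" and C: "module k D" and t: "t \<Colon> tensor k (dual k B) D"
  shows "bil k (dual k B) B (tensor k (dual k B) D)
      (\<lambda>f e. pure k (dual k B) D f (lift D (\<lambda>u v. u e \<odot>\<^bsub>D\<^esub> v) t))" (is "bil k _ _ ?T (?b t)")
    and "lift (tensor k (dual k B) D)
      (\<lambda>f e. pure k (dual k B) D f (lift D (\<lambda>u v. u e \<odot>\<^bsub>D\<^esub> v) t)) (dual_basis k B) = t" (is "?F t = t")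
proof -
  note BM = fg_projective_module[OF B] note BD = dual_module[OF BM] and c = dual_basis(1)[OF B]
  have T: "module k ?T" by (intro tensor_is_module BD C)
  have p: "bil k (dual k B) D ?T (pure k (dual k B) D)" by (rule pure_bil[OF BD C])
  have bil: "bil k (dual k B) B ?T (?b t)" if "t \<Colon> ?T" for t
    by (intro bil_comp[OF p lin_id[OF BD]] lin_lift_param[OF BM that bil_coeff[OF BM C]] lin_coeff dual_lin BM C)
  then show "bil k (dual k B) B ?T (?b t)" using t .
  have lF: "lin k ?T ?T ?F"
    by (intro lin_lift_param[OF T c bil] lin_pure_right lin_lift bil_coeff BM BD C)
  show "?F t = t"
  proof (rule lin_tensor_eqI[OF lF lin_id[OF T] BD C _ t])
    fix u v assume u: "u \<Colon> dual k B" and v: "v \<Colon> D"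
    have pl: "lin k (dual k B) ?T (\<lambda>f. pure k (dual k B) D f v)" by (intro lin_pure_left lin_id BD C v)
    have b: "bil k (dual k B) B (dual k B) (\<lambda>f e. u e \<odot>\<^bsub>dual k B\<^esub> f)"
      by (intro bilI lin_coeff[OF dual_lin[OF u BM]] lin_scale[OF lin_id] BD BM dual_value[OF u])
    have "?F (pure k (dual k B) D u v) = lift ?T (\<lambda>f e. pure k (dual k B) D (u e \<odot>\<^bsub>dual k B\<^esub> f) v) (dual_basis k B)"
    proof (rule lift_cong[OF _ c])
      show "bil k (dual k B) B ?T (\<lambda>f e. pure k (dual k B) D (u e \<odot>\<^bsub>dual k B\<^esub> f) v)"
        by (intro bilI lin_pure_left bil_left[OF b] bil_right[OF b] BD BM C T v)
      fix f e assume f: "f \<Colon> dual k B" and e: "e \<Colon> B"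
      show "?b (pure k (dual k B) D u v) f e = pure k (dual k B) D (u e \<odot>\<^bsub>dual k B\<^esub> f) v"
        using u v f e lin_smult[OF pl dual_value[OF u e] f] lin_smult[OF bil_right[OF p f] dual_value[OF u e] v]
        by (simp add: lift_pure[OF bil_coeff[OF BM C e]])
    qed
    also have "\<dots> = pure k (dual k B) D (lift (dual k B) (\<lambda>f e. u e \<odot>\<^bsub>dual k B\<^esub> f) (dual_basis k B)) v"
      by (rule lin_of_lift[OF pl b c, symmetric])
    also have "\<dots> = pure k (dual k B) D u v" by (simp add: dual_expand[OF B u])
    finally show "?F (pure k (dual k B) D u v) = pure k (dual k B) D u v" .
  qed
qed

text \<open>A tensor of functionals is reconstructed from its values, as \<open>\<Sum> e\<^sub>i\<^sup>* \<otimes>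
  t(e\<^sub>i, _)\<close>.\<close>

lemma tensor_of_duals_eqI:
  assumes B: "fg_projective k B" and C: "module k C"
    and s: "s \<Colon> tensor k (dual k B) (dual k C)" and t: "t \<Colon> tensor k (dual k B) (dual k C)"
    and eq: "\<And>h h'. \<lbrakk>h \<Colon> B; h' \<Colon> C\<rbrakk> \<Longrightarrow>
      lift k (\<lambda>u v. u h \<otimes>\<^bsub>k\<^esub> v h') s = lift k (\<lambda>u v. u h \<otimes>\<^bsub>k\<^esub> v h') t"
  shows "s = t"
proof -
  note BM = fg_projective_module[OF B] note CD = dual_module[OF C]
  have ev: "lift (dual k C) (\<lambda>u v. u h \<odot>\<^bsub>dual k C\<^esub> v) t h' = lift k (\<lambda>u v. u h \<otimes>\<^bsub>k\<^esub> v h') t"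
    if h: "h \<Colon> B" "h' \<Colon> C" and t: "t \<Colon> tensor k (dual k B) (dual k C)" for h h' t
    unfolding tensor_lift_base[of k]
    by (subst lin_of_lift[OF lin_eval[OF C h(2)] bil_coeff[OF BM CD h(1)] t])
      (rule lift_cong[OF bil_evaluate[OF BM C h] t], simp add: dual_simps h)
  have eq': "lift (dual k C) (\<lambda>u v. u h \<odot>\<^bsub>dual k C\<^esub> v) s = lift (dual k C) (\<lambda>u v. u h \<odot>\<^bsub>dual k C\<^esub> v) t"
    if h: "h \<Colon> B" for h
    by (rule dual_eqI[OF lift_closed lift_closed, OF bil_coeff[OF BM CD h] s bil_coeff[OF BM CD h] t])
      (simp add: ev h s t eq)
  note r = tensor_of_duals_reconstruct[OF B CD]
  have "lift (tensor k (dual k B) (dual k C)) (\<lambda>f e. pure k (dual k B) (dual k C) f (lift (dual k C) (\<lambda>u v. u e \<odot>\<^bsub>dual k C\<^esub> v) s)) (dual_basis k B)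
     = lift (tensor k (dual k B) (dual k C)) (\<lambda>f e. pure k (dual k B) (dual k C) f (lift (dual k C) (\<lambda>u v. u e \<odot>\<^bsub>dual k C\<^esub> v) t)) (dual_basis k B)"
    by (rule lift_cong[OF r(1)[OF t] dual_basis(1)[OF B]]) (simp add: eq')
  then show ?thesis by (simp add: r(2) s t)
qed

text \<open>The tensor \<open>\<Sum> e\<^sub>i\<^sup>* \<otimes> f(e\<^sub>i _)\<close> has the values demanded of
  the dual comultiplication, and it is the only one because values separate tensors of functionals.\<close>

lemma dual_comult:
  assumes B: "k_algebra k B" and P: "fg_projective k B" and f: "f \<Colon> dual k B"
  shows "dual_comult k B f \<Colon> tensor k (dual k B) (dual k B)"
    and "\<lbrakk>h \<Colon> B; h' \<Colon> B\<rbrakk> \<Longrightarrow>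
      lift k (\<lambda>u v. u h \<otimes>\<^bsub>k\<^esub> v h') (dual_comult k B f) = f (h \<otimes>\<^bsub>B\<^esub> h')"
proof -
  interpret B: k_algebra k B by (rule B)
  let ?D = "dual k B" let ?T = "tensor k ?D ?D" let ?c = "dual_basis k B"
  note BM = fg_projective_module[OF P] note D = dual_module[OF BM] and c = dual_basis[OF P]
  note fl = dual_lin[OF f BM]
  let ?g = "\<lambda>e. \<lambda>x\<in>carrier B. f (e \<otimes>\<^bsub>B\<^esub> x)"
  have g: "?g e \<Colon> ?D" if "e \<Colon> B" for e
    by (rule lin_dual[OF lin_comp[OF fl lin_mult_left[OF B lin_id[OF BM] that]]])
  have gl: "lin k B ?D ?g"
    by (rule lin_dual_family[OF BM BM g]) (simp_all add: lin_comp[OF fl lin_mult_right[OF B lin_id[OF BM]]])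
  have b: "bil k ?D B ?T (\<lambda>u e. pure k ?D ?D u (?g e))"
    by (rule bil_comp[OF pure_bil[OF D D] lin_id[OF D] gl])
  let ?t = "lift ?T (\<lambda>u e. pure k ?D ?D u (?g e)) ?c"
  have t: "?t \<Colon> ?T" by (rule lift_closed[OF b c(1)])
  have te: "lift k (\<lambda>u v. u h \<otimes>\<^bsub>k\<^esub> v h') ?t = f (h \<otimes>\<^bsub>B\<^esub> h')" if h: "h \<Colon> B" "h' \<Colon> B" for h h'
  proof -
    note ev = bil_evaluate[OF BM BM h]
    have fh: "lin k B (base_module k) (\<lambda>e. f (e \<otimes>\<^bsub>B\<^esub> h'))" by (rule lin_comp[OF fl lin_mult_right[OF B lin_id[OF BM] h(2)]])
    have "lift k (\<lambda>u v. u h \<otimes>\<^bsub>k\<^esub> v h') ?t =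
       lift (base_module k) (\<lambda>u e. lift (base_module k) (\<lambda>u v. u h \<otimes>\<^bsub>k\<^esub> v h') (pure k ?D ?D u (?g e))) ?c"
      unfolding tensor_lift_base[of k] by (rule lin_of_lift[OF lin_lift[OF ev] b c(1)])
    also have "\<dots> = lift (base_module k) (\<lambda>u e. u h \<odot>\<^bsub>base_module k\<^esub> f (e \<otimes>\<^bsub>B\<^esub> h')) ?c"
      by (rule lift_cong[OF bil_comp[OF bil_coeff[OF BM lin_cod[OF fl] h(1)] lin_id[OF D] fh] c(1)])
        (simp add: lift_pure[OF ev] g h)
    also have "\<dots> = f (h \<otimes>\<^bsub>B\<^esub> h')" by (rule lin_via_canonical[OF P fh h(1)])
    finally show ?thesis .
  qed
  have "dual_comult k B f = ?t"
    unfolding dual_comult_def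
    by (rule the_equality) (simp add: t te, rule tensor_of_duals_eqI[OF P BM _ t], simp_all add: te)
  then show "dual_comult k B f \<Colon> ?T"
    "\<lbrakk>h \<Colon> B; h' \<Colon> B\<rbrakk> \<Longrightarrow> lift k (\<lambda>u v. u h \<otimes>\<^bsub>k\<^esub> v h') (dual_comult k B f) = f (h \<otimes>\<^bsub>B\<^esub> h')"
    using t te by simp_all
qed

section \<open>Direct sums and graded products\<close>

locale direct_sum_of_groups = group G for G :: "('g, 'x) monoid_scheme" (structure) +
  fixes C :: "'g \<Rightarrow> ('c, 'y) ring_scheme"
  assumes component_group: "\<alpha> \<Colon> G \<Longrightarrow> abelian_group (C \<alpha>)"
begin

lemma direct_sum_carrier: "carrier (direct_sum G C) =
  {x \<in> \<Pi>\<^sub>E \<alpha>\<in>carrier G. carrier (C \<alpha>). finite {\<alpha> \<in> carrier G. x \<alpha> \<noteq> \<zero>\<^bsub>C \<alpha>\<^esub>}}"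
proof -
  have "group (add_monoid (C \<alpha>))" if "\<alpha> \<Colon> G" for \<alpha>
    by (rule abelian_group.a_group[OF component_group[OF that]])
  then show ?thesis by (simp add: direct_sum_def Let_def carrier_sum_group)
qed

lemma direct_sum_simps:
  "x \<oplus>\<^bsub>direct_sum G C\<^esub> y = (\<lambda>\<alpha>\<in>carrier G. x \<alpha> \<oplus>\<^bsub>C \<alpha>\<^esub> y \<alpha>)"
  "\<zero>\<^bsub>direct_sum G C\<^esub> = (\<lambda>\<alpha>\<in>carrier G. \<zero>\<^bsub>C \<alpha>\<^esub>)"
  by (simp_all add: direct_sum_def Let_def)

lemma sum_value: "\<lbrakk>x \<Colon> direct_sum G C; \<alpha> \<Colon> G\<rbrakk> \<Longrightarrow> x \<alpha> \<Colon> C \<alpha>"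
  by (auto simp: direct_sum_carrier)

lemma direct_sum_support: "x \<Colon> direct_sum G C \<Longrightarrow> finite {\<alpha> \<in> carrier G. x \<alpha> \<noteq> \<zero>\<^bsub>C \<alpha>\<^esub>}"
  by (simp add: direct_sum_carrier)

lemma direct_sum_eqI: "\<lbrakk>x \<Colon> direct_sum G C; y \<Colon> direct_sum G C;
  \<And>\<alpha>. \<alpha> \<Colon> G \<Longrightarrow> x \<alpha> = y \<alpha>\<rbrakk> \<Longrightarrow> x = y"
  by (auto simp: direct_sum_carrier intro: PiE_ext)

lemma direct_sum_memI:
  assumes "finite I" "\<And>\<alpha>. \<alpha> \<Colon> G \<Longrightarrow> x \<alpha> \<Colon> C \<alpha>"
    "\<And>\<alpha>. \<lbrakk>\<alpha> \<Colon> G; \<alpha> \<notin> I\<rbrakk> \<Longrightarrow> x \<alpha> = \<zero>\<^bsub>C \<alpha>\<^esub>" "x \<in> extensional (carrier G)"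
  shows "x \<Colon> direct_sum G C"
  unfolding direct_sum_carrier
proof (intro CollectI conjI)
  show "x \<in> (\<Pi>\<^sub>E \<alpha>\<in>carrier G. carrier (C \<alpha>))" using assms by (simp add: PiE_iff)
  show "finite {\<alpha> \<in> carrier G. x \<alpha> \<noteq> \<zero>\<^bsub>C \<alpha>\<^esub>}"
    by (rule finite_subset[OF _ assms(1)]) (use assms(3) in blast)
qed

lemma component_ops:
  assumes "\<alpha> \<Colon> G"
  shows "\<zero>\<^bsub>C \<alpha>\<^esub> \<Colon> C \<alpha>"
    and "\<lbrakk>x \<Colon> C \<alpha>; y \<Colon> C \<alpha>\<rbrakk> \<Longrightarrow> x \<oplus>\<^bsub>C \<alpha>\<^esub> y \<Colon> C \<alpha>"
    and "x \<Colon> C \<alpha> \<Longrightarrow> \<zero>\<^bsub>C \<alpha>\<^esub> \<oplus>\<^bsub>C \<alpha>\<^esub> x = x"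
    and "x \<Colon> C \<alpha> \<Longrightarrow> x \<oplus>\<^bsub>C \<alpha>\<^esub> \<zero>\<^bsub>C \<alpha>\<^esub> = x"
    and "x \<Colon> C \<alpha> \<Longrightarrow> \<ominus>\<^bsub>C \<alpha>\<^esub> x \<Colon> C \<alpha>"
    and "x \<Colon> C \<alpha> \<Longrightarrow> \<ominus>\<^bsub>C \<alpha>\<^esub> x \<oplus>\<^bsub>C \<alpha>\<^esub> x = \<zero>\<^bsub>C \<alpha>\<^esub>"
    and "\<ominus>\<^bsub>C \<alpha>\<^esub> \<zero>\<^bsub>C \<alpha>\<^esub> = \<zero>\<^bsub>C \<alpha>\<^esub>"
proof -
  interpret C: abelian_group "C \<alpha>" by (rule component_group[OF assms])
  show "\<zero>\<^bsub>C \<alpha>\<^esub> \<Colon> C \<alpha>" "\<lbrakk>x \<Colon> C \<alpha>; y \<Colon> C \<alpha>\<rbrakk> \<Longrightarrow> x \<oplus>\<^bsub>C \<alpha>\<^esub> y \<Colon> C \<alpha>"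
    "x \<Colon> C \<alpha> \<Longrightarrow> \<zero>\<^bsub>C \<alpha>\<^esub> \<oplus>\<^bsub>C \<alpha>\<^esub> x = x" "x \<Colon> C \<alpha> \<Longrightarrow> x \<oplus>\<^bsub>C \<alpha>\<^esub> \<zero>\<^bsub>C \<alpha>\<^esub> = x"
    "x \<Colon> C \<alpha> \<Longrightarrow> \<ominus>\<^bsub>C \<alpha>\<^esub> x \<Colon> C \<alpha>"
    "x \<Colon> C \<alpha> \<Longrightarrow> \<ominus>\<^bsub>C \<alpha>\<^esub> x \<oplus>\<^bsub>C \<alpha>\<^esub> x = \<zero>\<^bsub>C \<alpha>\<^esub>"
    "\<ominus>\<^bsub>C \<alpha>\<^esub> \<zero>\<^bsub>C \<alpha>\<^esub> = \<zero>\<^bsub>C \<alpha>\<^esub>"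
    by (simp_all add: C.l_neg)
qed

lemma direct_sum_abelian_group: "abelian_group (direct_sum G C)"
proof -
  have add: "x \<oplus>\<^bsub>direct_sum G C\<^esub> y \<Colon> direct_sum G C"
    if "x \<Colon> direct_sum G C" "y \<Colon> direct_sum G C" for x y
    by (rule direct_sum_memI[OF finite_UnI[OF direct_sum_support[OF that(1)] direct_sum_support[OF that(2)]]])
      (auto simp: direct_sum_simps sum_value that component_ops)
  have zero: "\<zero>\<^bsub>direct_sum G C\<^esub> \<Colon> direct_sum G C"
    by (rule direct_sum_memI[OF finite.emptyI]) (auto simp: direct_sum_simps component_ops)
  show ?thesis
  proof (rule abelian_groupI)
    fix x assume x: "x \<Colon> direct_sum G C"
    show "\<zero>\<^bsub>direct_sum G C\<^esub> \<oplus>\<^bsub>direct_sum G C\<^esub> x = x"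
      by (rule direct_sum_eqI[OF add[OF zero x] x]) (simp add: direct_sum_simps sum_value[OF x] component_ops)
    have n: "(\<lambda>\<alpha>\<in>carrier G. \<ominus>\<^bsub>C \<alpha>\<^esub> x \<alpha>) \<Colon> direct_sum G C"
      by (rule direct_sum_memI[OF direct_sum_support[OF x]]) (auto simp: sum_value[OF x] component_ops)
    show "\<exists>y\<in>carrier (direct_sum G C). y \<oplus>\<^bsub>direct_sum G C\<^esub> x = \<zero>\<^bsub>direct_sum G C\<^esub>"
    proof (rule bexI[OF _ n])
      show "(\<lambda>\<alpha>\<in>carrier G. \<ominus>\<^bsub>C \<alpha>\<^esub> x \<alpha>) \<oplus>\<^bsub>direct_sum G C\<^esub> x = \<zero>\<^bsub>direct_sum G C\<^esub>"
        by (rule direct_sum_eqI[OF add[OF n x] zero]) (simp add: direct_sum_simps component_ops sum_value[OF x])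
    qed
    fix y assume y: "y \<Colon> direct_sum G C"
    show "x \<oplus>\<^bsub>direct_sum G C\<^esub> y = y \<oplus>\<^bsub>direct_sum G C\<^esub> x"
      by (rule direct_sum_eqI[OF add[OF x y] add[OF y x]])
        (simp add: direct_sum_simps abelian_groupE(4)[OF component_group] sum_value[OF x] sum_value[OF y])
    fix z assume z: "z \<Colon> direct_sum G C"
    show "x \<oplus>\<^bsub>direct_sum G C\<^esub> y \<oplus>\<^bsub>direct_sum G C\<^esub> z = x \<oplus>\<^bsub>direct_sum G C\<^esub> (y \<oplus>\<^bsub>direct_sum G C\<^esub> z)"
      by (rule direct_sum_eqI[OF add[OF add[OF x y] z] add[OF x add[OF y z]]])
        (simp add: direct_sum_simps abelian_groupE(3)[OF component_group] sum_value[OF x] sum_value[OF y] sum_value[OF z])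
  qed (fact add zero)+
qed

sublocale D: abelian_group "direct_sum G C" by (rule direct_sum_abelian_group)

lemma inclusion_closed:
  assumes "\<alpha> \<Colon> G" "x \<Colon> C \<alpha>"
  shows "inclusion G C \<alpha> x \<Colon> direct_sum G C"
proof (rule direct_sum_memI[of "{\<alpha>}"])
  fix \<beta> assume "\<beta> \<Colon> G"
  then interpret C: abelian_group "C \<beta>" by (rule component_group)
  show "inclusion G C \<alpha> x \<beta> \<Colon> C \<beta>" using assms \<open>\<beta> \<Colon> G\<close> by (simp add: inclusion_def)
qed (simp_all add: inclusion_def)

lemma inclusion_value: "\<beta> \<Colon> G \<Longrightarrow> inclusion G C \<alpha> x \<beta> = (if \<beta> = \<alpha> then x else \<zero>\<^bsub>C \<beta>\<^esub>)"
  by (simp add: inclusion_def)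

lemma inclusion_homogeneous:
  "\<lbrakk>\<alpha> \<Colon> G; x \<Colon> C \<alpha>\<rbrakk> \<Longrightarrow> inclusion G C \<alpha> x \<in> homogeneous G C \<alpha>"
  by (simp add: homogeneous_def inclusion_closed inclusion_value)

lemma homogeneous_closed: "x \<in> homogeneous G C \<alpha> \<Longrightarrow> x \<Colon> direct_sum G C"
  by (simp add: homogeneous_def)

lemma homogeneous_eq_inclusion:
  assumes "\<alpha> \<Colon> G" "x \<in> homogeneous G C \<alpha>"
  shows "x = inclusion G C \<alpha> (x \<alpha>)"
proof (rule direct_sum_eqI)
  have x: "x \<Colon> direct_sum G C" using assms by (simp add: homogeneous_def)
  then show "x \<Colon> direct_sum G C" "inclusion G C \<alpha> (x \<alpha>) \<Colon> direct_sum G C"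
    by (simp_all add: inclusion_closed assms sum_value)
  show "x \<beta> = inclusion G C \<alpha> (x \<alpha>) \<beta>" if "\<beta> \<Colon> G" for \<beta>
    using assms that by (simp add: homogeneous_def inclusion_value)
qed

lemma inclusion_add:
  assumes "\<alpha> \<Colon> G" "x \<Colon> C \<alpha>" "y \<Colon> C \<alpha>"
  shows "inclusion G C \<alpha> (x \<oplus>\<^bsub>C \<alpha>\<^esub> y) = inclusion G C \<alpha> x \<oplus>\<^bsub>direct_sum G C\<^esub> inclusion G C \<alpha> y"
proof -
  show ?thesis using assms unfolding direct_sum_simps
    by (simp add: inclusion_def, intro restrict_ext) (simp add: component_ops)
qed

lemma inclusion_zero: "inclusion G C \<alpha> \<zero>\<^bsub>C \<alpha>\<^esub> = \<zero>\<^bsub>direct_sum G C\<^esub>"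
  by (simp add: inclusion_def direct_sum_simps) (intro restrict_ext, simp)

lemma direct_sum_induct [consumes 1, case_names incl add]:
  assumes x: "x \<Colon> direct_sum G C"
    and incl: "\<And>\<alpha> y. \<lbrakk>\<alpha> \<Colon> G; y \<Colon> C \<alpha>\<rbrakk> \<Longrightarrow> P (inclusion G C \<alpha> y)"
    and add: "\<And>y z. \<lbrakk>y \<Colon> direct_sum G C; z \<Colon> direct_sum G C; P y; P z\<rbrakk> \<Longrightarrow> P (y \<oplus>\<^bsub>direct_sum G C\<^esub> z)"
  shows "P x"
proof -
  have zero: "P \<zero>\<^bsub>direct_sum G C\<^esub>"
    using incl[OF one_closed component_ops(1)[OF one_closed]] by (simp add: inclusion_zero)
  have "x \<Colon> direct_sum G C \<Longrightarrow> {\<alpha> \<in> carrier G. x \<alpha> \<noteq> \<zero>\<^bsub>C \<alpha>\<^esub>} \<subseteq> S \<Longrightarrow> P x" if "finite S" for S x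
    using that
  proof (induction S arbitrary: x)
    case empty
    have "x = \<zero>\<^bsub>direct_sum G C\<^esub>"
      by (rule direct_sum_eqI[OF empty(1) D.zero_closed]) (use empty(2) in \<open>auto simp: direct_sum_simps\<close>)
    then show ?case using zero by simp
  next
    case (insert \<alpha> S)
    show ?case
    proof (cases "\<alpha> \<Colon> G")
      case False
      then show ?thesis using insert by auto
    next
      case True
      define y where "y = (\<lambda>\<beta>\<in>carrier G. if \<beta> = \<alpha> then \<zero>\<^bsub>C \<beta>\<^esub> else x \<beta>)"
      have y: "y \<Colon> direct_sum G C"
        by (rule direct_sum_memI[OF direct_sum_support[OF insert(4)]])
          (auto simp: y_def sum_value[OF insert(4)] component_ops)
      have xa: "x \<alpha> \<Colon> C \<alpha>" by (rule sum_value[OF insert(4) True])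
      have "x = y \<oplus>\<^bsub>direct_sum G C\<^esub> inclusion G C \<alpha> (x \<alpha>)"
        by (rule direct_sum_eqI[OF insert(4) D.a_closed[OF y inclusion_closed[OF True xa]]])
          (auto simp: direct_sum_simps inclusion_value y_def sum_value[OF insert(4)] component_ops)
      moreover have "P y" by (rule insert.IH[OF y]) (use insert.prems in \<open>auto simp: y_def\<close>)
      ultimately show ?thesis
        using add[OF y inclusion_closed[OF True xa]] incl[OF True xa] by metis
    qed
  qed
  then show ?thesis using direct_sum_support[OF x] x by blast
qed

lemma finsum_value:
  assumes "finite I" "\<And>i. i \<in> I \<Longrightarrow> f i \<Colon> direct_sum G C" "\<alpha> \<Colon> G"
  shows "(\<Oplus>\<^bsub>direct_sum G C\<^esub>i\<in>I. f i) \<alpha> = (\<Oplus>\<^bsub>C \<alpha>\<^esub>i\<in>I. f i \<alpha>)"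
proof -
  interpret C: abelian_group "C \<alpha>" by (rule component_group[OF assms(3)])
  show ?thesis using assms(1,2)
  proof (induction I)
    case empty
    then show ?case using assms(3) by (simp add: direct_sum_simps)
  next
    case (insert i I)
    then show ?case using assms(3)
      by (subst D.finsum_insert, simp, simp, blast, simp, subst C.finsum_insert)
        (auto simp: sum_value direct_sum_simps(1))
  qed
qed

end

definition graded_product where
  "graded_product G L C P \<mu> f g = (\<lambda>\<gamma>\<in>carrier G.
       \<Oplus>\<^bsub>P \<gamma>\<^esub>p\<in>{(\<alpha>, \<beta>). \<alpha> \<Colon> G \<and> \<beta> \<Colon> G \<and> \<alpha> \<otimes>\<^bsub>G\<^esub> \<beta> = \<gamma> \<and>
                     f \<alpha> \<noteq> \<zero>\<^bsub>L \<alpha>\<^esub> \<and> g \<beta> \<noteq> \<zero>\<^bsub>C \<beta>\<^esub>}.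
         \<mu> (fst p) (snd p) (f (fst p)) (g (snd p)))"

text \<open>Both the product of a graded ring and its action on a graded module are pairings of this kind.\<close>

locale graded_pairing = L: direct_sum_of_groups G L + C: direct_sum_of_groups G C + P: direct_sum_of_groups G P
  for G :: "('g, 'x) monoid_scheme" (structure) and L :: "'g \<Rightarrow> ('l, 'y1) ring_scheme"
    and C :: "'g \<Rightarrow> ('c, 'y2) ring_scheme" and P :: "'g \<Rightarrow> ('p, 'y3) ring_scheme" +
  fixes \<mu> :: "'g \<Rightarrow> 'g \<Rightarrow> 'l \<Rightarrow> 'c \<Rightarrow> 'p"
  assumes pairing_closed: "\<lbrakk>\<alpha> \<Colon> G; \<beta> \<Colon> G; x \<Colon> L \<alpha>; y \<Colon> C \<beta>\<rbrakk> \<Longrightarrow>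
      \<mu> \<alpha> \<beta> x y \<Colon> P (\<alpha> \<otimes> \<beta>)"
    and pairing_add_left: "\<lbrakk>\<alpha> \<Colon> G; \<beta> \<Colon> G; x \<Colon> L \<alpha>; x' \<Colon> L \<alpha>; y \<Colon> C \<beta>\<rbrakk> \<Longrightarrow>
      \<mu> \<alpha> \<beta> (x \<oplus>\<^bsub>L \<alpha>\<^esub> x') y = \<mu> \<alpha> \<beta> x y \<oplus>\<^bsub>P (\<alpha> \<otimes> \<beta>)\<^esub> \<mu> \<alpha> \<beta> x' y"
    and pairing_add_right: "\<lbrakk>\<alpha> \<Colon> G; \<beta> \<Colon> G; x \<Colon> L \<alpha>; y \<Colon> C \<beta>; y' \<Colon> C \<beta>\<rbrakk> \<Longrightarrow>
      \<mu> \<alpha> \<beta> x (y \<oplus>\<^bsub>C \<beta>\<^esub> y') = \<mu> \<alpha> \<beta> x y \<oplus>\<^bsub>P (\<alpha> \<otimes> \<beta>)\<^esub> \<mu> \<alpha> \<beta> x y'"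
begin

abbreviation "gprod \<equiv> graded_product G L C P \<mu>"

lemma pairing_zero_left:
  assumes "\<alpha> \<Colon> G" "\<beta> \<Colon> G" "y \<Colon> C \<beta>"
  shows "\<mu> \<alpha> \<beta> \<zero>\<^bsub>L \<alpha>\<^esub> y = \<zero>\<^bsub>P (\<alpha> \<otimes> \<beta>)\<^esub>"
proof -
  interpret L': abelian_group "L \<alpha>" by (rule L.component_group[OF assms(1)])
  interpret P': abelian_group "P (\<alpha> \<otimes> \<beta>)" using assms by (intro P.component_group) simp
  show ?thesis
    using pairing_add_left[OF assms(1,2) L'.zero_closed L'.zero_closed assms(3)]
      pairing_closed[OF assms(1,2) L'.zero_closed assms(3)] by simp
qed

lemma pairing_zero_right:
  assumes "\<alpha> \<Colon> G" "\<beta> \<Colon> G" "x \<Colon> L \<alpha>"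
  shows "\<mu> \<alpha> \<beta> x \<zero>\<^bsub>C \<beta>\<^esub> = \<zero>\<^bsub>P (\<alpha> \<otimes> \<beta>)\<^esub>"
proof -
  interpret C': abelian_group "C \<beta>" by (rule C.component_group[OF assms(2)])
  interpret P': abelian_group "P (\<alpha> \<otimes> \<beta>)" using assms by (intro P.component_group) simp
  show ?thesis
    using pairing_add_right[OF assms C'.zero_closed C'.zero_closed]
      pairing_closed[OF assms C'.zero_closed] by simp
qed

text \<open>Index sets larger than the supports make sums with different supports comparable.\<close>

lemma graded_product_superset:
  assumes f: "f \<Colon> direct_sum G L" and g: "g \<Colon> direct_sum G C" and \<gamma>: "\<gamma> \<Colon> G"
    and I: "finite I" "I \<subseteq> carrier G" "{\<alpha> \<in> carrier G. f \<alpha> \<noteq> \<zero>\<^bsub>L \<alpha>\<^esub>} \<subseteq> I"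
    and J: "finite J" "J \<subseteq> carrier G" "{\<beta> \<in> carrier G. g \<beta> \<noteq> \<zero>\<^bsub>C \<beta>\<^esub>} \<subseteq> J"
  shows "gprod f g \<gamma> = (\<Oplus>\<^bsub>P \<gamma>\<^esub>p\<in>{p \<in> I \<times> J. fst p \<otimes> snd p = \<gamma>}. \<mu> (fst p) (snd p) (f (fst p)) (g (snd p)))"
proof -
  interpret P': abelian_group "P \<gamma>" by (rule P.component_group[OF \<gamma>])
  let ?S = "{p \<in> I \<times> J. fst p \<otimes> snd p = \<gamma>}"
  have cl: "\<mu> (fst p) (snd p) (f (fst p)) (g (snd p)) \<Colon> P \<gamma>" if "p \<in> ?S" for p
  proof -
    have ab: "fst p \<Colon> G" "snd p \<Colon> G" "fst p \<otimes> snd p = \<gamma>" using that I(2) J(2) by auto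
    then show ?thesis
      using pairing_closed[OF ab(1,2) L.sum_value[OF f ab(1)] C.sum_value[OF g ab(2)]] by simp
  qed
  have z: "\<mu> (fst p) (snd p) (f (fst p)) (g (snd p)) = \<zero>\<^bsub>P \<gamma>\<^esub>"
    if p: "p \<in> ?S - {(\<alpha>, \<beta>). \<alpha> \<Colon> G \<and> \<beta> \<Colon> G \<and> \<alpha> \<otimes>\<^bsub>G\<^esub> \<beta> = \<gamma> \<and>
                     f \<alpha> \<noteq> \<zero>\<^bsub>L \<alpha>\<^esub> \<and> g \<beta> \<noteq> \<zero>\<^bsub>C \<beta>\<^esub>}" for p
  proof -
    obtain \<alpha> \<beta> where p': "p = (\<alpha>, \<beta>)" by (cases p)
    have ab: "\<alpha> \<Colon> G" "\<beta> \<Colon> G" "\<alpha> \<otimes> \<beta> = \<gamma>" using p I J p' by auto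
    then consider "f \<alpha> = \<zero>\<^bsub>L \<alpha>\<^esub>" | "g \<beta> = \<zero>\<^bsub>C \<beta>\<^esub>" using p p' by auto
    then show ?thesis
      using pairing_zero_left[OF ab(1,2) C.sum_value[OF g ab(2)]]
        pairing_zero_right[OF ab(1,2) L.sum_value[OF f ab(1)]] ab p' by cases auto
  qed
  show ?thesis
    unfolding graded_product_def restrict_apply'[OF \<gamma>]
  proof (rule P'.add.finprod_mono_neutral_cong_left)
    show "finite ?S" using I(1) J(1) by simp
    show "{(\<alpha>, \<beta>). \<alpha> \<Colon> G \<and> \<beta> \<Colon> G \<and> \<alpha> \<otimes>\<^bsub>G\<^esub> \<beta> = \<gamma> \<and>
                     f \<alpha> \<noteq> \<zero>\<^bsub>L \<alpha>\<^esub> \<and> g \<beta> \<noteq> \<zero>\<^bsub>C \<beta>\<^esub>} \<subseteq> ?S"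
      using I(3) J(3) by auto
  qed (simp_all only: z cl Pi_I)
qed

lemma graded_product_value:
  assumes f: "f \<Colon> direct_sum G L" and g: "g \<Colon> direct_sum G C" and \<gamma>: "\<gamma> \<Colon> G"
  shows "gprod f g \<gamma> \<Colon> P \<gamma>"
proof -
  interpret P': abelian_group "P \<gamma>" by (rule P.component_group[OF \<gamma>])
  show ?thesis
    unfolding graded_product_def restrict_apply'[OF \<gamma>]
    by (rule P'.finsum_closed, rule Pi_I, elim CollectE case_prodE conjE)
      (use pairing_closed L.sum_value[OF f] C.sum_value[OF g] in fastforce)
qed

lemma graded_product_closed:
  assumes f: "f \<Colon> direct_sum G L" and g: "g \<Colon> direct_sum G C"
  shows "gprod f g \<Colon> direct_sum G P"
proof (rule P.direct_sum_memI)
  let ?S = "{\<alpha> \<in> carrier G. f \<alpha> \<noteq> \<zero>\<^bsub>L \<alpha>\<^esub>} \<times> {\<beta> \<in> carrier G. g \<beta> \<noteq> \<zero>\<^bsub>C \<beta>\<^esub>}"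
  show "finite ((\<lambda>(\<alpha>, \<beta>). \<alpha> \<otimes> \<beta>) ` ?S)"
    by (intro finite_imageI finite_cartesian_product L.direct_sum_support[OF f] C.direct_sum_support[OF g])
  show "gprod f g \<gamma> = \<zero>\<^bsub>P \<gamma>\<^esub>" if "\<gamma> \<Colon> G" "\<gamma> \<notin> (\<lambda>(\<alpha>, \<beta>). \<alpha> \<otimes> \<beta>) ` ?S" for \<gamma>
  proof -
    interpret P': abelian_group "P \<gamma>" by (rule P.component_group[OF that(1)])
    have "{(\<alpha>, \<beta>). \<alpha> \<Colon> G \<and> \<beta> \<Colon> G \<and> \<alpha> \<otimes>\<^bsub>G\<^esub> \<beta> = \<gamma> \<and>
                     f \<alpha> \<noteq> \<zero>\<^bsub>L \<alpha>\<^esub> \<and> g \<beta> \<noteq> \<zero>\<^bsub>C \<beta>\<^esub>} = {}" using that(2) by auto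
    then show ?thesis unfolding graded_product_def restrict_apply'[OF that(1)] by (simp only: P'.finsum_empty)
  qed
qed (simp_all add: graded_product_value f g, simp add: graded_product_def)

text \<open>Over common index sets the identity holds summand by summand.  Both distributive laws are instances.\<close>

lemma graded_product_sum:
  assumes f: "f \<Colon> direct_sum G L" "f1 \<Colon> direct_sum G L" "f2 \<Colon> direct_sum G L"
    and g: "g \<Colon> direct_sum G C" "g1 \<Colon> direct_sum G C" "g2 \<Colon> direct_sum G C"
    and eq: "\<And>\<alpha> \<beta>. \<lbrakk>\<alpha> \<Colon> G; \<beta> \<Colon> G\<rbrakk> \<Longrightarrow>
      \<mu> \<alpha> \<beta> (f \<alpha>) (g \<beta>) = \<mu> \<alpha> \<beta> (f1 \<alpha>) (g1 \<beta>) \<oplus>\<^bsub>P (\<alpha> \<otimes> \<beta>)\<^esub> \<mu> \<alpha> \<beta> (f2 \<alpha>) (g2 \<beta>)"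
  shows "gprod f g = gprod f1 g1 \<oplus>\<^bsub>direct_sum G P\<^esub> gprod f2 g2"
proof (rule P.direct_sum_eqI)
  show "gprod f g \<Colon> direct_sum G P" "gprod f1 g1 \<oplus>\<^bsub>direct_sum G P\<^esub> gprod f2 g2 \<Colon> direct_sum G P"
    by (intro graded_product_closed P.D.a_closed f g)+
  fix \<gamma> assume \<gamma>: "\<gamma> \<Colon> G"
  interpret P': abelian_group "P \<gamma>" by (rule P.component_group[OF \<gamma>])
  let ?s = "\<lambda>f. {\<alpha> \<in> carrier G. f \<alpha> \<noteq> \<zero>\<^bsub>L \<alpha>\<^esub>}" and ?t = "\<lambda>g. {\<beta> \<in> carrier G. g \<beta> \<noteq> \<zero>\<^bsub>C \<beta>\<^esub>}"
  let ?I = "?s f \<union> ?s f1 \<union> ?s f2" and ?J = "?t g \<union> ?t g1 \<union> ?t g2"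
  let ?S = "{p \<in> ?I \<times> ?J. fst p \<otimes> snd p = \<gamma>}" and ?m = "\<lambda>f g p. \<mu> (fst p) (snd p) (f (fst p)) (g (snd p))"
  have I: "finite ?I" "?I \<subseteq> carrier G" using f[THEN L.direct_sum_support] by auto
  have J: "finite ?J" "?J \<subseteq> carrier G" using g[THEN C.direct_sum_support] by auto
  have ab: "fst p \<Colon> G" "snd p \<Colon> G" "fst p \<otimes> snd p = \<gamma>" if "p \<in> ?S" for p using that by auto
  have cl: "?m f g p \<Colon> P \<gamma>" if "f \<Colon> direct_sum G L" "g \<Colon> direct_sum G C" "p \<in> ?S" for f g p
    using pairing_closed[OF ab(1,2)[OF that(3)] L.sum_value[OF that(1) ab(1)[OF that(3)]]
      C.sum_value[OF that(2) ab(2)[OF that(3)]]] by (simp only: ab(3)[OF that(3)])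
  have "gprod f g \<gamma> = (\<Oplus>\<^bsub>P \<gamma>\<^esub>p\<in>?S. ?m f g p)"
    by (rule graded_product_superset[OF f(1) g(1) \<gamma> I _ J]) auto
  also have "\<dots> = (\<Oplus>\<^bsub>P \<gamma>\<^esub>p\<in>?S. ?m f1 g1 p \<oplus>\<^bsub>P \<gamma>\<^esub> ?m f2 g2 p)"
  proof (rule P'.finsum_cong'[OF refl])
    show "?m f g p = ?m f1 g1 p \<oplus>\<^bsub>P \<gamma>\<^esub> ?m f2 g2 p" if "p \<in> ?S" for p
      using eq[OF ab(1,2)[OF that]] by (simp only: ab(3)[OF that])
  qed (rule Pi_I, rule P'.a_closed[OF cl[OF f(2) g(2)] cl[OF f(3) g(3)]])
  also have "\<dots> = (\<Oplus>\<^bsub>P \<gamma>\<^esub>p\<in>?S. ?m f1 g1 p) \<oplus>\<^bsub>P \<gamma>\<^esub> (\<Oplus>\<^bsub>P \<gamma>\<^esub>p\<in>?S. ?m f2 g2 p)"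
    by (rule P'.finsum_addf; rule Pi_I) (erule cl[OF f(2) g(2)], erule cl[OF f(3) g(3)])
  also have "(\<Oplus>\<^bsub>P \<gamma>\<^esub>p\<in>?S. ?m f1 g1 p) = gprod f1 g1 \<gamma>"
    by (rule graded_product_superset[OF f(2) g(2) \<gamma> I _ J, symmetric]) auto
  also have "(\<Oplus>\<^bsub>P \<gamma>\<^esub>p\<in>?S. ?m f2 g2 p) = gprod f2 g2 \<gamma>"
    by (rule graded_product_superset[OF f(3) g(3) \<gamma> I _ J, symmetric]) auto
  finally show "gprod f g \<gamma> = (gprod f1 g1 \<oplus>\<^bsub>direct_sum G P\<^esub> gprod f2 g2) \<gamma>"
    using \<gamma> by (simp add: P.direct_sum_simps)
qed

lemma graded_product_add_left:
  assumes f: "f \<Colon> direct_sum G L" "f' \<Colon> direct_sum G L" and g: "g \<Colon> direct_sum G C"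
  shows "gprod (f \<oplus>\<^bsub>direct_sum G L\<^esub> f') g = gprod f g \<oplus>\<^bsub>direct_sum G P\<^esub> gprod f' g"
  by (rule graded_product_sum[OF L.D.a_closed[OF f] f g g g])
    (simp add: L.direct_sum_simps pairing_add_left L.sum_value f C.sum_value g)

lemma graded_product_add_right:
  assumes f: "f \<Colon> direct_sum G L" and g: "g \<Colon> direct_sum G C" "g' \<Colon> direct_sum G C"
  shows "gprod f (g \<oplus>\<^bsub>direct_sum G C\<^esub> g') = gprod f g \<oplus>\<^bsub>direct_sum G P\<^esub> gprod f g'"
  by (rule graded_product_sum[OF f f f C.D.a_closed[OF g] g])
    (simp add: C.direct_sum_simps pairing_add_right L.sum_value f C.sum_value g)

lemma graded_product_inclusion:
  assumes a: "\<alpha> \<Colon> G" and b: "\<beta> \<Colon> G" and x: "x \<Colon> L \<alpha>" and y: "y \<Colon> C \<beta>"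
  shows "gprod (inclusion G L \<alpha> x) (inclusion G C \<beta> y) = inclusion G P (\<alpha> \<otimes> \<beta>) (\<mu> \<alpha> \<beta> x y)"
proof (rule P.direct_sum_eqI)
  note ix = L.inclusion_closed[OF a x] note iy = C.inclusion_closed[OF b y]
  have ab: "\<alpha> \<otimes> \<beta> \<Colon> G" using a b by simp
  show "gprod (inclusion G L \<alpha> x) (inclusion G C \<beta> y) \<Colon> direct_sum G P"
    "inclusion G P (\<alpha> \<otimes> \<beta>) (\<mu> \<alpha> \<beta> x y) \<Colon> direct_sum G P"
    by (intro graded_product_closed P.inclusion_closed ix iy ab pairing_closed a b x y)+
  fix \<gamma> assume \<gamma>: "\<gamma> \<Colon> G"
  interpret P': abelian_group "P \<gamma>" by (rule P.component_group[OF \<gamma>])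
  have "gprod (inclusion G L \<alpha> x) (inclusion G C \<beta> y) \<gamma> = (\<Oplus>\<^bsub>P \<gamma>\<^esub>p\<in>{p \<in> {\<alpha>} \<times> {\<beta>}. fst p \<otimes> snd p = \<gamma>}. \<mu> (fst p) (snd p) (inclusion G L \<alpha> x (fst p)) (inclusion G C \<beta> y (snd p)))" (is "?l = _")
    by (rule graded_product_superset[OF ix iy \<gamma>]) (use a b in \<open>auto simp: L.inclusion_value C.inclusion_value split: if_splits\<close>)
  also have "\<dots> = inclusion G P (\<alpha> \<otimes> \<beta>) (\<mu> \<alpha> \<beta> x y) \<gamma>"
  proof (cases "\<alpha> \<otimes> \<beta> = \<gamma>")
    case True
    then have e: "{p \<in> {\<alpha>} \<times> {\<beta>}. fst p \<otimes> snd p = \<gamma>} = {(\<alpha>, \<beta>)}" by auto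
    have "\<mu> \<alpha> \<beta> x y \<Colon> P \<gamma>" using pairing_closed[OF a b x y] True by simp
    then show ?thesis unfolding e using True a b \<gamma> by (simp add: L.inclusion_value C.inclusion_value P.inclusion_value)
  next
    case False
    then have e: "{p \<in> {\<alpha>} \<times> {\<beta>}. fst p \<otimes> snd p = \<gamma>} = {}" by auto
    show ?thesis unfolding e using False \<gamma> by (auto simp: P.inclusion_value)
  qed
  finally show "?l = \<dots>" .
qed

end

section \<open>Graded rings from components\<close>

lemma same_abelian_group:
  assumes "abelian_group Q" "carrier P = carrier Q" "\<And>x y. x \<oplus>\<^bsub>P\<^esub> y = x \<oplus>\<^bsub>Q\<^esub> y" "\<zero>\<^bsub>P\<^esub> = \<zero>\<^bsub>Q\<^esub>"
  shows "abelian_group P"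
  by (rule abelian_groupI) (use abelian_groupE[OF assms(1)] assms(2-) in auto)

text \<open>Axioms for homogeneous elements, which extend to the direct sum by biadditivity.\<close>

locale graded_ring_data = graded_pairing G C C C \<mu> + A: ring A
  for G :: "('g, 'x) monoid_scheme" (structure) and C :: "'g \<Rightarrow> ('c, 'y) ring_scheme"
    and \<mu> and A :: "('a, 'w) ring_scheme" and u :: 'c and \<iota> :: "'a \<Rightarrow> 'c" +
  assumes mult_assoc: "\<lbrakk>\<alpha> \<Colon> G; \<beta> \<Colon> G; \<gamma> \<Colon> G; x \<Colon> C \<alpha>; y \<Colon> C \<beta>; z \<Colon> C \<gamma>\<rbrakk> \<Longrightarrow>
      \<mu> (\<alpha> \<otimes> \<beta>) \<gamma> (\<mu> \<alpha> \<beta> x y) z = \<mu> \<alpha> (\<beta> \<otimes> \<gamma>) x (\<mu> \<beta> \<gamma> y z)"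
    and unit_closed: "u \<Colon> C \<one>"
    and unit_left: "\<lbrakk>\<alpha> \<Colon> G; x \<Colon> C \<alpha>\<rbrakk> \<Longrightarrow> \<mu> \<one> \<alpha> u x = x"
    and unit_right: "\<lbrakk>\<alpha> \<Colon> G; x \<Colon> C \<alpha>\<rbrakk> \<Longrightarrow> \<mu> \<alpha> \<one> x u = x"
    and base_closed: "a \<Colon> A \<Longrightarrow> \<iota> a \<Colon> C \<one>"
    and base_add: "\<lbrakk>a \<Colon> A; b \<Colon> A\<rbrakk> \<Longrightarrow> \<iota> (a \<oplus>\<^bsub>A\<^esub> b) = \<iota> a \<oplus>\<^bsub>C \<one>\<^esub> \<iota> b"
    and base_mult: "\<lbrakk>a \<Colon> A; b \<Colon> A\<rbrakk> \<Longrightarrow> \<iota> (a \<otimes>\<^bsub>A\<^esub> b) = \<mu> \<one> \<one> (\<iota> a) (\<iota> b)"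
    and base_one: "\<iota> \<one>\<^bsub>A\<^esub> = u"
begin

abbreviation "R \<equiv> graded_ring_of G C \<mu> u \<iota>"
abbreviation "DC \<equiv> direct_sum G C"

lemma graded_ring_simps:
  "carrier R = carrier DC" "f \<oplus>\<^bsub>R\<^esub> g = f \<oplus>\<^bsub>DC\<^esub> g" "\<zero>\<^bsub>R\<^esub> = \<zero>\<^bsub>DC\<^esub>"
  "f \<otimes>\<^bsub>R\<^esub> g = gprod f g" "\<one>\<^bsub>R\<^esub> = inclusion G C \<one> u"
  "component R \<alpha> = homogeneous G C \<alpha>" "from_base R a = inclusion G C \<one> (\<iota> a)"
  by (simp_all add: graded_ring_of_def graded_product_def)

lemma graded_ring_assoc:
  assumes f: "f \<Colon> DC" and g: "g \<Colon> DC" and h: "h \<Colon> DC"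
  shows "gprod (gprod f g) h = gprod f (gprod g h)"
  using f
proof (induction f rule: L.direct_sum_induct)
  case (add f f')
  then show ?case using g h by (simp add: graded_product_add_left graded_product_closed)
next
  case i: (incl \<alpha> x)
  note ix = L.inclusion_closed[OF i]
  show ?case using g
  proof (induction g rule: L.direct_sum_induct)
    case (add f f')
    then show ?case using h ix by (simp add: graded_product_add_left graded_product_add_right graded_product_closed)
  next
    case j: (incl \<beta> y)
    note iy = L.inclusion_closed[OF j]
    show ?case using h
    proof (induction h rule: L.direct_sum_induct)
      case (add f f')
      then show ?case using ix iy by (simp add: graded_product_add_right graded_product_closed)
    next
      case (incl \<gamma> z)
      then show ?case using i j by (simp add: graded_product_inclusion pairing_closed mult_assoc L.m_assoc)
    qed
  qed
qed

lemma graded_ring_unit: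
  assumes f: "f \<Colon> DC"
  shows "gprod (inclusion G C \<one> u) f = f" "gprod f (inclusion G C \<one> u) = f"
proof -
  have u: "inclusion G C \<one> u \<Colon> DC" by (intro L.inclusion_closed unit_closed L.one_closed)
  show "gprod (inclusion G C \<one> u) f = f"
    using f by (induction f rule: L.direct_sum_induct)
      (simp_all add: graded_product_add_right u graded_product_inclusion unit_closed unit_left)
  show "gprod f (inclusion G C \<one> u) = f"
    using f by (induction f rule: L.direct_sum_induct)
      (simp_all add: graded_product_add_left u graded_product_inclusion unit_closed unit_right)
qed

lemma ring_R: "ring R"
proof (rule ringI)
  show "abelian_group R"
    by (rule same_abelian_group[OF L.direct_sum_abelian_group]) (simp_all add: graded_ring_simps)
  show "monoid R"
    by (rule monoidI) (simp_all add: graded_ring_simps graded_product_closed graded_ring_assoc graded_ring_unit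
        L.inclusion_closed unit_closed)
qed (simp_all add: graded_ring_simps graded_product_add_left graded_product_add_right)

lemma same_finsum_R: "finsum R f I = finsum DC f I"
  by (rule same_finsum) (simp_all add: graded_ring_simps)

text \<open>A sum of homogeneous elements \<open>f \<alpha>\<close> has the value \<open>f \<beta> \<beta>\<close> at
  \<open>\<beta>\<close>, so an element has exactly one decomposition, given by its values.\<close>

lemma graded_A_ring_R: "graded_A_ring G A R"
proof -
  interpret R: ring R by (rule ring_R)
  show ?thesis
  proof (intro graded_A_ring.intro graded_A_ring_axioms.intro L.is_group A.ring_axioms ring_R)
    fix \<alpha> assume a: "\<alpha> \<Colon> G"
    have m: "m_inv (add_monoid R) x = a_inv R x" for x by (simp add: a_inv_def)
    show "additive_subgroup (component R \<alpha>) R"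
    proof (intro additive_subgroup.intro subgroup.intro; (simp add: graded_ring_simps(6))?)
      show "homogeneous G C \<alpha> \<subseteq> carrier R" by (auto simp: graded_ring_simps L.homogeneous_closed)
      show "\<zero>\<^bsub>R\<^esub> \<in> homogeneous G C \<alpha>"
        by (simp add: graded_ring_simps homogeneous_def L.D.zero_closed) (simp add: L.direct_sum_simps)
      fix x assume x: "x \<in> homogeneous G C \<alpha>"
      show "m_inv (add_monoid R) x \<in> homogeneous G C \<alpha>"
      proof -
        have xc: "x \<Colon> DC" using x by (rule L.homogeneous_closed)
        have ne: "\<ominus>\<^bsub>R\<^esub> x \<Colon> DC" using R.a_inv_closed[of x] xc by (simp add: graded_ring_simps)
        have "(\<ominus>\<^bsub>R\<^esub> x) \<beta> = \<zero>\<^bsub>C \<beta>\<^esub>" if b: "\<beta> \<Colon> G" "\<beta> \<noteq> \<alpha>" for \<beta>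
        proof -
          have "((\<ominus>\<^bsub>R\<^esub> x) \<oplus>\<^bsub>R\<^esub> x) \<beta> = \<zero>\<^bsub>R\<^esub> \<beta>" using R.l_neg[of x] xc by (simp add: graded_ring_simps)
          then show ?thesis
            using x b L.component_ops(4)[OF b(1) L.sum_value[OF ne b(1)]]
            by (simp add: graded_ring_simps L.direct_sum_simps homogeneous_def)
        qed
        then show ?thesis using ne by (simp add: m homogeneous_def)
      qed
      fix y assume y: "y \<in> homogeneous G C \<alpha>"
      show "x \<oplus>\<^bsub>R\<^esub> y \<in> homogeneous G C \<alpha>"
        using x y L.D.a_closed[of x y] by (simp add: graded_ring_simps homogeneous_def) (simp add: L.direct_sum_simps L.component_ops)
    qed
    fix \<beta> x y assume b: "\<beta> \<Colon> G" and x: "x \<in> component R \<alpha>" and y: "y \<in> component R \<beta>"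
    have xy: "x = inclusion G C \<alpha> (x \<alpha>)" "y = inclusion G C \<beta> (y \<beta>)"
      using L.homogeneous_eq_inclusion[OF a, of x] L.homogeneous_eq_inclusion[OF b, of y] x y
      by (auto simp: graded_ring_simps)
    have c: "x \<alpha> \<Colon> C \<alpha>" "y \<beta> \<Colon> C \<beta>"
      using x y a b by (auto simp: graded_ring_simps homogeneous_def intro: L.sum_value)
    have "x \<otimes>\<^bsub>R\<^esub> y = inclusion G C (\<alpha> \<otimes> \<beta>) (\<mu> \<alpha> \<beta> (x \<alpha>) (y \<beta>))"
      unfolding graded_ring_simps(4) by (subst xy(1), subst xy(2)) (rule graded_product_inclusion[OF a b c])
    then show "x \<otimes>\<^bsub>R\<^esub> y \<in> component R (\<alpha> \<otimes> \<beta>)"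
      using a b by (simp add: graded_ring_simps(6) L.inclusion_homogeneous pairing_closed c)
  next
    fix r assume "r \<Colon> R"
    then have r: "r \<Colon> DC" by (simp add: graded_ring_simps)
    let ?f = "\<lambda>\<alpha>\<in>carrier G. inclusion G C \<alpha> (r \<alpha>)"
    have nz: "inclusion G C \<alpha> x = \<zero>\<^bsub>DC\<^esub> \<longleftrightarrow> x = \<zero>\<^bsub>C \<alpha>\<^esub>" if "\<alpha> \<Colon> G" for \<alpha> x
      using that L.inclusion_value[OF that, of \<alpha> x] L.inclusion_zero[of \<alpha>]
      by (auto simp: L.direct_sum_simps)
    have val: "(\<Oplus>\<^bsub>R\<^esub>\<alpha>\<in>{\<alpha> \<in> carrier G. f \<alpha> \<noteq> \<zero>\<^bsub>R\<^esub>}. f \<alpha>) \<beta> = f \<beta> \<beta>"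
      if f: "f \<in> (\<Pi>\<^sub>E \<alpha>\<in>carrier G. component R \<alpha>)" and fin: "finite {\<alpha> \<in> carrier G. f \<alpha> \<noteq> \<zero>\<^bsub>R\<^esub>}"
        and b: "\<beta> \<Colon> G" for f \<beta>
    proof -
      let ?I = "{\<alpha> \<in> carrier G. f \<alpha> \<noteq> \<zero>\<^bsub>R\<^esub>}"
      interpret Cb: abelian_group "C \<beta>" by (rule L.component_group[OF b])
      have fh: "f \<alpha> \<in> homogeneous G C \<alpha>" if "\<alpha> \<Colon> G" for \<alpha>
        using f that by (auto simp: graded_ring_simps)
      then have fc: "f \<alpha> \<Colon> DC" if "\<alpha> \<Colon> G" for \<alpha> using that L.homogeneous_closed by blast
      have "(\<Oplus>\<^bsub>R\<^esub>\<alpha>\<in>?I. f \<alpha>) \<beta> = (\<Oplus>\<^bsub>C \<beta>\<^esub>\<alpha>\<in>?I. f \<alpha> \<beta>)"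
        unfolding same_finsum_R by (rule L.finsum_value[OF fin _ b]) (simp add: fc)
      also have "\<dots> = (\<Oplus>\<^bsub>C \<beta>\<^esub>\<alpha>\<in>insert \<beta> ?I. f \<alpha> \<beta>)"
      proof (rule Cb.add.finprod_mono_neutral_cong_left)
        show "finite (insert \<beta> ?I)" using fin by simp
        show "f \<alpha> \<beta> = \<zero>\<^bsub>C \<beta>\<^esub>" if "\<alpha> \<in> insert \<beta> ?I - ?I" for \<alpha>
          using that b by (auto simp: graded_ring_simps L.direct_sum_simps)
      qed (use b fc L.sum_value in auto)
      also have "\<dots> = (\<Oplus>\<^bsub>C \<beta>\<^esub>\<alpha>\<in>{\<beta>}. f \<alpha> \<beta>)"
      proof (rule Cb.add.finprod_mono_neutral_cong_left[symmetric])
        show "finite (insert \<beta> ?I)" using fin by simp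
        show "f \<alpha> \<beta> = \<zero>\<^bsub>C \<beta>\<^esub>" if "\<alpha> \<in> insert \<beta> ?I - {\<beta>}" for \<alpha>
          using that b fh[of \<alpha>] by (auto simp: homogeneous_def)
      qed (use b fc L.sum_value in auto)
      also have "\<dots> = f \<beta> \<beta>" using L.sum_value[OF fc[OF b] b] by (simp add: Cb.finsum_singleton)
      finally show ?thesis .
    qed
    have f: "?f \<in> (\<Pi>\<^sub>E \<alpha>\<in>carrier G. component R \<alpha>)"
      by (auto simp: graded_ring_simps intro: L.inclusion_homogeneous L.sum_value[OF r])
    have supp: "{\<alpha> \<in> carrier G. ?f \<alpha> \<noteq> \<zero>\<^bsub>R\<^esub>} = {\<alpha> \<in> carrier G. r \<alpha> \<noteq> \<zero>\<^bsub>C \<alpha>\<^esub>}"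
      by (auto simp: graded_ring_simps nz)
    have fin: "finite {\<alpha> \<in> carrier G. ?f \<alpha> \<noteq> \<zero>\<^bsub>R\<^esub>}"
      unfolding supp by (rule L.direct_sum_support[OF r])
    have cl: "(\<Oplus>\<^bsub>R\<^esub>\<alpha>\<in>{\<alpha> \<in> carrier G. f \<alpha> \<noteq> \<zero>\<^bsub>R\<^esub>}. f \<alpha>) \<Colon> DC"
      if "f \<in> (\<Pi>\<^sub>E \<alpha>\<in>carrier G. component R \<alpha>)" for f
      unfolding same_finsum_R by (rule L.D.finsum_closed) (use that in \<open>auto simp: graded_ring_simps PiE_iff L.homogeneous_closed\<close>)
    show "\<exists>!f. f \<in> (\<Pi>\<^sub>E \<alpha>\<in>carrier G. component R \<alpha>) \<and> finite {\<alpha> \<in> carrier G. f \<alpha> \<noteq> \<zero>\<^bsub>R\<^esub>} \<and>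
           r = (\<Oplus>\<^bsub>R\<^esub>\<alpha>\<in>{\<alpha> \<in> carrier G. f \<alpha> \<noteq> \<zero>\<^bsub>R\<^esub>}. f \<alpha>)"
    proof (rule ex1I[of _ ?f], intro conjI f fin)
      show "r = (\<Oplus>\<^bsub>R\<^esub>\<alpha>\<in>{\<alpha> \<in> carrier G. ?f \<alpha> \<noteq> \<zero>\<^bsub>R\<^esub>}. ?f \<alpha>)"
        by (rule L.direct_sum_eqI[OF r cl[OF f]]) (simp only: val[OF f fin], simp add: L.inclusion_value)
      fix g assume g: "g \<in> (\<Pi>\<^sub>E \<alpha>\<in>carrier G. component R \<alpha>) \<and> finite {\<alpha> \<in> carrier G. g \<alpha> \<noteq> \<zero>\<^bsub>R\<^esub>} \<and>
           r = (\<Oplus>\<^bsub>R\<^esub>\<alpha>\<in>{\<alpha> \<in> carrier G. g \<alpha> \<noteq> \<zero>\<^bsub>R\<^esub>}. g \<alpha>)"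
      show "g = ?f"
      proof (rule PiE_ext[of _ "carrier G" "component R"])
        show "g \<in> Pi\<^sub>E (carrier G) (component R)" "?f \<in> Pi\<^sub>E (carrier G) (component R)" using g f by blast+
        fix \<alpha> assume a: "\<alpha> \<Colon> G"
        have "r \<alpha> = g \<alpha> \<alpha>" using val[of g \<alpha>] g a by metis
        moreover have "g \<alpha> \<in> homogeneous G C \<alpha>" using g a by (auto simp: graded_ring_simps)
        ultimately show "g \<alpha> = ?f \<alpha>" using L.homogeneous_eq_inclusion[OF a] a by simp
      qed
    qed
  next
    show "\<one>\<^bsub>R\<^esub> \<in> component R \<one>"
      by (simp add: graded_ring_simps L.inclusion_homogeneous unit_closed)
    show "from_base R \<in> ring_hom A R"
      by (rule ring_hom_memI) (simp_all add: graded_ring_simps L.inclusion_closed base_closed base_add base_mult base_one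
          L.inclusion_add graded_product_inclusion)
    show "from_base R a \<in> component R \<one>" if "a \<Colon> A" for a
      using that by (simp add: graded_ring_simps L.inclusion_homogeneous base_closed)
  qed
qed

end

subsection \<open>Transport along isomorphisms of the components\<close>

text \<open>Ring axioms are given for the target.  The source inherits them by injectivity, which spares their direct
  verification for a complicated product.\<close>

locale component_isomorphism = target: graded_ring_data G C' \<mu>' A u' \<iota>' + source: direct_sum_of_groups G C
  for G :: "('g, 'x) monoid_scheme" (structure) and C' :: "'g \<Rightarrow> ('d, 'y1) ring_scheme"
    and \<mu>' and A :: "('a, 'w) ring_scheme" and u' and \<iota>'
    and C :: "'g \<Rightarrow> ('c, 'y2) ring_scheme" +
  fixes \<mu> u \<iota> \<phi>
  assumes iso_bij: "\<alpha> \<Colon> G \<Longrightarrow> bij_betw (\<phi> \<alpha>) (carrier (C \<alpha>)) (carrier (C' \<alpha>))"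
    and iso_add: "\<lbrakk>\<alpha> \<Colon> G; x \<Colon> C \<alpha>; y \<Colon> C \<alpha>\<rbrakk> \<Longrightarrow> \<phi> \<alpha> (x \<oplus>\<^bsub>C \<alpha>\<^esub> y) = \<phi> \<alpha> x \<oplus>\<^bsub>C' \<alpha>\<^esub> \<phi> \<alpha> y"
    and mult_closed: "\<lbrakk>\<alpha> \<Colon> G; \<beta> \<Colon> G; x \<Colon> C \<alpha>; y \<Colon> C \<beta>\<rbrakk> \<Longrightarrow>
      \<mu> \<alpha> \<beta> x y \<Colon> C (\<alpha> \<otimes> \<beta>)"
    and iso_mult: "\<lbrakk>\<alpha> \<Colon> G; \<beta> \<Colon> G; x \<Colon> C \<alpha>; y \<Colon> C \<beta>\<rbrakk> \<Longrightarrow>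
      \<phi> (\<alpha> \<otimes> \<beta>) (\<mu> \<alpha> \<beta> x y) = \<mu>' \<alpha> \<beta> (\<phi> \<alpha> x) (\<phi> \<beta> y)"
    and iso_unit: "u \<Colon> C \<one>" "\<phi> \<one> u = u'"
    and iso_base: "a \<Colon> A \<Longrightarrow> \<iota> a \<Colon> C \<one>" "a \<Colon> A \<Longrightarrow> \<phi> \<one> (\<iota> a) = \<iota>' a"
begin

lemma iso_closed: "\<lbrakk>\<alpha> \<Colon> G; x \<Colon> C \<alpha>\<rbrakk> \<Longrightarrow> \<phi> \<alpha> x \<Colon> C' \<alpha>"
  using bij_betwE[OF iso_bij] by blast

lemma iso_eqI: "\<lbrakk>\<alpha> \<Colon> G; x \<Colon> C \<alpha>; y \<Colon> C \<alpha>; \<phi> \<alpha> x = \<phi> \<alpha> y\<rbrakk> \<Longrightarrow> x = y"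
  using inj_onD[OF bij_betw_imp_inj_on[OF iso_bij]] by blast

lemma iso_zero: "\<alpha> \<Colon> G \<Longrightarrow> \<phi> \<alpha> \<zero>\<^bsub>C \<alpha>\<^esub> = \<zero>\<^bsub>C' \<alpha>\<^esub>"
proof -
  assume a: "\<alpha> \<Colon> G"
  interpret C: abelian_group "C \<alpha>" by (rule source.component_group[OF a])
  interpret C': abelian_group "C' \<alpha>" by (rule target.L.component_group[OF a])
  show ?thesis using iso_add[OF a C.zero_closed C.zero_closed] iso_closed[OF a C.zero_closed] by simp
qed

lemma source_data: "graded_ring_data G C \<mu> A u \<iota>"
proof (intro graded_ring_data.intro graded_pairing.intro source.direct_sum_of_groups_axioms
    graded_pairing_axioms.intro target.A.ring_axioms graded_ring_data_axioms.intro mult_closed iso_unit iso_base)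
  note s = source.component_ops(2) and m = mult_closed and c = iso_closed
  note m' = target.pairing_closed
  fix \<alpha> \<beta> x y assume ab: "\<alpha> \<Colon> G" "\<beta> \<Colon> G" and xy: "x \<Colon> C \<alpha>" "y \<Colon> C \<beta>"
  have abc: "\<alpha> \<otimes> \<beta> \<Colon> G" using ab by simp
  show "\<mu> \<alpha> \<beta> (x \<oplus>\<^bsub>C \<alpha>\<^esub> x') y = \<mu> \<alpha> \<beta> x y \<oplus>\<^bsub>C (\<alpha> \<otimes> \<beta>)\<^esub> \<mu> \<alpha> \<beta> x' y" if x': "x' \<Colon> C \<alpha>" for x'
    by (rule iso_eqI[OF abc]) (simp_all add: s m iso_mult iso_add ab xy x' abc c target.pairing_add_left)
  show "\<mu> \<alpha> \<beta> x (y \<oplus>\<^bsub>C \<beta>\<^esub> y') = \<mu> \<alpha> \<beta> x y \<oplus>\<^bsub>C (\<alpha> \<otimes> \<beta>)\<^esub> \<mu> \<alpha> \<beta> x y'" if y': "y' \<Colon> C \<beta>" for y'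
    by (rule iso_eqI[OF abc]) (simp_all add: s m iso_mult iso_add ab xy y' abc c target.pairing_add_right)
  show "\<mu> (\<alpha> \<otimes> \<beta>) \<gamma> (\<mu> \<alpha> \<beta> x y) z = \<mu> \<alpha> (\<beta> \<otimes> \<gamma>) x (\<mu> \<beta> \<gamma> y z)" if g: "\<gamma> \<Colon> G" "z \<Colon> C \<gamma>" for \<gamma> z
  proof (rule iso_eqI[of "\<alpha> \<otimes> \<beta> \<otimes> \<gamma>"])
    have bg: "\<beta> \<otimes> \<gamma> \<Colon> G" using ab g by simp
    note e = target.L.m_assoc[OF ab g(1)]
    show "\<alpha> \<otimes> \<beta> \<otimes> \<gamma> \<Colon> G" using ab g by simp
    show "\<mu> (\<alpha> \<otimes> \<beta>) \<gamma> (\<mu> \<alpha> \<beta> x y) z \<Colon> C (\<alpha> \<otimes> \<beta> \<otimes> \<gamma>)" by (intro m ab g xy abc)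
    show "\<mu> \<alpha> (\<beta> \<otimes> \<gamma>) x (\<mu> \<beta> \<gamma> y z) \<Colon> C (\<alpha> \<otimes> \<beta> \<otimes> \<gamma>)" unfolding e by (intro m ab g xy bg)
    have "\<phi> (\<alpha> \<otimes> \<beta> \<otimes> \<gamma>) (\<mu> (\<alpha> \<otimes> \<beta>) \<gamma> (\<mu> \<alpha> \<beta> x y) z) = \<mu>' (\<alpha> \<otimes> \<beta>) \<gamma> (\<mu>' \<alpha> \<beta> (\<phi> \<alpha> x) (\<phi> \<beta> y)) (\<phi> \<gamma> z)" (is "?l = _")
      by (simp only: iso_mult m ab g xy abc)
    also have "\<dots> = \<mu>' \<alpha> (\<beta> \<otimes> \<gamma>) (\<phi> \<alpha> x) (\<mu>' \<beta> \<gamma> (\<phi> \<beta> y) (\<phi> \<gamma> z))"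
      by (rule target.mult_assoc) (simp_all add: c ab g xy)
    also have "\<dots> = \<phi> (\<alpha> \<otimes> \<beta> \<otimes> \<gamma>) (\<mu> \<alpha> (\<beta> \<otimes> \<gamma>) x (\<mu> \<beta> \<gamma> y z))"
      by (simp only: e iso_mult m ab g xy bg)
    finally show "?l = \<dots>" .
  qed
  show "\<mu> \<one> \<alpha> u x = x"
    by (rule iso_eqI[OF ab(1) _ xy(1)])
      (use m[OF _ ab(1) iso_unit(1) xy(1)] iso_mult[OF _ ab(1) iso_unit(1) xy(1)] ab xy in \<open>simp_all add: iso_unit target.unit_left c\<close>)
  show "\<mu> \<alpha> \<one> x u = x"
    by (rule iso_eqI[OF ab(1) _ xy(1)])
      (use m[OF ab(1) _ xy(1) iso_unit(1)] iso_mult[OF ab(1) _ xy(1) iso_unit(1)] ab xy in \<open>simp_all add: iso_unit target.unit_right c\<close>)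
next
  note o = target.L.one_closed
  fix a b assume a: "a \<Colon> A" and b: "b \<Colon> A"
  show "\<iota> (a \<oplus>\<^bsub>A\<^esub> b) = \<iota> a \<oplus>\<^bsub>C \<one>\<^esub> \<iota> b"
    by (rule iso_eqI[OF o]) (simp_all add: iso_base a b source.component_ops iso_add target.base_add)
  show "\<iota> (a \<otimes>\<^bsub>A\<^esub> b) = \<mu> \<one> \<one> (\<iota> a) (\<iota> b)"
    by (rule iso_eqI[OF o])
      (use mult_closed[OF o o, of "\<iota> a" "\<iota> b"] iso_mult[OF o o, of "\<iota> a" "\<iota> b"] in
        \<open>simp_all add: iso_base a b target.base_mult\<close>)
next
  show "\<iota> \<one>\<^bsub>A\<^esub> = u"
    by (rule iso_eqI[OF target.L.one_closed]) (simp_all add: iso_base iso_unit target.base_one)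
qed

sublocale source: graded_ring_data G C \<mu> A u \<iota> by (rule source_data)

definition "\<Phi> f = (\<lambda>\<alpha>\<in>carrier G. \<phi> \<alpha> (f \<alpha>))"

lemma Phi_closed: "f \<Colon> direct_sum G C \<Longrightarrow> \<Phi> f \<Colon> direct_sum G C'"
  by (rule target.L.direct_sum_memI[OF source.direct_sum_support])
    (auto simp: \<Phi>_def iso_zero intro: iso_closed source.sum_value)

lemma Phi_add: "\<lbrakk>f \<Colon> direct_sum G C; g \<Colon> direct_sum G C\<rbrakk> \<Longrightarrow>
  \<Phi> (f \<oplus>\<^bsub>direct_sum G C\<^esub> g) = \<Phi> f \<oplus>\<^bsub>direct_sum G C'\<^esub> \<Phi> g"
  unfolding \<Phi>_def source.direct_sum_simps target.L.direct_sum_simps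
  by (rule restrict_ext) (simp add: iso_add source.sum_value)

lemma Phi_inclusion: "\<lbrakk>\<alpha> \<Colon> G; x \<Colon> C \<alpha>\<rbrakk> \<Longrightarrow> \<Phi> (inclusion G C \<alpha> x) = inclusion G C' \<alpha> (\<phi> \<alpha> x)"
  unfolding \<Phi>_def inclusion_def by (rule restrict_ext) (simp add: iso_zero)

lemma Phi_mult:
  assumes f: "f \<Colon> direct_sum G C" and g: "g \<Colon> direct_sum G C"
  shows "\<Phi> (source.gprod f g) = target.gprod (\<Phi> f) (\<Phi> g)"
  using f
proof (induction f rule: source.direct_sum_induct)
  case (add f f')
  then show ?case using g
    by (simp add: source.graded_product_add_left target.graded_product_add_left Phi_add Phi_closed source.graded_product_closed)
next
  case i: (incl \<alpha> x)
  note ix = source.inclusion_closed[OF i]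
  show ?case using g
  proof (induction g rule: source.direct_sum_induct)
    case (add f f')
    then show ?case using ix
      by (simp add: source.graded_product_add_right target.graded_product_add_right Phi_add Phi_closed source.graded_product_closed)
  next
    case (incl \<beta> y)
    then show ?case using i
      by (simp add: source.graded_product_inclusion target.graded_product_inclusion Phi_inclusion iso_closed iso_mult mult_closed)
  qed
qed

lemma Phi_bij: "bij_betw \<Phi> (carrier (direct_sum G C)) (carrier (direct_sum G C'))"
proof (rule bij_betwI)
  let ?inv = "\<lambda>g. \<lambda>\<alpha>\<in>carrier G. inv_into (carrier (C \<alpha>)) (\<phi> \<alpha>) (g \<alpha>)"
  have i1: "inv_into (carrier (C \<alpha>)) (\<phi> \<alpha>) y \<Colon> C \<alpha>" "\<phi> \<alpha> (inv_into (carrier (C \<alpha>)) (\<phi> \<alpha>) y) = y"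
    if "\<alpha> \<Colon> G" "y \<Colon> C' \<alpha>" for \<alpha> y
    using that bij_betw_imp_surj_on[OF iso_bij[OF that(1)]] by (auto intro: inv_into_into f_inv_into_f)
  have i2: "inv_into (carrier (C \<alpha>)) (\<phi> \<alpha>) (\<phi> \<alpha> x) = x" if "\<alpha> \<Colon> G" "x \<Colon> C \<alpha>" for \<alpha> x
    by (rule inv_into_f_f[OF bij_betw_imp_inj_on[OF iso_bij[OF that(1)]] that(2)])
  have i3: "inv_into (carrier (C \<alpha>)) (\<phi> \<alpha>) \<zero>\<^bsub>C' \<alpha>\<^esub> = \<zero>\<^bsub>C \<alpha>\<^esub>" if "\<alpha> \<Colon> G" for \<alpha>
    using i2[OF that source.component_ops(1)[OF that]] by (simp add: iso_zero that)
  have inv: "?inv g \<Colon> direct_sum G C" if g: "g \<Colon> direct_sum G C'" for g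
    by (rule source.direct_sum_memI[OF target.L.direct_sum_support[OF g]])
      (auto simp: i3 intro: i1 target.L.sum_value[OF g])
  then show "?inv \<in> carrier (direct_sum G C') \<rightarrow> carrier (direct_sum G C)" by simp
  show "\<Phi> \<in> carrier (direct_sum G C) \<rightarrow> carrier (direct_sum G C')" by (simp add: Phi_closed)
  show "?inv (\<Phi> f) = f" if f: "f \<Colon> direct_sum G C" for f
    by (rule source.direct_sum_eqI[OF inv[OF Phi_closed[OF f]] f]) (simp add: \<Phi>_def i2 source.sum_value[OF f])
  show "\<Phi> (?inv g) = g" if g: "g \<Colon> direct_sum G C'" for g
    by (rule target.L.direct_sum_eqI[OF Phi_closed[OF inv[OF g]] g]) (simp add: \<Phi>_def i1 target.L.sum_value[OF g])
qed

lemma isomorphic: "graded_A_ring_isomorphic G A (graded_ring_of G C \<mu> u \<iota>) (graded_ring_of G C' \<mu>' u' \<iota>')"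
  unfolding graded_A_ring_isomorphic_def
proof (intro conjI bexI ballI)
  note ss = source.graded_ring_simps and ts = target.graded_ring_simps
  show "graded_A_ring G A source.R" "graded_A_ring G A target.R"
    by (rule source.graded_A_ring_R target.graded_A_ring_R)+
  show "\<Phi> \<in> ring_iso source.R target.R"
    unfolding ring_iso_def
  proof (intro CollectI conjI ring_hom_memI)
    show "bij_betw \<Phi> (carrier source.R) (carrier target.R)" by (simp add: ss ts Phi_bij)
  qed (simp_all add: ss ts Phi_closed Phi_add Phi_mult Phi_inclusion iso_unit)
  fix \<alpha> assume a: "\<alpha> \<Colon> G"
  have h: "\<Phi> f \<in> homogeneous G C' \<alpha> \<longleftrightarrow> f \<in> homogeneous G C \<alpha>" if f: "f \<Colon> direct_sum G C" for f
  proof -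
    have "\<phi> \<beta> (f \<beta>) = \<zero>\<^bsub>C' \<beta>\<^esub> \<longleftrightarrow> f \<beta> = \<zero>\<^bsub>C \<beta>\<^esub>" if b: "\<beta> \<Colon> G" for \<beta>
      using iso_eqI[OF b source.sum_value[OF f b] source.component_ops(1)[OF b]] by (auto simp: iso_zero b)
    then show ?thesis using f by (simp add: homogeneous_def Phi_closed) (simp add: \<Phi>_def)
  qed
  show "\<Phi> ` component source.R \<alpha> = component target.R \<alpha>"
    unfolding ss ts
  proof (intro equalityI subsetI)
    fix g assume g: "g \<in> homogeneous G C' \<alpha>"
    then obtain f where "f \<Colon> direct_sum G C" "g = \<Phi> f"
      using bij_betw_imp_surj_on[OF Phi_bij] target.L.homogeneous_closed by blast
    then show "g \<in> \<Phi> ` homogeneous G C \<alpha>" using g h by blast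
  qed (use h source.homogeneous_closed in blast)
next
  fix a assume "a \<Colon> A"
  then show "\<Phi> (from_base source.R a) = from_base target.R a"
    by (simp add: source.graded_ring_simps target.graded_ring_simps Phi_inclusion iso_base)
qed

end

lemma graded_A_ring_isomorphic_trans:
  assumes "graded_A_ring_isomorphic G A R R'" "graded_A_ring_isomorphic G A R' R''"
  shows "graded_A_ring_isomorphic G A R R''"
proof -
  note d = assms[unfolded graded_A_ring_isomorphic_def]
  obtain f where f: "f \<in> ring_iso R R'" "\<forall>\<alpha>\<in>carrier G. f ` component R \<alpha> = component R' \<alpha>"
    "\<forall>a\<in>carrier A. f (from_base R a) = from_base R' a"
    using d(1) by (elim conjE bexE) (rule that)
  obtain g where g: "g \<in> ring_iso R' R''" "\<forall>\<alpha>\<in>carrier G. g ` component R' \<alpha> = component R'' \<alpha>"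
    "\<forall>a\<in>carrier A. g (from_base R' a) = from_base R'' a"
    using d(2) by (elim conjE bexE) (rule that)
  have "g \<circ> f \<in> ring_iso R R''" by (rule ring_iso_set_trans[OF f(1) g(1)])
  moreover have "(g \<circ> f) ` component R \<alpha> = component R'' \<alpha>" if "\<alpha> \<Colon> G" for \<alpha>
    using f(2) g(2) that by (simp only: image_comp[symmetric])
  moreover have "(g \<circ> f) (from_base R a) = from_base R'' a" if "a \<Colon> A" for a
    using f(3) g(3) that by simp
  ultimately show ?thesis
    unfolding graded_A_ring_isomorphic_def using d by (intro conjI bexI[of _ "g \<circ> f"] ballI) simp_all
qed

lemma graded_A_ring_isomorphic_sym:
  assumes "graded_A_ring_isomorphic G A R R'"
  shows "graded_A_ring_isomorphic G A R' R"
proof -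
  from assms obtain f where R: "graded_A_ring G A R" "graded_A_ring G A R'" and f: "f \<in> ring_iso R R'"
    "\<forall>\<alpha>\<in>carrier G. f ` component R \<alpha> = component R' \<alpha>"
    "\<forall>a\<in>carrier A. f (from_base R a) = from_base R' a"
    using assms[unfolded graded_A_ring_isomorphic_def] by (elim conjE bexE) (rule that)
  interpret R: graded_A_ring G A R by (rule R(1))
  let ?g = "inv_into (carrier R) f"
  have inj: "inj_on f (carrier R)" using f(1) by (simp add: ring_iso_def bij_betw_def)
  have "?g \<in> ring_iso R' R" by (rule ring_iso_set_sym[OF R.R.ring_axioms f(1)])
  moreover have "?g ` component R' \<alpha> = component R \<alpha>" if "\<alpha> \<Colon> G" for \<alpha>
  proof -
    have "component R \<alpha> \<subseteq> carrier R" by (rule additive_subgroup.a_subset[OF R.component_subgroup[OF that]])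
    then show ?thesis using f(2)[rule_format, OF that, symmetric] inv_into_image_cancel[OF inj] by simp
  qed
  moreover have "?g (from_base R' a) = from_base R a" if "a \<Colon> A" for a
    using that f(3) inv_into_f_f[OF inj ring_hom_closed[OF R.from_base_hom that]] by simp
  ultimately show ?thesis
    unfolding graded_A_ring_isomorphic_def using R by (intro conjI bexI[of _ ?g] ballI)
qed

section \<open>Graded modules from components\<close>

context graded_ring_data
begin

definition component_action where
  "component_action M \<alpha> \<beta> m r =
    gm_act M (inclusion G (gm_group M) \<alpha> m) (inclusion G C \<beta> r) (\<alpha> \<otimes> \<beta>)"

definition total_action where
  "total_action N act m r = (if m \<Colon> direct_sum G N \<and> r \<Colon> R
     then graded_product G N C N act m r else undefined)"

text \<open>A graded module in terms of the action of homogeneous elements on homogeneous elements.\<close>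

definition component_module where
  "component_module N act \<longleftrightarrow> N \<in> extensional (carrier G) \<and> (\<forall>\<alpha>\<in>carrier G. plain_abelian_group (N \<alpha>)) \<and>
    graded_pairing G N C N act \<and>
    (\<forall>\<alpha>\<in>carrier G. \<forall>\<beta>\<in>carrier G. \<forall>\<gamma>\<in>carrier G. \<forall>m\<in>carrier (N \<alpha>). \<forall>r\<in>carrier (C \<beta>). \<forall>s\<in>carrier (C \<gamma>).
       act \<alpha> (\<beta> \<otimes> \<gamma>) m (\<mu> \<beta> \<gamma> r s) = act (\<alpha> \<otimes> \<beta>) \<gamma> (act \<alpha> \<beta> m r) s) \<and>
    (\<forall>\<alpha>\<in>carrier G. \<forall>m\<in>carrier (N \<alpha>). act \<alpha> \<one> m u = m)"

lemma component_moduleD: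
  assumes "component_module N act"
  shows "N \<in> extensional (carrier G)" "\<alpha> \<Colon> G \<Longrightarrow> plain_abelian_group (N \<alpha>)" "graded_pairing G N C N act"
    and "\<lbrakk>\<alpha> \<Colon> G; \<beta> \<Colon> G; \<gamma> \<Colon> G; m \<Colon> N \<alpha>; r \<Colon> C \<beta>; s \<Colon> C \<gamma>\<rbrakk> \<Longrightarrow>
       act \<alpha> (\<beta> \<otimes> \<gamma>) m (\<mu> \<beta> \<gamma> r s) = act (\<alpha> \<otimes> \<beta>) \<gamma> (act \<alpha> \<beta> m r) s"
    and "\<lbrakk>\<alpha> \<Colon> G; m \<Colon> N \<alpha>\<rbrakk> \<Longrightarrow> act \<alpha> \<one> m u = m"
  using assms by (auto simp: component_module_def)

lemma plain_group: "plain_abelian_group M \<Longrightarrow> abelian_group M"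
  by (simp add: plain_abelian_group_def)

lemma graded_module_of_components:
  assumes N: "component_module N act"
  shows "\<lparr>gm_group = N, gm_act = total_action N act\<rparr> \<in> graded_modules G R" (is "?M \<in> _")
proof -
  note cm = component_moduleD[OF N]
  interpret N: graded_pairing G N C N act by (rule cm)
  interpret R: ring R by (rule ring_R)
  let ?D = "direct_sum G N"
  have act: "total_action N act m r = N.gprod m r" if "m \<Colon> ?D" "r \<Colon> DC" for m r
    using that by (simp add: total_action_def graded_ring_simps)
  have assoc: "N.gprod m (gprod r s) = N.gprod (N.gprod m r) s"
    if m: "m \<Colon> ?D" and r: "r \<Colon> DC" and s: "s \<Colon> DC" for m r s
    using m
  proof (induction m rule: N.L.direct_sum_induct)
    case (add f f')
    then show ?case using r s by (simp add: N.graded_product_add_left N.graded_product_closed graded_product_closed)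
  next
    case i: (incl \<alpha> x)
    note ix = N.L.inclusion_closed[OF i]
    show ?case using r
    proof (induction r rule: L.direct_sum_induct)
      case (add f f')
      then show ?case using s ix
        by (simp add: N.graded_product_add_left N.graded_product_add_right N.graded_product_closed
            graded_product_add_left graded_product_closed)
    next
      case j: (incl \<beta> y)
      note iy = L.inclusion_closed[OF j]
      show ?case using s
      proof (induction s rule: L.direct_sum_induct)
        case (add f f')
        then show ?case using ix iy
          by (simp add: N.graded_product_add_right N.graded_product_closed graded_product_add_right graded_product_closed)
      next
        case (incl \<gamma> z)
        then show ?case using i j
          by (simp add: graded_product_inclusion N.graded_product_inclusion pairing_closed N.pairing_closed cm(4) L.m_assoc)
      qed
    qed
  qed
  have unit: "N.gprod m (inclusion G C \<one> u) = m" if m: "m \<Colon> ?D" for m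
    using m by (induction m rule: N.L.direct_sum_induct)
      (simp_all add: N.graded_product_add_left N.graded_product_inclusion unit_closed L.inclusion_closed cm(5))
  have mod: "right_module R ?D (total_action N act)"
    by (intro right_module.intro right_module_axioms.intro R.ring_axioms N.L.direct_sum_abelian_group)
      (simp_all add: graded_ring_simps act N.graded_product_closed N.graded_product_add_left N.graded_product_add_right
        graded_product_closed assoc unit L.inclusion_closed unit_closed)
  have hom: "total_action N act m r \<in> homogeneous G N (\<alpha> \<otimes> \<beta>)"
    if a: "\<alpha> \<Colon> G" "\<beta> \<Colon> G" and m: "m \<in> homogeneous G N \<alpha>" and r: "r \<in> homogeneous G C \<beta>" for \<alpha> \<beta> m r
  proof -
    have c: "m \<alpha> \<Colon> N \<alpha>" "r \<beta> \<Colon> C \<beta>"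
      using m r a by (auto simp: homogeneous_def intro: N.L.sum_value L.sum_value)
    have "total_action N act m r = N.gprod m r" by (intro act N.L.homogeneous_closed[OF m] L.homogeneous_closed[OF r])
    also have "\<dots> = inclusion G N (\<alpha> \<otimes> \<beta>) (act \<alpha> \<beta> (m \<alpha>) (r \<beta>))"
      by (subst N.L.homogeneous_eq_inclusion[OF a(1) m], subst L.homogeneous_eq_inclusion[OF a(2) r])
        (rule N.graded_product_inclusion[OF a c])
    finally show ?thesis using a by (simp add: N.L.inclusion_homogeneous N.pairing_closed c)
  qed
  have ext: "extensional2 (carrier ?D) (carrier R) (total_action N act)"
    by (simp add: extensional2_def total_action_def)
  show ?thesis
    unfolding graded_modules_def using cm(1,2) ext mod hom by (simp add: graded_ring_simps)
qed

lemma component_action_total: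
  assumes N: "component_module N act" and "\<alpha> \<Colon> G" "\<beta> \<Colon> G" "m \<Colon> N \<alpha>" "r \<Colon> C \<beta>"
  shows "component_action \<lparr>gm_group = N, gm_act = total_action N act\<rparr> \<alpha> \<beta> m r = act \<alpha> \<beta> m r"
proof -
  interpret N: graded_pairing G N C N act by (rule component_moduleD[OF N])
  show ?thesis
    using assms by (simp add: component_action_def total_action_def graded_ring_simps N.L.inclusion_closed L.inclusion_closed
        N.graded_product_inclusion N.L.inclusion_value)
qed

lemma graded_modulesD:
  assumes "M \<in> graded_modules G R"
  shows "gm_group M \<in> extensional (carrier G)"
    and "\<alpha> \<Colon> G \<Longrightarrow> plain_abelian_group (gm_group M \<alpha>)"
    and "extensional2 (carrier (direct_sum G (gm_group M))) (carrier R) (gm_act M)"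
    and "right_module R (direct_sum G (gm_group M)) (gm_act M)"
    and "\<lbrakk>\<alpha> \<Colon> G; \<beta> \<Colon> G; m \<in> homogeneous G (gm_group M) \<alpha>; r \<in> homogeneous G C \<beta>\<rbrakk> \<Longrightarrow>
           gm_act M m r \<in> homogeneous G (gm_group M) (\<alpha> \<otimes>\<^bsub>G\<^esub> \<beta>)"
  using assms by (auto simp: graded_modules_def graded_ring_simps)

text \<open>Homogeneity places the product of homogeneous elements in one component, and additivity recovers the
  whole action.\<close>

lemma component_module_of_graded:
  assumes M: "M \<in> graded_modules G R"
  shows "component_module (gm_group M) (component_action M)"
    and "\<lbrakk>\<alpha> \<Colon> G; \<beta> \<Colon> G; m \<Colon> gm_group M \<alpha>; r \<Colon> C \<beta>\<rbrakk> \<Longrightarrow>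
       gm_act M (inclusion G (gm_group M) \<alpha> m) (inclusion G C \<beta> r) =
       inclusion G (gm_group M) (\<alpha> \<otimes> \<beta>) (component_action M \<alpha> \<beta> m r)"
    and "gm_act M = total_action (gm_group M) (component_action M)"
proof -
  let ?N = "gm_group M" let ?D = "direct_sum G ?N"
  note gm = graded_modulesD[OF M]
  interpret N: direct_sum_of_groups G ?N
    by (intro direct_sum_of_groups.intro direct_sum_of_groups_axioms.intro L.is_group plain_group gm)
  interpret M: right_module R ?D "gm_act M" by (rule gm)
  have act: "gm_act M (inclusion G ?N \<alpha> m) (inclusion G C \<beta> r) = inclusion G ?N (\<alpha> \<otimes> \<beta>) (component_action M \<alpha> \<beta> m r)"
    if a: "\<alpha> \<Colon> G" "\<beta> \<Colon> G" and m: "m \<Colon> ?N \<alpha>" and r: "r \<Colon> C \<beta>" for \<alpha> \<beta> m r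
    unfolding component_action_def
    by (rule N.homogeneous_eq_inclusion) (simp_all add: a gm(5)[OF a] N.inclusion_homogeneous L.inclusion_homogeneous m r)
  then show "gm_act M (inclusion G ?N \<alpha> m) (inclusion G C \<beta> r) = inclusion G ?N (\<alpha> \<otimes> \<beta>) (component_action M \<alpha> \<beta> m r)"
    if a: "\<alpha> \<Colon> G" "\<beta> \<Colon> G" and m: "m \<Colon> ?N \<alpha>" and r: "r \<Colon> C \<beta>"
    using that .
  note inc = N.inclusion_closed L.inclusion_closed
  have cl: "component_action M \<alpha> \<beta> m r \<Colon> ?N (\<alpha> \<otimes> \<beta>)"
    if a: "\<alpha> \<Colon> G" "\<beta> \<Colon> G" and m: "m \<Colon> ?N \<alpha>" and r: "r \<Colon> C \<beta>" for \<alpha> \<beta> m r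
    unfolding component_action_def
    by (rule N.sum_value[OF M.act_closed]) (simp_all add: inc a m r graded_ring_simps)
  have inj: "x = y" if "inclusion G ?N \<alpha> x = inclusion G ?N \<alpha> y" "\<alpha> \<Colon> G" for \<alpha> x y
    using fun_cong[OF that(1), of \<alpha>] that(2) by (simp add: N.inclusion_value)
  interpret P: graded_pairing G ?N C ?N "component_action M"
  proof (intro graded_pairing.intro graded_pairing_axioms.intro N.direct_sum_of_groups_axioms L.direct_sum_of_groups_axioms cl)
    fix \<alpha> \<beta> x y assume ab: "\<alpha> \<Colon> G" "\<beta> \<Colon> G" and x: "x \<Colon> ?N \<alpha>" and y: "y \<Colon> C \<beta>"
    have abc: "\<alpha> \<otimes> \<beta> \<Colon> G" using ab by simp
    show "component_action M \<alpha> \<beta> (x \<oplus>\<^bsub>?N \<alpha>\<^esub> x') y = component_action M \<alpha> \<beta> x y \<oplus>\<^bsub>?N (\<alpha> \<otimes> \<beta>)\<^esub> component_action M \<alpha> \<beta> x' y"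
      if x': "x' \<Colon> ?N \<alpha>" for x'
      using M.act_add_left[OF N.inclusion_closed[OF ab(1) x] N.inclusion_closed[OF ab(1) x'], of "inclusion G C \<beta> y"]
      by (intro inj[OF _ abc]) (simp add: N.inclusion_add cl abc ab x x' y inc graded_ring_simps act[symmetric] N.component_ops)
    show "component_action M \<alpha> \<beta> x (y \<oplus>\<^bsub>C \<beta>\<^esub> y') = component_action M \<alpha> \<beta> x y \<oplus>\<^bsub>?N (\<alpha> \<otimes> \<beta>)\<^esub> component_action M \<alpha> \<beta> x y'"
      if y': "y' \<Colon> C \<beta>" for y'
      using M.act_add_right[OF N.inclusion_closed[OF ab(1) x], of "inclusion G C \<beta> y" "inclusion G C \<beta> y'"]
      by (intro inj[OF _ abc]) (simp add: N.inclusion_add L.inclusion_add cl abc ab x y' y inc graded_ring_simps act[symmetric] L.component_ops)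
  qed
  show "component_module ?N (component_action M)"
    unfolding component_module_def
  proof (intro conjI ballI gm P.graded_pairing_axioms)
    fix \<alpha> \<beta> \<gamma> m r s assume a: "\<alpha> \<Colon> G" "\<beta> \<Colon> G" "\<gamma> \<Colon> G"
      and m: "m \<Colon> ?N \<alpha>" and r: "r \<Colon> C \<beta>" and s: "s \<Colon> C \<gamma>"
    have g: "\<alpha> \<otimes> (\<beta> \<otimes> \<gamma>) \<Colon> G" "\<alpha> \<otimes> \<beta> \<Colon> G" "\<beta> \<otimes> \<gamma> \<Colon> G" using a by simp_all
    have "inclusion G ?N (\<alpha> \<otimes> (\<beta> \<otimes> \<gamma>)) (component_action M \<alpha> (\<beta> \<otimes> \<gamma>) m (\<mu> \<beta> \<gamma> r s)) =
      gm_act M (inclusion G ?N \<alpha> m) (inclusion G C (\<beta> \<otimes> \<gamma>) (\<mu> \<beta> \<gamma> r s))"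
      by (rule act[symmetric]) (simp_all add: a m r s pairing_closed)
    also have "\<dots> = gm_act M (gm_act M (inclusion G ?N \<alpha> m) (inclusion G C \<beta> r)) (inclusion G C \<gamma> s)"
      using M.act_mult[OF N.inclusion_closed[OF a(1) m], of "inclusion G C \<beta> r" "inclusion G C \<gamma> s"]
      by (simp add: graded_ring_simps inc a r s graded_product_inclusion)
    also have "\<dots> = inclusion G ?N (\<alpha> \<otimes> \<beta> \<otimes> \<gamma>) (component_action M (\<alpha> \<otimes> \<beta>) \<gamma> (component_action M \<alpha> \<beta> m r) s)"
      by (simp add: act a g m r s cl)
    finally show "component_action M \<alpha> (\<beta> \<otimes> \<gamma>) m (\<mu> \<beta> \<gamma> r s) = component_action M (\<alpha> \<otimes> \<beta>) \<gamma> (component_action M \<alpha> \<beta> m r) s"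
      using a by (intro inj[OF _ g(1)]) (simp add: L.m_assoc)
  next
    fix \<alpha> m assume a: "\<alpha> \<Colon> G" and m: "m \<Colon> ?N \<alpha>"
    show "component_action M \<alpha> \<one> m u = m"
      using M.act_one[OF N.inclusion_closed[OF a m]] act[OF a L.one_closed m unit_closed] a
      by (intro inj[OF _ a]) (simp add: graded_ring_simps)
  qed
  have prod: "gm_act M m r = P.gprod m r" if m: "m \<Colon> ?D" and r: "r \<Colon> DC" for m r
    using m
  proof (induction m rule: N.direct_sum_induct)
    case (add f f')
    then show ?case using r by (simp add: P.graded_product_add_left M.act_add_left graded_ring_simps)
  next
    case i: (incl \<alpha> x)
    note ix = N.inclusion_closed[OF i]
    show ?case using r
    proof (induction r rule: L.direct_sum_induct)
      case (add f f')
      then show ?case using M.act_add_right[OF ix, of f f'] ix by (simp add: P.graded_product_add_right graded_ring_simps)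
    next
      case (incl \<beta> y)
      then show ?case using i by (simp add: P.graded_product_inclusion act)
    qed
  qed
  show "gm_act M = total_action ?N (component_action M)"
    by (intro ext) (use gm(3) in \<open>auto simp: total_action_def graded_ring_simps prod extensional2_def\<close>)
qed

text \<open>Morphisms of graded modules are families of additive maps of the components.\<close>

definition sum_map where
  "sum_map N f = (\<lambda>m\<in>carrier (direct_sum G N). \<lambda>\<alpha>\<in>carrier G. f \<alpha> (m \<alpha>))"

definition component_map where
  "component_map N f = (\<lambda>\<alpha>\<in>carrier G. \<lambda>m\<in>carrier (N \<alpha>). f (inclusion G N \<alpha> m) \<alpha>)"

definition component_homs where
  "component_homs N act N' act' = {f \<in> (\<Pi>\<^sub>E \<alpha>\<in>carrier G. carrier (N \<alpha>) \<rightarrow>\<^sub>E carrier (N' \<alpha>)).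
     (\<forall>\<alpha>\<in>carrier G. \<forall>x\<in>carrier (N \<alpha>). \<forall>y\<in>carrier (N \<alpha>). f \<alpha> (x \<oplus>\<^bsub>N \<alpha>\<^esub> y) = f \<alpha> x \<oplus>\<^bsub>N' \<alpha>\<^esub> f \<alpha> y) \<and>
     (\<forall>\<alpha>\<in>carrier G. \<forall>\<beta>\<in>carrier G. \<forall>m\<in>carrier (N \<alpha>). \<forall>r\<in>carrier (C \<beta>).
        f (\<alpha> \<otimes> \<beta>) (act \<alpha> \<beta> m r) = act' \<alpha> \<beta> (f \<alpha> m) r)}"

lemma component_homsD:
  assumes "f \<in> component_homs N act N' act'" "\<alpha> \<Colon> G"
  shows "x \<Colon> N \<alpha> \<Longrightarrow> f \<alpha> x \<Colon> N' \<alpha>"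
    and "\<lbrakk>x \<Colon> N \<alpha>; y \<Colon> N \<alpha>\<rbrakk> \<Longrightarrow> f \<alpha> (x \<oplus>\<^bsub>N \<alpha>\<^esub> y) = f \<alpha> x \<oplus>\<^bsub>N' \<alpha>\<^esub> f \<alpha> y"
    and "\<lbrakk>\<beta> \<Colon> G; x \<Colon> N \<alpha>; r \<Colon> C \<beta>\<rbrakk> \<Longrightarrow> f (\<alpha> \<otimes> \<beta>) (act \<alpha> \<beta> x r) = act' \<alpha> \<beta> (f \<alpha> x) r"
  using assms by (auto simp: component_homs_def PiE_iff)

lemma graded_hom_iff:
  "f \<in> Hom (graded_module_category G R) M M' \<longleftrightarrow>
    f \<in> right_linear_maps R (direct_sum G (gm_group M)) (gm_act M) (direct_sum G (gm_group M')) (gm_act M') \<and>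
    (\<forall>\<alpha>\<in>carrier G. f ` homogeneous G (gm_group M) \<alpha> \<subseteq> homogeneous G (gm_group M') \<alpha>)"
  by (simp add: graded_module_category_def Let_def)

lemma sum_map_hom:
  assumes N: "component_module N act" and N': "component_module N' act'"
    and f: "f \<in> component_homs N act N' act'"
  shows "sum_map N f \<in> Hom (graded_module_category G R)
    \<lparr>gm_group = N, gm_act = total_action N act\<rparr> \<lparr>gm_group = N', gm_act = total_action N' act'\<rparr>"
    and "\<lbrakk>\<alpha> \<Colon> G; x \<Colon> N \<alpha>\<rbrakk> \<Longrightarrow> sum_map N f (inclusion G N \<alpha> x) = inclusion G N' \<alpha> (f \<alpha> x)"
proof -
  note cm = component_moduleD[OF N] and cm' = component_moduleD[OF N'] and fD = component_homsD[OF f]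
  interpret N: graded_pairing G N C N act by (rule cm)
  interpret N': graded_pairing G N' C N' act' by (rule cm')
  let ?D = "direct_sum G N" let ?D' = "direct_sum G N'"
  have f0: "f \<alpha> \<zero>\<^bsub>N \<alpha>\<^esub> = \<zero>\<^bsub>N' \<alpha>\<^esub>" if a: "\<alpha> \<Colon> G" for \<alpha>
  proof -
    interpret Na: abelian_group "N \<alpha>" by (rule N.L.component_group[OF a])
    interpret Na': abelian_group "N' \<alpha>" by (rule N'.L.component_group[OF a])
    show ?thesis using fD(2)[OF a Na.zero_closed Na.zero_closed] fD(1)[OF a Na.zero_closed] by simp
  qed
  have val: "sum_map N f m \<alpha> = f \<alpha> (m \<alpha>)" if "m \<Colon> ?D" "\<alpha> \<Colon> G" for m \<alpha>
    using that by (simp add: sum_map_def)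
  have cl: "sum_map N f m \<Colon> ?D'" if m: "m \<Colon> ?D" for m
    by (rule N'.L.direct_sum_memI[OF N.L.direct_sum_support[OF m]])
      (use m in \<open>auto simp: val f0 fD N.L.sum_value sum_map_def\<close>)
  have add: "sum_map N f (m \<oplus>\<^bsub>?D\<^esub> m') = sum_map N f m \<oplus>\<^bsub>?D'\<^esub> sum_map N f m'"
    if m: "m \<Colon> ?D" "m' \<Colon> ?D" for m m'
    by (rule N'.L.direct_sum_eqI)
      (simp_all add: cl m N.L.D.a_closed N'.L.D.a_closed val, simp add: m N.L.direct_sum_simps N'.L.direct_sum_simps val fD N.L.sum_value)
  show inc: "sum_map N f (inclusion G N \<alpha> x) = inclusion G N' \<alpha> (f \<alpha> x)"
    if "\<alpha> \<Colon> G" "x \<Colon> N \<alpha>" for \<alpha> x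
    by (rule N'.L.direct_sum_eqI[OF cl N'.L.inclusion_closed])
      (simp_all add: that N.L.inclusion_closed fD(1) val N.L.inclusion_value N'.L.inclusion_value f0)
  have prod: "sum_map N f (N.gprod m r) = N'.gprod (sum_map N f m) r" if m: "m \<Colon> ?D" and r: "r \<Colon> DC" for m r
    using m
  proof (induction m rule: N.L.direct_sum_induct)
    case (add x x')
    then show ?case using r
      by (simp add: N.graded_product_add_left N'.graded_product_add_left \<open>\<And>m m'. _ \<Longrightarrow> _ \<Longrightarrow> sum_map N f (m \<oplus>\<^bsub>?D\<^esub> m') = _\<close> N.graded_product_closed cl)
  next
    case i: (incl \<alpha> x)
    note ix = N.L.inclusion_closed[OF i]
    show ?case using r
    proof (induction r rule: L.direct_sum_induct)
      case (add r r')
      then show ?case using ix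
        by (simp add: N.graded_product_add_right N'.graded_product_add_right \<open>\<And>m m'. _ \<Longrightarrow> _ \<Longrightarrow> sum_map N f (m \<oplus>\<^bsub>?D\<^esub> m') = _\<close> N.graded_product_closed cl)
    next
      case (incl \<beta> y)
      then show ?case using i
        by (simp add: N.graded_product_inclusion N'.graded_product_inclusion inc N.pairing_closed fD)
    qed
  qed
  show "sum_map N f \<in> Hom (graded_module_category G R)
    \<lparr>gm_group = N, gm_act = total_action N act\<rparr> \<lparr>gm_group = N', gm_act = total_action N' act'\<rparr>"
    unfolding graded_hom_iff right_linear_maps_def graded_module.simps
  proof (intro conjI CollectI ballI PiE_I subsetI)
    fix m assume m: "m \<Colon> ?D"
    show "sum_map N f m \<Colon> ?D'" by (rule cl[OF m])
    show "sum_map N f (m \<oplus>\<^bsub>?D\<^esub> m') = sum_map N f m \<oplus>\<^bsub>?D'\<^esub> sum_map N f m'" if "m' \<Colon> ?D" for m'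
      by (rule add[OF m that])
    show "sum_map N f (total_action N act m r) = total_action N' act' (sum_map N f m) r" if "r \<Colon> R" for r
      using m that cl[OF m] prod by (simp add: total_action_def graded_ring_simps)
  next
    show "sum_map N f m = undefined" if "m \<notin> carrier ?D" for m using that by (simp add: sum_map_def)
  next
    fix \<alpha> m' assume a: "\<alpha> \<Colon> G" and "m' \<in> sum_map N f ` homogeneous G N \<alpha>"
    then obtain m where m: "m \<in> homogeneous G N \<alpha>" "m' = sum_map N f m" by auto
    then show "m' \<in> homogeneous G N' \<alpha>"
      using cl[of m] by (simp add: homogeneous_def val f0)
  qed
qed

lemma component_map_hom:
  assumes M: "M \<in> graded_modules G R" and M': "M' \<in> graded_modules G R"
    and f: "f \<in> Hom (graded_module_category G R) M M'"
  shows "component_map (gm_group M) f \<in> component_homs (gm_group M) (component_action M) (gm_group M') (component_action M')"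
    and "sum_map (gm_group M) (component_map (gm_group M) f) = f"
proof -
  let ?N = "gm_group M" let ?N' = "gm_group M'"
  let ?D = "direct_sum G ?N" let ?D' = "direct_sum G ?N'"
  note c = component_module_of_graded[OF M] and c' = component_module_of_graded[OF M']
  interpret N: graded_pairing G ?N C ?N "component_action M" by (rule component_moduleD(3)[OF c(1)])
  interpret N': graded_pairing G ?N' C ?N' "component_action M'" by (rule component_moduleD(3)[OF c'(1)])
  note f = f[unfolded graded_hom_iff right_linear_maps_def]
  have fD: "m \<Colon> ?D \<Longrightarrow> f m \<Colon> ?D'"
    "\<lbrakk>m \<Colon> ?D; m' \<Colon> ?D\<rbrakk> \<Longrightarrow> f (m \<oplus>\<^bsub>?D\<^esub> m') = f m \<oplus>\<^bsub>?D'\<^esub> f m'"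
    "\<lbrakk>m \<Colon> ?D; r \<Colon> DC\<rbrakk> \<Longrightarrow> f (gm_act M m r) = gm_act M' (f m) r"
    "\<alpha> \<Colon> G \<Longrightarrow> m \<in> homogeneous G ?N \<alpha> \<Longrightarrow> f m \<in> homogeneous G ?N' \<alpha>" "f \<in> extensional (carrier ?D)"
    for m m' r \<alpha>
    using f by (auto simp: graded_ring_simps PiE_iff image_subset_iff)
  let ?g = "component_map ?N f"
  have gv: "?g \<alpha> m = f (inclusion G ?N \<alpha> m) \<alpha>" if "\<alpha> \<Colon> G" "m \<Colon> ?N \<alpha>" for \<alpha> m
    using that by (simp add: component_map_def)
  have fi: "f (inclusion G ?N \<alpha> m) = inclusion G ?N' \<alpha> (?g \<alpha> m)" if "\<alpha> \<Colon> G" "m \<Colon> ?N \<alpha>" for \<alpha> m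
    using N'.L.homogeneous_eq_inclusion[OF that(1) fD(4)[OF that(1) N.L.inclusion_homogeneous[OF that]]] that by (simp add: gv)
  have gc: "?g \<alpha> m \<Colon> ?N' \<alpha>" if "\<alpha> \<Colon> G" "m \<Colon> ?N \<alpha>" for \<alpha> m
    unfolding gv[OF that] by (intro N'.L.sum_value fD(1) N.L.inclusion_closed that)
  show g: "?g \<in> component_homs ?N (component_action M) ?N' (component_action M')"
    unfolding component_homs_def
  proof (intro CollectI conjI PiE_I ballI)
    fix \<alpha> assume a: "\<alpha> \<Colon> G"
    fix x assume x: "x \<Colon> ?N \<alpha>"
    show "?g \<alpha> x \<Colon> ?N' \<alpha>" by (rule gc[OF a x])
    show "?g \<alpha> (x \<oplus>\<^bsub>?N \<alpha>\<^esub> y) = ?g \<alpha> x \<oplus>\<^bsub>?N' \<alpha>\<^esub> ?g \<alpha> y" if y: "y \<Colon> ?N \<alpha>" for y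
      using fD(2)[OF N.L.inclusion_closed[OF a x] N.L.inclusion_closed[OF a y]]
      by (simp add: gv a x y N.L.component_ops N.L.inclusion_add N'.L.direct_sum_simps)
    fix \<beta> r assume b: "\<beta> \<Colon> G" and r: "r \<Colon> C \<beta>"
    have "?g (\<alpha> \<otimes> \<beta>) (component_action M \<alpha> \<beta> x r) = f (gm_act M (inclusion G ?N \<alpha> x) (inclusion G C \<beta> r)) (\<alpha> \<otimes> \<beta>)" (is "?l = _")
      using a b by (simp add: gv N.pairing_closed x r c(2))
    also have "\<dots> = gm_act M' (f (inclusion G ?N \<alpha> x)) (inclusion G C \<beta> r) (\<alpha> \<otimes> \<beta>)"
      by (simp add: fD(3) N.L.inclusion_closed L.inclusion_closed a b x r)
    also have "\<dots> = component_action M' \<alpha> \<beta> (?g \<alpha> x) r"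
      using a b by (simp add: fi x c'(2) gc r N'.L.inclusion_value)
    finally show "?l = \<dots>" .
  qed (simp_all add: component_map_def)
  note s = sum_map_hom[OF c(1) c'(1) g]
  have M2: "\<lparr>gm_group = ?N, gm_act = total_action ?N (component_action M)\<rparr> = M"
    "\<lparr>gm_group = ?N', gm_act = total_action ?N' (component_action M')\<rparr> = M'"
    using c(3) c'(3) by simp_all
  note s1 = s(1)[unfolded M2 graded_hom_iff right_linear_maps_def]
  have sD: "m \<Colon> ?D \<Longrightarrow> sum_map ?N ?g m \<Colon> ?D'" "sum_map ?N ?g \<in> extensional (carrier ?D)"
    "\<lbrakk>m \<Colon> ?D; m' \<Colon> ?D\<rbrakk> \<Longrightarrow> sum_map ?N ?g (m \<oplus>\<^bsub>?D\<^esub> m') = sum_map ?N ?g m \<oplus>\<^bsub>?D'\<^esub> sum_map ?N ?g m'" for m m'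
    using s1 by (auto simp: PiE_iff)
  show "sum_map ?N ?g = f"
  proof (rule extensionalityI[OF sD(2) fD(5)])
    fix m assume "m \<Colon> ?D"
    then show "sum_map ?N ?g m = f m"
      by (induction m rule: N.L.direct_sum_induct) (simp_all add: s(2) fi sD fD)
  qed
qed

lemma component_map_sum_map:
  fixes N N' :: "'g \<Rightarrow> 'm ring"
  assumes N: "component_module N act" and N': "component_module N' act'"
    and f: "f \<in> component_homs N act N' act'"
  shows "component_map N (sum_map N f) = f"
proof -
  interpret N: graded_pairing G N C N act by (rule component_moduleD[OF N])
  interpret N': graded_pairing G N' C N' act' by (rule component_moduleD[OF N'])
  have ext: "f \<in> extensional (carrier G)" "\<alpha> \<Colon> G \<Longrightarrow> f \<alpha> \<in> extensional (carrier (N \<alpha>))" for \<alpha>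
    using f by (auto simp: component_homs_def PiE_iff)
  show ?thesis
  proof (rule extensionalityI[OF _ ext(1)])
    fix \<alpha> assume a: "\<alpha> \<Colon> G"
    show "component_map N (sum_map N f) \<alpha> = f \<alpha>"
      by (rule extensionalityI[OF _ ext(2)[OF a]])
        (simp_all add: component_map_def a sum_map_hom(2)[OF N N' f] N'.L.inclusion_value)
  qed (simp add: component_map_def)
qed

lemma total_action_cong:
  fixes N :: "'g \<Rightarrow> 'm ring"
  assumes N: "component_module N act" and N': "component_module N act'"
    and eq: "\<And>\<alpha> \<beta> m r. \<lbrakk>\<alpha> \<Colon> G; \<beta> \<Colon> G; m \<Colon> N \<alpha>; r \<Colon> C \<beta>\<rbrakk> \<Longrightarrow> act' \<alpha> \<beta> m r = act \<alpha> \<beta> m r"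
  shows "total_action N act' = total_action N act"
proof -
  interpret N: graded_pairing G N C N act by (rule component_moduleD(3)[OF N])
  interpret N': graded_pairing G N C N act' by (rule component_moduleD(3)[OF N'])
  have "N'.gprod m r = N.gprod m r" if m: "m \<Colon> direct_sum G N" and r: "r \<Colon> DC" for m r
    using m
  proof (induction m rule: N.L.direct_sum_induct)
    case (add f f')
    then show ?case using r by (simp add: N.graded_product_add_left N'.graded_product_add_left)
  next
    case i: (incl \<alpha> x)
    note ix = N.L.inclusion_closed[OF i]
    show ?case using r
    proof (induction r rule: L.direct_sum_induct)
      case (add f f')
      then show ?case using ix by (simp add: N.graded_product_add_right N'.graded_product_add_right)
    next
      case (incl \<beta> y)
      then show ?case using i by (simp add: N.graded_product_inclusion N'.graded_product_inclusion eq)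
    qed
  qed
  then show ?thesis by (intro ext) (simp add: total_action_def graded_ring_simps)
qed

lemma component_homs_cong:
  assumes eq: "\<And>\<alpha> \<beta> m r. \<lbrakk>\<alpha> \<Colon> G; \<beta> \<Colon> G; m \<Colon> N \<alpha>; r \<Colon> C \<beta>\<rbrakk> \<Longrightarrow> act \<alpha> \<beta> m r = bct \<alpha> \<beta> m r"
    and eq': "\<And>\<alpha> \<beta> m r. \<lbrakk>\<alpha> \<Colon> G; \<beta> \<Colon> G; m \<Colon> N' \<alpha>; r \<Colon> C \<beta>\<rbrakk> \<Longrightarrow> act' \<alpha> \<beta> m r = bct' \<alpha> \<beta> m r"
    and f: "f \<in> component_homs N act N' act'"
  shows "f \<in> component_homs N bct N' bct'"
  using f unfolding component_homs_def
  by (elim CollectE conjE, intro CollectI conjI ballI) (simp_all add: eq[symmetric] eq'[symmetric] PiE_iff)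

lemma sum_map_compose:
  fixes L M N :: "'g \<Rightarrow> 'm ring"
  assumes "component_module L act" "component_module M act'" "component_module N act''"
    and f: "f \<in> component_homs L act M act'" and g: "g \<in> component_homs M act' N act''"
  shows "sum_map L (\<lambda>\<alpha>\<in>carrier G. compose (carrier (L \<alpha>)) (g \<alpha>) (f \<alpha>)) = compose (carrier (direct_sum G L)) (sum_map M g) (sum_map L f)"
proof -
  interpret L: graded_pairing G L C L act by (rule component_moduleD(3)[OF assms(1)])
  have f': "sum_map L f m \<Colon> direct_sum G M" if "m \<Colon> direct_sum G L" for m
    using sum_map_hom(1)[OF assms(1,2) f] that unfolding graded_hom_iff right_linear_maps_def by (auto simp: PiE_iff)
  show ?thesis
    unfolding compose_def sum_map_def[of L "\<lambda>\<alpha>\<in>carrier G. _ \<alpha>"]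
    by (rule restrict_ext) (simp add: sum_map_def[of M] f', intro restrict_ext, simp add: sum_map_def L.L.sum_value)
qed

lemma sum_map_identity:
  fixes L :: "'g \<Rightarrow> 'm ring"
  assumes "component_module L act"
  shows "sum_map L (\<lambda>\<alpha>\<in>carrier G. \<lambda>m\<in>carrier (L \<alpha>). m) = (\<lambda>m\<in>carrier (direct_sum G L). m)"
proof -
  interpret L: graded_pairing G L C L act by (rule component_moduleD(3)[OF assms])
  show ?thesis
    unfolding sum_map_def
  proof (rule restrict_ext)
    fix m assume m: "m \<Colon> direct_sum G L"
    then have "m \<in> extensional (carrier G)" by (simp add: L.L.direct_sum_carrier PiE_iff)
    then show "(\<lambda>\<alpha>\<in>carrier G. (\<lambda>\<alpha>\<in>carrier G. \<lambda>m\<in>carrier (L \<alpha>). m) \<alpha> (m \<alpha>)) = m"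
      by (intro extensionalityI[of _ "carrier G"]) (simp_all add: L.L.sum_value[OF m])
  qed
qed

end

section \<open>Isomorphisms of categories\<close>

text \<open>The inverse of a bijective functor is functorial, so only one direction has to preserve identities and
  composition.\<close>

lemma isomorphic_categoriesI:
  assumes C: "category C" and D: "category D"
    and F: "\<And>X. X \<in> Obj C \<Longrightarrow> F X \<in> Obj D" and E: "\<And>Y. Y \<in> Obj D \<Longrightarrow> E Y \<in> Obj C"
    and EF: "\<And>X. X \<in> Obj C \<Longrightarrow> E (F X) = X" and FE: "\<And>Y. Y \<in> Obj D \<Longrightarrow> F (E Y) = Y"
    and F1: "\<And>X X' f. \<lbrakk>X \<in> Obj C; X' \<in> Obj C; f \<in> Hom C X X'\<rbrakk> \<Longrightarrow> F\<^sub>1 X X' f \<in> Hom D (F X) (F X')"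
    and E1: "\<And>Y Y' g. \<lbrakk>Y \<in> Obj D; Y' \<in> Obj D; g \<in> Hom D Y Y'\<rbrakk> \<Longrightarrow> E\<^sub>1 Y Y' g \<in> Hom C (E Y) (E Y')"
    and E1F1: "\<And>X X' f. \<lbrakk>X \<in> Obj C; X' \<in> Obj C; f \<in> Hom C X X'\<rbrakk> \<Longrightarrow> E\<^sub>1 (F X) (F X') (F\<^sub>1 X X' f) = f"
    and F1E1: "\<And>Y Y' g. \<lbrakk>Y \<in> Obj D; Y' \<in> Obj D; g \<in> Hom D Y Y'\<rbrakk> \<Longrightarrow> F\<^sub>1 (E Y) (E Y') (E\<^sub>1 Y Y' g) = g"
    and id: "\<And>X. X \<in> Obj C \<Longrightarrow> F\<^sub>1 X X (Ident C X) = Ident D (F X)"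
    and comp: "\<And>X Y Z f g. \<lbrakk>X \<in> Obj C; Y \<in> Obj C; Z \<in> Obj C; f \<in> Hom C X Y; g \<in> Hom C Y Z\<rbrakk>
      \<Longrightarrow> F\<^sub>1 X Z (Comp C X Y Z g f) = Comp D (F X) (F Y) (F Z) (F\<^sub>1 Y Z g) (F\<^sub>1 X Y f)"
  shows "isomorphic_categories C D"
proof -
  interpret C: category C by (rule C)
  interpret D: category D by (rule D)
  have "covariant_functor C D F F\<^sub>1"
    by (intro covariant_functor.intro covariant_functor_axioms.intro C D F F1 id comp)
  moreover have "covariant_functor D C E E\<^sub>1"
  proof (intro covariant_functor.intro covariant_functor_axioms.intro C D E E1)
    show "E\<^sub>1 Y Y (Ident D Y) = Ident C (E Y)" if "Y \<in> Obj D" for Y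
      using E1F1[OF E[OF that] E[OF that] C.Ident_closed[OF E[OF that]]] by (simp add: id E FE that)
  next
    fix X Y Z f g assume o: "X \<in> Obj D" "Y \<in> Obj D" "Z \<in> Obj D" and f: "f \<in> Hom D X Y" and g: "g \<in> Hom D Y Z"
    note eo = E[OF o(1)] E[OF o(2)] E[OF o(3)] and ef = E1[OF o(1,2) f] and eg = E1[OF o(2,3) g]
    show "E\<^sub>1 X Z (Comp D X Y Z g f) = Comp C (E X) (E Y) (E Z) (E\<^sub>1 Y Z g) (E\<^sub>1 X Y f)"
      using E1F1[OF eo(1,3) C.Comp_closed[OF eo ef eg]]
      by (simp add: comp[OF eo ef eg] FE o F1E1[OF o(1,2) f] F1E1[OF o(2,3) g])
  qed
  ultimately show ?thesis
    unfolding isomorphic_categories_def using EF FE E1F1 F1E1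
    by (intro exI[of _ F] exI[of _ F\<^sub>1] exI[of _ E] exI[of _ E\<^sub>1]) simp
qed

lemma isomorphic_categories_trans:
  assumes "isomorphic_categories C D" "isomorphic_categories D B"
  shows "isomorphic_categories C B"
proof -
  obtain F F\<^sub>1 E E\<^sub>1 where F: "covariant_functor C D F F\<^sub>1" and E: "covariant_functor D C E E\<^sub>1"
    and i: "\<forall>X\<in>Obj C. E (F X) = X" "\<forall>Y\<in>Obj D. F (E Y) = Y"
       "\<forall>X\<in>Obj C. \<forall>X'\<in>Obj C. \<forall>f\<in>Hom C X X'. E\<^sub>1 (F X) (F X') (F\<^sub>1 X X' f) = f"
       "\<forall>Y\<in>Obj D. \<forall>Y'\<in>Obj D. \<forall>g\<in>Hom D Y Y'. F\<^sub>1 (E Y) (E Y') (E\<^sub>1 Y Y' g) = g"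
    using assms(1)[unfolded isomorphic_categories_def] by (elim exE conjE) (rule that)
  obtain F' F\<^sub>1' E' E\<^sub>1' where F': "covariant_functor D B F' F\<^sub>1'" and E': "covariant_functor B D E' E\<^sub>1'"
    and i': "\<forall>X\<in>Obj D. E' (F' X) = X" "\<forall>Y\<in>Obj B. F' (E' Y) = Y"
       "\<forall>X\<in>Obj D. \<forall>X'\<in>Obj D. \<forall>f\<in>Hom D X X'. E\<^sub>1' (F' X) (F' X') (F\<^sub>1' X X' f) = f"
       "\<forall>Y\<in>Obj B. \<forall>Y'\<in>Obj B. \<forall>g\<in>Hom B Y Y'. F\<^sub>1' (E' Y) (E' Y') (E\<^sub>1' Y Y' g) = g"
    using assms(2)[unfolded isomorphic_categories_def] by (elim exE conjE) (rule that)
  interpret F: covariant_functor C D F F\<^sub>1 by (rule F)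
  interpret E: covariant_functor D C E E\<^sub>1 by (rule E)
  interpret F': covariant_functor D B F' F\<^sub>1' by (rule F')
  interpret E': covariant_functor B D E' E\<^sub>1' by (rule E')
  show ?thesis
    by (rule isomorphic_categoriesI[OF F.C.category_axioms F'.D.category_axioms,
          where F = "\<lambda>X. F' (F X)" and E = "\<lambda>Y. E (E' Y)" and F\<^sub>1 = "\<lambda>X X' f. F\<^sub>1' (F X) (F X') (F\<^sub>1 X X' f)"
          and E\<^sub>1 = "\<lambda>Y Y' g. E\<^sub>1 (E' Y) (E' Y') (E\<^sub>1' Y Y' g)"])
      (simp_all add: i i' F.Obj_closed F'.Obj_closed E.Obj_closed E'.Obj_closed F.Hom_closed F'.Hom_closed
        E.Hom_closed E'.Hom_closed F.preserves_Ident F'.preserves_Ident F.preserves_Comp F'.preserves_Comp)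
qed

subsection \<open>Restriction of scalars\<close>

lemma graded_modules_right_module: "M \<in> graded_modules G R \<Longrightarrow> right_module R (direct_sum G (gm_group M)) (gm_act M)"
  by (simp add: graded_modules_def)

lemma category_graded_modules: "category (graded_module_category G R)"
proof -
  let ?D = "\<lambda>M. direct_sum G (gm_group M)"
  have HD: "x \<Colon> ?D M \<Longrightarrow> f x \<Colon> ?D N" "f \<in> extensional (carrier (?D M))"
     "\<lbrakk>x \<Colon> ?D M; y \<Colon> ?D M\<rbrakk> \<Longrightarrow> f (x \<oplus>\<^bsub>?D M\<^esub> y) = f x \<oplus>\<^bsub>?D N\<^esub> f y"
     "\<lbrakk>x \<Colon> ?D M; r \<Colon> R\<rbrakk> \<Longrightarrow> f (gm_act M x r) = gm_act N (f x) r"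
     "\<alpha> \<Colon> G \<Longrightarrow> f ` homogeneous G (gm_group M) \<alpha> \<subseteq> homogeneous G (gm_group N) \<alpha>"
    if "f \<in> Hom (graded_module_category G R) M N" for f M N x y r \<alpha>
    using that by (auto simp: graded_module_category_def Let_def right_linear_maps_def PiE_iff)
  have HI: "f \<in> Hom (graded_module_category G R) M N"
    if "\<And>x. x \<Colon> ?D M \<Longrightarrow> f x \<Colon> ?D N" "f \<in> extensional (carrier (?D M))"
     "\<And>x y. \<lbrakk>x \<Colon> ?D M; y \<Colon> ?D M\<rbrakk> \<Longrightarrow> f (x \<oplus>\<^bsub>?D M\<^esub> y) = f x \<oplus>\<^bsub>?D N\<^esub> f y"
     "\<And>x r. \<lbrakk>x \<Colon> ?D M; r \<Colon> R\<rbrakk> \<Longrightarrow> f (gm_act M x r) = gm_act N (f x) r"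
     "\<And>\<alpha> x. \<lbrakk>\<alpha> \<Colon> G; x \<in> homogeneous G (gm_group M) \<alpha>\<rbrakk> \<Longrightarrow> f x \<in> homogeneous G (gm_group N) \<alpha>"
    for f M N
    using that by (simp add: graded_module_category_def Let_def right_linear_maps_def PiE_iff image_subset_iff)
  have ID: "Ident (graded_module_category G R) M = (\<lambda>m\<in>carrier (?D M). m)" for M
    by (simp add: graded_module_category_def Let_def)
  have CD: "Comp (graded_module_category G R) L M N g f = compose (carrier (?D L)) g f" for L M N g f
    by (simp add: graded_module_category_def Let_def)
  have OD: "Obj (graded_module_category G R) = graded_modules G R"
    by (simp add: graded_module_category_def Let_def)
  have hc: "x \<in> homogeneous G N \<alpha> \<Longrightarrow> x \<Colon> direct_sum G N" for x and N :: "_ \<Rightarrow> _ ring" and \<alpha>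
    by (simp add: homogeneous_def)
  show ?thesis
  proof (rule category.intro; unfold OD)
    fix X assume X: "X \<in> graded_modules G R"
    interpret X: right_module R "?D X" "gm_act X" by (rule graded_modules_right_module[OF X])
    show "Ident (graded_module_category G R) X \<in> Hom (graded_module_category G R) X X"
      unfolding ID by (rule HI) (simp_all add: X.act_closed hc)
    fix Y f assume Y: "Y \<in> graded_modules G R" and f: "f \<in> Hom (graded_module_category G R) X Y"
    note fD = HD[OF f]
    show "Comp (graded_module_category G R) X Y Y (Ident (graded_module_category G R) Y) f = f"
      unfolding CD ID by (rule extensionalityI[OF compose_extensional fD(2)]) (simp add: compose_eq fD)
    show "Comp (graded_module_category G R) X X Y f (Ident (graded_module_category G R) X) = f"
      unfolding CD ID by (rule extensionalityI[OF compose_extensional fD(2)]) (simp add: compose_eq)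
    fix Z g assume Z: "Z \<in> graded_modules G R" and g: "g \<in> Hom (graded_module_category G R) Y Z"
    note gD = HD[OF g]
    show "Comp (graded_module_category G R) X Y Z g f \<in> Hom (graded_module_category G R) X Z"
      unfolding CD
    proof (rule HI)
      show "compose (carrier (?D X)) g f x \<in> homogeneous G (gm_group Z) \<alpha>"
        if "\<alpha> \<Colon> G" "x \<in> homogeneous G (gm_group X) \<alpha>" for \<alpha> x
        using that fD(5)[OF that(1)] gD(5)[OF that(1)] by (simp add: compose_eq hc image_subset_iff)
    qed (simp_all add: compose_eq fD(1,3,4) gD(1,3,4) X.act_closed)
    fix W h assume "W \<in> graded_modules G R" and h: "h \<in> Hom (graded_module_category G R) Z W"
    show "Comp (graded_module_category G R) X Z W h (Comp (graded_module_category G R) X Y Z g f) =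
      Comp (graded_module_category G R) X Y W (Comp (graded_module_category G R) Y Z W h g) f"
      unfolding CD by (rule extensionalityI[OF compose_extensional compose_extensional]) (simp add: compose_eq fD)
  qed
qed

text \<open>Underlying graded groups and maps stay fixed, and the isomorphism only relabels the elements that act.\<close>

lemma restriction_of_scalars:
  fixes R :: "('g, 'a, 'r) graded_ring" and R' :: "('g, 'a, 's) graded_ring"
  assumes "graded_A_ring_isomorphic G A R R'"
  shows "isomorphic_categories
    (graded_module_category G R :: (('g, 'r, 'm) graded_module, ('g \<Rightarrow> 'm) \<Rightarrow> 'g \<Rightarrow> 'm) category)
    (graded_module_category G R' :: (('g, 's, 'm) graded_module, ('g \<Rightarrow> 'm) \<Rightarrow> 'g \<Rightarrow> 'm) category)"
proof -
  obtain \<phi> where R: "graded_A_ring G A R" "graded_A_ring G A R'" and phi: "\<phi> \<in> ring_iso R R'"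
    "\<forall>\<alpha>\<in>carrier G. \<phi> ` component R \<alpha> = component R' \<alpha>"
    "\<forall>a\<in>carrier A. \<phi> (from_base R a) = from_base R' a"
    using assms[unfolded graded_A_ring_isomorphic_def] by (elim conjE bexE) (rule that)
  interpret R: graded_A_ring G A R by (rule R(1))
  interpret R': graded_A_ring G A R' by (rule R(2))
  define \<psi> where "\<psi> = inv_into (carrier R) \<phi>"
  have psi: "\<psi> \<in> ring_iso R' R" unfolding \<psi>_def by (rule ring_iso_set_sym[OF R.R.ring_axioms phi(1)])
  have bij: "bij_betw \<phi> (carrier R) (carrier R')" using phi(1) by (simp add: ring_iso_def)
  have inv: "r \<Colon> R \<Longrightarrow> \<psi> (\<phi> r) = r" "s \<Colon> R' \<Longrightarrow> \<phi> (\<psi> s) = s" for r s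
    unfolding \<psi>_def using bij by (simp_all add: bij_betw_def inv_into_f_f f_inv_into_f)
  let ?res = "\<lambda>S \<theta> M. \<lparr>gm_group = gm_group M, gm_act = (\<lambda>m r. if m \<Colon> direct_sum G (gm_group M) \<and> r \<Colon> S
      then gm_act M m (\<theta> r) else undefined)\<rparr>"
  have res: "?res S \<theta> M \<in> graded_modules G S"
    if S: "ring S" "ring Q" and th: "\<theta> \<in> ring_hom S Q"
      and comp: "\<And>\<alpha>. \<alpha> \<Colon> G \<Longrightarrow> \<theta> ` component S \<alpha> \<subseteq> component Q \<alpha>"
      and sub: "\<And>\<alpha>. \<alpha> \<Colon> G \<Longrightarrow> component S \<alpha> \<subseteq> carrier S"
      and M: "M \<in> graded_modules G Q"
    for S :: "('g, 'a, 't) graded_ring" and Q :: "('g, 'a, 'q) graded_ring" and \<theta> and M :: "('g, 'q, 'm) graded_module"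
  proof -
    interpret S: ring S by (rule S)
    interpret M: right_module Q "direct_sum G (gm_group M)" "gm_act M" by (rule graded_modules_right_module[OF M])
    note t = ring_hom_memE[OF th]
    have "right_module S (direct_sum G (gm_group M)) (gm_act (?res S \<theta> M))"
      by (intro right_module.intro right_module_axioms.intro S M.M.abelian_group_axioms)
        (simp_all add: t M.act_closed M.act_add_left M.act_add_right M.act_mult M.act_one)
    moreover have "gm_act (?res S \<theta> M) m r \<in> homogeneous G (gm_group M) (\<alpha> \<otimes>\<^bsub>G\<^esub> \<beta>)"
      if a: "\<alpha> \<Colon> G" "\<beta> \<Colon> G" and m: "m \<in> homogeneous G (gm_group M) \<alpha>" and r: "r \<in> component S \<beta>" for \<alpha> \<beta> m r
    proof -
      have "r \<Colon> S" "\<theta> r \<in> component Q \<beta>" using sub[OF a(2)] comp[OF a(2)] r by auto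
      moreover have "m \<Colon> direct_sum G (gm_group M)" using m by (simp add: homogeneous_def)
      ultimately show ?thesis using M a m by (simp add: graded_modules_def)
    qed
    ultimately show ?thesis
      using M by (simp add: graded_modules_def extensional2_def)
  qed
  have sub: "component R \<alpha> \<subseteq> carrier R" "component R' \<alpha> \<subseteq> carrier R'" if "\<alpha> \<Colon> G" for \<alpha>
    using additive_subgroup.a_subset[OF R.component_subgroup[OF that]]
      additive_subgroup.a_subset[OF R'.component_subgroup[OF that]] by auto
  have psic: "\<psi> ` component R' \<alpha> \<subseteq> component R \<alpha>" if "\<alpha> \<Colon> G" for \<alpha>
  proof -
    have "\<psi> ` \<phi> ` component R \<alpha> = component R \<alpha>"
      unfolding \<psi>_def by (rule inv_into_image_cancel[OF bij_betw_imp_inj_on[OF bij] sub(1)[OF that]])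
    then show ?thesis using phi(2) that by simp
  qed
  have fwd: "?res R' \<psi> M \<in> graded_modules G R'" if "M \<in> graded_modules G R" for M :: "('g, 'r, 'm) graded_module"
    by (rule res[OF R'.R.ring_axioms R.R.ring_axioms _ psic sub(2) that]) (use psi in \<open>simp_all add: ring_iso_def\<close>)
  have bwd: "?res R \<phi> M \<in> graded_modules G R" if "M \<in> graded_modules G R'" for M :: "('g, 's, 'm) graded_module"
    by (rule res[OF R.R.ring_axioms R'.R.ring_axioms _ _ sub(1) that]) (use phi in \<open>simp_all add: ring_iso_def\<close>)
  have cl: "r \<Colon> R \<Longrightarrow> \<phi> r \<Colon> R'" "s \<Colon> R' \<Longrightarrow> \<psi> s \<Colon> R" for r s
    using phi(1) psi by (auto simp: ring_iso_def ring_hom_closed)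
  have hom: "Hom (graded_module_category G S) (?res S \<theta> M) (?res S \<theta> N) = Hom (graded_module_category G Q) M N"
    if th: "\<And>s. s \<Colon> S \<Longrightarrow> \<theta> s \<Colon> Q" "\<And>r. r \<Colon> Q \<Longrightarrow> \<exists>s\<in>carrier S. r = \<theta> s"
    for S :: "('g, 'a, 't) graded_ring" and Q :: "('g, 'a, 'q) graded_ring" and \<theta> and M N :: "('g, 'q, 'm) graded_module"
  proof (rule Set.set_eqI)
    fix f
    let ?D = "direct_sum G (gm_group M)" let ?D' = "direct_sum G (gm_group N)"
    have "(\<forall>x\<in>carrier ?D. \<forall>s\<in>carrier S. f (gm_act M x (\<theta> s)) = gm_act N (f x) (\<theta> s)) \<longleftrightarrow>
      (\<forall>x\<in>carrier ?D. \<forall>r\<in>carrier Q. f (gm_act M x r) = gm_act N (f x) r)"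
      using th(1) by (auto dest!: th(2))
    moreover have "(\<forall>x\<in>carrier ?D. \<forall>s\<in>carrier S. f (gm_act (?res S \<theta> M) x s) = gm_act (?res S \<theta> N) (f x) s) \<longleftrightarrow>
      (\<forall>x\<in>carrier ?D. \<forall>s\<in>carrier S. f (gm_act M x (\<theta> s)) = gm_act N (f x) (\<theta> s))"
      if "f \<in> carrier ?D \<rightarrow>\<^sub>E carrier ?D'"
    proof -
      have "f x \<Colon> ?D'" if "x \<Colon> ?D" for x using \<open>f \<in> _\<close> that by (rule PiE_mem)
      then show ?thesis by simp
    qed
    ultimately show "f \<in> Hom (graded_module_category G S) (?res S \<theta> M) (?res S \<theta> N) \<longleftrightarrow> f \<in> Hom (graded_module_category G Q) M N"
      by (cases "f \<in> carrier ?D \<rightarrow>\<^sub>E carrier ?D'") (simp_all add: graded_module_category_def Let_def right_linear_maps_def)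
  qed
  have ex: "\<exists>s\<in>carrier R'. r = \<psi> s" if "r \<Colon> R" for r
    by (rule bexI[of _ "\<phi> r"]) (simp_all add: inv cl that)
  have ex': "\<exists>r\<in>carrier R. s = \<phi> r" if "s \<Colon> R'" for s
    by (rule bexI[of _ "\<psi> s"]) (simp_all add: inv cl that)
  note hom1 = hom[of R' \<psi> R, OF cl(2) ex] and hom2 = hom[of R \<phi> R', OF cl(1) ex']
  show ?thesis
  proof (rule isomorphic_categoriesI[OF category_graded_modules category_graded_modules,
        where F = "?res R' \<psi>" and E = "?res R \<phi>" and F\<^sub>1 = "\<lambda>_ _ f. f" and E\<^sub>1 = "\<lambda>_ _ f. f"])
    fix X :: "('g, 'r, 'm) graded_module" assume "X \<in> Obj (graded_module_category G R)"
    then have X: "X \<in> graded_modules G R" by (simp add: graded_module_category_def Let_def)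
    show "?res R' \<psi> X \<in> Obj (graded_module_category G R')" using fwd[OF X] by (simp add: graded_module_category_def Let_def)
    have "extensional2 (carrier (direct_sum G (gm_group X))) (carrier R) (gm_act X)"
      using X by (simp add: graded_modules_def)
    then show "?res R \<phi> (?res R' \<psi> X) = X"
      by (cases X) (auto simp: extensional2_def inv cl fun_eq_iff)
  next
    fix X :: "('g, 's, 'm) graded_module" assume "X \<in> Obj (graded_module_category G R')"
    then have X: "X \<in> graded_modules G R'" by (simp add: graded_module_category_def Let_def)
    show "?res R \<phi> X \<in> Obj (graded_module_category G R)" using bwd[OF X] by (simp add: graded_module_category_def Let_def)
    have "extensional2 (carrier (direct_sum G (gm_group X))) (carrier R') (gm_act X)"
      using X by (simp add: graded_modules_def)
    then show "?res R' \<psi> (?res R \<phi> X) = X"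
      by (cases X) (auto simp: extensional2_def inv cl fun_eq_iff)
  qed (simp_all only: hom1 hom2, simp_all add: graded_module_category_def Let_def)
qed

section \<open>Sweedler calculus\<close>

lemma bil_lift_left:
  assumes mods: "module k X" "module k Y" "module k Z"
    and bil: "\<And>z. z \<Colon> Z \<Longrightarrow> bil k X Y P (\<lambda>x y. \<tau> x y z)"
    and lin: "\<And>x y. \<lbrakk>x \<Colon> X; y \<Colon> Y\<rbrakk> \<Longrightarrow> lin k Z P (\<lambda>z. \<tau> x y z)"
  shows "bil k (tensor k X Y) Z P (\<lambda>s z. lift P (\<lambda>x y. \<tau> x y z) s)"
proof -
  interpret Z: module k Z by (rule mods)
  have P: "module k P" using bil[OF Z.zero_closed] by (rule bilD)
  show ?thesis
  proof (rule bilI)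
    show "lin k Z P (\<lambda>z. lift P (\<lambda>x y. \<tau> x y z) s)" if "s \<Colon> tensor k X Y" for s
      by (rule lin_lift_param[OF mods(3) that bil lin])
    show "lin k (tensor k X Y) P (\<lambda>s. lift P (\<lambda>x y. \<tau> x y z) s)" if "z \<Colon> Z" for z
      by (rule lin_lift[OF bil[OF that]])
  qed (intro tensor_is_module mods P)+
qed

lemma bil_cong:
  assumes "bil k M N P b" "\<And>m n. \<lbrakk>m \<Colon> M; n \<Colon> N\<rbrakk> \<Longrightarrow> b' m n = b m n"
  shows "bil k M N P b'"
  by (rule bilI[OF bilD(1,2,3)[OF assms(1)] lin_cong[OF bil_right[OF assms(1)]] lin_cong[OF bil_left[OF assms(1)]]])
    (simp_all add: assms(2))

lemma bil_sum:
  assumes "bil k M N P b" "bil k M N P b'"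
  shows "bil k M N P (\<lambda>m n. b m n \<oplus>\<^bsub>P\<^esub> b' m n)"
  by (rule bilI[OF bilD(1,2,3)[OF assms(1)] lin_sum[OF bil_right[OF assms(1)] bil_right[OF assms(2)]]
        lin_sum[OF bil_left[OF assms(1)] bil_left[OF assms(2)]]])

lemma lift_sum:
  assumes b: "bil k M N P b" and b': "bil k M N P b'" and t: "t \<Colon> tensor k M N"
  shows "lift P (\<lambda>m n. b m n \<oplus>\<^bsub>P\<^esub> b' m n) t = lift P b t \<oplus>\<^bsub>P\<^esub> lift P b' t"
  by (rule lin_tensor_eqI[OF lin_lift[OF bil_sum[OF b b']] lin_sum[OF lin_lift[OF b] lin_lift[OF b']] bilD(1,2)[OF b] _ t])
    (simp add: lift_pure[OF bil_sum[OF b b']] lift_pure[OF b] lift_pure[OF b'])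

text \<open>A coassociativity axiom equates elements of \<open>(X \<otimes> Y) \<otimes> Z\<close>.  Evaluating the
  trilinear map \<open>\<tau>\<close> on both gives the exchange of nested Sweedler sums.\<close>

lemma lift_coassoc:
  assumes mods: "module k X" "module k Y" "module k Z"
    and D1: "lin k V (tensor k X Y) D1" and D2: "lin k W (tensor k Y Z) D2"
    and s: "s \<Colon> tensor k V Z" and t: "t \<Colon> tensor k X W"
    and eq: "tensor_map k (tensor k X Y) Z D1 id s = tensor_assoc k X Y Z (tensor_map k X (tensor k Y Z) id D2 t)"
    and bil: "\<And>z. z \<Colon> Z \<Longrightarrow> bil k X Y P (\<lambda>x y. \<tau> x y z)"
    and bil': "\<And>x. x \<Colon> X \<Longrightarrow> bil k Y Z P (\<lambda>y z. \<tau> x y z)"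
  shows "lift P (\<lambda>v z. lift P (\<lambda>x y. \<tau> x y z) (D1 v)) s =
    lift P (\<lambda>x w. lift P (\<lambda>y z. \<tau> x y z) (D2 w)) t"
proof -
  let ?b = "\<lambda>u z. lift P (\<lambda>x y. \<tau> x y z) u"
  interpret Z: module k Z by (rule mods)
  have P: "module k P" using bil[OF Z.zero_closed] by (rule bilD)
  have b: "bil k (tensor k X Y) Z P ?b"
    by (rule bil_lift_left[OF mods bil bil_right[OF bil']])
  have i: "lin k Z Z id" "lin k X X id" using lin_id mods by (auto simp: id_def)
  have l: "lin k (tensor k X W) (tensor k X (tensor k Y Z)) (tensor_map k X (tensor k Y Z) id D2)"
    by (rule lin_tensor_map[OF i(2) D2])
  note b' = bil_assoc[OF mods b]
  have "lift P (\<lambda>v z. ?b (D1 v) z) s = lift P (\<lambda>u z. ?b u z) (tensor_map k (tensor k X Y) Z D1 id s)"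
    by (subst lift_tensor_map[OF D1 i(1) b s]) simp
  also have "\<dots> = lift P (\<lambda>x u. lift P (\<lambda>y z. ?b (pure k X Y x y) z) u) (tensor_map k X (tensor k Y Z) id D2 t)"
    unfolding eq by (rule lift_tensor_assoc[OF mods b lin_closed[OF l t]])
  also have "\<dots> = lift P (\<lambda>x w. lift P (\<lambda>y z. ?b (pure k X Y x y) z) (D2 w)) t"
    by (subst lift_tensor_map[OF i(2) D2 b' t]) simp
  also have "\<dots> = lift P (\<lambda>x w. lift P (\<lambda>y z. \<tau> x y z) (D2 w)) t"
  proof (rule lift_cong[OF _ t])
    show "bil k X W P (\<lambda>x w. lift P (\<lambda>y z. \<tau> x y z) (D2 w))"
      by (intro bilI mods lin_dom[OF D2] P lin_lift_arg[OF D2] bil' lin_lift_param[OF mods(1) lin_closed[OF D2]] bil_left[OF bil])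
    fix x w assume x: "x \<Colon> X" and w: "w \<Colon> W"
    show "lift P (\<lambda>y z. ?b (pure k X Y x y) z) (D2 w) = lift P (\<lambda>y z. \<tau> x y z) (D2 w)"
      by (rule lift_cong[OF bil'[OF x] lin_closed[OF D2 w]]) (simp add: lift_pure[OF bil] x)
  qed
  finally show ?thesis .
qed

lemma lift_tensor_mult:
  assumes M: "k_algebra k M" and N: "k_algebra k N" and b: "bil k M N P b"
    and s: "s \<Colon> tensor k M N" and t: "t \<Colon> tensor k M N"
  shows "lift P b (s \<otimes>\<^bsub>tensor k M N\<^esub> t) =
    lift P (\<lambda>m n. lift P (\<lambda>m' n'. b (m \<otimes>\<^bsub>M\<^esub> m') (n \<otimes>\<^bsub>N\<^esub> n')) t) s"
proof -
  let ?T = "tensor k M N"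
  note mods = bilD(1,2)[OF b]
  interpret MN: module_pair k M N by (rule module_pairI[OF b])
  interpret M': k_algebra k M by (rule M)
  interpret N': k_algebra k N by (rule N)
  have e: "s \<otimes>\<^bsub>?T\<^esub> t = lift ?T (\<lambda>m n. lift ?T (\<lambda>m' n'. pure k M N (m \<otimes>\<^bsub>M\<^esub> m') (n \<otimes>\<^bsub>N\<^esub> n')) t) s"
    unfolding MN.lift_T by (simp add: tensor_def Let_def)
  have b1: "bil k M N Q (\<lambda>m' n'. c (m \<otimes>\<^bsub>M\<^esub> m') (n \<otimes>\<^bsub>N\<^esub> n'))"
    if "bil k M N Q c" "m \<Colon> M" "n \<Colon> N" for Q c m n
    by (rule bil_comp[OF that(1) lin_mult_left[OF M lin_id[OF mods(1)] that(2)] lin_mult_left[OF N lin_id[OF mods(2)] that(3)]])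
  have b2: "bil k M N Q (\<lambda>m n. lift Q (\<lambda>m' n'. c (m \<otimes>\<^bsub>M\<^esub> m') (n \<otimes>\<^bsub>N\<^esub> n')) t)" if c: "bil k M N Q c" for Q c
    by (intro bilI mods bilD(3)[OF c] lin_lift_param[OF _ t b1[OF c]] lin_comp[OF bil_left[OF c]] lin_comp[OF bil_right[OF c]]
        lin_mult_right M N lin_id M'.m_closed N'.m_closed)
  have p: "bil k M N ?T (pure k M N)" by (rule pure_bil[OF mods])
  show ?thesis
    unfolding e
  proof (subst lin_of_lift[OF lin_lift[OF b] b2[OF p] s], rule lift_cong[OF b2[OF b] s])
    fix m n assume m: "m \<Colon> M" and n: "n \<Colon> N"
    have "lift P b (lift ?T (\<lambda>m' n'. pure k M N (m \<otimes>\<^bsub>M\<^esub> m') (n \<otimes>\<^bsub>N\<^esub> n')) t) =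
      lift P (\<lambda>m' n'. lift P b (pure k M N (m \<otimes>\<^bsub>M\<^esub> m') (n \<otimes>\<^bsub>N\<^esub> n'))) t" (is "?l = _")
      by (rule lin_of_lift[OF lin_lift[OF b] b1[OF p m n] t])
    also have "\<dots> = lift P (\<lambda>m' n'. b (m \<otimes>\<^bsub>M\<^esub> m') (n \<otimes>\<^bsub>N\<^esub> n')) t"
      by (rule lift_cong[OF b1[OF b m n] t]) (simp add: lift_pure[OF b] m n)
    finally show "?l = \<dots>" .
  qed
qed

section \<open>The convolution ring of \<open>A\<close>-valued functionals\<close>

context comodule_algebra
begin

abbreviation A_mult (infixl "\<cdot>" 70) where "a \<cdot> b \<equiv> a \<otimes>\<^bsub>A\<^esub> b"
abbreviation A_smult (infixr "\<bullet>" 75) where "c \<bullet> a \<equiv> c \<odot>\<^bsub>A\<^esub> a"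

lemma k_cring: "cring k" by unfold_locales
lemma A_algebra: "k_algebra k A" by unfold_locales
lemma A_module: "module k A" by unfold_locales
lemma base_mod: "module k (base_module k)" by (rule module_base[OF k_cring])

lemma A_ring: "ring A" by unfold_locales

lemma A_assoc: "\<lbrakk>a \<Colon> A; b \<Colon> A; c \<Colon> A\<rbrakk> \<Longrightarrow> a \<cdot> b \<cdot> c = a \<cdot> (b \<cdot> c)"
  by (rule monoid.m_assoc[OF ring.is_monoid[OF A_ring]])

lemma G_group: "group G" by unfold_locales

lemma G_ops [simp]:
  shows G_mult_closed: "\<lbrakk>\<alpha> \<Colon> G; \<beta> \<Colon> G\<rbrakk> \<Longrightarrow> \<alpha> \<otimes> \<beta> \<Colon> G"
    and G_one: "\<one> \<Colon> G"
    and G_inv_closed: "\<alpha> \<Colon> G \<Longrightarrow> inv \<alpha> \<Colon> G"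
    and "\<alpha> \<Colon> G \<Longrightarrow> \<one> \<otimes> \<alpha> = \<alpha>"
    and "\<alpha> \<Colon> G \<Longrightarrow> \<alpha> \<otimes> \<one> = \<alpha>"
    and "\<alpha> \<Colon> G \<Longrightarrow> inv (inv \<alpha>) = \<alpha>"
    and "\<alpha> \<Colon> G \<Longrightarrow> inv \<alpha> \<otimes> \<alpha> = \<one>"
    and "\<alpha> \<Colon> G \<Longrightarrow> \<alpha> \<otimes> inv \<alpha> = \<one>"
    and "inv \<one> = \<one>"
  using monoid.m_closed monoid.l_one monoid.r_one group.inv_closed group.inv_inv group.l_inv group.r_inv
    monoid.inv_one monoid.one_closed group.is_monoid[OF G_group] G_group by (metis+)

lemma G_assoc: "\<lbrakk>\<alpha> \<Colon> G; \<beta> \<Colon> G; \<gamma> \<Colon> G\<rbrakk> \<Longrightarrow> \<alpha> \<otimes> \<beta> \<otimes> \<gamma> = \<alpha> \<otimes> (\<beta> \<otimes> \<gamma>)"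
  by (rule monoid.m_assoc[OF group.is_monoid[OF G_group]])

lemma G_inv_mult: "\<lbrakk>\<alpha> \<Colon> G; \<beta> \<Colon> G\<rbrakk> \<Longrightarrow> inv (\<alpha> \<otimes> \<beta>) = inv \<beta> \<otimes> inv \<alpha>"
  by (rule inv_mult_group)

lemma comult_lin: "\<lbrakk>\<alpha> \<Colon> G; \<beta> \<Colon> G\<rbrakk> \<Longrightarrow> lin k (H (\<alpha> \<otimes> \<beta>)) (tensor k (H \<alpha>) (H \<beta>)) (\<Delta> \<alpha> \<beta>)"
  by (simp add: lin_def comult_linear H_module tensor_is_module)

lemma comult_closed: "\<lbrakk>\<alpha> \<Colon> G; \<beta> \<Colon> G; h \<Colon> H (\<alpha> \<otimes> \<beta>)\<rbrakk> \<Longrightarrow> \<Delta> \<alpha> \<beta> h \<Colon> tensor k (H \<alpha>) (H \<beta>)"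
  by (rule lin_closed[OF comult_lin])

lemma counit_lin: "lin k (H \<one>) (base_module k) \<epsilon>"
  by (simp add: lin_def counit_linear H_module base_mod)

lemma counit_closed: "h \<Colon> H \<one> \<Longrightarrow> \<epsilon> h \<Colon> k"
  using lin_closed[OF counit_lin] by simp

lemma counit_mult: "\<lbrakk>x \<Colon> H \<one>; y \<Colon> H \<one>\<rbrakk> \<Longrightarrow> \<epsilon> (x \<otimes>\<^bsub>H \<one>\<^esub> y) = \<epsilon> x \<otimes>\<^bsub>k\<^esub> \<epsilon> y"
  using ring_hom_mult[OF counit_hom] .

lemma coact_lin: "\<alpha> \<Colon> G \<Longrightarrow> lin k A (tensor k A (H \<alpha>)) (\<rho> \<alpha>)"
  by (simp add: lin_def coact_linear H_module tensor_is_module A_module)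

lemma coact_closed: "\<lbrakk>\<alpha> \<Colon> G; a \<Colon> A\<rbrakk> \<Longrightarrow> \<rho> \<alpha> a \<Colon> tensor k A (H \<alpha>)"
  by (rule lin_closed[OF coact_lin])

lemma H_ring: "\<alpha> \<Colon> G \<Longrightarrow> ring (H \<alpha>)"
  using H_algebra by (rule k_algebra.axioms)

lemma H_mult_closed: "\<lbrakk>\<alpha> \<Colon> G; x \<Colon> H \<alpha>; y \<Colon> H \<alpha>\<rbrakk> \<Longrightarrow> x \<otimes>\<^bsub>H \<alpha>\<^esub> y \<Colon> H \<alpha>"
  using ring.ring_simprules(5)[OF H_ring] .

lemma H_lin_left: "\<lbrakk>\<alpha> \<Colon> G; x \<Colon> H \<alpha>\<rbrakk> \<Longrightarrow> lin k (H \<alpha>) (H \<alpha>) (\<lambda>y. x \<otimes>\<^bsub>H \<alpha>\<^esub> y)"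
  by (intro lin_mult_left H_algebra lin_id H_module)

lemma H_lin_right: "\<lbrakk>\<alpha> \<Colon> G; y \<Colon> H \<alpha>\<rbrakk> \<Longrightarrow> lin k (H \<alpha>) (H \<alpha>) (\<lambda>x. x \<otimes>\<^bsub>H \<alpha>\<^esub> y)"
  by (intro lin_mult_right H_algebra lin_id H_module)

lemma comult_coassoc:
  assumes "\<alpha> \<Colon> G" "\<beta> \<Colon> G" "\<gamma> \<Colon> G" "h \<Colon> H (\<alpha> \<otimes> \<beta> \<otimes> \<gamma>)"
    and "\<And>z. z \<Colon> H \<gamma> \<Longrightarrow> bil k (H \<alpha>) (H \<beta>) P (\<lambda>x y. \<tau> x y z)"
    and "\<And>x. x \<Colon> H \<alpha> \<Longrightarrow> bil k (H \<beta>) (H \<gamma>) P (\<lambda>y z. \<tau> x y z)"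
  shows "lift P (\<lambda>v z. lift P (\<lambda>x y. \<tau> x y z) (\<Delta> \<alpha> \<beta> v)) (\<Delta> (\<alpha> \<otimes> \<beta>) \<gamma> h) =
    lift P (\<lambda>x w. lift P (\<lambda>y z. \<tau> x y z) (\<Delta> \<beta> \<gamma> w)) (\<Delta> \<alpha> (\<beta> \<otimes> \<gamma>) h)"
  by (rule lift_coassoc[OF H_module[OF assms(1)] H_module[OF assms(2)] H_module[OF assms(3)] comult_lin[OF assms(1,2)]
        comult_lin[OF assms(2,3)] _ _ coassoc[OF assms(1-4)] assms(5,6)])
    (use assms(1-4) G_assoc[OF assms(1-3)] in \<open>simp_all add: comult_closed\<close>)

lemma coact_coassoc_lift:
  assumes "\<alpha> \<Colon> G" "\<beta> \<Colon> G" "a \<Colon> A"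
    and "\<And>z. z \<Colon> H \<beta> \<Longrightarrow> bil k A (H \<alpha>) P (\<lambda>b y. \<tau> b y z)"
    and "\<And>b. b \<Colon> A \<Longrightarrow> bil k (H \<alpha>) (H \<beta>) P (\<lambda>y z. \<tau> b y z)"
  shows "lift P (\<lambda>b z. lift P (\<lambda>b' y. \<tau> b' y z) (\<rho> \<alpha> b)) (\<rho> \<beta> a) =
    lift P (\<lambda>b w. lift P (\<lambda>y z. \<tau> b y z) (\<Delta> \<alpha> \<beta> w)) (\<rho> (\<alpha> \<otimes> \<beta>) a)"
  by (rule lift_coassoc[OF A_module H_module[OF assms(1)] H_module[OF assms(2)] coact_lin[OF assms(1)]
        comult_lin[OF assms(1,2)] _ _ coact_coassoc[OF assms(1-3), symmetric] assms(4,5)])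
    (use assms(1-3) in \<open>simp_all add: coact_closed\<close>)

text \<open>In Sweedler notation \<open>a\<^sub>0 g(x a\<^sub>1)\<close>, the value at \<open>(1 \<otimes> x)
  a\<close> of the left \<open>A\<close>-linear extension of \<open>g\<close>.\<close>

definition twist where
  "twist \<nu> g x a = lift A (\<lambda>b z. b \<cdot> g (x \<otimes>\<^bsub>H \<nu>\<^esub> z)) (\<rho> \<nu> a)"

lemma twist_bil_inner:
  assumes "\<nu> \<Colon> G" "lin k (H \<nu>) A g" "x \<Colon> H \<nu>"
  shows "bil k A (H \<nu>) A (\<lambda>b z. b \<cdot> g (x \<otimes>\<^bsub>H \<nu>\<^esub> z))"
  by (intro bilI A_module H_module assms lin_mult_left[OF A_algebra] lin_mult_right[OF A_algebra] lin_id
      lin_comp[OF assms(2)] H_lin_left) (simp_all add: lin_closed[OF assms(2)] H_mult_closed assms)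

lemma twist_bil:
  assumes "\<nu> \<Colon> G" "lin k (H \<nu>) A g"
  shows "bil k (H \<nu>) A A (\<lambda>x a. twist \<nu> g x a)"
  unfolding twist_def
  by (intro bilI A_module H_module assms(1) lin_lift_arg[OF coact_lin] twist_bil_inner
      lin_lift_param[OF H_module coact_closed] lin_mult_left[OF A_algebra] lin_comp[OF assms(2)] H_lin_right assms)

lemma twist_closed:
  "\<lbrakk>\<nu> \<Colon> G; lin k (H \<nu>) A g; x \<Colon> H \<nu>; a \<Colon> A\<rbrakk> \<Longrightarrow> twist \<nu> g x a \<Colon> A"
  by (rule bil_closed[OF twist_bil])

text \<open>Multiplicativity of the coaction, followed by associativity in \<open>H\<close> and \<open>A\<close>.\<close>

lemma twist_mult:
  assumes d: "\<nu> \<Colon> G" and g: "lin k (H \<nu>) A g" and x: "x \<Colon> H \<nu>" and a: "a \<Colon> A" "b \<Colon> A"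
  shows "twist \<nu> g x (a \<cdot> b) = lift A (\<lambda>c z. c \<cdot> twist \<nu> g (x \<otimes>\<^bsub>H \<nu>\<^esub> z) b) (\<rho> \<nu> a)"
proof -
  interpret Hd: k_algebra k "H \<nu>" by (rule H_algebra[OF d])
  note inner = twist_bil_inner[OF d g x]
  have lc: "lin k A A (\<lambda>c'. c \<cdot> c')" if "c \<Colon> A" for c
    by (intro lin_mult_left A_algebra lin_id A_module that)
  have b2: "bil k A (H \<nu>) A (\<lambda>c z. c \<cdot> twist \<nu> g (x \<otimes>\<^bsub>H \<nu>\<^esub> z) b)"
    by (intro bilI A_module H_module d lin_mult_left[OF A_algebra] lin_mult_right[OF A_algebra] lin_id
        lin_comp[OF bil_left[OF twist_bil[OF d g] a(2)]] H_lin_left x)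
      (simp_all add: twist_closed d g a x)
  have "twist \<nu> g x (a \<cdot> b) = lift A (\<lambda>c z. c \<cdot> g (x \<otimes>\<^bsub>H \<nu>\<^esub> z)) (\<rho> \<nu> a \<otimes>\<^bsub>tensor k A (H \<nu>)\<^esub> \<rho> \<nu> b)"
    by (simp add: twist_def coact_mult d a)
  also have "\<dots> = lift A (\<lambda>c z. lift A (\<lambda>c' z'. c \<cdot> c' \<cdot> g (x \<otimes>\<^bsub>H \<nu>\<^esub> (z \<otimes>\<^bsub>H \<nu>\<^esub> z'))) (\<rho> \<nu> b)) (\<rho> \<nu> a)"
    by (rule lift_tensor_mult[OF A_algebra H_algebra[OF d] inner coact_closed[OF d a(1)] coact_closed[OF d a(2)]])
  also have "\<dots> = lift A (\<lambda>c z. c \<cdot> twist \<nu> g (x \<otimes>\<^bsub>H \<nu>\<^esub> z) b) (\<rho> \<nu> a)"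
  proof (rule lift_cong[OF b2 coact_closed[OF d a(1)]])
    fix c z assume c: "c \<Colon> A" and z: "z \<Colon> H \<nu>"
    note xz = H_mult_closed[OF d x z]
    have "c \<cdot> twist \<nu> g (x \<otimes>\<^bsub>H \<nu>\<^esub> z) b =
      lift A (\<lambda>c' z'. c \<cdot> (c' \<cdot> g (x \<otimes>\<^bsub>H \<nu>\<^esub> z \<otimes>\<^bsub>H \<nu>\<^esub> z'))) (\<rho> \<nu> b)"
      unfolding twist_def by (rule lin_of_lift[OF lc[OF c] twist_bil_inner[OF d g xz] coact_closed[OF d a(2)]])
    also have "\<dots> = lift A (\<lambda>c' z'. c \<cdot> c' \<cdot> g (x \<otimes>\<^bsub>H \<nu>\<^esub> (z \<otimes>\<^bsub>H \<nu>\<^esub> z'))) (\<rho> \<nu> b)"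
    proof (rule lift_cong[OF _ coact_closed[OF d a(2)]])
      show "bil k A (H \<nu>) A (\<lambda>c' z'. c \<cdot> c' \<cdot> g (x \<otimes>\<^bsub>H \<nu>\<^esub> (z \<otimes>\<^bsub>H \<nu>\<^esub> z')))"
        by (rule bil_comp[OF inner lc[OF c] H_lin_left[OF d z]])
      fix c' z' assume "c' \<Colon> A" "z' \<Colon> H \<nu>"
      then show "c \<cdot> (c' \<cdot> g (x \<otimes>\<^bsub>H \<nu>\<^esub> z \<otimes>\<^bsub>H \<nu>\<^esub> z')) = c \<cdot> c' \<cdot> g (x \<otimes>\<^bsub>H \<nu>\<^esub> (z \<otimes>\<^bsub>H \<nu>\<^esub> z'))"
        using lin_closed[OF g] x z c by (simp add: Hd.m_assoc A_assoc)
    qed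
    finally show "lift A (\<lambda>c' z'. c \<cdot> c' \<cdot> g (x \<otimes>\<^bsub>H \<nu>\<^esub> (z \<otimes>\<^bsub>H \<nu>\<^esub> z'))) (\<rho> \<nu> b) = c \<cdot> twist \<nu> g (x \<otimes>\<^bsub>H \<nu>\<^esub> z) b" ..
  qed
  finally show ?thesis .
qed

lemma twist_one:
  assumes d: "\<nu> \<Colon> G" and g: "lin k (H \<nu>) A g" and x: "x \<Colon> H \<nu>"
  shows "twist \<nu> g x \<one>\<^bsub>A\<^esub> = g x"
proof -
  interpret Hd: k_algebra k "H \<nu>" by (rule H_algebra[OF d])
  show ?thesis
    using lin_closed[OF g] x
    by (simp add: twist_def coact_one d lift_pure[OF twist_bil_inner[OF d g x]])
qed

definition hom_comp :: "'g \<Rightarrow> ('h \<Rightarrow> 'a) ring" where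
  "hom_comp \<alpha> = \<lparr>carrier = linear_maps k (H (inv \<alpha>)) A \<inter> extensional (carrier (H (inv \<alpha>))),
     monoid.mult = undefined, monoid.one = undefined,
     ring.zero = (\<lambda>h\<in>carrier (H (inv \<alpha>)). \<zero>\<^bsub>A\<^esub>),
     ring.add = (\<lambda>f g. \<lambda>h\<in>carrier (H (inv \<alpha>)). f h \<oplus>\<^bsub>A\<^esub> g h)\<rparr>"

definition hom_mult where
  "hom_mult \<alpha> \<beta> f g = (\<lambda>h\<in>carrier (H (inv (\<alpha> \<otimes> \<beta>))).
     lift A (\<lambda>x y. twist (inv \<beta>) g x (f y)) (\<Delta> (inv \<beta>) (inv \<alpha>) h))"

definition hom_unit where "hom_unit = (\<lambda>h\<in>carrier (H \<one>). \<epsilon> h \<bullet> \<one>\<^bsub>A\<^esub>)"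
definition hom_base where "hom_base a = (\<lambda>h\<in>carrier (H \<one>). \<epsilon> h \<bullet> a)"

lemma hom_comp_lin: "\<lbrakk>\<alpha> \<Colon> G; f \<Colon> hom_comp \<alpha>\<rbrakk> \<Longrightarrow> lin k (H (inv \<alpha>)) A f"
  by (simp add: hom_comp_def lin_def H_module A_module)

lemma hom_compI: "\<lbrakk>\<alpha> \<Colon> G; lin k (H (inv \<alpha>)) A f\<rbrakk> \<Longrightarrow> restrict f (carrier (H (inv \<alpha>))) \<Colon> hom_comp \<alpha>"
proof -
  assume a: "\<alpha> \<Colon> G" and f: "lin k (H (inv \<alpha>)) A f"
  have "lin k (H (inv \<alpha>)) A (restrict f (carrier (H (inv \<alpha>))))" by (rule lin_cong[OF f]) simp
  then show ?thesis by (simp add: hom_comp_def lin_def)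
qed

lemma hom_comp_eqI:
  "\<lbrakk>f \<Colon> hom_comp \<alpha>; g \<Colon> hom_comp \<alpha>; \<And>h. h \<Colon> H (inv \<alpha>) \<Longrightarrow> f h = g h\<rbrakk> \<Longrightarrow> f = g"
  by (auto simp: hom_comp_def intro: extensionalityI)

lemma hom_comp_value: "\<lbrakk>f \<Colon> hom_comp \<alpha>; h \<Colon> H (inv \<alpha>)\<rbrakk> \<Longrightarrow> f h \<Colon> A"
  by (auto simp: hom_comp_def linear_maps_def)

lemma hom_comp_simps:
  "h \<Colon> H (inv \<alpha>) \<Longrightarrow> (f \<oplus>\<^bsub>hom_comp \<alpha>\<^esub> g) h = f h \<oplus>\<^bsub>A\<^esub> g h"
  "h \<Colon> H (inv \<alpha>) \<Longrightarrow> \<zero>\<^bsub>hom_comp \<alpha>\<^esub> h = \<zero>\<^bsub>A\<^esub>"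
  by (simp_all add: hom_comp_def)

lemma hom_comp_add:
  assumes a: "\<alpha> \<Colon> G" and f: "f \<Colon> hom_comp \<alpha>" "g \<Colon> hom_comp \<alpha>"
  shows "f \<oplus>\<^bsub>hom_comp \<alpha>\<^esub> g \<Colon> hom_comp \<alpha>"
  using hom_compI[OF a lin_sum[OF hom_comp_lin[OF a f(1)] hom_comp_lin[OF a f(2)]]]
  by (simp add: hom_comp_def)

lemma hom_comp_group:
  assumes a: "\<alpha> \<Colon> G"
  shows "abelian_group (hom_comp \<alpha>)"
proof (rule abelian_groupI)
  interpret Ha: module k "H (inv \<alpha>)" by (intro H_module inv_closed a)
  note v = hom_comp_value and s = hom_comp_simps and add = hom_comp_add[OF a]
  show z: "\<zero>\<^bsub>hom_comp \<alpha>\<^esub> \<Colon> hom_comp \<alpha>"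
    by (auto simp: hom_comp_def linear_maps_def)
  fix f assume f: "f \<Colon> hom_comp \<alpha>"
  show "\<zero>\<^bsub>hom_comp \<alpha>\<^esub> \<oplus>\<^bsub>hom_comp \<alpha>\<^esub> f = f"
    by (rule hom_comp_eqI[OF add[OF z f] f]) (simp add: s v[OF f])
  have n: "(\<lambda>h\<in>carrier (H (inv \<alpha>)). (\<ominus>\<^bsub>k\<^esub> \<one>\<^bsub>k\<^esub>) \<bullet> f h) \<Colon> hom_comp \<alpha>"
    by (rule hom_compI[OF a lin_scale[OF hom_comp_lin[OF a f]]]) simp
  show "\<exists>g\<in>carrier (hom_comp \<alpha>). g \<oplus>\<^bsub>hom_comp \<alpha>\<^esub> f = \<zero>\<^bsub>hom_comp \<alpha>\<^esub>"
    by (rule bexI[OF _ n], rule hom_comp_eqI[OF add[OF n f] z])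
      (simp add: s v[OF f] smult_l_minus M.l_neg)
  fix g assume g: "g \<Colon> hom_comp \<alpha>"
  show "f \<oplus>\<^bsub>hom_comp \<alpha>\<^esub> g \<Colon> hom_comp \<alpha>" by (rule add[OF f g])
  show "f \<oplus>\<^bsub>hom_comp \<alpha>\<^esub> g = g \<oplus>\<^bsub>hom_comp \<alpha>\<^esub> f"
    by (rule hom_comp_eqI[OF add[OF f g] add[OF g f]]) (simp add: s v[OF f] v[OF g] M.a_comm)
  fix h assume h: "h \<Colon> hom_comp \<alpha>"
  show "f \<oplus>\<^bsub>hom_comp \<alpha>\<^esub> g \<oplus>\<^bsub>hom_comp \<alpha>\<^esub> h = f \<oplus>\<^bsub>hom_comp \<alpha>\<^esub> (g \<oplus>\<^bsub>hom_comp \<alpha>\<^esub> h)"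
    by (rule hom_comp_eqI[OF add[OF add[OF f g] h] add[OF f add[OF g h]]]) (simp add: s v[OF f] v[OF g] v[OF h] M.a_assoc)
qed

lemma product_bil:
  assumes "\<mu> \<Colon> G" "lin k (H \<mu>) A l" "lin k X A f"
  shows "bil k (H \<mu>) X A (\<lambda>x y. twist \<mu> l x (f y))"
  by (rule bil_comp[OF twist_bil[OF assms(1,2)] lin_id[OF H_module[OF assms(1)]] assms(3)])

lemma product_lin:
  assumes "\<mu> \<Colon> G" "\<nu> \<Colon> G" "lin k (H \<mu>) A l" "lin k (H \<nu>) A f"
  shows "lin k (H (\<mu> \<otimes> \<nu>)) A (\<lambda>h. lift A (\<lambda>x y. twist \<mu> l x (f y)) (\<Delta> \<mu> \<nu> h))"
  by (rule lin_lift_arg[OF comult_lin[OF assms(1,2)] product_bil[OF assms(1,3,4)]])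

text \<open>Multiplicativity separates the two factors of the inner element, and coassociativity merges the two
  coactions on \<open>a\<close> into a single one.\<close>

lemma twist_twist:
  assumes k: "\<mu> \<Colon> G" and d: "\<nu> \<Colon> G" and l: "lin k (H \<mu>) A l" and g: "lin k (H \<nu>) A g"
    and x: "x \<Colon> H \<mu>" and y: "y \<Colon> H \<nu>" and a: "a \<Colon> A"
  shows "twist \<mu> l x (twist \<nu> g y a) = lift A (\<lambda>c v. lift A
    (\<lambda>w z. c \<cdot> twist \<mu> l (x \<otimes>\<^bsub>H \<mu>\<^esub> w) (g (y \<otimes>\<^bsub>H \<nu>\<^esub> z))) (\<Delta> \<mu> \<nu> v)) (\<rho> (\<mu> \<otimes> \<nu>) a)"
proof -
  let ?t = "\<lambda>c w z. c \<cdot> twist \<mu> l (x \<otimes>\<^bsub>H \<mu>\<^esub> w) (g (y \<otimes>\<^bsub>H \<nu>\<^esub> z))"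
  have gy: "lin k (H \<nu>) A (\<lambda>z. g (y \<otimes>\<^bsub>H \<nu>\<^esub> z))" by (rule lin_comp[OF g H_lin_left[OF d y]])
  have tw: "bil k (H \<mu>) (H \<nu>) A (\<lambda>w z. twist \<mu> l (x \<otimes>\<^bsub>H \<mu>\<^esub> w) (g (y \<otimes>\<^bsub>H \<nu>\<^esub> z)))"
    by (rule bil_comp[OF twist_bil[OF k l] H_lin_left[OF k x] gy])
  have b1: "bil k A (H \<mu>) A (\<lambda>c w. ?t c w z)" if z: "z \<Colon> H \<nu>" for z
  proof (rule bilI)
    show "lin k (H \<mu>) A (\<lambda>w. ?t c w z)" if "c \<Colon> A" for c
      by (rule lin_mult_left[OF A_algebra bil_left[OF tw z] that])
    show "lin k A A (\<lambda>c. ?t c w z)" if "w \<Colon> H \<mu>" for w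
      by (rule lin_mult_right[OF A_algebra lin_id[OF A_module] bil_closed[OF tw that z]])
  qed (rule A_module H_module[OF k])+
  have b2: "bil k (H \<mu>) (H \<nu>) A (\<lambda>w z. ?t c w z)" if c: "c \<Colon> A" for c
  proof (rule bilI)
    show "lin k (H \<nu>) A (\<lambda>z. ?t c w z)" if "w \<Colon> H \<mu>" for w
      by (rule lin_mult_left[OF A_algebra bil_right[OF tw that] c])
    show "lin k (H \<mu>) A (\<lambda>w. ?t c w z)" if "z \<Colon> H \<nu>" for z
      by (rule lin_mult_left[OF A_algebra bil_left[OF tw that] c])
  qed (rule A_module H_module[OF k] H_module[OF d])+
  have "twist \<mu> l x (twist \<nu> g y a) = lift A (\<lambda>c z. twist \<mu> l x (c \<cdot> g (y \<otimes>\<^bsub>H \<nu>\<^esub> z))) (\<rho> \<nu> a)"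
    unfolding twist_def[of \<nu>] by (rule lin_of_lift[OF bil_right[OF twist_bil[OF k l] x] twist_bil_inner[OF d g y] coact_closed[OF d a]])
  also have "\<dots> = lift A (\<lambda>c z. lift A (\<lambda>c' w. ?t c' w z) (\<rho> \<mu> c)) (\<rho> \<nu> a)"
  proof (rule lift_cong[OF _ coact_closed[OF d a]])
    show "bil k A (H \<nu>) A (\<lambda>c z. lift A (\<lambda>c' w. ?t c' w z) (\<rho> \<mu> c))"
    proof (rule bilI)
      show "lin k (H \<nu>) A (\<lambda>z. lift A (\<lambda>c' w. ?t c' w z) (\<rho> \<mu> c))" if "c \<Colon> A" for c
        by (rule lin_lift_param[OF H_module[OF d] coact_closed[OF k that] b1 bil_right[OF b2]])
      show "lin k A A (\<lambda>c. lift A (\<lambda>c' w. ?t c' w z) (\<rho> \<mu> c))" if "z \<Colon> H \<nu>" for z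
        by (rule lin_lift_arg[OF coact_lin[OF k] b1[OF that]])
    qed (rule A_module H_module[OF d])+
    fix c z assume "c \<Colon> A" "z \<Colon> H \<nu>"
    then show "twist \<mu> l x (c \<cdot> g (y \<otimes>\<^bsub>H \<nu>\<^esub> z)) = lift A (\<lambda>c' w. ?t c' w z) (\<rho> \<mu> c)"
      by (intro twist_mult k l x lin_closed[OF gy])
  qed
  also have "\<dots> = lift A (\<lambda>c v. lift A (\<lambda>w z. ?t c w z) (\<Delta> \<mu> \<nu> v)) (\<rho> (\<mu> \<otimes> \<nu>) a)"
    by (rule coact_coassoc_lift[OF k d a b1 b2])
  finally show ?thesis .
qed

text \<open>Since \<open>\<Delta>\<close> is multiplicative, \<open>\<Delta>(t a\<^sub>1)\<close> splits into the
  comultiplications of \<open>t\<close> and \<open>a\<^sub>1\<close>, which is what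
  \<open>twist_twist\<close> produces.\<close>

lemma twist_product:
  assumes k: "\<mu> \<Colon> G" and d: "\<nu> \<Colon> G" and l: "lin k (H \<mu>) A l" and g: "lin k (H \<nu>) A g"
    and t: "t \<Colon> H (\<mu> \<otimes> \<nu>)" and a: "a \<Colon> A"
    and m: "\<And>v. v \<Colon> H (\<mu> \<otimes> \<nu>) \<Longrightarrow> m v = lift A (\<lambda>x y. twist \<mu> l x (g y)) (\<Delta> \<mu> \<nu> v)"
  shows "twist (\<mu> \<otimes> \<nu>) m t a = lift A (\<lambda>x y. twist \<mu> l x (twist \<nu> g y a)) (\<Delta> \<mu> \<nu> t)"
proof -
  have kd: "\<mu> \<otimes> \<nu> \<Colon> G" using k d by simp
  let ?r = "\<lambda>c x w y z. c \<cdot> twist \<mu> l (x \<otimes>\<^bsub>H \<mu>\<^esub> w) (g (y \<otimes>\<^bsub>H \<nu>\<^esub> z))"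
  let ?B = "\<lambda>c v x y. lift A (\<lambda>w z. ?r c x w y z) (\<Delta> \<mu> \<nu> v)"
  note tb = twist_bil[OF k l]
  have cl: "\<lbrakk>x \<Colon> H \<mu>; w \<Colon> H \<mu>; y \<Colon> H \<nu>; z \<Colon> H \<nu>\<rbrakk>
      \<Longrightarrow> twist \<mu> l (x \<otimes>\<^bsub>H \<mu>\<^esub> w) (g (y \<otimes>\<^bsub>H \<nu>\<^esub> z)) \<Colon> A" for x w y z
    by (intro twist_closed k l lin_closed[OF g] H_mult_closed d)
  have pb: "bil k (H \<mu>) (H \<nu>) A (\<lambda>x y. twist \<mu> l x (g y))" by (rule product_bil[OF k l g])
  have r1: "bil k (H \<mu>) (H \<nu>) A (\<lambda>w z. ?r c x w y z)"
    if c: "c \<Colon> A" and x: "x \<Colon> H \<mu>" and y: "y \<Colon> H \<nu>" for c x y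
  proof -
    note b = bil_comp[OF tb H_lin_left[OF k x] lin_comp[OF g H_lin_left[OF d y]]]
    show ?thesis
      by (rule bilI[OF bilD(1,2,3)[OF b] lin_mult_left[OF A_algebra bil_right[OF b] c] lin_mult_left[OF A_algebra bil_left[OF b] c]])
  qed
  have r2: "bil k (H \<mu>) (H \<nu>) A (\<lambda>x y. ?r c x w y z)"
    if c: "c \<Colon> A" and w: "w \<Colon> H \<mu>" and z: "z \<Colon> H \<nu>" for c w z
  proof -
    note b = bil_comp[OF tb H_lin_right[OF k w] lin_comp[OF g H_lin_right[OF d z]]]
    show ?thesis
      by (rule bilI[OF bilD(1,2,3)[OF b] lin_mult_left[OF A_algebra bil_right[OF b] c] lin_mult_left[OF A_algebra bil_left[OF b] c]])
  qed
  have B1: "bil k (H \<mu>) (H \<nu>) A (\<lambda>x y. ?B c v x y)" if c: "c \<Colon> A" and v: "v \<Colon> H (\<mu> \<otimes> \<nu>)" for c v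
  proof (rule bilI)
    note dv = comult_closed[OF k d v]
    show "lin k (H \<nu>) A (\<lambda>y. ?B c v x y)" if x: "x \<Colon> H \<mu>" for x
      by (rule lin_lift_param[OF H_module[OF d] dv r1[OF c x] bil_right[OF r2[OF c] x]])
    show "lin k (H \<mu>) A (\<lambda>x. ?B c v x y)" if y: "y \<Colon> H \<nu>" for y
      by (rule lin_lift_param[OF H_module[OF k] dv r1[OF c _ y] bil_left[OF r2[OF c] y]])
  qed (rule A_module H_module[OF k] H_module[OF d])+
  have B2: "bil k A (H (\<mu> \<otimes> \<nu>)) A (\<lambda>c v. ?B c v x y)" if x: "x \<Colon> H \<mu>" and y: "y \<Colon> H \<nu>" for x y
  proof (rule bilI)
    show "lin k (H (\<mu> \<otimes> \<nu>)) A (\<lambda>v. ?B c v x y)" if c: "c \<Colon> A" for c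
      by (rule lin_lift_arg[OF comult_lin[OF k d] r1[OF c x y]])
    show "lin k A A (\<lambda>c. ?B c v x y)" if v: "v \<Colon> H (\<mu> \<otimes> \<nu>)" for v
      by (rule lin_lift_param[OF A_module comult_closed[OF k d v] r1[OF _ x y]
            lin_mult_right[OF A_algebra lin_id[OF A_module] cl[OF x _ y]]])
  qed (rule A_module H_module[OF kd])+
  have prod: "c \<cdot> m (t \<otimes>\<^bsub>H (\<mu> \<otimes> \<nu>)\<^esub> v) = lift A (\<lambda>x y. ?B c v x y) (\<Delta> \<mu> \<nu> t)"
    if c: "c \<Colon> A" and v: "v \<Colon> H (\<mu> \<otimes> \<nu>)" for c v
  proof -
    have lc: "lin k A A (\<lambda>c'. c \<cdot> c')" by (intro lin_mult_left A_algebra lin_id A_module c)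
    have cb: "bil k (H \<mu>) (H \<nu>) A (\<lambda>x y. c \<cdot> twist \<mu> l x (g y))"
      by (rule bilI[OF bilD(1,2,3)[OF pb] lin_comp[OF lc bil_right[OF pb]] lin_comp[OF lc bil_left[OF pb]]])
    have "c \<cdot> m (t \<otimes>\<^bsub>H (\<mu> \<otimes> \<nu>)\<^esub> v) =
      c \<cdot> lift A (\<lambda>x y. twist \<mu> l x (g y)) (\<Delta> \<mu> \<nu> (t \<otimes>\<^bsub>H (\<mu> \<otimes> \<nu>)\<^esub> v))"
      by (simp only: m[OF H_mult_closed[OF kd t v]])
    also have "\<dots> = lift A (\<lambda>x y. c \<cdot> twist \<mu> l x (g y)) (\<Delta> \<mu> \<nu> (t \<otimes>\<^bsub>H (\<mu> \<otimes> \<nu>)\<^esub> v))"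
      by (rule lin_of_lift[OF lc pb comult_closed[OF k d H_mult_closed[OF kd t v]]])
    also have "\<dots> = lift A (\<lambda>x y. c \<cdot> twist \<mu> l x (g y)) (\<Delta> \<mu> \<nu> t \<otimes>\<^bsub>tensor k (H \<mu>) (H \<nu>)\<^esub> \<Delta> \<mu> \<nu> v)"
      by (simp only: ring_hom_mult[OF comult_hom[OF k d] t v])
    also have "\<dots> = lift A (\<lambda>x y. ?B c v x y) (\<Delta> \<mu> \<nu> t)"
      by (rule lift_tensor_mult[OF H_algebra[OF k] H_algebra[OF d] cb comult_closed[OF k d t] comult_closed[OF k d v]])
    finally show ?thesis .
  qed
  have lm: "lin k (H (\<mu> \<otimes> \<nu>)) A m" by (rule lin_cong[OF product_lin[OF k d l g] m])
  have "twist (\<mu> \<otimes> \<nu>) m t a = lift A (\<lambda>c v. lift A (\<lambda>x y. ?B c v x y) (\<Delta> \<mu> \<nu> t)) (\<rho> (\<mu> \<otimes> \<nu>) a)"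
    unfolding twist_def[of "\<mu> \<otimes> \<nu>"]
    by (rule lift_cong[OF bil_cong[OF twist_bil_inner[OF kd lm t]] coact_closed[OF kd a]]) (simp_all add: prod)
  also have "\<dots> = lift A (\<lambda>x y. lift A (\<lambda>c v. ?B c v x y) (\<rho> (\<mu> \<otimes> \<nu>) a)) (\<Delta> \<mu> \<nu> t)"
    by (rule lift_swap[OF coact_closed[OF kd a] comult_closed[OF k d t] A_module H_module[OF kd] H_module[OF k] H_module[OF d] B1 B2])
  also have "\<dots> = lift A (\<lambda>x y. twist \<mu> l x (twist \<nu> g y a)) (\<Delta> \<mu> \<nu> t)"
  proof (rule lift_cong[OF _ comult_closed[OF k d t]])
    show "bil k (H \<mu>) (H \<nu>) A (\<lambda>x y. twist \<mu> l x (twist \<nu> g y a))"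
      by (rule product_bil[OF k l bil_left[OF twist_bil[OF d g] a]])
  qed (simp add: twist_twist[OF k d l g _ _ a])
  finally show ?thesis .
qed

lemma hom_mult_value:
  assumes "\<alpha> \<Colon> G" "\<beta> \<Colon> G" "h \<Colon> H (inv \<beta> \<otimes> inv \<alpha>)"
  shows "hom_mult \<alpha> \<beta> f g h = lift A (\<lambda>x y. twist (inv \<beta>) g x (f y)) (\<Delta> (inv \<beta>) (inv \<alpha>) h)"
  using assms by (simp add: hom_mult_def G_inv_mult)

lemma hom_mult_closed:
  assumes a: "\<alpha> \<Colon> G" and b: "\<beta> \<Colon> G" and f: "f \<Colon> hom_comp \<alpha>" and g: "g \<Colon> hom_comp \<beta>"
  shows "hom_mult \<alpha> \<beta> f g \<Colon> hom_comp (\<alpha> \<otimes> \<beta>)"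
  unfolding hom_mult_def
  by (rule hom_compI) (use a b product_lin[OF G_inv_closed[OF b] G_inv_closed[OF a] hom_comp_lin[OF b g] hom_comp_lin[OF a f]] in
    \<open>simp_all add: G_inv_mult\<close>)

text \<open>Both sides expand to \<open>twist l x (twist g y (f z))\<close> summed over the threefold
  comultiplication \<open>x \<otimes> y \<otimes> z\<close> of \<open>h\<close>.\<close>

lemma hom_mult_assoc:
  assumes a: "\<alpha> \<Colon> G" and b: "\<beta> \<Colon> G" and c: "\<gamma> \<Colon> G"
    and f: "f \<Colon> hom_comp \<alpha>" and g: "g \<Colon> hom_comp \<beta>" and l: "l \<Colon> hom_comp \<gamma>"
  shows "hom_mult (\<alpha> \<otimes> \<beta>) \<gamma> (hom_mult \<alpha> \<beta> f g) l = hom_mult \<alpha> (\<beta> \<otimes> \<gamma>) f (hom_mult \<beta> \<gamma> g l)"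
proof (rule hom_comp_eqI)
  show "hom_mult (\<alpha> \<otimes> \<beta>) \<gamma> (hom_mult \<alpha> \<beta> f g) l \<Colon> hom_comp (\<alpha> \<otimes> (\<beta> \<otimes> \<gamma>))"
    using hom_mult_closed[OF _ c hom_mult_closed[OF a b f g] l] a b c by (simp add: G_assoc)
  show "hom_mult \<alpha> (\<beta> \<otimes> \<gamma>) f (hom_mult \<beta> \<gamma> g l) \<Colon> hom_comp (\<alpha> \<otimes> (\<beta> \<otimes> \<gamma>))"
    using hom_mult_closed[OF a _ f hom_mult_closed[OF b c g l]] b c by simp
  let ?a = "inv \<alpha>" and ?d = "inv \<beta>" and ?k = "inv \<gamma>"
  have i: "?a \<Colon> G" "?d \<Colon> G" "?k \<Colon> G" using a b c by simp_all
  note fl = hom_comp_lin[OF a f] and gl = hom_comp_lin[OF b g] and ll = hom_comp_lin[OF c l]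
  fix h assume "h \<Colon> H (inv (\<alpha> \<otimes> (\<beta> \<otimes> \<gamma>)))"
  then have h: "h \<Colon> H (?k \<otimes> ?d \<otimes> ?a)" using a b c by (simp add: G_inv_mult)
  have h': "h \<Colon> H (?k \<otimes> (?d \<otimes> ?a))" using h i by (simp add: G_assoc)
  have ab: "\<alpha> \<otimes> \<beta> \<Colon> G" "\<beta> \<otimes> \<gamma> \<Colon> G" "?k \<otimes> ?d \<Colon> G" "?d \<otimes> ?a \<Colon> G" using a b c by simp_all
  let ?t = "\<lambda>x y s. twist ?k l x (twist ?d g y (f s))"
  note dg = product_bil[OF i(2) gl fl]
  have t1: "bil k (H ?k) (H ?d) A (\<lambda>x y. ?t x y s)" if "s \<Colon> H ?a" for s
    by (rule product_bil[OF i(3) ll bil_left[OF dg that]])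
  have t2: "bil k (H ?d) (H ?a) A (\<lambda>y s. ?t x y s)" if x: "x \<Colon> H ?k" for x
    by (rule bilI[OF bilD(1,2,3)[OF dg] lin_comp[OF bil_right[OF twist_bil[OF i(3) ll] x] bil_right[OF dg]]
          lin_comp[OF bil_right[OF twist_bil[OF i(3) ll] x] bil_left[OF dg]]])
  have "hom_mult (\<alpha> \<otimes> \<beta>) \<gamma> (hom_mult \<alpha> \<beta> f g) l h =
    lift A (\<lambda>x r. twist ?k l x (hom_mult \<alpha> \<beta> f g r)) (\<Delta> ?k (?d \<otimes> ?a) h)" (is "?l = _")
    using hom_mult_value[OF ab(1) c, of h] h' a b by (simp add: G_inv_mult)
  also have "\<dots> = lift A (\<lambda>x r. lift A (\<lambda>y s. ?t x y s) (\<Delta> ?d ?a r)) (\<Delta> ?k (?d \<otimes> ?a) h)"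
  proof (rule lift_cong[OF _ comult_closed[OF i(3) ab(4) h']])
    have p: "lin k (H (?d \<otimes> ?a)) A (\<lambda>r. lift A (\<lambda>y s. twist ?d g y (f s)) (\<Delta> ?d ?a r))"
      by (rule product_lin[OF i(2,1) gl fl])
    have e: "twist ?k l x (lift A (\<lambda>y s. twist ?d g y (f s)) (\<Delta> ?d ?a r)) =
       lift A (\<lambda>y s. ?t x y s) (\<Delta> ?d ?a r)" if x: "x \<Colon> H ?k" and r: "r \<Colon> H (?d \<otimes> ?a)" for x r
      by (rule lin_of_lift[OF bil_right[OF twist_bil[OF i(3) ll] x] dg comult_closed[OF i(2,1) r]])
    show "bil k (H ?k) (H (?d \<otimes> ?a)) A (\<lambda>x r. lift A (\<lambda>y s. ?t x y s) (\<Delta> ?d ?a r))"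
      by (rule bil_cong[OF product_bil[OF i(3) ll p]]) (simp add: e)
    show "twist ?k l x (hom_mult \<alpha> \<beta> f g r) = lift A (\<lambda>y s. ?t x y s) (\<Delta> ?d ?a r)"
      if "x \<Colon> H ?k" "r \<Colon> H (?d \<otimes> ?a)" for x r
      using e[OF that] by (simp add: hom_mult_value[OF a b that(2)])
  qed
  also have "\<dots> = lift A (\<lambda>v s. lift A (\<lambda>x y. ?t x y s) (\<Delta> ?k ?d v)) (\<Delta> (?k \<otimes> ?d) ?a h)"
    by (rule comult_coassoc[OF i(3,2,1) h t1 t2, symmetric])
  also have "\<dots> = lift A (\<lambda>v s. twist (?k \<otimes> ?d) (hom_mult \<beta> \<gamma> g l) v (f s)) (\<Delta> (?k \<otimes> ?d) ?a h)"
  proof (rule lift_cong[OF _ comult_closed[OF ab(3) i(1) h]])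
    have m: "lin k (H (?k \<otimes> ?d)) A (hom_mult \<beta> \<gamma> g l)"
      using hom_comp_lin[OF ab(2) hom_mult_closed[OF b c g l]] b c by (simp add: G_inv_mult)
    show "bil k (H (?k \<otimes> ?d)) (H ?a) A (\<lambda>v s. twist (?k \<otimes> ?d) (hom_mult \<beta> \<gamma> g l) v (f s))"
      by (rule product_bil[OF ab(3) m fl])
    show "lift A (\<lambda>x y. ?t x y s) (\<Delta> ?k ?d v) = twist (?k \<otimes> ?d) (hom_mult \<beta> \<gamma> g l) v (f s)"
      if "v \<Colon> H (?k \<otimes> ?d)" "s \<Colon> H ?a" for v s
      by (rule twist_product[OF i(3,2) ll gl that(1) lin_closed[OF fl that(2)] hom_mult_value[OF b c], symmetric])
  qed
  also have "\<dots> = hom_mult \<alpha> (\<beta> \<otimes> \<gamma>) f (hom_mult \<beta> \<gamma> g l) h"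
    using hom_mult_value[OF a ab(2), of h] h b c by (simp add: G_inv_mult)
  finally show "?l = \<dots>" .
qed

lemma hom_unit_lin: "a \<Colon> A \<Longrightarrow> lin k (H \<one>) A (\<lambda>h. \<epsilon> h \<bullet> a)"
  by (rule lin_coeff[OF counit_lin A_module])

lemma hom_base_lin: "a \<Colon> A \<Longrightarrow> lin k (H \<one>) A (hom_base a)"
  by (rule lin_cong[OF hom_unit_lin]) (simp_all add: hom_base_def)

lemma hom_base_closed: "a \<Colon> A \<Longrightarrow> hom_base a \<Colon> hom_comp \<one>"
  unfolding hom_base_def using hom_compI[OF G_one, of "\<lambda>h. \<epsilon> h \<bullet> a"] hom_unit_lin by simp

lemma A_one: "\<one>\<^bsub>A\<^esub> \<Colon> A" by (rule monoid.one_closed[OF ring.is_monoid[OF A_ring]])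

lemma hom_unit_base: "hom_unit = hom_base \<one>\<^bsub>A\<^esub>"
  by (simp add: hom_unit_def hom_base_def)

lemma twist_scaled:
  assumes d: "\<nu> \<Colon> G" and g: "lin k (H \<nu>) A g" and x: "x \<Colon> H \<nu>" and c: "c \<Colon> k" and a: "a \<Colon> A"
  shows "twist \<nu> g x (c \<bullet> a) = c \<bullet> twist \<nu> g x a"
  by (rule lin_smult[OF bil_right[OF twist_bil[OF d g] x] c a])

lemma twist_base:
  assumes b: "b \<Colon> A" and x: "x \<Colon> H \<one>" and a: "a \<Colon> A"
  shows "twist \<one> (hom_base b) x a = \<epsilon> x \<bullet> (a \<cdot> b)"
proof -
  have l: "lin k A A (\<lambda>c. \<epsilon> x \<bullet> (c \<cdot> b))"
    by (intro lin_scale lin_mult_right A_algebra lin_id A_module b counit_closed x)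
  have e: "bil k A (H \<one>) A (\<lambda>c z. \<epsilon> z \<bullet> c)"
    by (intro bilI A_module H_module G_one lin_scale lin_id counit_closed lin_coeff[OF counit_lin])
  have "\<epsilon> x \<bullet> (a \<cdot> b) = \<epsilon> x \<bullet> (lift A (\<lambda>c z. \<epsilon> z \<bullet> c) (\<rho> \<one> a) \<cdot> b)"
    by (simp add: coact_counit a)
  also have "\<dots> = lift A (\<lambda>c z. \<epsilon> x \<bullet> (\<epsilon> z \<bullet> c \<cdot> b)) (\<rho> \<one> a)"
    by (rule lin_of_lift[OF l e coact_closed[OF G_one a]])
  also have "\<dots> = twist \<one> (hom_base b) x a"
    unfolding twist_def
  proof (rule lift_cong[OF twist_bil_inner[OF G_one hom_base_lin[OF b] x] coact_closed[OF G_one a]])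
    fix c z assume c: "c \<Colon> A" and z: "z \<Colon> H \<one>"
    have cb: "c \<cdot> b \<Colon> A" by (rule ring.ring_simprules(5)[OF A_ring c b])
    show "\<epsilon> x \<bullet> (\<epsilon> z \<bullet> c \<cdot> b) = c \<cdot> hom_base b (x \<otimes>\<^bsub>H \<one>\<^esub> z)"
      using c z x b cb counit_closed[OF x] counit_closed[OF z]
      by (simp add: hom_base_def H_mult_closed counit_mult smult_mult_left smult_mult_right smult_assoc1)
  qed
  finally show ?thesis ..
qed

lemma hom_mult_base_right:
  assumes a: "\<alpha> \<Colon> G" and f: "f \<Colon> hom_comp \<alpha>" and b: "b \<Colon> A" and h: "h \<Colon> H (inv \<alpha>)"
  shows "hom_mult \<alpha> \<one> f (hom_base b) h = f h \<cdot> b"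
proof -
  let ?a = "inv \<alpha>"
  have i: "?a \<Colon> G" using a by simp
  note fl = hom_comp_lin[OF a f]
  have d: "\<Delta> \<one> ?a h \<Colon> tensor k (H \<one>) (H ?a)" using comult_closed[OF G_one i] h i by simp
  have l: "lin k (H ?a) A (\<lambda>y. f y \<cdot> b)" by (rule lin_mult_right[OF A_algebra fl b])
  have e: "bil k (H \<one>) (H ?a) (H ?a) (\<lambda>x y. \<epsilon> x \<odot>\<^bsub>H ?a\<^esub> y)"
    by (intro bilI H_module G_one i lin_scale lin_id counit_closed lin_coeff[OF counit_lin])
  have "hom_mult \<alpha> \<one> f (hom_base b) h = lift A (\<lambda>x y. twist \<one> (hom_base b) x (f y)) (\<Delta> \<one> ?a h)"
    using hom_mult_value[OF a G_one, of h] h i by simp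
  also have "\<dots> = lift A (\<lambda>x y. f (\<epsilon> x \<odot>\<^bsub>H ?a\<^esub> y) \<cdot> b) (\<Delta> \<one> ?a h)"
  proof (rule lift_cong[OF _ d])
    show "bil k (H \<one>) (H ?a) A (\<lambda>x y. f (\<epsilon> x \<odot>\<^bsub>H ?a\<^esub> y) \<cdot> b)"
      by (rule bilI[OF bilD(1,2)[OF e] A_module lin_comp[OF l bil_right[OF e]] lin_comp[OF l bil_left[OF e]]])
    fix x y assume x: "x \<Colon> H \<one>" and y: "y \<Colon> H ?a"
    show "twist \<one> (hom_base b) x (f y) = f (\<epsilon> x \<odot>\<^bsub>H ?a\<^esub> y) \<cdot> b"
      using lin_smult[OF l counit_closed[OF x] y] twist_base[OF b x lin_closed[OF fl y]] by simp
  qed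
  also have "\<dots> = f (lift (H ?a) (\<lambda>x y. \<epsilon> x \<odot>\<^bsub>H ?a\<^esub> y) (\<Delta> \<one> ?a h)) \<cdot> b"
    by (rule lin_of_lift[OF l e d, symmetric])
  also have "\<dots> = f h \<cdot> b" by (simp add: counit_left i h)
  finally show ?thesis .
qed

lemma hom_mult_base_left:
  assumes a: "\<alpha> \<Colon> G" and g: "g \<Colon> hom_comp \<alpha>" and b: "b \<Colon> A" and h: "h \<Colon> H (inv \<alpha>)"
  shows "hom_mult \<one> \<alpha> (hom_base b) g h = twist (inv \<alpha>) g h b"
proof -
  let ?a = "inv \<alpha>"
  have i: "?a \<Colon> G" using a by simp
  note gl = hom_comp_lin[OF a g]
  have d: "\<Delta> ?a \<one> h \<Colon> tensor k (H ?a) (H \<one>)" using comult_closed[OF i G_one] h i by simp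
  have l: "lin k (H ?a) A (\<lambda>x. twist ?a g x b)" by (rule bil_left[OF twist_bil[OF i gl] b])
  have e: "bil k (H ?a) (H \<one>) (H ?a) (\<lambda>x y. \<epsilon> y \<odot>\<^bsub>H ?a\<^esub> x)"
    by (intro bilI H_module G_one i lin_scale lin_id counit_closed lin_coeff[OF counit_lin])
  have "hom_mult \<one> \<alpha> (hom_base b) g h = lift A (\<lambda>x y. twist ?a g x (hom_base b y)) (\<Delta> ?a \<one> h)"
    using hom_mult_value[OF G_one a, of h] h i by simp
  also have "\<dots> = lift A (\<lambda>x y. twist ?a g (\<epsilon> y \<odot>\<^bsub>H ?a\<^esub> x) b) (\<Delta> ?a \<one> h)"
  proof (rule lift_cong[OF _ d])
    show "bil k (H ?a) (H \<one>) A (\<lambda>x y. twist ?a g (\<epsilon> y \<odot>\<^bsub>H ?a\<^esub> x) b)"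
      by (rule bilI[OF bilD(1,2)[OF e] A_module lin_comp[OF l bil_right[OF e]] lin_comp[OF l bil_left[OF e]]])
    fix x y assume x: "x \<Colon> H ?a" and y: "y \<Colon> H \<one>"
    show "twist ?a g x (hom_base b y) = twist ?a g (\<epsilon> y \<odot>\<^bsub>H ?a\<^esub> x) b"
      using lin_smult[OF l counit_closed[OF y] x] twist_scaled[OF i gl x counit_closed[OF y] b] y by (simp add: hom_base_def)
  qed
  also have "\<dots> = twist ?a g (lift (H ?a) (\<lambda>x y. \<epsilon> y \<odot>\<^bsub>H ?a\<^esub> x) (\<Delta> ?a \<one> h)) b"
    by (rule lin_of_lift[OF l e d, symmetric])
  also have "\<dots> = twist ?a g h b" by (simp add: counit_right i h)
  finally show ?thesis .
qed

text \<open>The unit \<open>h \<mapsto> \<epsilon>(h) 1\<close> is the image of \<open>1\<close> under the embedding of \<open>A\<close>, so the unit laws are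
  instances of the formulas for products with elements of \<open>A\<close>.\<close>

theorem hom_ring_data: "graded_ring_data G hom_comp hom_mult A hom_unit hom_base"
proof (intro graded_ring_data.intro graded_pairing.intro graded_pairing_axioms.intro graded_ring_data_axioms.intro
    direct_sum_of_groups.intro direct_sum_of_groups_axioms.intro G_group hom_comp_group A_ring
    hom_mult_closed hom_mult_assoc hom_base_closed)
  fix \<alpha> \<beta> x y assume a: "\<alpha> \<Colon> G" and b: "\<beta> \<Colon> G" and x: "x \<Colon> hom_comp \<alpha>" and y: "y \<Colon> hom_comp \<beta>"
  let ?a = "inv \<alpha>" and ?b = "inv \<beta>"
  have ab: "\<alpha> \<otimes> \<beta> \<Colon> G" "?a \<Colon> G" "?b \<Colon> G" using a b by simp_all
  note xl = hom_comp_lin[OF a x] and yl = hom_comp_lin[OF b y]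
  show "hom_mult \<alpha> \<beta> (x \<oplus>\<^bsub>hom_comp \<alpha>\<^esub> x') y = hom_mult \<alpha> \<beta> x y \<oplus>\<^bsub>hom_comp (\<alpha> \<otimes> \<beta>)\<^esub> hom_mult \<alpha> \<beta> x' y"
    if x': "x' \<Colon> hom_comp \<alpha>" for x'
  proof (rule hom_comp_eqI[OF hom_mult_closed[OF a b hom_comp_add[OF a x x'] y]
        hom_comp_add[OF ab(1) hom_mult_closed[OF a b x y] hom_mult_closed[OF a b x' y]]])
    fix h assume h': "h \<Colon> H (inv (\<alpha> \<otimes> \<beta>))"
    then have h: "h \<Colon> H (?b \<otimes> ?a)" using a b by (simp add: G_inv_mult)
    note d = comult_closed[OF ab(3,2) h] and x'l = hom_comp_lin[OF a x']
    have "lift A (\<lambda>u v. twist ?b y u ((x \<oplus>\<^bsub>hom_comp \<alpha>\<^esub> x') v)) (\<Delta> ?b ?a h) =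
      lift A (\<lambda>u v. twist ?b y u (x v) \<oplus>\<^bsub>A\<^esub> twist ?b y u (x' v)) (\<Delta> ?b ?a h)"
      by (rule lift_cong[OF bil_sum[OF product_bil[OF ab(3) yl xl] product_bil[OF ab(3) yl x'l]] d])
        (simp add: hom_comp_simps lin_add[OF bil_right[OF twist_bil[OF ab(3) yl]]] lin_closed[OF xl] lin_closed[OF x'l])
    also have "\<dots> = lift A (\<lambda>u v. twist ?b y u (x v)) (\<Delta> ?b ?a h) \<oplus>\<^bsub>A\<^esub> lift A (\<lambda>u v. twist ?b y u (x' v)) (\<Delta> ?b ?a h)"
      by (rule lift_sum[OF product_bil[OF ab(3) yl xl] product_bil[OF ab(3) yl x'l] d])
    finally show "hom_mult \<alpha> \<beta> (x \<oplus>\<^bsub>hom_comp \<alpha>\<^esub> x') y h = (hom_mult \<alpha> \<beta> x y \<oplus>\<^bsub>hom_comp (\<alpha> \<otimes> \<beta>)\<^esub> hom_mult \<alpha> \<beta> x' y) h"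
      by (simp add: hom_comp_simps(1)[OF h'] hom_mult_value[OF a b h])
  qed
  show "hom_mult \<alpha> \<beta> x (y \<oplus>\<^bsub>hom_comp \<beta>\<^esub> y') = hom_mult \<alpha> \<beta> x y \<oplus>\<^bsub>hom_comp (\<alpha> \<otimes> \<beta>)\<^esub> hom_mult \<alpha> \<beta> x y'"
    if y': "y' \<Colon> hom_comp \<beta>" for y'
  proof (rule hom_comp_eqI[OF hom_mult_closed[OF a b x hom_comp_add[OF b y y']]
        hom_comp_add[OF ab(1) hom_mult_closed[OF a b x y] hom_mult_closed[OF a b x y']]])
    fix h assume h': "h \<Colon> H (inv (\<alpha> \<otimes> \<beta>))"
    then have h: "h \<Colon> H (?b \<otimes> ?a)" using a b by (simp add: G_inv_mult)
    note d = comult_closed[OF ab(3,2) h] and y'l = hom_comp_lin[OF b y']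
      have tw: "twist ?b (y \<oplus>\<^bsub>hom_comp \<beta>\<^esub> y') u v = twist ?b y u v \<oplus>\<^bsub>A\<^esub> twist ?b y' u v"
      if u: "u \<Colon> H ?b" and v: "v \<Colon> A" for u v
    proof -
      note i = twist_bil_inner[OF ab(3) yl u] twist_bil_inner[OF ab(3) y'l u] and r = coact_closed[OF ab(3) v]
      have "twist ?b (y \<oplus>\<^bsub>hom_comp \<beta>\<^esub> y') u v =
        lift A (\<lambda>c z. c \<cdot> y (u \<otimes>\<^bsub>H ?b\<^esub> z) \<oplus>\<^bsub>A\<^esub> c \<cdot> y' (u \<otimes>\<^bsub>H ?b\<^esub> z)) (\<rho> ?b v)"
        unfolding twist_def
        by (rule lift_cong[OF bil_sum[OF i] r])
          (simp add: hom_comp_simps H_mult_closed ab u lin_closed[OF yl] lin_closed[OF y'l] ring.ring_simprules(23)[OF A_ring])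
      also have "\<dots> = twist ?b y u v \<oplus>\<^bsub>A\<^esub> twist ?b y' u v"
        unfolding twist_def by (rule lift_sum[OF i r])
      finally show ?thesis .
    qed
    have "lift A (\<lambda>u v. twist ?b (y \<oplus>\<^bsub>hom_comp \<beta>\<^esub> y') u (x v)) (\<Delta> ?b ?a h) =
      lift A (\<lambda>u v. twist ?b y u (x v) \<oplus>\<^bsub>A\<^esub> twist ?b y' u (x v)) (\<Delta> ?b ?a h)"
      by (rule lift_cong[OF bil_sum[OF product_bil[OF ab(3) yl xl] product_bil[OF ab(3) y'l xl]] d])
        (simp add: tw lin_closed[OF xl])
    also have "\<dots> = lift A (\<lambda>u v. twist ?b y u (x v)) (\<Delta> ?b ?a h) \<oplus>\<^bsub>A\<^esub> lift A (\<lambda>u v. twist ?b y' u (x v)) (\<Delta> ?b ?a h)"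
      by (rule lift_sum[OF product_bil[OF ab(3) yl xl] product_bil[OF ab(3) y'l xl] d])
    finally show "hom_mult \<alpha> \<beta> x (y \<oplus>\<^bsub>hom_comp \<beta>\<^esub> y') h = (hom_mult \<alpha> \<beta> x y \<oplus>\<^bsub>hom_comp (\<alpha> \<otimes> \<beta>)\<^esub> hom_mult \<alpha> \<beta> x y') h"
      by (simp add: hom_comp_simps(1)[OF h'] hom_mult_value[OF a b h])
  qed
  show "hom_mult \<one> \<alpha> hom_unit x = x"
  proof (rule hom_comp_eqI[OF _ x])
    show "hom_mult \<one> \<alpha> hom_unit x \<Colon> hom_comp \<alpha>"
      using hom_mult_closed[OF G_one a hom_base_closed[OF A_one] x] a by (simp add: hom_unit_base)
    show "hom_mult \<one> \<alpha> hom_unit x h = x h" if "h \<Colon> H ?a" for h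
      unfolding hom_unit_base hom_mult_base_left[OF a x A_one that] by (rule twist_one[OF ab(2) xl that])
  qed
  show "hom_mult \<alpha> \<one> x hom_unit = x"
  proof (rule hom_comp_eqI[OF _ x])
    show "hom_mult \<alpha> \<one> x hom_unit \<Colon> hom_comp \<alpha>"
      using hom_mult_closed[OF a G_one x hom_base_closed[OF A_one]] a by (simp add: hom_unit_base)
    show "hom_mult \<alpha> \<one> x hom_unit h = x h" if "h \<Colon> H ?a" for h
      unfolding hom_unit_base hom_mult_base_right[OF a x A_one that]
      by (rule monoid.r_one[OF ring.is_monoid[OF A_ring] lin_closed[OF xl that]])
  qed
next
  show "hom_unit \<Colon> hom_comp \<one>" unfolding hom_unit_base by (intro hom_base_closed A_one)
  show "hom_base \<one>\<^bsub>A\<^esub> = hom_unit" by (simp add: hom_unit_base)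
  fix a b assume a: "a \<Colon> A" and b: "b \<Colon> A"
  have c: "a \<oplus>\<^bsub>A\<^esub> b \<Colon> A" "a \<cdot> b \<Colon> A" using ring.ring_simprules(1,5)[OF A_ring] a b by auto
  show "hom_base (a \<oplus>\<^bsub>A\<^esub> b) = hom_base a \<oplus>\<^bsub>hom_comp \<one>\<^esub> hom_base b"
    by (rule hom_comp_eqI[OF hom_base_closed[OF c(1)] hom_comp_add[OF G_one hom_base_closed[OF a] hom_base_closed[OF b]]])
      (simp add: hom_comp_simps, simp add: hom_base_def smult_r_distr counit_closed a b)
  show "hom_base (a \<cdot> b) = hom_mult \<one> \<one> (hom_base a) (hom_base b)"
  proof (rule hom_comp_eqI[OF hom_base_closed[OF c(2)]])
    show "hom_mult \<one> \<one> (hom_base a) (hom_base b) \<Colon> hom_comp \<one>"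
      using hom_mult_closed[OF G_one G_one hom_base_closed[OF a] hom_base_closed[OF b]] by simp
    fix h assume "h \<Colon> H (inv \<one>)"
    then show "hom_base (a \<cdot> b) h = hom_mult \<one> \<one> (hom_base a) (hom_base b) h"
      using twist_base[OF b _ a, of h] by (simp add: hom_mult_base_left[OF G_one hom_base_closed[OF b] a]) (simp add: hom_base_def)
  qed
qed

end

section \<open>The left dual ring of the coring\<close>

lemma abelian_group_transfer:
  fixes P :: "('p, 'x) ring_scheme" and Q :: "('q, 'y) ring_scheme"
  assumes Q: "abelian_group Q" and f: "bij_betw f (carrier P) (carrier Q)"
    and z: "\<zero>\<^bsub>P\<^esub> \<Colon> P" "f \<zero>\<^bsub>P\<^esub> = \<zero>\<^bsub>Q\<^esub>"
    and c: "\<And>x y. \<lbrakk>x \<Colon> P; y \<Colon> P\<rbrakk> \<Longrightarrow> x \<oplus>\<^bsub>P\<^esub> y \<Colon> P"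
    and a: "\<And>x y. \<lbrakk>x \<Colon> P; y \<Colon> P\<rbrakk> \<Longrightarrow> f (x \<oplus>\<^bsub>P\<^esub> y) = f x \<oplus>\<^bsub>Q\<^esub> f y"
  shows "abelian_group P"
proof -
  interpret Q: abelian_group Q by (rule Q)
  have fc: "f x \<Colon> Q" if "x \<Colon> P" for x using bij_betwE[OF f] that by blast
  have inj: "x = y" if "x \<Colon> P" "y \<Colon> P" "f x = f y" for x y
    using inj_onD[OF bij_betw_imp_inj_on[OF f] that(3,1,2)] .
  show ?thesis
  proof (rule abelian_groupI)
    fix x assume x: "x \<Colon> P"
    obtain y where y: "y \<Colon> P" "f y = \<ominus>\<^bsub>Q\<^esub> f x"
      using bij_betw_imp_surj_on[OF f] Q.a_inv_closed[OF fc[OF x]] by (metis imageE)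
    show "\<exists>y\<in>carrier P. y \<oplus>\<^bsub>P\<^esub> x = \<zero>\<^bsub>P\<^esub>"
      by (rule bexI[OF _ y(1)], rule inj) (simp_all add: c a z x y fc Q.l_neg)
    show "\<zero>\<^bsub>P\<^esub> \<oplus>\<^bsub>P\<^esub> x = x" by (rule inj) (simp_all add: c a z x fc)
    fix y assume y: "y \<Colon> P"
    show "x \<oplus>\<^bsub>P\<^esub> y = y \<oplus>\<^bsub>P\<^esub> x" by (rule inj) (simp_all add: c a x y fc Q.a_comm)
    fix w assume w: "w \<Colon> P"
    show "x \<oplus>\<^bsub>P\<^esub> y \<oplus>\<^bsub>P\<^esub> w = x \<oplus>\<^bsub>P\<^esub> (y \<oplus>\<^bsub>P\<^esub> w)" by (rule inj) (simp_all add: c a x y w fc Q.a_assoc)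
  qed (fact z c)+
qed

lemma (in tensor_factors) additive_of_lift:
  assumes b: "balanced P b" and b': "balanced Q (\<lambda>m n. f (b m n))"
    and f: "\<And>x y. \<lbrakk>x \<Colon> P; y \<Colon> P\<rbrakk> \<Longrightarrow> f (x \<oplus>\<^bsub>P\<^esub> y) = f x \<oplus>\<^bsub>Q\<^esub> f y"
    and t: "t \<Colon> T"
  shows "f (lift P b t) = lift Q (\<lambda>m n. f (b m n)) t"
  using t
proof (induction t rule: tensor_induct)
  case (pure m n)
  then show ?case by (simp add: lift_pure[OF b] lift_pure[OF b'])
next
  case (add s t)
  then show ?case by (simp add: lift_add[OF b] lift_add[OF b'] f lift_closed[OF b])
qed

context module_pair
begin

lemma additive_of_balanced_lift:
  assumes "balanced P b" "bil k M N Q (\<lambda>m n. f (b m n))"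
    and "\<And>x y. \<lbrakk>x \<Colon> P; y \<Colon> P\<rbrakk> \<Longrightarrow> f (x \<oplus>\<^bsub>P\<^esub> y) = f x \<oplus>\<^bsub>Q\<^esub> f y"
    and "t \<Colon> tensor k M N"
  shows "f (lift P b t) = lift Q (\<lambda>m n. f (b m n)) t"
  by (rule additive_of_lift[OF assms(1) bil_balanced[OF assms(2)] assms(3) assms(4)[unfolded tensor_simps(1)]])

end

context comodule_algebra
begin

abbreviation "\<C> \<equiv> comodule_algebra_coring k H \<Delta> \<epsilon> A \<rho>"
abbreviation "AH \<nu> \<equiv> tensor k A (H \<nu>)"

definition left_act where "left_act \<nu> a = lift (AH \<nu>) (\<lambda>b h. pure k A (H \<nu>) (a \<cdot> b) h)"

definition right_act where "right_act \<nu> c a = lift (AH \<nu>) (\<lambda>b h. lift (AH \<nu>)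
  (\<lambda>a' h'. pure k A (H \<nu>) (b \<cdot> a') (h \<otimes>\<^bsub>H \<nu>\<^esub> h')) (\<rho> \<nu> a)) c"

definition coring_comult where
  "coring_comult \<mu> \<nu> = (let T = balanced_tensor A (AH \<mu>) (right_act \<mu>) (AH \<nu>) (left_act \<nu>)
     in lift T (\<lambda>a h. lift T (\<lambda>x y. balanced_pure A (AH \<mu>) (right_act \<mu>) (AH \<nu>) (left_act \<nu>)
           (pure k A (H \<mu>) a x) (pure k A (H \<nu>) \<one>\<^bsub>A\<^esub> y)) (\<Delta> \<mu> \<nu> h)))"

lemma coring_simps:
  "carrier (cgroup \<C> \<nu>) = carrier (AH \<nu>)" "x \<oplus>\<^bsub>cgroup \<C> \<nu>\<^esub> y = x \<oplus>\<^bsub>AH \<nu>\<^esub> y"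
  "lact \<C> \<nu> = left_act \<nu>" "ract \<C> \<nu> = right_act \<nu>" "comult \<C> \<mu> \<nu> = coring_comult \<mu> \<nu>"
  "counit \<C> = lift A (\<lambda>a h. \<epsilon> h \<bullet> a)"
  by (simp_all add: comodule_algebra_coring_def Let_def ring.defs left_act_def[abs_def] right_act_def[abs_def]
      coring_comult_def[abs_def])

lemma AH_module: "\<nu> \<Colon> G \<Longrightarrow> module k (AH \<nu>)"
  by (intro tensor_is_module A_module H_module)

lemma AH_pure_bil: "\<nu> \<Colon> G \<Longrightarrow> bil k A (H \<nu>) (AH \<nu>) (pure k A (H \<nu>))"
  by (intro pure_bil A_module H_module)

lemma A_lin_left: "a \<Colon> A \<Longrightarrow> lin k A A (\<lambda>b. a \<cdot> b)"
  by (intro lin_mult_left A_algebra lin_id A_module)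

lemma A_lin_right: "a \<Colon> A \<Longrightarrow> lin k A A (\<lambda>b. b \<cdot> a)"
  by (intro lin_mult_right A_algebra lin_id A_module)

lemma A_mult_closed: "\<lbrakk>a \<Colon> A; b \<Colon> A\<rbrakk> \<Longrightarrow> a \<cdot> b \<Colon> A"
  by (rule ring.ring_simprules(5)[OF A_ring])

lemma left_act_bil: "\<lbrakk>\<nu> \<Colon> G; a \<Colon> A\<rbrakk> \<Longrightarrow> bil k A (H \<nu>) (AH \<nu>) (\<lambda>b h. pure k A (H \<nu>) (a \<cdot> b) h)"
  by (rule bil_comp[OF AH_pure_bil A_lin_left lin_id[OF H_module]])

lemma left_act_lin: "\<lbrakk>\<nu> \<Colon> G; a \<Colon> A\<rbrakk> \<Longrightarrow> lin k (AH \<nu>) (AH \<nu>) (left_act \<nu> a)"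
  unfolding left_act_def by (rule lin_lift[OF left_act_bil])

lemma left_act_pure: "\<lbrakk>\<nu> \<Colon> G; a \<Colon> A; b \<Colon> A; h \<Colon> H \<nu>\<rbrakk> \<Longrightarrow>
    left_act \<nu> a (pure k A (H \<nu>) b h) = pure k A (H \<nu>) (a \<cdot> b) h"
  unfolding left_act_def by (rule lift_pure[OF left_act_bil])

text \<open>Left \<open>A\<close>-linear maps on \<open>A \<otimes> H\<close> are determined by their values on \<open>1 \<otimes> h\<close>.\<close>

definition extend_hom where
  "extend_hom \<nu> f = (\<lambda>c\<in>carrier (AH \<nu>). lift A (\<lambda>a h. a \<cdot> f h) c)"

lemma extend_bil: "\<lbrakk>\<nu> \<Colon> G; lin k (H \<nu>) A f\<rbrakk> \<Longrightarrow> bil k A (H \<nu>) A (\<lambda>a h. a \<cdot> f h)"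
  by (rule bilI[OF A_module H_module A_module lin_mult_left[OF A_algebra] A_lin_right]) (simp_all add: lin_closed)

lemma extend_lin: "\<lbrakk>\<nu> \<Colon> G; lin k (H \<nu>) A f\<rbrakk> \<Longrightarrow> lin k (AH \<nu>) A (extend_hom \<nu> f)"
  by (rule lin_cong[OF lin_lift[OF extend_bil]]) (simp_all add: extend_hom_def)

lemma extend_pure: "\<lbrakk>\<nu> \<Colon> G; lin k (H \<nu>) A f; a \<Colon> A; h \<Colon> H \<nu>\<rbrakk> \<Longrightarrow>
    extend_hom \<nu> f (pure k A (H \<nu>) a h) = a \<cdot> f h"
  by (simp add: extend_hom_def pure_closed A_module H_module lift_pure[OF extend_bil])

definition left_homs where "left_homs \<nu> = {F. lin k (AH \<nu>) A F \<and> F \<in> extensional (carrier (AH \<nu>)) \<and>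
   (\<forall>a\<in>carrier A. \<forall>x\<in>carrier (AH \<nu>). F (left_act \<nu> a x) = a \<cdot> F x)}"

lemma left_act_scalar:
  assumes d: "\<nu> \<Colon> G" and c: "c \<Colon> k" and t: "t \<Colon> AH \<nu>"
  shows "left_act \<nu> (c \<bullet> \<one>\<^bsub>A\<^esub>) t = c \<odot>\<^bsub>AH \<nu>\<^esub> t"
proof -
  have c1: "c \<bullet> \<one>\<^bsub>A\<^esub> \<Colon> A" by (rule module.smult_closed[OF A_module c A_one])
  show ?thesis
  proof (rule lin_tensor_eqI[OF left_act_lin[OF d c1] lin_scale[OF lin_id[OF AH_module[OF d]] c] A_module H_module[OF d] _ t])
    fix b h assume b: "b \<Colon> A" and h: "h \<Colon> H \<nu>"
    have "c \<bullet> \<one>\<^bsub>A\<^esub> \<cdot> b = c \<bullet> b"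
      using c b A_one by (simp add: smult_mult_left monoid.l_one[OF ring.is_monoid[OF A_ring]])
    then show "left_act \<nu> (c \<bullet> \<one>\<^bsub>A\<^esub>) (pure k A (H \<nu>) b h) = c \<odot>\<^bsub>AH \<nu>\<^esub> pure k A (H \<nu>) b h"
      by (simp add: left_act_pure d c1 b h lin_smult[OF bil_left[OF AH_pure_bil[OF d] h] c b])
  qed
qed

lemma left_hom_carrier:
  assumes d: "\<nu> \<Colon> G"
  shows "carrier (left_hom A (cgroup \<C> \<nu>) (lact \<C> \<nu>)) = left_homs \<nu>"
proof (intro equalityI subsetI)
  fix F assume F: "F \<Colon> left_hom A (cgroup \<C> \<nu>) (lact \<C> \<nu>)"
  have FD: "F \<in> carrier (AH \<nu>) \<rightarrow>\<^sub>E carrier A"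
    "\<forall>x\<in>carrier (AH \<nu>). \<forall>y\<in>carrier (AH \<nu>). F (x \<oplus>\<^bsub>AH \<nu>\<^esub> y) = F x \<oplus>\<^bsub>A\<^esub> F y"
    "\<forall>a\<in>carrier A. \<forall>x\<in>carrier (AH \<nu>). F (left_act \<nu> a x) = a \<cdot> F x"
    using F by (simp_all add: left_hom_def coring_simps)
  have "lin k (AH \<nu>) A F"
  proof (rule linI[OF AH_module[OF d] A_module])
    fix c t assume c: "c \<Colon> k" and t: "t \<Colon> AH \<nu>"
    have c1: "c \<bullet> \<one>\<^bsub>A\<^esub> \<Colon> A" by (rule module.smult_closed[OF A_module c A_one])
    have Ft: "F t \<Colon> A" using FD(1) t by (rule PiE_mem)
    have "F (c \<odot>\<^bsub>AH \<nu>\<^esub> t) = (c \<bullet> \<one>\<^bsub>A\<^esub>) \<cdot> F t"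
      using FD(3) c1 t by (simp add: left_act_scalar[OF d c t, symmetric])
    then show "F (c \<odot>\<^bsub>AH \<nu>\<^esub> t) = c \<bullet> F t"
      using c Ft A_one by (simp add: smult_mult_left monoid.l_one[OF ring.is_monoid[OF A_ring]])
  qed (use FD in \<open>auto simp: PiE_iff\<close>)
  then show "F \<in> left_homs \<nu>" using FD by (simp add: left_homs_def PiE_iff)
next
  fix F assume "F \<in> left_homs \<nu>"
  then show "F \<Colon> left_hom A (cgroup \<C> \<nu>) (lact \<C> \<nu>)"
    by (auto simp: left_hom_def coring_simps left_homs_def PiE_iff lin_closed lin_add)
qed

lemma left_homsD:
  assumes "F \<in> left_homs \<nu>"
  shows "lin k (AH \<nu>) A F" "F \<in> extensional (carrier (AH \<nu>))"
    "\<lbrakk>a \<Colon> A; x \<Colon> AH \<nu>\<rbrakk> \<Longrightarrow> F (left_act \<nu> a x) = a \<cdot> F x"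
  using assms by (auto simp: left_homs_def)

lemma extend_left_hom:
  assumes d: "\<nu> \<Colon> G" and f: "lin k (H \<nu>) A f"
  shows "extend_hom \<nu> f \<in> left_homs \<nu>"
  unfolding left_homs_def
proof (intro CollectI conjI ballI extend_lin[OF d f])
  fix a x assume a: "a \<Colon> A" and x: "x \<Colon> AH \<nu>"
  show "extend_hom \<nu> f (left_act \<nu> a x) = a \<cdot> extend_hom \<nu> f x"
    by (rule lin_tensor_eqI[OF lin_comp[OF extend_lin[OF d f] left_act_lin[OF d a]] lin_mult_left[OF A_algebra extend_lin[OF d f] a]
       A_module H_module[OF d] _ x])
      (simp add: left_act_pure extend_pure d f a A_mult_closed A_assoc lin_closed[OF f])
qed (simp add: extend_hom_def)

definition at_unit where
  "at_unit \<nu> F = (\<lambda>h\<in>carrier (H \<nu>). F (pure k A (H \<nu>) \<one>\<^bsub>A\<^esub> h))"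

lemma restriction_lin: "\<lbrakk>\<nu> \<Colon> G; F \<in> left_homs \<nu>\<rbrakk> \<Longrightarrow> lin k (H \<nu>) A (\<lambda>h. F (pure k A (H \<nu>) \<one>\<^bsub>A\<^esub> h))"
  by (rule lin_comp[OF left_homsD(1) lin_pure_right[OF lin_id[OF H_module] A_module A_one]])

lemma restriction_lin': "\<lbrakk>\<nu> \<Colon> G; F \<in> left_homs \<nu>\<rbrakk> \<Longrightarrow> lin k (H \<nu>) A (at_unit \<nu> F)"
  by (rule lin_cong[OF restriction_lin]) (simp_all add: at_unit_def)

lemma extend_restriction:
  assumes d: "\<nu> \<Colon> G" and F: "F \<in> left_homs \<nu>"
  shows "extend_hom \<nu> (at_unit \<nu> F) = F"
proof (rule extensionalityI[OF _ left_homsD(2)[OF F]])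
  fix x assume x: "x \<Colon> AH \<nu>"
  show "extend_hom \<nu> (at_unit \<nu> F) x = F x"
  proof (rule lin_tensor_eqI[OF extend_lin[OF d restriction_lin'[OF d F]] left_homsD(1)[OF F] A_module H_module[OF d] _ x])
    fix a h assume a: "a \<Colon> A" and h: "h \<Colon> H \<nu>"
    have "F (pure k A (H \<nu>) a h) = F (left_act \<nu> a (pure k A (H \<nu>) \<one>\<^bsub>A\<^esub> h))"
      using a by (simp add: left_act_pure d h A_one monoid.r_one[OF ring.is_monoid[OF A_ring]])
    also have "\<dots> = a \<cdot> F (pure k A (H \<nu>) \<one>\<^bsub>A\<^esub> h)"
      by (rule left_homsD(3)[OF F a pure_closed[OF A_module H_module[OF d] A_one h]])
    finally show "extend_hom \<nu> (at_unit \<nu> F) (pure k A (H \<nu>) a h) = F (pure k A (H \<nu>) a h)"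
      unfolding extend_pure[OF d restriction_lin'[OF d F] a h] using h by (simp add: at_unit_def)
  qed
qed (simp add: extend_hom_def)

lemma restriction_extend:
  assumes d: "\<nu> \<Colon> G" and f: "lin k (H \<nu>) A f" and h: "h \<Colon> H \<nu>"
  shows "at_unit \<nu> (extend_hom \<nu> f) h = f h"
  using h lin_closed[OF f h] by (simp add: at_unit_def extend_pure d f A_one monoid.l_one[OF ring.is_monoid[OF A_ring]])

subsection \<open>The product of the left dual ring\<close>

lemma right_act_inner:
  assumes d: "\<nu> \<Colon> G" and b: "b \<Colon> A" and h: "h \<Colon> H \<nu>"
  shows "bil k A (H \<nu>) (AH \<nu>) (\<lambda>a' h'. pure k A (H \<nu>) (b \<cdot> a') (h \<otimes>\<^bsub>H \<nu>\<^esub> h'))"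
  by (rule bil_comp[OF AH_pure_bil[OF d] A_lin_left[OF b] H_lin_left[OF d h]])

lemma right_act_bil:
  assumes d: "\<nu> \<Colon> G" and a: "a \<Colon> A"
  shows "bil k A (H \<nu>) (AH \<nu>) (\<lambda>b h. lift (AH \<nu>) (\<lambda>a' h'. pure k A (H \<nu>) (b \<cdot> a') (h \<otimes>\<^bsub>H \<nu>\<^esub> h')) (\<rho> \<nu> a))"
proof (rule bilI[OF A_module H_module[OF d] AH_module[OF d]])
  fix b assume b: "b \<Colon> A"
  show "lin k (H \<nu>) (AH \<nu>) (\<lambda>h. lift (AH \<nu>) (\<lambda>a' h'. pure k A (H \<nu>) (b \<cdot> a') (h \<otimes>\<^bsub>H \<nu>\<^esub> h')) (\<rho> \<nu> a))"
    by (rule lin_lift_param[OF H_module[OF d] coact_closed[OF d a] right_act_inner[OF d b]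
       lin_pure_right[OF H_lin_right[OF d] A_module A_mult_closed[OF b]]])
next
  fix h assume h: "h \<Colon> H \<nu>"
  show "lin k A (AH \<nu>) (\<lambda>b. lift (AH \<nu>) (\<lambda>a' h'. pure k A (H \<nu>) (b \<cdot> a') (h \<otimes>\<^bsub>H \<nu>\<^esub> h')) (\<rho> \<nu> a))"
    by (rule lin_lift_param[OF A_module coact_closed[OF d a] right_act_inner[OF d _ h]
       lin_pure_left[OF A_lin_right H_module[OF d] H_mult_closed[OF d h]]])
qed

lemma right_act_lin: "\<lbrakk>\<nu> \<Colon> G; a \<Colon> A\<rbrakk> \<Longrightarrow> lin k (AH \<nu>) (AH \<nu>) (\<lambda>c. right_act \<nu> c a)"
  unfolding right_act_def by (rule lin_lift[OF right_act_bil])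

lemma right_act_pure: "\<lbrakk>\<nu> \<Colon> G; a \<Colon> A; b \<Colon> A; h \<Colon> H \<nu>\<rbrakk> \<Longrightarrow>
   right_act \<nu> (pure k A (H \<nu>) b h) a = lift (AH \<nu>) (\<lambda>a' h'. pure k A (H \<nu>) (b \<cdot> a') (h \<otimes>\<^bsub>H \<nu>\<^esub> h')) (\<rho> \<nu> a)"
  unfolding right_act_def by (rule lift_pure[OF right_act_bil])

lemma extend_right_act_pure:
  assumes d: "\<nu> \<Colon> G" and g: "lin k (H \<nu>) A g" and a: "a \<Colon> A" and b: "b \<Colon> A" and h: "h \<Colon> H \<nu>"
  shows "extend_hom \<nu> g (right_act \<nu> (pure k A (H \<nu>) b h) a) = b \<cdot> twist \<nu> g h a"
proof -
  have "extend_hom \<nu> g (right_act \<nu> (pure k A (H \<nu>) b h) a) =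
    lift A (\<lambda>a' h'. extend_hom \<nu> g (pure k A (H \<nu>) (b \<cdot> a') (h \<otimes>\<^bsub>H \<nu>\<^esub> h'))) (\<rho> \<nu> a)"
    unfolding right_act_pure[OF d a b h]
    by (rule lin_of_lift[OF extend_lin[OF d g] right_act_inner[OF d b h] coact_closed[OF d a]])
  also have "\<dots> = lift A (\<lambda>a' h'. b \<cdot> (a' \<cdot> g (h \<otimes>\<^bsub>H \<nu>\<^esub> h'))) (\<rho> \<nu> a)"
  proof (rule lift_cong[OF _ coact_closed[OF d a]])
    note i = twist_bil_inner[OF d g h]
    show "bil k A (H \<nu>) A (\<lambda>a' h'. b \<cdot> (a' \<cdot> g (h \<otimes>\<^bsub>H \<nu>\<^esub> h')))"
      by (rule bilI[OF bilD(1-3)[OF i] lin_comp[OF A_lin_left[OF b] bil_right[OF i]] lin_comp[OF A_lin_left[OF b] bil_left[OF i]]])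
    fix a' h' assume "a' \<Colon> A" "h' \<Colon> H \<nu>"
    then show "extend_hom \<nu> g (pure k A (H \<nu>) (b \<cdot> a') (h \<otimes>\<^bsub>H \<nu>\<^esub> h')) = b \<cdot> (a' \<cdot> g (h \<otimes>\<^bsub>H \<nu>\<^esub> h'))"
      using b h lin_closed[OF g] by (simp add: extend_pure d g A_mult_closed H_mult_closed A_assoc)
  qed
  also have "\<dots> = b \<cdot> twist \<nu> g h a"
    unfolding twist_def by (rule lin_of_lift[OF A_lin_left[OF b] twist_bil_inner[OF d g h] coact_closed[OF d a], symmetric])
  finally show ?thesis .
qed

lemma extend_right_act_mult:
  assumes d: "\<nu> \<Colon> G" and g: "lin k (H \<nu>) A g" and a: "a \<Colon> A" and b: "b \<Colon> A" and x: "x \<Colon> AH \<nu>"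
  shows "extend_hom \<nu> g (right_act \<nu> (right_act \<nu> x a) b) = extend_hom \<nu> g (right_act \<nu> x (a \<cdot> b))"
proof (rule lin_tensor_eqI[OF _ _ A_module H_module[OF d] _ x])
  note e = extend_lin[OF d g] and ra = right_act_lin[OF d]
  show "lin k (AH \<nu>) A (\<lambda>x. extend_hom \<nu> g (right_act \<nu> (right_act \<nu> x a) b))"
    by (rule lin_comp[OF lin_comp[OF e ra[OF b]] ra[OF a]])
  show "lin k (AH \<nu>) A (\<lambda>x. extend_hom \<nu> g (right_act \<nu> x (a \<cdot> b)))"
    by (rule lin_comp[OF e ra[OF A_mult_closed[OF a b]]])
  fix c h assume c: "c \<Colon> A" and h: "h \<Colon> H \<nu>"
  have i: "bil k A (H \<nu>) A (\<lambda>a' h'. a' \<cdot> twist \<nu> g (h \<otimes>\<^bsub>H \<nu>\<^esub> h') b)"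
    by (rule extend_bil[OF d lin_comp[OF bil_left[OF twist_bil[OF d g] b] H_lin_left[OF d h]]])
  have "extend_hom \<nu> g (right_act \<nu> (right_act \<nu> (pure k A (H \<nu>) c h) a) b) =
    lift A (\<lambda>a' h'. extend_hom \<nu> g (right_act \<nu> (pure k A (H \<nu>) (c \<cdot> a') (h \<otimes>\<^bsub>H \<nu>\<^esub> h')) b)) (\<rho> \<nu> a)" (is "?l = _")
    unfolding right_act_pure[OF d a c h]
    by (rule lin_of_lift[OF lin_comp[OF e ra[OF b]] right_act_inner[OF d c h] coact_closed[OF d a]])
  also have "\<dots> = lift A (\<lambda>a' h'. c \<cdot> (a' \<cdot> twist \<nu> g (h \<otimes>\<^bsub>H \<nu>\<^esub> h') b)) (\<rho> \<nu> a)"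
  proof (rule lift_cong[OF _ coact_closed[OF d a]])
    show "bil k A (H \<nu>) A (\<lambda>a' h'. c \<cdot> (a' \<cdot> twist \<nu> g (h \<otimes>\<^bsub>H \<nu>\<^esub> h') b))"
      by (rule bilI[OF bilD(1-3)[OF i] lin_comp[OF A_lin_left[OF c] bil_right[OF i]] lin_comp[OF A_lin_left[OF c] bil_left[OF i]]])
    fix a' h' assume a': "a' \<Colon> A" and h': "h' \<Colon> H \<nu>"
    note hh = H_mult_closed[OF d h h']
    show "extend_hom \<nu> g (right_act \<nu> (pure k A (H \<nu>) (c \<cdot> a') (h \<otimes>\<^bsub>H \<nu>\<^esub> h')) b) = c \<cdot> (a' \<cdot> twist \<nu> g (h \<otimes>\<^bsub>H \<nu>\<^esub> h') b)"
      by (simp add: extend_right_act_pure[OF d g b A_mult_closed[OF c a'] hh] A_assoc[OF c a' twist_closed[OF d g hh b]])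
  qed
  also have "\<dots> = c \<cdot> twist \<nu> g h (a \<cdot> b)"
    unfolding twist_mult[OF d g h a b]
    by (rule lin_of_lift[OF A_lin_left[OF c] i coact_closed[OF d a], symmetric])
  also have "\<dots> = extend_hom \<nu> g (right_act \<nu> (pure k A (H \<nu>) c h) (a \<cdot> b))"
    by (rule extend_right_act_pure[OF d g A_mult_closed[OF a b] c h, symmetric])
  finally show "?l = \<dots>" .
qed

lemma right_act_scalar:
  assumes d: "\<nu> \<Colon> G" and c: "c \<Colon> k" and b: "b \<Colon> A" and h: "h \<Colon> H \<nu>"
  shows "right_act \<nu> (pure k A (H \<nu>) b h) (c \<bullet> \<one>\<^bsub>A\<^esub>) = pure k A (H \<nu>) b (c \<odot>\<^bsub>H \<nu>\<^esub> h)"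
proof -
  interpret Hd: k_algebra k "H \<nu>" by (rule H_algebra[OF d])
  have c1: "c \<bullet> \<one>\<^bsub>A\<^esub> \<Colon> A" by (rule module.smult_closed[OF A_module c A_one])
  have r: "\<rho> \<nu> (c \<bullet> \<one>\<^bsub>A\<^esub>) = pure k A (H \<nu>) (c \<bullet> \<one>\<^bsub>A\<^esub>) \<one>\<^bsub>H \<nu>\<^esub>"
    using lin_smult[OF coact_lin[OF d] c A_one] lin_smult[OF bil_left[OF AH_pure_bil[OF d] Hd.one_closed] c A_one]
    by (simp add: coact_one d)
  have "right_act \<nu> (pure k A (H \<nu>) b h) (c \<bullet> \<one>\<^bsub>A\<^esub>) = pure k A (H \<nu>) (b \<cdot> (c \<bullet> \<one>\<^bsub>A\<^esub>)) (h \<otimes>\<^bsub>H \<nu>\<^esub> \<one>\<^bsub>H \<nu>\<^esub>)"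
    by (simp add: right_act_pure[OF d c1 b h] r lift_pure[OF right_act_inner[OF d b h]] c1)
  also have "\<dots> = pure k A (H \<nu>) (c \<bullet> b) h"
    using smult_mult_right[OF c b A_one] h monoid.r_one[OF ring.is_monoid[OF A_ring] b] by simp
  also have "\<dots> = pure k A (H \<nu>) b (c \<odot>\<^bsub>H \<nu>\<^esub> h)"
    by (simp add: lin_smult[OF bil_left[OF AH_pure_bil[OF d] h] c b] lin_smult[OF bil_right[OF AH_pure_bil[OF d] b] c h])
  finally show ?thesis .
qed

text \<open>The comultiplication of the coring lives over \<open>A\<close> but is assembled from
  \<open>\<Delta>\<close>, which lives over \<open>k\<close>.  The intermediate maps have values in the
  tensor product over \<open>A\<close>, a mere abelian group, so they are treated as balanced rather than
  bilinear.\<close>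

lemma lift_coring_comult:
  assumes k: "\<mu> \<Colon> G" and d: "\<nu> \<Colon> G" and c: "c \<Colon> AH (\<mu> \<otimes> \<nu>)"
    and th: "bil k (AH \<mu>) (AH \<nu>) A \<Theta>"
    and bal: "\<And>x a y. \<lbrakk>x \<Colon> AH \<mu>; a \<Colon> A; y \<Colon> AH \<nu>\<rbrakk> \<Longrightarrow>
      \<Theta> (right_act \<mu> x a) y = \<Theta> x (left_act \<nu> a y)"
  shows "lift A (\<lambda>x y. \<Theta> x y) (coring_comult \<mu> \<nu> c) =
    lift A (\<lambda>a h. lift A (\<lambda>x y. \<Theta> (pure k A (H \<mu>) a x) (pure k A (H \<nu>) \<one>\<^bsub>A\<^esub> y)) (\<Delta> \<mu> \<nu> h)) c"
proof -
  have kd: "\<mu> \<otimes> \<nu> \<Colon> G" using k d by simp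
  interpret Mk: module k "AH \<mu>" by (rule AH_module[OF k])
  interpret Md: module k "AH \<nu>" by (rule AH_module[OF d])
  interpret B: tensor_factors "AH \<mu>" "AH \<nu>" A "right_act \<mu>" "left_act \<nu>"
    by unfold_locales (simp_all add: lin_closed[OF right_act_lin[OF k]] lin_closed[OF left_act_lin[OF d]])
  interpret U: module_pair k "H \<mu>" "H \<nu>" by (intro module_pair.intro H_module k d)
  interpret V: module_pair k A "H (\<mu> \<otimes> \<nu>)" by (intro module_pair.intro A_module H_module kd)
  let ?b = "\<lambda>a x y. B.bpure (pure k A (H \<mu>) a x) (pure k A (H \<nu>) \<one>\<^bsub>A\<^esub> y)"
  let ?q = "\<lambda>a x y. \<Theta> (pure k A (H \<mu>) a x) (pure k A (H \<nu>) \<one>\<^bsub>A\<^esub> y)"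
  let ?inner = "\<lambda>a t. tensor_lift B.T (\<lambda>(x, y). ?b a x y) t"
  let ?th = "\<lambda>u. lift A (\<lambda>x y. \<Theta> x y) u"
  note pk = AH_pure_bil[OF k] and pd = AH_pure_bil[OF d] and o = A_one
  have tb: "B.balanced A \<Theta>"
    unfolding B.balanced_def
    by (intro conjI ballI ring.is_abelian_group[OF A_ring] bal bil_closed[OF th] lin_add[OF bil_left[OF th]] lin_add[OF bil_right[OF th]])
  have b1: "U.balanced B.T (?b a)" if a: "a \<Colon> A" for a
    unfolding U.balanced_def
  proof (intro conjI ballI B.abelian_T)
    fix x x' y assume x: "x \<Colon> H \<mu>" "x' \<Colon> H \<mu>" and y: "y \<Colon> H \<nu>"
    show "?b a x y \<Colon> B.T" by (intro B.bpure_closed bil_closed[OF pk] bil_closed[OF pd] a x y o)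
    show "?b a (x \<oplus>\<^bsub>H \<mu>\<^esub> x') y = ?b a x y \<oplus>\<^bsub>B.T\<^esub> ?b a x' y"
      by (simp only: lin_add[OF bil_right[OF pk a] x] B.bpure_add_left bil_closed[OF pk] bil_closed[OF pd] a x y o)
  next
    fix x y y' assume x: "x \<Colon> H \<mu>" and y: "y \<Colon> H \<nu>" "y' \<Colon> H \<nu>"
    show "?b a x (y \<oplus>\<^bsub>H \<nu>\<^esub> y') = ?b a x y \<oplus>\<^bsub>B.T\<^esub> ?b a x y'"
      by (simp only: lin_add[OF bil_right[OF pd o] y] B.bpure_add_right bil_closed[OF pk] bil_closed[OF pd] a x y o)
  next
    fix x c y assume x: "x \<Colon> H \<mu>" and c: "c \<Colon> k" and y: "y \<Colon> H \<nu>"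
    have c1: "c \<bullet> \<one>\<^bsub>A\<^esub> \<Colon> A" by (rule module.smult_closed[OF A_module c o])
    have "?b a (c \<odot>\<^bsub>H \<mu>\<^esub> x) y = B.bpure (right_act \<mu> (pure k A (H \<mu>) a x) (c \<bullet> \<one>\<^bsub>A\<^esub>)) (pure k A (H \<nu>) \<one>\<^bsub>A\<^esub> y)" (is "?l = _")
      by (simp only: right_act_scalar[OF k c a x])
    also have "\<dots> = B.bpure (pure k A (H \<mu>) a x) (left_act \<nu> (c \<bullet> \<one>\<^bsub>A\<^esub>) (pure k A (H \<nu>) \<one>\<^bsub>A\<^esub> y))"
      by (rule B.bpure_balanced[OF bil_closed[OF pk a x] c1 bil_closed[OF pd o y]])
    also have "\<dots> = ?b a x (c \<odot>\<^bsub>H \<nu>\<^esub> y)"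
      by (simp only: left_act_scalar[OF d c bil_closed[OF pd o y]] lin_smult[OF bil_right[OF pd o] c y])
    finally show "?l = \<dots>" .
  qed
  have ic: "?inner a t \<Colon> B.T" if "a \<Colon> A" "t \<Colon> tensor k (H \<mu>) (H \<nu>)" for a t
    by (rule U.balanced_lift_closed[OF b1[OF that(1)] that(2)])
  interpret HH: module k "tensor k (H \<mu>) (H \<nu>)" by (rule U.tensor_module)
  have ia: "?inner (a \<oplus>\<^bsub>A\<^esub> a') t = ?inner a t \<oplus>\<^bsub>B.T\<^esub> ?inner a' t"
    if a: "a \<Colon> A" "a' \<Colon> A" and t: "t \<Colon> tensor k (H \<mu>) (H \<nu>)" for a a' t
    using H_module[OF k] H_module[OF d] t
  proof (induction t rule: k_tensor_induct)
    case (pure x y)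
    have aa: "a \<oplus>\<^bsub>A\<^esub> a' \<Colon> A" by (rule ring.ring_simprules(1)[OF A_ring a])
    show ?case
      by (simp only: U.balanced_lift_pure[OF b1 pure] a aa lin_add[OF bil_left[OF pk pure(1)] a] B.bpure_add_left
          bil_closed[OF pk] bil_closed[OF pd] pure o)
  next
    case (add s t)
    have aa: "a \<oplus>\<^bsub>A\<^esub> a' \<Colon> A" by (rule ring.ring_simprules(1)[OF A_ring a])
    show ?case
      by (simp add: U.balanced_lift_add[OF b1] add a aa ic B.T.a_ac)
  qed
  have ib: "?inner (c \<bullet> a) t = ?inner a (c \<odot>\<^bsub>tensor k (H \<mu>) (H \<nu>)\<^esub> t)"
    if a: "a \<Colon> A" and c: "c \<Colon> k" and t: "t \<Colon> tensor k (H \<mu>) (H \<nu>)" for a c t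
    using H_module[OF k] H_module[OF d] t
  proof (induction t rule: k_tensor_induct)
    case (pure x y)
    have ca: "c \<bullet> a \<Colon> A" by (rule module.smult_closed[OF A_module c a])
    show ?case
      by (simp only: U.smult_pure[OF c pure] U.balanced_lift_pure[OF b1] a ca pure U.M.smult_closed c
         lin_smult[OF bil_left[OF pk pure(1)] c a] lin_smult[OF bil_right[OF pk a] c pure(1)])
  next
    case (add s t)
    have ca: "c \<bullet> a \<Colon> A" by (rule module.smult_closed[OF A_module c a])
    show ?case
      by (simp add: U.balanced_lift_add[OF b1] add a ca c HH.smult_r_distr)
  qed
  note D = comult_closed[OF k d] and Dl = comult_lin[OF k d]
  have b2: "V.balanced B.T (\<lambda>a h. ?inner a (\<Delta> \<mu> \<nu> h))"
    unfolding V.balanced_def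
  proof (intro conjI ballI B.abelian_T)
    show "?inner a (\<Delta> \<mu> \<nu> h) \<Colon> B.T" if "a \<Colon> A" "h \<Colon> H (\<mu> \<otimes> \<nu>)" for a h
      by (rule ic[OF that(1) D[OF that(2)]])
    show "?inner (a \<oplus>\<^bsub>A\<^esub> a') (\<Delta> \<mu> \<nu> h) = ?inner a (\<Delta> \<mu> \<nu> h) \<oplus>\<^bsub>B.T\<^esub> ?inner a' (\<Delta> \<mu> \<nu> h)"
      if "a \<Colon> A" "a' \<Colon> A" "h \<Colon> H (\<mu> \<otimes> \<nu>)" for a a' h
      by (rule ia[OF that(1,2) D[OF that(3)]])
    show "?inner a (\<Delta> \<mu> \<nu> (h \<oplus>\<^bsub>H (\<mu> \<otimes> \<nu>)\<^esub> h')) = ?inner a (\<Delta> \<mu> \<nu> h) \<oplus>\<^bsub>B.T\<^esub> ?inner a (\<Delta> \<mu> \<nu> h')"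
      if "a \<Colon> A" "h \<Colon> H (\<mu> \<otimes> \<nu>)" "h' \<Colon> H (\<mu> \<otimes> \<nu>)" for a h h'
      unfolding lin_add[OF Dl that(2,3)] by (rule U.balanced_lift_add[OF b1[OF that(1)] D[OF that(2)] D[OF that(3)]])
    show "?inner (c \<bullet> a) (\<Delta> \<mu> \<nu> h) = ?inner a (\<Delta> \<mu> \<nu> (c \<odot>\<^bsub>H (\<mu> \<otimes> \<nu>)\<^esub> h))"
      if "a \<Colon> A" "c \<Colon> k" "h \<Colon> H (\<mu> \<otimes> \<nu>)" for a c h
      unfolding lin_smult[OF Dl that(2,3)] by (rule ib[OF that(1,2) D[OF that(3)]])
  qed
  have tpa: "?th (u \<oplus>\<^bsub>B.T\<^esub> v) = ?th u \<oplus>\<^bsub>A\<^esub> ?th v" if "u \<Colon> B.T" "v \<Colon> B.T" for u v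
    by (rule B.lift_add[OF tb that])
  have tp: "?th (?b a x y) = ?q a x y"
    if "a \<Colon> A" "x \<Colon> H \<mu>" "y \<Colon> H \<nu>" for a x y
    by (rule B.lift_pure[OF tb bil_closed[OF pk that(1,2)] bil_closed[OF pd o that(3)]])
  have c1: "bil k (H \<mu>) (H \<nu>) A (\<lambda>x y. ?q a x y)" if a: "a \<Colon> A" for a
    by (rule bil_comp[OF th bil_right[OF pk a] bil_right[OF pd o]])
  have t1: "?th (?inner a t) = lift A (\<lambda>x y. ?q a x y) t"
    if a: "a \<Colon> A" and t: "t \<Colon> tensor k (H \<mu>) (H \<nu>)" for a t
  proof -
    have "?th (?inner a t) = lift A (\<lambda>x y. ?th (?b a x y)) t"
      by (rule U.additive_of_balanced_lift[OF b1[OF a] bil_cong[OF c1[OF a] tp[OF a]] tpa t])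
    also have "\<dots> = lift A (\<lambda>x y. ?q a x y) t"
      by (rule lift_cong[OF c1[OF a] t tp[OF a]])
    finally show ?thesis .
  qed
  have c2: "bil k A (H (\<mu> \<otimes> \<nu>)) A (\<lambda>a h. lift A (\<lambda>x y. ?q a x y) (\<Delta> \<mu> \<nu> h))"
  proof (rule bilI[OF A_module H_module[OF kd] A_module])
    fix a assume a: "a \<Colon> A"
    show "lin k (H (\<mu> \<otimes> \<nu>)) A (\<lambda>h. lift A (\<lambda>x y. ?q a x y) (\<Delta> \<mu> \<nu> h))"
      by (rule lin_lift_arg[OF Dl c1[OF a]])
  next
    fix h assume h: "h \<Colon> H (\<mu> \<otimes> \<nu>)"
    show "lin k A A (\<lambda>a. lift A (\<lambda>x y. ?q a x y) (\<Delta> \<mu> \<nu> h))"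
      by (rule lin_lift_param[OF A_module D[OF h] c1 lin_comp[OF bil_left[OF th bil_closed[OF pd o]] bil_left[OF pk]]])
  qed
  have "?th (coring_comult \<mu> \<nu> c) = ?th (tensor_lift B.T (\<lambda>(a, h). ?inner a (\<Delta> \<mu> \<nu> h)) c)"
    by (simp add: coring_comult_def Let_def)
  also have "\<dots> = lift A (\<lambda>a h. ?th (?inner a (\<Delta> \<mu> \<nu> h))) c"
    by (rule V.additive_of_balanced_lift[OF b2 bil_cong[OF c2 t1[OF _ D]] tpa c])
  also have "\<dots> = lift A (\<lambda>a h. lift A (\<lambda>x y. ?q a x y) (\<Delta> \<mu> \<nu> h)) c"
    by (rule lift_cong[OF c2 c t1[OF _ D]])
  finally show ?thesis .
qed

definition dual_mult where
  "dual_mult \<alpha> \<beta> f g = (\<lambda>c\<in>carrier (cgroup \<C> (inv (\<alpha> \<otimes> \<beta>))).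
       lift A (\<lambda>x y. g (ract \<C> (inv \<beta>) x (f y)))
         (comult \<C> (inv \<beta>) (inv \<alpha>) c))"

abbreviation "dual_group \<alpha> \<equiv> left_hom A (cgroup \<C> (inv \<alpha>)) (lact \<C> (inv \<alpha>))"

text \<open>Left linearity reduces the comparison to elements \<open>1 \<otimes> h\<close>, where the right action of
  \<open>f(h\<^sub>2)\<close> on \<open>1 \<otimes> h\<^sub>1\<close> yields the twist.\<close>

lemma dual_mult_extend:
  assumes a: "\<alpha> \<Colon> G" and b: "\<beta> \<Colon> G" and F: "F \<in> left_homs (inv \<alpha>)" and E: "E \<in> left_homs (inv \<beta>)"
  shows "dual_mult \<alpha> \<beta> F E = extend_hom (inv (\<alpha> \<otimes> \<beta>))
    (hom_mult \<alpha> \<beta> (at_unit (inv \<alpha>) F) (at_unit (inv \<beta>) E))"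
proof -
  let ?k = "inv \<beta>" and ?d = "inv \<alpha>"
  have i: "?k \<Colon> G" "?d \<Colon> G" "?k \<otimes> ?d \<Colon> G" using a b by simp_all
  let ?f = "at_unit ?d F" and ?e = "at_unit ?k E"
  note fl = restriction_lin'[OF i(2) F] and el = restriction_lin'[OF i(1) E] and Fl = left_homsD(1)[OF F] and El = left_homsD(1)[OF E]
  have Ee: "E = extend_hom ?k ?e" by (rule extend_restriction[OF i(1) E, symmetric])
  have th: "bil k (AH ?k) (AH ?d) A (\<lambda>x y. E (right_act ?k x (F y)))"
  proof (rule bilI[OF AH_module[OF i(1)] AH_module[OF i(2)] A_module])
    show "lin k (AH ?k) A (\<lambda>x. E (right_act ?k x (F y)))" if "y \<Colon> AH ?d" for y
      by (rule lin_comp[OF El right_act_lin[OF i(1) lin_closed[OF Fl that]]])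
    have ra: "lin k A (AH ?k) (\<lambda>a. right_act ?k x a)" if x: "x \<Colon> AH ?k" for x
      unfolding right_act_def
      by (rule lin_lift_param[OF A_module x right_act_bil[OF i(1)] lin_lift_arg[OF coact_lin[OF i(1)] right_act_inner[OF i(1)]]])
    show "lin k (AH ?d) A (\<lambda>y. E (right_act ?k x (F y)))" if "x \<Colon> AH ?k" for x
      by (rule lin_comp[OF lin_comp[OF El ra[OF that]] Fl])
  qed
  show ?thesis
  proof (rule extensionalityI[of _ "carrier (AH (?k \<otimes> ?d))"])
    show "dual_mult \<alpha> \<beta> F E \<in> extensional (carrier (AH (?k \<otimes> ?d)))"
      "extend_hom (inv (\<alpha> \<otimes> \<beta>)) (hom_mult \<alpha> \<beta> ?f ?e) \<in> extensional (carrier (AH (?k \<otimes> ?d)))"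
      by (simp_all add: dual_mult_def extend_hom_def coring_simps G_inv_mult a b)
    fix c assume c: "c \<Colon> AH (?k \<otimes> ?d)"
    have "dual_mult \<alpha> \<beta> F E c = lift A (\<lambda>x y. E (right_act ?k x (F y))) (coring_comult ?k ?d c)" (is "?l = _")
      using c by (simp add: dual_mult_def coring_simps G_inv_mult a b)
    also have "\<dots> = lift A (\<lambda>a h. lift A (\<lambda>x y. E (right_act ?k (pure k A (H ?k) a x) (F (pure k A (H ?d) \<one>\<^bsub>A\<^esub> y)))) (\<Delta> ?k ?d h)) c"
    proof (rule lift_coring_comult[OF i(1,2) c th])
      fix x a y assume x: "x \<Colon> AH ?k" and a: "a \<Colon> A" and y: "y \<Colon> AH ?d"
      show "E (right_act ?k (right_act ?k x a) (F y)) = E (right_act ?k x (F (left_act ?d a y)))"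
        unfolding left_homsD(3)[OF F a y] by (subst (1 2) Ee) (rule extend_right_act_mult[OF i(1) el a lin_closed[OF Fl y] x])
    qed
    also have "\<dots> = lift A (\<lambda>a h. a \<cdot> hom_mult \<alpha> \<beta> ?f ?e h) c"
    proof (rule lift_cong[OF extend_bil[OF i(3)] c])
      show "lin k (H (?k \<otimes> ?d)) A (hom_mult \<alpha> \<beta> ?f ?e)"
        by (rule lin_cong[OF product_lin[OF i(1,2) el fl]]) (rule hom_mult_value[OF a b])
      fix a' h assume a': "a' \<Colon> A" and h: "h \<Colon> H (?k \<otimes> ?d)"
      note pb = product_bil[OF i(1) el fl]
      have "lift A (\<lambda>x y. E (right_act ?k (pure k A (H ?k) a' x) (F (pure k A (H ?d) \<one>\<^bsub>A\<^esub> y)))) (\<Delta> ?k ?d h) =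
        lift A (\<lambda>x y. a' \<cdot> twist ?k ?e x (?f y)) (\<Delta> ?k ?d h)" (is "?l = _")
      proof (rule lift_cong[OF _ comult_closed[OF i(1,2) h]])
        show "bil k (H ?k) (H ?d) A (\<lambda>x y. a' \<cdot> twist ?k ?e x (?f y))"
          by (rule bilI[OF bilD(1-3)[OF pb] lin_comp[OF A_lin_left[OF a'] bil_right[OF pb]] lin_comp[OF A_lin_left[OF a'] bil_left[OF pb]]])
        fix x y assume x: "x \<Colon> H ?k" and y: "y \<Colon> H ?d"
        have fy: "F (pure k A (H ?d) \<one>\<^bsub>A\<^esub> y) = ?f y" using y by (simp add: at_unit_def)
        show "E (right_act ?k (pure k A (H ?k) a' x) (F (pure k A (H ?d) \<one>\<^bsub>A\<^esub> y))) = a' \<cdot> twist ?k ?e x (?f y)"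
          unfolding fy by (subst Ee) (rule extend_right_act_pure[OF i(1) el lin_closed[OF fl y] a' x])
      qed
      also have "\<dots> = a' \<cdot> hom_mult \<alpha> \<beta> ?f ?e h"
        unfolding hom_mult_value[OF a b h] by (rule lin_of_lift[OF A_lin_left[OF a'] pb comult_closed[OF i(1,2) h], symmetric])
      finally show "?l = \<dots>" .
    qed
    also have "\<dots> = extend_hom (inv (\<alpha> \<otimes> \<beta>)) (hom_mult \<alpha> \<beta> ?f ?e) c"
      using c by (simp add: extend_hom_def G_inv_mult a b)
    finally show "?l = \<dots>" .
  qed
qed

lemma counit_extend:
  assumes a: "a \<Colon> A"
  shows "(\<lambda>c\<in>carrier (AH \<one>). lift A (\<lambda>a h. \<epsilon> h \<bullet> a) c \<cdot> a) = extend_hom \<one> (hom_base a)"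
  unfolding extend_hom_def
proof (rule restrict_ext)
  fix c assume c: "c \<Colon> AH \<one>"
  have e: "bil k A (H \<one>) A (\<lambda>b h. \<epsilon> h \<bullet> b)"
    by (intro bilI A_module H_module G_one lin_scale lin_id counit_closed lin_coeff[OF counit_lin])
  have "lift A (\<lambda>b h. \<epsilon> h \<bullet> b) c \<cdot> a = lift A (\<lambda>b h. \<epsilon> h \<bullet> b \<cdot> a) c" (is "?l = _")
    by (rule lin_of_lift[OF A_lin_right[OF a] e c])
  also have "\<dots> = lift A (\<lambda>b h. b \<cdot> hom_base a h) c"
    by (rule lift_cong[OF extend_bil[OF G_one hom_base_lin[OF a]] c])
      (simp add: hom_base_def smult_mult_left smult_mult_right counit_closed a)
  finally show "?l = \<dots>" .
qed

lemma dual_ring_isomorphism: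
  "component_isomorphism G hom_comp hom_mult A hom_unit hom_base dual_group dual_mult
     (\<lambda>c\<in>carrier (cgroup \<C> \<one>). counit \<C> c) (\<lambda>a. \<lambda>c\<in>carrier (cgroup \<C> \<one>). counit \<C> c \<cdot> a)
     (\<lambda>\<alpha>. at_unit (inv \<alpha>))"
proof -
  have car: "carrier (dual_group \<alpha>) = left_homs (inv \<alpha>)" if "\<alpha> \<Colon> G" for \<alpha>
    using that by (simp add: left_hom_carrier)
  have ur: "at_unit (inv \<alpha>) F \<Colon> hom_comp \<alpha>" if "\<alpha> \<Colon> G" "F \<in> left_homs (inv \<alpha>)" for \<alpha> F
    unfolding at_unit_def by (rule hom_compI[OF that(1) restriction_lin[OF G_inv_closed[OF that(1)] that(2)]])
  have ure: "at_unit (inv \<alpha>) (extend_hom (inv \<alpha>) f) = f" if "\<alpha> \<Colon> G" "f \<Colon> hom_comp \<alpha>" for \<alpha> f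
  proof (rule hom_comp_eqI[OF ur that(2)])
    show "\<alpha> \<Colon> G" "extend_hom (inv \<alpha>) f \<in> left_homs (inv \<alpha>)"
      using that by (auto intro: extend_left_hom hom_comp_lin)
  qed (use that in \<open>simp add: restriction_extend hom_comp_lin\<close>)
  have bij: "bij_betw (at_unit (inv \<alpha>)) (carrier (dual_group \<alpha>)) (carrier (hom_comp \<alpha>))" if a: "\<alpha> \<Colon> G" for \<alpha>
    unfolding car[OF a]
    by (rule bij_betwI[where g = "extend_hom (inv \<alpha>)"])
      (auto simp: ur[OF a] ure[OF a] extend_restriction a extend_left_hom hom_comp_lin)
  have pc: "pure k A (H (inv \<alpha>)) \<one>\<^bsub>A\<^esub> h \<Colon> AH (inv \<alpha>)" if "\<alpha> \<Colon> G" "h \<Colon> H (inv \<alpha>)" for \<alpha> h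
    using that by (intro pure_closed A_module H_module G_inv_closed A_one)
  have add: "at_unit (inv \<alpha>) (F \<oplus>\<^bsub>dual_group \<alpha>\<^esub> F') =
     at_unit (inv \<alpha>) F \<oplus>\<^bsub>hom_comp \<alpha>\<^esub> at_unit (inv \<alpha>) F'"
    if "\<alpha> \<Colon> G" for \<alpha> F F'
    unfolding hom_comp_def using that
    by (simp add: at_unit_def left_hom_def coring_simps pc cong: restrict_cong)
  have cl: "F \<oplus>\<^bsub>dual_group \<alpha>\<^esub> F' \<Colon> dual_group \<alpha>"
    if a: "\<alpha> \<Colon> G" and F: "F \<Colon> dual_group \<alpha>" and F': "F' \<Colon> dual_group \<alpha>" for \<alpha> F F'
  proof -
    let ?a = "inv \<alpha>"
    have i: "?a \<Colon> G" using a by simp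
    note FD = left_homsD[OF F[unfolded car[OF a]]] and FD' = left_homsD[OF F'[unfolded car[OF a]]]
    have e: "F \<oplus>\<^bsub>dual_group \<alpha>\<^esub> F' = (\<lambda>c\<in>carrier (AH ?a). F c \<oplus>\<^bsub>A\<^esub> F' c)"
      by (simp add: left_hom_def coring_simps)
    show ?thesis
      unfolding car[OF a] left_homs_def e
      by (intro CollectI conjI ballI lin_cong[OF lin_sum[OF FD(1) FD'(1)]])
        (simp_all add: FD(3) FD'(3) lin_closed[OF left_act_lin[OF i]] ring.ring_simprules(23)[OF A_ring] lin_closed[OF FD(1)] lin_closed[OF FD'(1)])
  qed
  have zero: "\<zero>\<^bsub>dual_group \<alpha>\<^esub> \<Colon> dual_group \<alpha>" "at_unit (inv \<alpha>) \<zero>\<^bsub>dual_group \<alpha>\<^esub> = \<zero>\<^bsub>hom_comp \<alpha>\<^esub>"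
    if a: "\<alpha> \<Colon> G" for \<alpha>
  proof -
    interpret M: module k "AH (inv \<alpha>)" by (rule AH_module[OF G_inv_closed[OF a]])
    have lc: "left_act (inv \<alpha>) b x \<Colon> AH (inv \<alpha>)" if "b \<Colon> A" "x \<Colon> AH (inv \<alpha>)" for b x
      by (rule lin_closed[OF left_act_lin[OF G_inv_closed[OF a] that(1)] that(2)])
    show "\<zero>\<^bsub>dual_group \<alpha>\<^esub> \<Colon> dual_group \<alpha>"
      by (simp add: left_hom_def coring_simps lc ring.ring_simprules(25)[OF A_ring])
    show "at_unit (inv \<alpha>) \<zero>\<^bsub>dual_group \<alpha>\<^esub> = \<zero>\<^bsub>hom_comp \<alpha>\<^esub>"
      by (simp add: left_hom_def coring_simps at_unit_def hom_comp_def pc a cong: restrict_cong)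
  qed
  have mult: "dual_mult \<alpha> \<beta> F E = extend_hom (inv (\<alpha> \<otimes> \<beta>)) (hom_mult \<alpha> \<beta> (at_unit (inv \<alpha>) F) (at_unit (inv \<beta>) E))"
    "hom_mult \<alpha> \<beta> (at_unit (inv \<alpha>) F) (at_unit (inv \<beta>) E) \<Colon> hom_comp (\<alpha> \<otimes> \<beta>)"
    if "\<alpha> \<Colon> G" "\<beta> \<Colon> G" "F \<Colon> dual_group \<alpha>" "E \<Colon> dual_group \<beta>" for \<alpha> \<beta> F E
    using that by (auto simp: car intro: dual_mult_extend hom_mult_closed ur)
  have base: "(\<lambda>c\<in>carrier (cgroup \<C> \<one>). counit \<C> c \<cdot> a) = extend_hom \<one> (hom_base a)" if "a \<Colon> A" for a
    using counit_extend[OF that] by (simp add: coring_simps)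
  have unit: "(\<lambda>c\<in>carrier (cgroup \<C> \<one>). counit \<C> c) = extend_hom \<one> hom_unit"
  proof -
    have e: "bil k A (H \<one>) A (\<lambda>b h. \<epsilon> h \<bullet> b)"
      by (intro bilI A_module H_module G_one lin_scale lin_id counit_closed lin_coeff[OF counit_lin])
    have "(\<lambda>c\<in>carrier (cgroup \<C> \<one>). counit \<C> c) = (\<lambda>c\<in>carrier (cgroup \<C> \<one>). counit \<C> c \<cdot> \<one>\<^bsub>A\<^esub>)"
      unfolding coring_simps by (rule restrict_ext) (simp add: monoid.r_one[OF ring.is_monoid[OF A_ring] lift_closed[OF e]])
    then show ?thesis by (simp add: base[OF A_one] hom_unit_base)
  qed
  have ext1: "extend_hom \<one> (hom_base a) \<Colon> dual_group \<one>" "at_unit (inv \<one>) (extend_hom \<one> (hom_base a)) = hom_base a"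
    if "a \<Colon> A" for a
    using ure[OF G_one hom_base_closed[OF that]] extend_left_hom[OF G_one hom_base_lin[OF that]] by (simp_all add: left_hom_carrier)
  show ?thesis
  proof (intro component_isomorphism.intro hom_ring_data component_isomorphism_axioms.intro
      direct_sum_of_groups.intro direct_sum_of_groups_axioms.intro G_group bij add)
    show "abelian_group (dual_group \<alpha>)" if "\<alpha> \<Colon> G" for \<alpha>
      by (rule abelian_group_transfer[OF hom_comp_group[OF that] bij[OF that] zero[OF that] cl[OF that]])
        (assumption+, rule add[OF that])
    show "dual_mult \<alpha> \<beta> F E \<Colon> dual_group (\<alpha> \<otimes> \<beta>)"
      if "\<alpha> \<Colon> G" "\<beta> \<Colon> G" "F \<Colon> dual_group \<alpha>" "E \<Colon> dual_group \<beta>" for \<alpha> \<beta> F E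
      unfolding mult(1)[OF that] car[OF G_mult_closed[OF that(1,2)]]
      by (rule extend_left_hom[OF G_inv_closed[OF G_mult_closed[OF that(1,2)]] hom_comp_lin[OF G_mult_closed[OF that(1,2)] mult(2)[OF that]]])
    show "at_unit (inv (\<alpha> \<otimes> \<beta>)) (dual_mult \<alpha> \<beta> F E) = hom_mult \<alpha> \<beta> (at_unit (inv \<alpha>) F) (at_unit (inv \<beta>) E)"
      if "\<alpha> \<Colon> G" "\<beta> \<Colon> G" "F \<Colon> dual_group \<alpha>" "E \<Colon> dual_group \<beta>" for \<alpha> \<beta> F E
      unfolding mult(1)[OF that] by (rule ure[OF G_mult_closed[OF that(1,2)] mult(2)[OF that]])
  qed (simp_all only: unit base ext1 hom_unit_base A_one)
qed

lemma left_dual_ring_eq: "left_dual_ring G A \<C> = graded_ring_of G dual_group dual_mult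
     (\<lambda>c\<in>carrier (cgroup \<C> \<one>). counit \<C> c) (\<lambda>a. \<lambda>c\<in>carrier (cgroup \<C> \<one>). counit \<C> c \<cdot> a)"
  by (simp add: left_dual_ring_def dual_mult_def[abs_def])

theorem left_dual_ring_isomorphic:
  "graded_A_ring_isomorphic G A (left_dual_ring G A \<C>) (graded_ring_of G hom_comp hom_mult hom_unit hom_base)"
  unfolding left_dual_ring_eq by (rule component_isomorphism.isomorphic[OF dual_ring_isomorphism])

end

section \<open>The smash product\<close>

text \<open>Maps \<open>ev x\<close> that separate points detect bilinearity, and they compute the induced map.  For
  the iterated sums of the smash product this replaces a proof that each layer is linear.\<close>

lemma lift_detected:
  assumes mods: "module k M" "module k N" "module k T"
    and ev: "\<And>x. x \<in> X \<Longrightarrow> lin k T P (ev x)"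
    and inj: "\<And>s t. \<lbrakk>s \<Colon> T; t \<Colon> T; \<And>x. x \<in> X \<Longrightarrow> ev x s = ev x t\<rbrakk> \<Longrightarrow> s = t"
    and closed: "\<And>m n. \<lbrakk>m \<Colon> M; n \<Colon> N\<rbrakk> \<Longrightarrow> b m n \<Colon> T"
    and g: "\<And>x. x \<in> X \<Longrightarrow> lin k (tensor k M N) P (g x)"
    and eq: "\<And>x m n. \<lbrakk>x \<in> X; m \<Colon> M; n \<Colon> N\<rbrakk> \<Longrightarrow> ev x (b m n) = g x (pure k M N m n)"
  shows "bil k M N T b"
    and "\<lbrakk>t \<Colon> tensor k M N; x \<in> X\<rbrakk> \<Longrightarrow> ev x (lift T b t) = g x t"
proof -
  interpret T: module k T by (rule mods)
  have lin: "lin k Y T f" if Y: "module k Y" and c: "\<And>y. y \<Colon> Y \<Longrightarrow> f y \<Colon> T"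
    and l: "\<And>x. x \<in> X \<Longrightarrow> lin k Y P (\<lambda>y. ev x (f y))" for Y :: "('a, 'y, 'yy) module_scheme" and f
  proof (rule linI[OF Y mods(3) c])
    interpret Y: module k Y by (rule Y)
    show "f (y \<oplus>\<^bsub>Y\<^esub> z) = f y \<oplus>\<^bsub>T\<^esub> f z" if y: "y \<Colon> Y" "z \<Colon> Y" for y z
      by (rule inj) (simp_all add: c y lin_add[OF l] lin_add[OF ev])
    show "f (r \<odot>\<^bsub>Y\<^esub> y) = r \<odot>\<^bsub>T\<^esub> f y" if y: "r \<Colon> k" "y \<Colon> Y" for r y
      by (rule inj) (simp_all add: c y lin_smult[OF l] lin_smult[OF ev])
  qed
  have gb: "bil k M N P (\<lambda>m n. g x (pure k M N m n))" if "x \<in> X" for x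
    using g[OF that] mods by (intro bilI lin_comp[OF g[OF that]] lin_pure_left lin_pure_right lin_id) (simp_all add: lin_cod)
  show b: "bil k M N T b"
    by (intro bilI mods lin closed; (rule lin_cong[OF bil_left[OF gb]] lin_cong[OF bil_right[OF gb]])?) (simp_all add: eq)
  show "ev x (lift T b t) = g x t" if t: "t \<Colon> tensor k M N" and x: "x \<in> X"
    by (rule lin_tensor_eqI[OF lin_comp[OF ev[OF x] lin_lift[OF b]] g[OF x] mods(1,2) _ t])
      (simp add: lift_pure[OF b] eq x)
qed

text \<open>For \<open>r = n \<otimes> w\<close> this is \<open>f\<^sub>1(y) f\<^sub>2(w) n = f(y w) n\<close>.\<close>

lemma dual_comult_contract:
  assumes B: "k_algebra k B" and P: "fg_projective k B" and f: "f \<Colon> dual k B" and N: "module k N"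
    and y: "y \<Colon> B" and r: "r \<Colon> tensor k N B"
  shows "lift N (\<lambda>u v. u y \<odot>\<^bsub>N\<^esub> lift N (\<lambda>n w. v w \<odot>\<^bsub>N\<^esub> n) r) (dual_comult k B f) =
    lift N (\<lambda>n w. f (y \<otimes>\<^bsub>B\<^esub> w) \<odot>\<^bsub>N\<^esub> n) r"
proof -
  note BM = fg_projective_module[OF P] note D = dual_module[OF BM]
  note d = dual_comult[OF B P f] note con = bil_contract[OF N BM]
  have fl: "lin k B (base_module k) (\<lambda>w. f (y \<otimes>\<^bsub>B\<^esub> w))"
    by (rule lin_comp[OF dual_lin[OF f BM] lin_mult_left[OF B lin_id[OF BM] y]])
  have fb: "bil k N B N (\<lambda>n w. f (y \<otimes>\<^bsub>B\<^esub> w) \<odot>\<^bsub>N\<^esub> n)"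
    by (intro bilI N BM lin_coeff[OF fl] lin_scale lin_id) (simp_all add: lin_closed[OF fl, simplified])
  have b: "bil k (dual k B) (dual k B) N (\<lambda>u v. u y \<odot>\<^bsub>N\<^esub> lift N (\<lambda>n w. v w \<odot>\<^bsub>N\<^esub> n) r)" if "r \<Colon> tensor k N B" for r
    using that by (intro bilI D N lin_coeff[OF lin_eval[OF BM y]] lin_scale lin_contract_param[OF N BM] lift_closed[OF con])
      (simp_all add: dual_value y)
  have bc: "bil k (dual k B) (dual k B) N (\<lambda>u v. (u y \<otimes>\<^bsub>k\<^esub> v w) \<odot>\<^bsub>N\<^esub> n)" if "n \<Colon> N" "w \<Colon> B" for n w
    using bil_comp[OF pure_bil[OF module_base N] lin_id lin_id] bilD(4,5)[OF bil_evaluate[OF BM BM y that(2)]]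
    by (intro bilI D N lin_coeff that) simp_all
  show ?thesis
  proof (rule lin_tensor_eqI[OF _ lin_lift[OF fb] N BM _ r])
    show "lin k (tensor k N B) N (\<lambda>r. lift N (\<lambda>u v. u y \<odot>\<^bsub>N\<^esub> lift N (\<lambda>n w. v w \<odot>\<^bsub>N\<^esub> n) r) (dual_comult k B f))"
      by (intro lin_lift_param[OF tensor_is_module[OF N BM] d(1) b] lin_scale lin_lift[OF con]) (simp_all add: dual_value y)
    fix n w assume n: "n \<Colon> N" and w: "w \<Colon> B"
    interpret N: module k N by (rule N)
    have "lift N (\<lambda>u v. u y \<odot>\<^bsub>N\<^esub> lift N (\<lambda>n w. v w \<odot>\<^bsub>N\<^esub> n) (pure k N B n w)) (dual_comult k B f) =
      lift N (\<lambda>u v. (u y \<otimes>\<^bsub>k\<^esub> v w) \<odot>\<^bsub>N\<^esub> n) (dual_comult k B f)" (is "?l = _")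
      by (rule lift_cong[OF bc[OF n w] d(1)])
        (simp add: lift_pure[OF con] n w N.smult_assoc1 dual_value[OF _ y] dual_value[OF _ w])
    also have "\<dots> = lift k (\<lambda>u v. u y \<otimes>\<^bsub>k\<^esub> v w) (dual_comult k B f) \<odot>\<^bsub>N\<^esub> n"
      unfolding tensor_lift_base[of k]
      by (rule lin_of_lift[OF lin_coeff[OF lin_id[OF module_base[OF N.R.is_cring]] N n] bil_evaluate[OF BM BM y w] d(1), symmetric])
    also have "\<dots> = f (y \<otimes>\<^bsub>B\<^esub> w) \<odot>\<^bsub>N\<^esub> n" by (simp add: d(2) y w)
    finally show "?l = lift N (\<lambda>n w. f (y \<otimes>\<^bsub>B\<^esub> w) \<odot>\<^bsub>N\<^esub> n) (pure k N B n w)"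
      by (simp add: lift_pure[OF fb] n w)
  qed
qed

locale finite_comodule_algebra = comodule_algebra +
  assumes finite: "homogeneously_finite G k H"
begin

lemma H_fg: "\<alpha> \<Colon> G \<Longrightarrow> fg_projective k (H \<alpha>)"
  using finite by (simp add: homogeneously_finite_def)

abbreviation "Hd \<alpha> \<equiv> dual k (H \<alpha>)"
definition "smash_eval s h = lift A (\<lambda>u a. u h \<bullet> a) s"

lemma Hd_module: "\<alpha> \<Colon> G \<Longrightarrow> module k (Hd \<alpha>)" by (intro dual_module H_module)

lemma smash_eval_lin: "\<lbrakk>\<alpha> \<Colon> G; h \<Colon> H \<alpha>\<rbrakk> \<Longrightarrow> lin k (tensor k (Hd \<alpha>) A) A (\<lambda>s. smash_eval s h)"
  unfolding smash_eval_def by (intro lin_lift bil_coeff H_module A_module)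

lemma smash_eval_pure: "\<lbrakk>\<alpha> \<Colon> G; h \<Colon> H \<alpha>; u \<Colon> Hd \<alpha>; a \<Colon> A\<rbrakk> \<Longrightarrow>
   smash_eval (pure k (Hd \<alpha>) A u a) h = u h \<bullet> a"
  unfolding smash_eval_def by (rule lift_pure[OF bil_coeff[OF H_module A_module]])

lemma smash_eval_lin_arg:
  assumes a: "\<alpha> \<Colon> G" and s: "s \<Colon> tensor k (Hd \<alpha>) A"
  shows "lin k (H \<alpha>) A (smash_eval s)"
  unfolding smash_eval_def
  by (intro lin_lift_param[OF H_module[OF a] s] bil_coeff lin_coeff dual_lin H_module A_module a)

lemma smash_eval_inj:
  assumes a: "\<alpha> \<Colon> G" and s: "s \<Colon> tensor k (Hd \<alpha>) A" and t: "t \<Colon> tensor k (Hd \<alpha>) A"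
    and eq: "\<And>h. h \<Colon> H \<alpha> \<Longrightarrow> smash_eval s h = smash_eval t h"
  shows "s = t"
proof -
  note r = tensor_of_duals_reconstruct[OF H_fg[OF a] A_module]
  let ?T = "tensor k (Hd \<alpha>) A" let ?c = "dual_basis k (H \<alpha>)"
  have "lift ?T (\<lambda>f e. pure k (Hd \<alpha>) A f (lift A (\<lambda>u v. u e \<bullet> v) s)) ?c =
    lift ?T (\<lambda>f e. pure k (Hd \<alpha>) A f (lift A (\<lambda>u v. u e \<bullet> v) t)) ?c"
    by (rule lift_cong[OF r(1)[OF t] dual_basis(1)[OF H_fg[OF a]]]) (simp add: eq[unfolded smash_eval_def])
  then show ?thesis by (simp add: r(2) s t)
qed

lemma smash_eval_lift:
  assumes a: "\<alpha> \<Colon> G" and f: "lin k (H \<alpha>) A f"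
  shows "bil k (Hd \<alpha>) (H \<alpha>) (tensor k (Hd \<alpha>) A) (\<lambda>u e. pure k (Hd \<alpha>) A u (f e))" (is "bil _ _ _ ?T _")
    and "lift (tensor k (Hd \<alpha>) A) (\<lambda>u e. pure k (Hd \<alpha>) A u (f e)) (dual_basis k (H \<alpha>))
      \<Colon> tensor k (Hd \<alpha>) A" (is "?s \<in> _")
    and "h \<Colon> H \<alpha> \<Longrightarrow> smash_eval (lift (tensor k (Hd \<alpha>) A) (\<lambda>u e. pure k (Hd \<alpha>) A u (f e))
      (dual_basis k (H \<alpha>))) h = f h"
proof -
  note c = dual_basis(1)[OF H_fg[OF a]]
  have b: "bil k (Hd \<alpha>) (H \<alpha>) ?T (\<lambda>u e. pure k (Hd \<alpha>) A u (f e))"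
    by (rule bil_comp[OF pure_bil[OF Hd_module[OF a] A_module] lin_id[OF Hd_module[OF a]] f])
  then show "bil k (Hd \<alpha>) (H \<alpha>) ?T (\<lambda>u e. pure k (Hd \<alpha>) A u (f e))" .
  show "?s \<Colon> ?T" by (rule lift_closed[OF b c])
  assume h: "h \<Colon> H \<alpha>"
  have "smash_eval ?s h = lift A (\<lambda>u e. smash_eval (pure k (Hd \<alpha>) A u (f e)) h) (dual_basis k (H \<alpha>))"
    by (rule lin_of_lift[OF smash_eval_lin[OF a h] b c])
  also have "\<dots> = lift A (\<lambda>u e. u h \<bullet> f e) (dual_basis k (H \<alpha>))"
    by (rule lift_cong[OF bil_comp[OF bil_coeff[OF H_module[OF a] A_module h] lin_id[OF Hd_module[OF a]] f] c])
      (simp add: smash_eval_pure a h lin_closed[OF f])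
  also have "\<dots> = f h" by (rule lin_via_canonical[OF H_fg[OF a] f h])
  finally show "smash_eval ?s h = f h" .
qed

definition "smash_to_hom \<alpha> s = (\<lambda>h\<in>carrier (H (inv \<alpha>)). smash_eval s h)"

text \<open>The inverse sends \<open>f\<close> to \<open>\<Sum> e\<^sub>i\<^sup>* \<otimes> f(e\<^sub>i)\<close>.\<close>

lemma smash_to_hom_bij:
  assumes a: "\<alpha> \<Colon> G"
  shows "bij_betw (smash_to_hom \<alpha>) (carrier (tensor k (Hd (inv \<alpha>)) A)) (carrier (hom_comp \<alpha>))"
proof -
  have i: "inv \<alpha> \<Colon> G" using a by simp
  have cl: "smash_to_hom \<alpha> s \<Colon> hom_comp \<alpha>" if "s \<Colon> tensor k (Hd (inv \<alpha>)) A" for s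
    unfolding smash_to_hom_def by (rule hom_compI[OF a smash_eval_lin_arg[OF i that]])
  show ?thesis
  proof (rule bij_betw_imageI[OF inj_onI], goal_cases)
    case (1 s t)
    have "smash_eval s h = smash_eval t h" if "h \<Colon> H (inv \<alpha>)" for h
      using fun_cong[OF 1(3), of h] that by (simp add: smash_to_hom_def)
    then show ?case by (rule smash_eval_inj[OF i 1(1,2)])
  next
    case 2
    show ?case
    proof (rule equalityI)
      show "smash_to_hom \<alpha> ` carrier (tensor k (Hd (inv \<alpha>)) A) \<subseteq> carrier (hom_comp \<alpha>)" using cl by blast
      show "carrier (hom_comp \<alpha>) \<subseteq> smash_to_hom \<alpha> ` carrier (tensor k (Hd (inv \<alpha>)) A)"
      proof
        fix f assume f: "f \<Colon> hom_comp \<alpha>"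
        note s = smash_eval_lift(2,3)[OF i hom_comp_lin[OF a f]]
        have "smash_to_hom \<alpha> (lift (tensor k (Hd (inv \<alpha>)) A) (\<lambda>u e. pure k (Hd (inv \<alpha>)) A u (f e))
          (dual_basis k (H (inv \<alpha>)))) = f"
          by (rule hom_comp_eqI[OF cl[OF s(1)] f]) (simp add: smash_to_hom_def s(2))
        then show "f \<in> smash_to_hom \<alpha> ` carrier (tensor k (Hd (inv \<alpha>)) A)" using imageI[OF s(1), of "smash_to_hom \<alpha>"] by simp
      qed
    qed
  qed
qed

text \<open>The convolution product at the point \<open>x\<close>, with both factors given as tensors.\<close>

definition "pairing_at \<nu> \<mu> x s t = lift A (\<lambda>y z. twist \<mu> (smash_eval t) y (smash_eval s z)) (\<Delta> \<mu> \<nu> x)"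

lemma pairing_at_lin_left:
  assumes d: "\<nu> \<Colon> G" "\<mu> \<Colon> G" and x: "x \<Colon> H (\<mu> \<otimes> \<nu>)" and t: "t \<Colon> tensor k (Hd \<mu>) A"
  shows "lin k (tensor k (Hd \<nu>) A) A (\<lambda>s. pairing_at \<nu> \<mu> x s t)"
  unfolding pairing_at_def
proof (rule lin_lift_param[OF tensor_is_module[OF Hd_module[OF d(1)] A_module] comult_closed[OF d(2,1) x]])
  note tl = smash_eval_lin_arg[OF d(2) t]
  show "bil k (H \<mu>) (H \<nu>) A (\<lambda>y z. twist \<mu> (smash_eval t) y (smash_eval s z))" if "s \<Colon> tensor k (Hd \<nu>) A" for s
    by (rule product_bil[OF d(2) tl smash_eval_lin_arg[OF d(1) that]])
  show "lin k (tensor k (Hd \<nu>) A) A (\<lambda>s. twist \<mu> (smash_eval t) y (smash_eval s z))" if "y \<Colon> H \<mu>" "z \<Colon> H \<nu>" for y z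
    by (rule lin_comp[OF bil_right[OF twist_bil[OF d(2) tl] that(1)] smash_eval_lin[OF d(1) that(2)]])
qed

lemma pairing_at_lin_right:
  assumes d: "\<nu> \<Colon> G" "\<mu> \<Colon> G" and x: "x \<Colon> H (\<mu> \<otimes> \<nu>)" and s: "s \<Colon> tensor k (Hd \<nu>) A"
  shows "lin k (tensor k (Hd \<mu>) A) A (\<lambda>t. pairing_at \<nu> \<mu> x s t)"
  unfolding pairing_at_def
proof (rule lin_lift_param[OF tensor_is_module[OF Hd_module[OF d(2)] A_module] comult_closed[OF d(2,1) x]])
  note sl = smash_eval_lin_arg[OF d(1) s] and tl = smash_eval_lin_arg[OF d(2)]
  show "bil k (H \<mu>) (H \<nu>) A (\<lambda>y z. twist \<mu> (smash_eval t) y (smash_eval s z))" if "t \<Colon> tensor k (Hd \<mu>) A" for t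
    by (rule product_bil[OF d(2) tl[OF that] sl])
  show "lin k (tensor k (Hd \<mu>) A) A (\<lambda>t. twist \<mu> (smash_eval t) y (smash_eval s z))" if y: "y \<Colon> H \<mu>" and z: "z \<Colon> H \<nu>" for y z
    unfolding twist_def
    by (intro lin_lift_param[OF tensor_is_module[OF Hd_module[OF d(2)] A_module] coact_closed[OF d(2) lin_closed[OF sl z]]]
      twist_bil_inner[OF d(2) tl y] lin_mult_left[OF A_algebra] smash_eval_lin d H_mult_closed y)
qed

lemma convolution_lin_left:
  assumes a: "\<alpha> \<Colon> G" and b: "\<beta> \<Colon> G" and h: "h \<Colon> Hd (inv \<alpha>)"
  shows "lin k (Hd (inv \<beta>)) (Hd (inv (\<alpha> \<otimes> \<beta>))) (\<lambda>f. convolution G k H \<Delta> \<beta> \<alpha> f h)"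
proof -
  let ?a = "inv \<alpha>" and ?b = "inv \<beta>"
  have i: "?a \<Colon> G" "?b \<Colon> G" "inv (\<alpha> \<otimes> \<beta>) \<Colon> G" using a b by simp_all
  have e: "inv (\<alpha> \<otimes> \<beta>) = ?b \<otimes> ?a" by (rule G_inv_mult[OF a b])
  note hl = dual_lin[OF h H_module[OF i(1)]]
  have bl: "bil k (H ?b) (H ?a) (base_module k) (\<lambda>x y. f x \<otimes>\<^bsub>k\<^esub> h y)" if "f \<Colon> Hd ?b" for f
    using dual_lin[OF that H_module[OF i(2)]]
    by (intro bilI H_module i module_base k_cring base_mult_left[OF hl] base_mult_right) (simp_all add: dual_value[OF that] dual_value[OF h])
  show ?thesis
  proof (rule lin_dual_family[OF Hd_module[OF i(2)] H_module[OF i(3)]])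
    show "convolution G k H \<Delta> \<beta> \<alpha> f h \<Colon> Hd (inv (\<alpha> \<otimes> \<beta>))" if "f \<Colon> Hd ?b" for f
      unfolding convolution_def tensor_lift_base[of k] e
      by (rule lin_dual[OF lin_lift_arg[OF comult_lin[OF i(2,1)] bl[OF that]]])
    fix m assume m: "m \<Colon> H (inv (\<alpha> \<otimes> \<beta>))"
    have "lin k (Hd ?b) (base_module k) (\<lambda>f. lift (base_module k) (\<lambda>x y. f x \<otimes>\<^bsub>k\<^esub> h y) (\<Delta> ?b ?a m))"
      by (intro lin_lift_param[OF Hd_module[OF i(2)] comult_closed[OF i(2,1)] bl] base_mult_right lin_eval H_module i)
         (use m in \<open>simp_all add: e dual_value[OF h]\<close>)
    then show "lin k (Hd ?b) (base_module k) (\<lambda>f. convolution G k H \<Delta> \<beta> \<alpha> f h m)"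
      using m by (simp add: convolution_def tensor_lift_base[of k])
  qed
qed

abbreviation "smash_pure_product \<alpha> \<beta> h a f b \<equiv> lift (tensor k (Hd (inv (\<alpha> \<otimes> \<beta>))) A) (\<lambda>f1 f2.    pure k (Hd (inv (\<alpha> \<otimes> \<beta>))) A (convolution G k H \<Delta> \<beta> \<alpha> f1 h) (dual_action G A \<rho> \<beta> f2 a \<cdot> b))
   (dual_comult k (H (inv \<beta>)) f)"

text \<open>At \<open>x\<close> the product is \<open>f\<^sub>1(x\<^sub>1) h(x\<^sub>2) f\<^sub>2(a\<^sub>1)
  a\<^sub>0 b\<close>, where the sum over \<open>f\<^sub>1 \<otimes> f\<^sub>2\<close> gives
  \<open>f(x\<^sub>1 a\<^sub>1)\<close>.\<close>

lemma smash_pure_product: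
  assumes a: "\<alpha> \<Colon> G" and b: "\<beta> \<Colon> G" and h: "h \<Colon> Hd (inv \<alpha>)" and a': "a' \<Colon> A"
    and f: "f \<Colon> Hd (inv \<beta>)" and b': "b' \<Colon> A"
  shows "smash_pure_product \<alpha> \<beta> h a' f b' \<Colon> tensor k (Hd (inv (\<alpha> \<otimes> \<beta>))) A" (is "?P \<Colon> ?T")
    and "x \<Colon> H (inv (\<alpha> \<otimes> \<beta>)) \<Longrightarrow> smash_eval (smash_pure_product \<alpha> \<beta> h a' f b') x =
      pairing_at (inv \<alpha>) (inv \<beta>) x (pure k (Hd (inv \<alpha>)) A h a') (pure k (Hd (inv \<beta>)) A f b')"
proof -
  let ?a = "inv \<alpha>" and ?b = "inv \<beta>" and ?ab = "inv (\<alpha> \<otimes> \<beta>)"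
  have i: "?a \<Colon> G" "?b \<Colon> G" "?ab \<Colon> G" using a b by simp_all
  have e: "?ab = ?b \<otimes> ?a" by (rule G_inv_mult[OF a b])
  let ?D = "dual_comult k (H ?b) f"
  note D = dual_comult(1)[OF H_algebra[OF i(2)] H_fg[OF i(2)] f]
  note r = coact_closed[OF i(2) a']
  note con = bil_contract[OF A_module H_module[OF i(2)]]
  let ?act = "\<lambda>v. lift A (\<lambda>c w. v w \<bullet> c) (\<rho> ?b a')"
  have actl: "lin k (Hd ?b) A ?act" by (rule lin_contract_param[OF A_module H_module[OF i(2)] r])
  have actb: "lin k (Hd ?b) A (\<lambda>v. ?act v \<cdot> b')" by (rule lin_mult_right[OF A_algebra actl b'])
  note convl = convolution_lin_left[OF a b h]
  have bP: "bil k (Hd ?b) (Hd ?b) ?T (\<lambda>f1 f2. pure k (Hd ?ab) A (convolution G k H \<Delta> \<beta> \<alpha> f1 h) (dual_action G A \<rho> \<beta> f2 a' \<cdot> b'))"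
    unfolding dual_action_def by (rule bil_comp[OF pure_bil[OF Hd_module[OF i(3)] A_module] convl actb])
  show "?P \<Colon> ?T" by (rule lift_closed[OF bP D])
  assume x: "x \<Colon> H ?ab"
  note xd = comult_closed[OF i(2,1) x[unfolded e]]
  note tp = smash_eval_lin_arg[OF i(2) pure_closed[OF Hd_module[OF i(2)] A_module f b']]
    and sp = smash_eval_lin_arg[OF i(1) pure_closed[OF Hd_module[OF i(1)] A_module h a']]
  have kb: "bil k (H ?b) (H ?a) (base_module k) (\<lambda>y z. f1 y \<otimes>\<^bsub>k\<^esub> h z)" if "f1 \<Colon> Hd ?b" for f1
    using dual_lin[OF that H_module[OF i(2)]] dual_lin[OF h H_module[OF i(1)]]
    by (intro bilI H_module i module_base k_cring base_mult_left base_mult_right) (simp_all add: dual_value[OF that] dual_value[OF h])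
  let ?t = "smash_eval (pure k (Hd ?b) A f b')" and ?s = "smash_eval (pure k (Hd ?a) A h a')"
  let ?F = "\<lambda>d. lift A (\<lambda>f1 f2. lift (base_module k) (\<lambda>y z. f1 y \<otimes>\<^bsub>k\<^esub> h z) d \<bullet> (?act f2 \<cdot> b')) ?D"
  have Fb: "bil k (Hd ?b) (Hd ?b) A (\<lambda>f1 f2. lift (base_module k) (\<lambda>y z. f1 y \<otimes>\<^bsub>k\<^esub> h z) d \<bullet> (?act f2 \<cdot> b'))"
    if d: "d \<Colon> tensor k (H ?b) (H ?a)" for d
  proof -
    have l: "lin k (Hd ?b) (base_module k) (\<lambda>f1. lift (base_module k) (\<lambda>y z. f1 y \<otimes>\<^bsub>k\<^esub> h z) d)"
      by (intro lin_lift_param[OF Hd_module[OF i(2)] d kb] base_mult_right lin_eval H_module i) (simp_all add: dual_value[OF h])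
    show ?thesis
      by (intro bilI Hd_module i A_module lin_coeff[OF l] lin_scale[OF actb] lin_closed[OF actb]) (simp_all add: lin_closed[OF l, simplified])
  qed
  have "smash_eval ?P x = lift A (\<lambda>f1 f2. smash_eval (pure k (Hd ?ab) A (convolution G k H \<Delta> \<beta> \<alpha> f1 h) (dual_action G A \<rho> \<beta> f2 a' \<cdot> b')) x) ?D"
    by (rule lin_of_lift[OF smash_eval_lin[OF i(3) x] bP D])
  also have "\<dots> = ?F (\<Delta> ?b ?a x)"
    by (rule lift_cong[OF Fb[OF xd] D])
      (use x lin_closed[OF actb] lin_closed[OF convl] in \<open>simp add: smash_eval_pure i dual_action_def convolution_def tensor_lift_base[of k]\<close>)
  also have "\<dots> = lift A (\<lambda>y z. twist ?b ?t y (?s z)) (\<Delta> ?b ?a x)"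
  proof (rule lin_tensor_eqI[OF _ lin_lift[OF product_bil[OF i(2) tp sp]] H_module[OF i(2)] H_module[OF i(1)] _ xd])
    show "lin k (tensor k (H ?b) (H ?a)) A ?F"
      by (intro lin_lift_param[OF tensor_is_module[OF H_module[OF i(2)] H_module[OF i(1)]] D Fb] lin_coeff[OF lin_lift[OF kb]] A_module lin_closed[OF actb])
    fix y z assume y: "y \<Colon> H ?b" and z: "z \<Colon> H ?a"
    have hz: "h z \<Colon> k" by (rule dual_value[OF h z])
    have l: "lin k A A (\<lambda>c. h z \<bullet> (c \<cdot> b'))" by (intro lin_scale lin_mult_right A_algebra lin_id A_module b' hz)
    have yb: "bil k (Hd ?b) (Hd ?b) A (\<lambda>f1 f2. f1 y \<bullet> ?act f2)"
      by (rule bilI[OF Hd_module[OF i(2)] Hd_module[OF i(2)] A_module])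
        (rule lin_scale[OF actl dual_value[OF _ y]], assumption,
         rule lin_coeff[OF lin_eval[OF H_module[OF i(2)] y] A_module lin_closed[OF actl]])
    have fb: "bil k A (H ?b) A (\<lambda>c w. f (y \<otimes>\<^bsub>H ?b\<^esub> w) \<bullet> c)"
      by (rule bilI[OF A_module H_module[OF i(2)] A_module])
        (rule lin_coeff[OF lin_comp[OF dual_lin[OF f H_module[OF i(2)]] H_lin_left[OF i(2) y]] A_module], assumption,
         rule lin_scale[OF lin_id[OF A_module] dual_value[OF f H_mult_closed[OF i(2) y]]])
    have pe: "smash_eval (pure k (Hd ?b) A f b') (y \<otimes>\<^bsub>H ?b\<^esub> w) = f (y \<otimes>\<^bsub>H ?b\<^esub> w) \<bullet> b'" if "w \<Colon> H ?b" for w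
      by (rule smash_eval_pure[OF i(2) H_mult_closed[OF i(2) y that] f b'])
    have "?F (pure k (H ?b) (H ?a) y z) = lift A (\<lambda>f1 f2. h z \<bullet> ((f1 y \<bullet> ?act f2) \<cdot> b')) ?D"
    proof (rule lift_cong[OF _ D])
      show "bil k (Hd ?b) (Hd ?b) A (\<lambda>f1 f2. h z \<bullet> ((f1 y \<bullet> ?act f2) \<cdot> b'))"
        by (rule bilI[OF bilD(1-3)[OF yb]]) (rule lin_comp[OF l bil_right[OF yb]], assumption, rule lin_comp[OF l bil_left[OF yb]])
      fix f1 f2 assume f1: "f1 \<Colon> Hd ?b" and f2: "f2 \<Colon> Hd ?b"
      have c: "f1 y \<Colon> k" "?act f2 \<Colon> A" by (rule dual_value[OF f1 y], rule lin_closed[OF actl f2])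
      show "lift (base_module k) (\<lambda>y z. f1 y \<otimes>\<^bsub>k\<^esub> h z) (pure k (H ?b) (H ?a) y z) \<bullet> (?act f2 \<cdot> b') =
        h z \<bullet> ((f1 y \<bullet> ?act f2) \<cdot> b')"
        using c hz b' lin_closed[OF actb f2]
        by (simp add: lift_pure[OF kb[OF f1] y z] smult_mult_left smult_assoc1[symmetric] cring.cring_simprules(14)[OF k_cring])
    qed
    also have "\<dots> = h z \<bullet> (lift A (\<lambda>f1 f2. f1 y \<bullet> ?act f2) ?D \<cdot> b')"
      by (rule lin_of_lift[OF l yb D, symmetric])
    also have "\<dots> = h z \<bullet> (lift A (\<lambda>c w. f (y \<otimes>\<^bsub>H ?b\<^esub> w) \<bullet> c) (\<rho> ?b a') \<cdot> b')"
      by (simp only: dual_comult_contract[OF H_algebra[OF i(2)] H_fg[OF i(2)] f A_module y r])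
    also have "\<dots> = h z \<bullet> twist ?b ?t y a'"
      unfolding twist_def
      by (subst lin_of_lift[OF lin_mult_right[OF A_algebra lin_id[OF A_module] b'] fb r], rule arg_cong[where f = "\<lambda>c. h z \<bullet> c"],
         rule lift_cong[OF twist_bil_inner[OF i(2) tp y] r])
        (simp add: pe smult_mult_left smult_mult_right b' dual_value[OF f] H_mult_closed[OF i(2) y])
    also have "\<dots> = twist ?b ?t y (?s z)"
      by (simp add: smash_eval_pure[OF i(1) z h a'] twist_scaled[OF i(2) tp y hz a'])
    also have "\<dots> = lift A (\<lambda>y z. twist ?b ?t y (?s z)) (pure k (H ?b) (H ?a) y z)"
      by (rule lift_pure[OF product_bil[OF i(2) tp sp] y z, symmetric])
    finally show "?F (pure k (H ?b) (H ?a) y z) = lift A (\<lambda>y z. twist ?b ?t y (?s z)) (pure k (H ?b) (H ?a) y z)" .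
  qed
  also have "\<dots> = pairing_at ?a ?b x (pure k (Hd ?a) A h a') (pure k (Hd ?b) A f b')" by (simp add: pairing_at_def)
  finally show "smash_eval ?P x = pairing_at ?a ?b x (pure k (Hd ?a) A h a') (pure k (Hd ?b) A f b')" .
qed

definition "smash_mult \<alpha> \<beta> s t = (let T = tensor k (Hd (inv (\<alpha> \<otimes> \<beta>))) A in
  lift T (\<lambda>h a. lift T (\<lambda>f b. smash_pure_product \<alpha> \<beta> h a f b) t) s)"

lemma smash_mult:
  assumes a: "\<alpha> \<Colon> G" and b: "\<beta> \<Colon> G"
    and s: "s \<Colon> tensor k (Hd (inv \<alpha>)) A" and t: "t \<Colon> tensor k (Hd (inv \<beta>)) A"
  shows "smash_mult \<alpha> \<beta> s t \<Colon> tensor k (Hd (inv (\<alpha> \<otimes> \<beta>))) A"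
    and "x \<Colon> H (inv (\<alpha> \<otimes> \<beta>)) \<Longrightarrow>
      smash_eval (smash_mult \<alpha> \<beta> s t) x = pairing_at (inv \<alpha>) (inv \<beta>) x s t"
proof -
  let ?a = "inv \<alpha>" and ?b = "inv \<beta>" and ?ab = "inv (\<alpha> \<otimes> \<beta>)"
  have i: "?a \<Colon> G" "?b \<Colon> G" "?ab \<Colon> G" using a b by simp_all
  have e: "?ab = ?b \<otimes> ?a" by (rule G_inv_mult[OF a b])
  let ?T = "tensor k (Hd ?ab) A"
  have T: "module k ?T" by (intro tensor_is_module Hd_module i A_module)
  note ev = smash_eval_lin[OF i(3)] and inj = smash_eval_inj[OF i(3)]
  have xd: "x \<Colon> H ?ab \<Longrightarrow> x \<Colon> H (?b \<otimes> ?a)" for x by (simp add: e)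
  have ip: "bil k (Hd ?b) A ?T (\<lambda>f b. smash_pure_product \<alpha> \<beta> h a' f b)" (is ?bil)
    "\<lbrakk>t \<Colon> tensor k (Hd ?b) A; x \<Colon> H ?ab\<rbrakk> \<Longrightarrow>
      smash_eval (lift ?T (\<lambda>f b. smash_pure_product \<alpha> \<beta> h a' f b) t) x = pairing_at ?a ?b x (pure k (Hd ?a) A h a') t"
      (is "\<lbrakk>?t; ?x\<rbrakk> \<Longrightarrow> ?val")
    if h: "h \<Colon> Hd ?a" and a': "a' \<Colon> A" for h a' t x
  proof -
    note rules = lift_detected[OF Hd_module[OF i(2)] A_module T, where X = "carrier (H ?ab)" and P = A
      and ev = "\<lambda>x s. smash_eval s x" and g = "\<lambda>x. pairing_at ?a ?b x (pure k (Hd ?a) A h a')"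
      and b = "\<lambda>f b. smash_pure_product \<alpha> \<beta> h a' f b"]
    note sub = smash_pure_product(1)[OF a b h a'] pairing_at_lin_right[OF i(1,2) xd pure_closed[OF Hd_module[OF i(1)] A_module h a']]
      smash_pure_product(2)[OF a b h a']
    show ?bil by (rule rules(1); (rule ev inj sub)?; assumption?)
    show ?val if ?t ?x by (rule rules(2)[OF _ _ _ _ _ that]; (rule ev inj sub)?; assumption?)
  qed
  have op: "bil k (Hd ?a) A ?T (\<lambda>h a'. lift ?T (\<lambda>f b. smash_pure_product \<alpha> \<beta> h a' f b) t)" (is ?bil)
    "x \<Colon> H ?ab \<Longrightarrow> smash_eval (lift ?T (\<lambda>h a'. lift ?T (\<lambda>f b. smash_pure_product \<alpha> \<beta> h a' f b) t) s) x = pairing_at ?a ?b x s t" (is "?x \<Longrightarrow> ?val") for x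
  proof -
    note rules = lift_detected[OF Hd_module[OF i(1)] A_module T, where X = "carrier (H ?ab)" and P = A
      and ev = "\<lambda>x s. smash_eval s x" and g = "\<lambda>x s. pairing_at ?a ?b x s t"
      and b = "\<lambda>h a'. lift ?T (\<lambda>f b. smash_pure_product \<alpha> \<beta> h a' f b) t"]
    note sub = lift_closed[OF ip(1) t] pairing_at_lin_left[OF i(1,2) xd t] ip(2)[OF _ _ t]
    show ?bil by (rule rules(1); (rule ev inj sub)?; assumption?)
    show ?val if ?x by (rule rules(2)[OF _ _ _ _ _ s that]; (rule ev inj sub)?; assumption?)
  qed
  show "smash_mult \<alpha> \<beta> s t \<Colon> ?T" unfolding smash_mult_def Let_def by (rule lift_closed[OF op(1) s])
  show "smash_eval (smash_mult \<alpha> \<beta> s t) x = pairing_at ?a ?b x s t" if "x \<Colon> H ?ab"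
    unfolding smash_mult_def Let_def by (rule op(2)[OF that])
qed

lemma smash_counit: "restrict \<epsilon> (carrier (H \<one>)) \<Colon> Hd \<one>"
  by (rule lin_dual[OF counit_lin])

theorem smash_product_isomorphic:
  "graded_A_ring_isomorphic G A (smash_product G k H \<Delta> \<epsilon> A \<rho>)
     (graded_ring_of G hom_comp hom_mult hom_unit hom_base)"
proof -
  let ?C = "\<lambda>\<alpha>. tensor k (Hd (inv \<alpha>)) A"
  let ?\<eta> = "restrict \<epsilon> (carrier (H \<one>))"
  let ?u = "pure k (Hd \<one>) A ?\<eta> \<one>\<^bsub>A\<^esub>" and ?i = "\<lambda>a. pure k (Hd \<one>) A ?\<eta> a"
  have inv1: "inv \<one> = \<one>" by simp
  have ic: "?i a \<Colon> ?C \<one>" if "a \<Colon> A" for a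
    unfolding inv1 by (intro pure_closed Hd_module G_one A_module smash_counit that)
  have ib: "smash_to_hom \<one> (?i a) = hom_base a" if "a \<Colon> A" for a
    unfolding smash_to_hom_def hom_base_def inv1
    by (rule restrict_ext) (use that in \<open>simp add: smash_eval_pure[OF G_one _ smash_counit]\<close>)
  have "component_isomorphism G hom_comp hom_mult A hom_unit hom_base ?C smash_mult ?u ?i smash_to_hom"
  proof (intro component_isomorphism.intro component_isomorphism_axioms.intro hom_ring_data
      direct_sum_of_groups.intro direct_sum_of_groups_axioms.intro G_group smash_to_hom_bij smash_mult(1) ic ib A_one)
    show "abelian_group (?C \<alpha>)" if "\<alpha> \<Colon> G" for \<alpha>
      using that by (intro module.axioms(2)[of k] tensor_is_module Hd_module G_inv_closed A_module)
    show "smash_to_hom \<alpha> (x \<oplus>\<^bsub>?C \<alpha>\<^esub> y) = smash_to_hom \<alpha> x \<oplus>\<^bsub>hom_comp \<alpha>\<^esub> smash_to_hom \<alpha> y"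
      if a: "\<alpha> \<Colon> G" and x: "x \<Colon> ?C \<alpha>" and y: "y \<Colon> ?C \<alpha>" for \<alpha> x y
      unfolding smash_to_hom_def hom_comp_def
      by (simp, rule restrict_ext) (simp add: lin_add[OF smash_eval_lin[OF G_inv_closed[OF a]] x y])
    show "smash_to_hom (\<alpha> \<otimes> \<beta>) (smash_mult \<alpha> \<beta> x y) = hom_mult \<alpha> \<beta> (smash_to_hom \<alpha> x) (smash_to_hom \<beta> y)"
      if a: "\<alpha> \<Colon> G" and b: "\<beta> \<Colon> G" and x: "x \<Colon> ?C \<alpha>" and y: "y \<Colon> ?C \<beta>" for \<alpha> \<beta> x y
      unfolding smash_to_hom_def[of "\<alpha> \<otimes> \<beta>"] hom_mult_def
    proof (rule restrict_ext)
      fix h assume h: "h \<Colon> H (inv (\<alpha> \<otimes> \<beta>))"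
      let ?a = "inv \<alpha>" and ?b = "inv \<beta>"
      have i: "?a \<Colon> G" "?b \<Colon> G" using a b by simp_all
      note d = comult_closed[OF i(2,1), of h]
      note xl = smash_eval_lin_arg[OF i(1) x] and yl = smash_eval_lin_arg[OF i(2) y]
      have tw: "twist ?b (smash_to_hom \<beta> y) p c = twist ?b (smash_eval y) p c" if "p \<Colon> H ?b" "c \<Colon> A" for p c
        unfolding twist_def
        by (rule lift_cong[OF twist_bil_inner[OF i(2) yl that(1)] coact_closed[OF i(2) that(2)]])
          (simp add: smash_to_hom_def H_mult_closed[OF i(2) that(1)])
      show "smash_eval (smash_mult \<alpha> \<beta> x y) h = lift A (\<lambda>p q. twist ?b (smash_to_hom \<beta> y) p (smash_to_hom \<alpha> x q)) (\<Delta> ?b ?a h)"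
        unfolding smash_mult(2)[OF a b x y h] pairing_at_def
        by (rule lift_cong[OF product_bil[OF i(2) yl xl] d, symmetric])
          (use h in \<open>simp_all add: G_inv_mult a b tw lin_closed[OF xl] smash_to_hom_def[of \<alpha>]\<close>)
    qed
    show "smash_to_hom \<one> ?u = hom_unit" unfolding hom_unit_base by (rule ib[OF A_one])
  qed
  then have "graded_A_ring_isomorphic G A (graded_ring_of G ?C smash_mult ?u ?i) (graded_ring_of G hom_comp hom_mult hom_unit hom_base)"
    by (rule component_isomorphism.isomorphic)
  moreover have "smash_product G k H \<Delta> \<epsilon> A \<rho> = graded_ring_of G ?C smash_mult ?u ?i"
    unfolding smash_product_def Let_def dual_component_def smash_mult_def inv1 by (rule refl)
  ultimately show ?thesis by simp
qed

end

section \<open>Relative Hopf modules as graded modules\<close>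

lemma underlying_simps [simp]:
  "carrier (underlying_module A N act) = carrier N" "x \<oplus>\<^bsub>underlying_module A N act\<^esub> y = x \<oplus>\<^bsub>N\<^esub> y"
  "\<zero>\<^bsub>underlying_module A N act\<^esub> = \<zero>\<^bsub>N\<^esub>" "c \<odot>\<^bsub>underlying_module A N act\<^esub> m = act m (c \<odot>\<^bsub>A\<^esub> \<one>\<^bsub>A\<^esub>)"
  by (simp_all add: underlying_module_def ring.defs)

context finite_comodule_algebra
begin

sublocale K: graded_ring_data G hom_comp hom_mult A hom_unit hom_base by (rule hom_ring_data)

abbreviation "V \<equiv> underlying_module A"

lemma scalar_closed: "c \<Colon> k \<Longrightarrow> c \<bullet> \<one>\<^bsub>A\<^esub> \<Colon> A"
  by (intro module.smult_closed[OF A_module] A_one)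

lemma scalar_mult: "\<lbrakk>c \<Colon> k; a \<Colon> A\<rbrakk> \<Longrightarrow> (c \<bullet> \<one>\<^bsub>A\<^esub>) \<cdot> a = c \<bullet> a"
  "\<lbrakk>c \<Colon> k; a \<Colon> A\<rbrakk> \<Longrightarrow> a \<cdot> (c \<bullet> \<one>\<^bsub>A\<^esub>) = c \<bullet> a"
  by (simp_all add: smult_mult_left smult_mult_right A_one monoid.l_one[OF ring.is_monoid[OF A_ring]]
      monoid.r_one[OF ring.is_monoid[OF A_ring]])

lemma underlying_is_module:
  assumes M: "right_module A N act"
  shows "module k (V N act)"
proof -
  interpret M: right_module A N act by (rule M)
  have ag: "abelian_group (V N act)" by (rule same_abelian_group[OF M.M.abelian_group_axioms]) simp_all
  show ?thesis
  proof (rule moduleI[OF k_cring ag])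
    fix c d x assume c: "c \<Colon> k" and d: "d \<Colon> k" and x: "x \<Colon> V N act"
    show "(c \<oplus>\<^bsub>k\<^esub> d) \<odot>\<^bsub>V N act\<^esub> x = c \<odot>\<^bsub>V N act\<^esub> x \<oplus>\<^bsub>V N act\<^esub> d \<odot>\<^bsub>V N act\<^esub> x"
      using c d x by (simp add: M.act_add_right[symmetric] scalar_closed module.smult_l_distr[OF A_module] A_one)
    show "(c \<otimes>\<^bsub>k\<^esub> d) \<odot>\<^bsub>V N act\<^esub> x = c \<odot>\<^bsub>V N act\<^esub> (d \<odot>\<^bsub>V N act\<^esub> x)"
      using c d x cring.cring_simprules(14)[OF k_cring c d]
      by (simp add: M.act_mult[symmetric] scalar_closed scalar_mult smult_assoc1[symmetric] A_one)
  qed (simp_all add: M.act_closed M.act_add_left scalar_closed M.act_one module.smult_one[OF A_module] A_one)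
qed

lemma act_bil:
  assumes M: "right_module A N act"
  shows "bil k (V N act) A (V N act) act"
proof -
  interpret M: right_module A N act by (rule M)
  note V = underlying_is_module[OF M]
  show ?thesis
  proof (rule bilI[OF V A_module V])
    show "lin k A (V N act) (act m)" if "m \<Colon> V N act" for m
      by (rule linI[OF A_module V])
        (use that in \<open>simp_all add: M.act_closed M.act_add_right M.act_mult[symmetric] scalar_closed scalar_mult\<close>)
    show "lin k (V N act) (V N act) (\<lambda>m. act m a)" if "a \<Colon> A" for a
      by (rule linI[OF V V])
        (use that in \<open>simp_all add: M.act_closed M.act_add_left M.act_mult[symmetric] scalar_closed scalar_mult\<close>)
  qed
qed

text \<open>For \<open>t = \<rho>(m)\<close> this is the action \<open>m\<^sub>0 f(m\<^sub>1)\<close>.\<close>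

definition "pair_with N act f t = lift (V N act) (\<lambda>n h. act n (f h)) t"

lemma pair_bil:
  assumes M: "right_module A N act" and f: "lin k X A f"
  shows "bil k (V N act) X (V N act) (\<lambda>n h. act n (f h))"
  by (rule bil_comp[OF act_bil[OF M] lin_id[OF underlying_is_module[OF M]] f])

lemma pair_lin:
  "\<lbrakk>right_module A N act; lin k X A f\<rbrakk> \<Longrightarrow> lin k (tensor k (V N act) X) (V N act) (pair_with N act f)"
  unfolding pair_with_def by (rule lin_lift[OF pair_bil])

lemma pair_cong:
  assumes "right_module A N act" "lin k X A f" "t \<Colon> tensor k (V N act) X"
    and "\<And>h. h \<Colon> X \<Longrightarrow> f' h = f h"
  shows "pair_with N act f' t = pair_with N act f t"
  unfolding pair_with_def by (rule lift_cong[OF pair_bil[OF assms(1,2)] assms(3)]) (simp add: assms(4))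

definition "scalar_hom \<beta> u = (\<lambda>h\<in>carrier (H \<beta>). u h \<bullet> \<one>\<^bsub>A\<^esub>)"

lemma scalar_hom_lin:
  assumes "\<beta> \<Colon> G" "u \<Colon> Hd \<beta>"
  shows "lin k (H \<beta>) A (scalar_hom \<beta> u)"
  by (rule lin_cong[OF lin_coeff[OF dual_lin[OF assms(2) H_module[OF assms(1)]] A_module A_one]])
    (simp add: scalar_hom_def)

lemma scalar_hom_closed:
  assumes "\<beta> \<Colon> G" "u \<Colon> Hd \<beta>"
  shows "scalar_hom \<beta> u \<Colon> hom_comp (inv \<beta>)"
  using hom_compI[of "inv \<beta>" "scalar_hom \<beta> u"] scalar_hom_lin[OF assms] assms(1)
  by (simp add: scalar_hom_def restrict_restrict)

text \<open>Against scalar-valued functionals the pairing is contraction, so it separates tensors.\<close>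

lemma contract_pair:
  assumes M: "right_module A N act" and b: "\<beta> \<Colon> G" and u: "u \<Colon> Hd \<beta>"
    and t: "t \<Colon> tensor k (V N act) (H \<beta>)"
  shows "lift (V N act) (\<lambda>n h. u h \<odot>\<^bsub>V N act\<^esub> n) t = pair_with N act (scalar_hom \<beta> u) t"
  unfolding pair_with_def
  by (rule lift_cong[OF pair_bil[OF M scalar_hom_lin[OF b u]] t]) (simp add: scalar_hom_def)

lemma pair_eqI:
  assumes M: "right_module A N act" and b: "\<beta> \<Colon> G"
    and s: "s \<Colon> tensor k (V N act) (H \<beta>)" and t: "t \<Colon> tensor k (V N act) (H \<beta>)"
    and eq: "\<And>f. f \<Colon> hom_comp (inv \<beta>) \<Longrightarrow> pair_with N act f s = pair_with N act f t"
  shows "s = t"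
  by (rule tensor_dual_eqI[OF H_fg[OF b] underlying_is_module[OF M] s t])
    (simp only: contract_pair[OF M b _ s] contract_pair[OF M b _ t] eq scalar_hom_closed b)

text \<open>The right-hand side \<open>n a\<^sub>0 \<otimes> h a\<^sub>1\<close> of the compatibility condition of
  relative Hopf modules.\<close>

definition "diagonal_act N act \<beta> t a = (let T = tensor k (V N act) (H \<beta>) in lift T (\<lambda>n h. lift T (\<lambda>b h'. pure k (V N act) (H \<beta>) (act n b) (h \<otimes>\<^bsub>H \<beta>\<^esub> h')) (\<rho> \<beta> a)) t)"

lemma diagonal_act:
  assumes M: "right_module A N act" and b: "\<beta> \<Colon> G" and t: "t \<Colon> tensor k (V N act) (H \<beta>)"
    and a: "a \<Colon> A"
  shows "diagonal_act N act \<beta> t a \<Colon> tensor k (V N act) (H \<beta>)"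
    and "lin k (H \<beta>) A f \<Longrightarrow> pair_with N act f (diagonal_act N act \<beta> t a) = pair_with N act (\<lambda>x. twist \<beta> f x a) t"
proof -
  interpret M: right_module A N act by (rule M)
  let ?V = "V N act" let ?T = "tensor k ?V (H \<beta>)"
  let ?p = "\<lambda>n h c h'. pure k ?V (H \<beta>) (act n c) (h \<otimes>\<^bsub>H \<beta>\<^esub> h')"
  note V = underlying_is_module[OF M] note Hb = H_module[OF b] note r = coact_closed[OF b a]
  have T: "module k ?T" by (intro tensor_is_module V Hb)
  note p = pure_bil[OF V Hb] and ab = act_bil[OF M]
  have i: "bil k A (H \<beta>) ?T (\<lambda>c h'. ?p n h c h')" if "n \<Colon> ?V" "h \<Colon> H \<beta>" for n h
    by (rule bil_comp[OF p bil_right[OF ab that(1)] H_lin_left[OF b that(2)]])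
  have o: "bil k ?V (H \<beta>) ?T (\<lambda>n h. lift ?T (\<lambda>c h'. ?p n h c h') (\<rho> \<beta> a))"
  proof (rule bilI[OF V Hb T])
    show "lin k (H \<beta>) ?T (\<lambda>h. lift ?T (\<lambda>c h'. ?p n h c h') (\<rho> \<beta> a))" if n: "n \<Colon> ?V" for n
      by (rule lin_lift_param[OF Hb r i[OF n]], assumption, rule lin_pure_right[OF H_lin_right[OF b] V])
        (use n bil_closed[OF ab n] in \<open>simp_all add: M.act_closed\<close>)
    show "lin k ?V ?T (\<lambda>n. lift ?T (\<lambda>c h'. ?p n h c h') (\<rho> \<beta> a))" if h: "h \<Colon> H \<beta>" for h
      by (rule lin_lift_param[OF V r i[OF _ h]], assumption, rule lin_pure_left[OF bil_left[OF ab] Hb])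
        (simp_all add: H_mult_closed b h)
  qed
  show "diagonal_act N act \<beta> t a \<Colon> ?T" unfolding diagonal_act_def Let_def by (rule lift_closed[OF o t])
  assume f: "lin k (H \<beta>) A f"
  note pl = pair_lin[OF M f] and tl = bil_left[OF twist_bil[OF b f] a]
  have "pair_with N act f (diagonal_act N act \<beta> t a) =
    lift ?V (\<lambda>n h. pair_with N act f (lift ?T (\<lambda>c h'. ?p n h c h') (\<rho> \<beta> a))) t" (is "?l = _")
    unfolding diagonal_act_def Let_def by (rule lin_of_lift[OF pl o t])
  also have "\<dots> = lift ?V (\<lambda>n h. act n (twist \<beta> f h a)) t"
  proof (rule lift_cong[OF pair_bil[OF M tl] t])
    fix n h assume n: "n \<Colon> ?V" and h: "h \<Colon> H \<beta>"
    note ti = twist_bil_inner[OF b f h]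
    have "pair_with N act f (lift ?T (\<lambda>c h'. ?p n h c h') (\<rho> \<beta> a)) =
      lift ?V (\<lambda>c h'. pair_with N act f (?p n h c h')) (\<rho> \<beta> a)" (is "?l = _")
      by (rule lin_of_lift[OF pl i[OF n h] r])
    also have "\<dots> = lift ?V (\<lambda>c h'. act n (c \<cdot> f (h \<otimes>\<^bsub>H \<beta>\<^esub> h'))) (\<rho> \<beta> a)"
    proof (rule lift_cong[OF _ r])
      show "bil k A (H \<beta>) ?V (\<lambda>c h'. act n (c \<cdot> f (h \<otimes>\<^bsub>H \<beta>\<^esub> h')))"
        by (rule bilI[OF A_module Hb V]) (rule lin_comp[OF bil_right[OF ab n] bil_right[OF ti]], assumption,
          rule lin_comp[OF bil_right[OF ab n] bil_left[OF ti]])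
      fix c h' assume c: "c \<Colon> A" and h': "h' \<Colon> H \<beta>"
      show "pair_with N act f (?p n h c h') = act n (c \<cdot> f (h \<otimes>\<^bsub>H \<beta>\<^esub> h'))"
        unfolding pair_with_def using n c h h'
        by (simp add: lift_pure[OF pair_bil[OF M f]] M.act_closed H_mult_closed b M.act_mult lin_closed[OF f])
    qed
    also have "\<dots> = act n (twist \<beta> f h a)"
      unfolding twist_def by (rule lin_of_lift[OF bil_right[OF ab n] ti r, symmetric])
    finally show "?l = \<dots>" .
  qed
  finally show "?l = pair_with N act (\<lambda>x. twist \<beta> f x a) t"
    by (simp add: pair_with_def)
qed

subsection \<open>From relative Hopf modules to graded modules\<close>

lemma hopf_modulesD:
  assumes M: "M \<in> hopf_modules G k H \<Delta> \<epsilon> A \<rho>"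
  shows "hm_group M \<in> extensional (carrier G)" "hm_act M \<in> extensional (carrier G)"
    and "extensional2 (carrier G) (carrier G) (hm_coact M)"
    and "\<alpha> \<Colon> G \<Longrightarrow> plain_abelian_group (hm_group M \<alpha>)"
    and "\<alpha> \<Colon> G \<Longrightarrow> extensional2 (carrier (hm_group M \<alpha>)) (carrier A) (hm_act M \<alpha>)"
    and "\<alpha> \<Colon> G \<Longrightarrow> right_module A (hm_group M \<alpha>) (hm_act M \<alpha>)"
    and "\<lbrakk>\<alpha> \<Colon> G; \<beta> \<Colon> G\<rbrakk> \<Longrightarrow> hm_coact M \<alpha> \<beta> \<in> extensional (carrier (hm_group M (\<alpha> \<otimes> \<beta>)))"
    and "\<lbrakk>\<alpha> \<Colon> G; \<beta> \<Colon> G\<rbrakk> \<Longrightarrow>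
      lin k (hm_module A M (\<alpha> \<otimes> \<beta>)) (tensor k (hm_module A M \<alpha>) (H \<beta>)) (hm_coact M \<alpha> \<beta>)"
    and "\<lbrakk>\<alpha> \<Colon> G; \<beta> \<Colon> G; \<gamma> \<Colon> G; m \<Colon> hm_group M (\<alpha> \<otimes> \<beta> \<otimes> \<gamma>)\<rbrakk> \<Longrightarrow>
           tensor_assoc k (hm_module A M \<alpha>) (H \<beta>) (H \<gamma>)
             (tensor_map k (hm_module A M \<alpha>) (tensor k (H \<beta>) (H \<gamma>)) id (\<Delta> \<beta> \<gamma>)
               (hm_coact M \<alpha> (\<beta> \<otimes> \<gamma>) m)) =
           tensor_map k (tensor k (hm_module A M \<alpha>) (H \<beta>)) (H \<gamma>) (hm_coact M \<alpha> \<beta>) id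
             (hm_coact M (\<alpha> \<otimes> \<beta>) \<gamma> m)"
    and "\<lbrakk>\<alpha> \<Colon> G; m \<Colon> hm_group M \<alpha>\<rbrakk> \<Longrightarrow>
           lift (hm_module A M \<alpha>) (\<lambda>n h. \<epsilon> h \<odot>\<^bsub>hm_module A M \<alpha>\<^esub> n) (hm_coact M \<alpha> \<one> m) = m"
    and "\<lbrakk>\<alpha> \<Colon> G; \<beta> \<Colon> G; m \<Colon> hm_group M (\<alpha> \<otimes> \<beta>); a \<Colon> A\<rbrakk> \<Longrightarrow>
           hm_coact M \<alpha> \<beta> (hm_act M (\<alpha> \<otimes> \<beta>) m a) =
           diagonal_act (hm_group M \<alpha>) (hm_act M \<alpha>) \<beta> (hm_coact M \<alpha> \<beta> m) a"
proof -
  note M = M[unfolded hopf_modules_def mem_Collect_eq]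
  show rm: "\<alpha> \<Colon> G \<Longrightarrow> right_module A (hm_group M \<alpha>) (hm_act M \<alpha>)" for \<alpha> using M by (elim conjE) simp
  show "lin k (hm_module A M (\<alpha> \<otimes> \<beta>)) (tensor k (hm_module A M \<alpha>) (H \<beta>)) (hm_coact M \<alpha> \<beta>)"
    if "\<alpha> \<Colon> G" "\<beta> \<Colon> G"
    unfolding lin_def using M that by (elim conjE) (simp add: tensor_is_module underlying_is_module rm H_module)
  show "\<lbrakk>\<alpha> \<Colon> G; \<beta> \<Colon> G; m \<Colon> hm_group M (\<alpha> \<otimes> \<beta>); a \<Colon> A\<rbrakk> \<Longrightarrow>
           hm_coact M \<alpha> \<beta> (hm_act M (\<alpha> \<otimes> \<beta>) m a) =
           diagonal_act (hm_group M \<alpha>) (hm_act M \<alpha>) \<beta> (hm_coact M \<alpha> \<beta> m) a"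
    unfolding diagonal_act_def using M by (elim conjE) simp
qed (use M in \<open>unfold hopf_modules_def mem_Collect_eq, elim conjE, simp\<close>)+

definition "hopf_action M \<alpha> \<beta> m f = pair_with (hm_group M (\<alpha> \<otimes> \<beta>)) (hm_act M (\<alpha> \<otimes> \<beta>)) f
  (hm_coact M (\<alpha> \<otimes> \<beta>) (inv \<beta>) m)"

lemma G_cancel [simp]: "\<lbrakk>\<alpha> \<Colon> G; \<beta> \<Colon> G\<rbrakk> \<Longrightarrow> \<alpha> \<otimes> \<beta> \<otimes> inv \<beta> = \<alpha>"
  "\<lbrakk>\<alpha> \<Colon> G; \<beta> \<Colon> G\<rbrakk> \<Longrightarrow> \<alpha> \<otimes> inv \<beta> \<otimes> \<beta> = \<alpha>"
  by (simp_all add: G_assoc)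

lemma hopf_coact:
  assumes M: "M \<in> hopf_modules G k H \<Delta> \<epsilon> A \<rho>" and a: "\<alpha> \<Colon> G" and b: "\<beta> \<Colon> G"
  shows "lin k (hm_module A M \<alpha>) (tensor k (hm_module A M (\<alpha> \<otimes> \<beta>)) (H (inv \<beta>))) (hm_coact M (\<alpha> \<otimes> \<beta>) (inv \<beta>))"
  using hopf_modulesD(8)[OF M, of "\<alpha> \<otimes> \<beta>" "inv \<beta>"] a b by simp

lemma hopf_action_lin:
  assumes M: "M \<in> hopf_modules G k H \<Delta> \<epsilon> A \<rho>" and a: "\<alpha> \<Colon> G" and b: "\<beta> \<Colon> G"
    and f: "lin k (H (inv \<beta>)) A f"
  shows "lin k (hm_module A M \<alpha>) (hm_module A M (\<alpha> \<otimes> \<beta>)) (\<lambda>m. hopf_action M \<alpha> \<beta> m f)"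
  unfolding hopf_action_def
  by (rule lin_comp[OF pair_lin[OF hopf_modulesD(6)[OF M G_mult_closed[OF a b]] f] hopf_coact[OF M a b]])

text \<open>Contraction of the compatibility condition with \<open>f\<close>.\<close>

lemma hopf_action_act:
  assumes M: "M \<in> hopf_modules G k H \<Delta> \<epsilon> A \<rho>" and a: "\<alpha> \<Colon> G" and b: "\<beta> \<Colon> G"
    and f: "lin k (H (inv \<beta>)) A f" and m: "m \<Colon> hm_group M \<alpha>" and c: "c \<Colon> A"
  shows "hopf_action M \<alpha> \<beta> (hm_act M \<alpha> m c) f = hopf_action M \<alpha> \<beta> m (\<lambda>x. twist (inv \<beta>) f x c)"
proof -
  have ab: "\<alpha> \<otimes> \<beta> \<Colon> G" "inv \<beta> \<Colon> G" using a b by simp_all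
  note rm = hopf_modulesD(6)[OF M ab(1)]
  have m': "hm_coact M (\<alpha> \<otimes> \<beta>) (inv \<beta>) m \<Colon> tensor k (hm_module A M (\<alpha> \<otimes> \<beta>)) (H (inv \<beta>))"
    by (rule lin_closed[OF hopf_coact[OF M a b]]) (simp add: m)
  show ?thesis
    using hopf_modulesD(11)[OF M ab, of m c] diagonal_act(2)[OF rm ab(2) m' c f] a b m c by (simp add: hopf_action_def)
qed

text \<open>Coassociativity writes \<open>m\<^sub>0 (f # g)(m\<^sub>1)\<close> as a sum over the coaction applied
  twice, and compatibility lets \<open>f\<close> act before \<open>g\<close>.\<close>

lemma hopf_action_mult:
  assumes M: "M \<in> hopf_modules G k H \<Delta> \<epsilon> A \<rho>" and a: "\<alpha> \<Colon> G" and b: "\<beta> \<Colon> G" and c: "\<gamma> \<Colon> G"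
    and m: "m \<Colon> hm_group M \<alpha>" and f: "f \<Colon> hom_comp \<beta>" and g: "g \<Colon> hom_comp \<gamma>"
  shows "hopf_action M \<alpha> (\<beta> \<otimes> \<gamma>) m (hom_mult \<beta> \<gamma> f g) = hopf_action M (\<alpha> \<otimes> \<beta>) \<gamma> (hopf_action M \<alpha> \<beta> m f) g"
proof -
  let ?b = "inv \<beta>" and ?c = "inv \<gamma>" and ?d = "\<alpha> \<otimes> \<beta> \<otimes> \<gamma>"
  have G: "\<alpha> \<otimes> \<beta> \<Colon> G" "?d \<Colon> G" "?b \<Colon> G" "?c \<Colon> G" "\<beta> \<otimes> \<gamma> \<Colon> G" "?c \<otimes> ?b \<Colon> G" using a b c by simp_all
  have e: "\<alpha> \<otimes> (\<beta> \<otimes> \<gamma>) = ?d" "inv (\<beta> \<otimes> \<gamma>) = ?c \<otimes> ?b" "?d \<otimes> ?c = \<alpha> \<otimes> \<beta>" "?d \<otimes> (?c \<otimes> ?b) = \<alpha>"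
    using a b c by (simp_all add: G_inv_mult G_assoc[symmetric])
  note fl = hom_comp_lin[OF b f] and gl = hom_comp_lin[OF c g]
  note rm = hopf_modulesD(6)[OF M] and bi = act_bil[OF rm[OF G(2)]]
  let ?V = "hm_module A M ?d" and ?W = "hm_module A M (\<alpha> \<otimes> \<beta>)" and ?X = "hm_module A M \<alpha>"
  note V = underlying_is_module[OF rm[OF G(2)]] and W = underlying_is_module[OF rm[OF G(1)]] and X = underlying_is_module[OF rm[OF a]]
  have Dc: "lin k ?W (tensor k ?V (H ?c)) (hm_coact M ?d ?c)" by (rule hopf_coact[OF M G(1) c])
  have Db: "lin k ?X (tensor k ?W (H ?b)) (hm_coact M (\<alpha> \<otimes> \<beta>) ?b)" by (rule hopf_coact[OF M a b])
  have Dcb: "lin k ?X (tensor k ?V (H (?c \<otimes> ?b))) (hm_coact M ?d (?c \<otimes> ?b))"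
    using hopf_coact[OF M a G(5)] by (simp only: e)
  have mc: "m \<Colon> ?X" using m by simp
  let ?t = "\<lambda>n x y. hm_act M ?d n (twist ?c g x (f y))"
  note pb = product_bil[OF G(4) gl fl]
  have t1: "bil k ?V (H ?c) ?V (\<lambda>n x. ?t n x y)" if "y \<Colon> H ?b" for y
    by (rule pair_bil[OF rm[OF G(2)] bil_left[OF pb that]])
  have t2: "bil k (H ?c) (H ?b) ?V (\<lambda>x y. ?t n x y)" if n: "n \<Colon> ?V" for n
    by (rule bilI[OF H_module[OF G(4)] H_module[OF G(3)] V]) (rule lin_comp[OF bil_right[OF bi n] bil_right[OF pb]], assumption,
      rule lin_comp[OF bil_right[OF bi n] bil_left[OF pb]])
  have hl: "lin k (H (?c \<otimes> ?b)) A (hom_mult \<beta> \<gamma> f g)"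
    using hom_comp_lin[OF G(5) hom_mult_closed[OF b c f g]] by (simp only: e)
  have "hopf_action M \<alpha> (\<beta> \<otimes> \<gamma>) m (hom_mult \<beta> \<gamma> f g) = lift ?V (\<lambda>n w. hm_act M ?d n (hom_mult \<beta> \<gamma> f g w)) (hm_coact M ?d (?c \<otimes> ?b) m)"
    by (simp only: hopf_action_def pair_with_def e)
  also have "\<dots> = lift ?V (\<lambda>n w. lift ?V (\<lambda>x y. ?t n x y) (\<Delta> ?c ?b w)) (hm_coact M ?d (?c \<otimes> ?b) m)"
  proof (rule lift_cong[OF pair_bil[OF rm[OF G(2)] hl] lin_closed[OF Dcb mc], symmetric])
    fix n w assume n: "n \<Colon> ?V" and w: "w \<Colon> H (?c \<otimes> ?b)"
    show "lift ?V (\<lambda>x y. ?t n x y) (\<Delta> ?c ?b w) = hm_act M ?d n (hom_mult \<beta> \<gamma> f g w)"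
      unfolding hom_mult_value[OF b c w] by (rule lin_of_lift[OF bil_right[OF bi n] pb comult_closed[OF G(4,3) w], symmetric])
  qed
  also have "\<dots> = lift ?V (\<lambda>v y. lift ?V (\<lambda>n x. ?t n x y) (hm_coact M ?d ?c v)) (hm_coact M (\<alpha> \<otimes> \<beta>) ?b m)"
  proof (rule lift_coassoc[OF V H_module[OF G(4)] H_module[OF G(3)] Dc comult_lin[OF G(4,3)] lin_closed[OF Db mc] lin_closed[OF Dcb mc] _ t1 t2, symmetric])
    show "tensor_map k (tensor k ?V (H ?c)) (H ?b) (hm_coact M ?d ?c) id (hm_coact M (\<alpha> \<otimes> \<beta>) ?b m) =
      tensor_assoc k ?V (H ?c) (H ?b) (tensor_map k ?V (tensor k (H ?c) (H ?b)) id (\<Delta> ?c ?b) (hm_coact M ?d (?c \<otimes> ?b) m))"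
      using hopf_modulesD(9)[OF M G(2,4,3), of m] m by (simp only: e G_assoc[OF G(2,4,3)] G_cancel(1)[OF a b])
  qed
  also have "\<dots> = lift ?V (\<lambda>v y. hopf_action M (\<alpha> \<otimes> \<beta>) \<gamma> (hm_act M (\<alpha> \<otimes> \<beta>) v (f y)) g) (hm_coact M (\<alpha> \<otimes> \<beta>) ?b m)"
  proof (rule lift_cong[OF _ lin_closed[OF Db mc]])
    note ab = pair_bil[OF rm[OF G(1)] fl] and hg = hopf_action_lin[OF M G(1) c gl]
    show "bil k ?W (H ?b) ?V (\<lambda>v y. hopf_action M (\<alpha> \<otimes> \<beta>) \<gamma> (hm_act M (\<alpha> \<otimes> \<beta>) v (f y)) g)"
      by (rule bilI[OF W H_module[OF G(3)] V]) (rule lin_comp[OF hg bil_right[OF ab]], assumption, rule lin_comp[OF hg bil_left[OF ab]])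
    fix v y assume v: "v \<Colon> ?W" and y: "y \<Colon> H ?b"
    show "lift ?V (\<lambda>n x. ?t n x y) (hm_coact M ?d ?c v) = hopf_action M (\<alpha> \<otimes> \<beta>) \<gamma> (hm_act M (\<alpha> \<otimes> \<beta>) v (f y)) g"
      using v hopf_action_act[OF M G(1) c gl _ lin_closed[OF fl y], of v] by (simp add: hopf_action_def pair_with_def)
  qed
  also have "\<dots> = hopf_action M (\<alpha> \<otimes> \<beta>) \<gamma> (hopf_action M \<alpha> \<beta> m f) g"
    unfolding hopf_action_def[of M \<alpha> \<beta>] pair_with_def
    by (rule lin_of_lift[OF hopf_action_lin[OF M G(1) c gl] pair_bil[OF rm[OF G(1)] fl] lin_closed[OF Db mc], symmetric])
  finally show ?thesis .
qed

text \<open>The degree-\<open>e\<close> part of the action is the action of \<open>A\<close>, by the counit axiom.\<close>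

lemma hopf_action_base:
  assumes M: "M \<in> hopf_modules G k H \<Delta> \<epsilon> A \<rho>" and a: "\<alpha> \<Colon> G"
    and m: "m \<Colon> hm_group M \<alpha>" and c: "c \<Colon> A"
  shows "hopf_action M \<alpha> \<one> m (hom_base c) = hm_act M \<alpha> m c"
proof -
  let ?V = "hm_module A M \<alpha>"
  note rm = hopf_modulesD(6)[OF M a] note V = underlying_is_module[OF rm] note bi = act_bil[OF rm]
  interpret M: right_module A "hm_group M \<alpha>" "hm_act M \<alpha>" by (rule rm)
  have t: "hm_coact M \<alpha> \<one> m \<Colon> tensor k ?V (H \<one>)"
    using lin_closed[OF hopf_coact[OF M a G_one]] a m by simp
  have cb: "bil k ?V (H \<one>) ?V (\<lambda>n h. \<epsilon> h \<odot>\<^bsub>?V\<^esub> n)"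
    by (rule bilI[OF V H_module[OF G_one] V]) (rule lin_coeff[OF counit_lin V], assumption, rule lin_scale[OF lin_id[OF V] counit_closed])
  have "hopf_action M \<alpha> \<one> m (hom_base c) = lift ?V (\<lambda>n h. hm_act M \<alpha> n (hom_base c h)) (hm_coact M \<alpha> \<one> m)"
    by (simp add: hopf_action_def pair_with_def a)
  also have "\<dots> = lift ?V (\<lambda>n h. hm_act M \<alpha> (\<epsilon> h \<odot>\<^bsub>?V\<^esub> n) c) (hm_coact M \<alpha> \<one> m)"
  proof (rule lift_cong[OF _ t])
    show "bil k ?V (H \<one>) ?V (\<lambda>n h. hm_act M \<alpha> (\<epsilon> h \<odot>\<^bsub>?V\<^esub> n) c)"
      by (rule bilI[OF V H_module[OF G_one] V]) (rule lin_comp[OF bil_left[OF bi c] bil_right[OF cb]], assumption,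
        rule lin_comp[OF bil_left[OF bi c] bil_left[OF cb]])
    show "hm_act M \<alpha> n (hom_base c h) = hm_act M \<alpha> (\<epsilon> h \<odot>\<^bsub>?V\<^esub> n) c" if "n \<Colon> ?V" "h \<Colon> H \<one>" for n h
      using that c by (simp add: hom_base_def M.act_mult[symmetric] scalar_closed counit_closed scalar_mult)
  qed
  also have "\<dots> = hm_act M \<alpha> (lift ?V (\<lambda>n h. \<epsilon> h \<odot>\<^bsub>?V\<^esub> n) (hm_coact M \<alpha> \<one> m)) c"
    by (rule lin_of_lift[OF bil_left[OF bi c] cb t, symmetric])
  also have "\<dots> = hm_act M \<alpha> m c" by (simp only: hopf_modulesD(10)[OF M a m])
  finally show ?thesis .
qed

theorem hopf_component_module:
  assumes M: "M \<in> hopf_modules G k H \<Delta> \<epsilon> A \<rho>"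
  shows "K.component_module (hm_group M) (hopf_action M)"
  unfolding K.component_module_def
proof (intro conjI ballI hopf_modulesD(1,4)[OF M] graded_pairing.intro graded_pairing_axioms.intro
    direct_sum_of_groups.intro direct_sum_of_groups_axioms.intro G_group hom_comp_group hopf_action_mult[OF M])
  note rm = hopf_modulesD(6)[OF M]
  show "abelian_group (hm_group M \<alpha>)" if "\<alpha> \<Colon> G" for \<alpha> by (rule K.plain_group[OF hopf_modulesD(4)[OF M that]])
  then show "abelian_group (hm_group M \<alpha>)" if "\<alpha> \<Colon> G" for \<alpha> using that .
  fix \<alpha> \<beta> m f assume a: "\<alpha> \<Colon> G" and b: "\<beta> \<Colon> G" and m: "m \<Colon> hm_group M \<alpha>" and f: "f \<Colon> hom_comp \<beta>"
  note fl = hom_comp_lin[OF b f]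
  have ab: "\<alpha> \<otimes> \<beta> \<Colon> G" using a b by simp
  show "hopf_action M \<alpha> \<beta> m f \<Colon> hm_group M (\<alpha> \<otimes> \<beta>)"
    using lin_closed[OF hopf_action_lin[OF M a b fl], of m] m by simp
  show "hopf_action M \<alpha> \<beta> (m \<oplus>\<^bsub>hm_group M \<alpha>\<^esub> m') f = hopf_action M \<alpha> \<beta> m f \<oplus>\<^bsub>hm_group M (\<alpha> \<otimes> \<beta>)\<^esub> hopf_action M \<alpha> \<beta> m' f"
    if "m' \<Colon> hm_group M \<alpha>" for m'
    using lin_add[OF hopf_action_lin[OF M a b fl], of m m'] m that by simp
  show "hopf_action M \<alpha> \<beta> m (f \<oplus>\<^bsub>hom_comp \<beta>\<^esub> f') = hopf_action M \<alpha> \<beta> m f \<oplus>\<^bsub>hm_group M (\<alpha> \<otimes> \<beta>)\<^esub> hopf_action M \<alpha> \<beta> m f'"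
    if f': "f' \<Colon> hom_comp \<beta>" for f'
  proof -
    let ?V = "hm_module A M (\<alpha> \<otimes> \<beta>)" let ?r = "hm_coact M (\<alpha> \<otimes> \<beta>) (inv \<beta>) m"
    have r: "?r \<Colon> tensor k ?V (H (inv \<beta>))" by (rule lin_closed[OF hopf_coact[OF M a b]]) (simp add: m)
    note f'l = hom_comp_lin[OF b f'] and p = pair_bil[OF rm[OF ab]]
    interpret M: right_module A "hm_group M (\<alpha> \<otimes> \<beta>)" "hm_act M (\<alpha> \<otimes> \<beta>)" by (rule rm[OF ab])
    have "lift ?V (\<lambda>n h. hm_act M (\<alpha> \<otimes> \<beta>) n ((f \<oplus>\<^bsub>hom_comp \<beta>\<^esub> f') h)) ?r =
      lift ?V (\<lambda>n h. hm_act M (\<alpha> \<otimes> \<beta>) n (f h) \<oplus>\<^bsub>?V\<^esub> hm_act M (\<alpha> \<otimes> \<beta>) n (f' h)) ?r"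
      by (rule lift_cong[OF bil_sum[OF p[OF fl] p[OF f'l]] r])
        (simp add: hom_comp_simps M.act_add_right lin_closed[OF fl] lin_closed[OF f'l])
    then show ?thesis
      using lift_sum[OF p[OF fl] p[OF f'l] r] by (simp add: hopf_action_def pair_with_def)
  qed
next
  fix \<alpha> m assume a: "\<alpha> \<Colon> G" and m: "m \<Colon> hm_group M \<alpha>"
  interpret M: right_module A "hm_group M \<alpha>" "hm_act M \<alpha>" by (rule hopf_modulesD(6)[OF M a])
  show "hopf_action M \<alpha> \<one> m hom_unit = m"
    unfolding hom_unit_base hopf_action_base[OF M a m A_one] by (rule M.act_one[OF m])
qed

subsection \<open>From graded modules to relative Hopf modules\<close>

definition "graded_act N r = (\<lambda>\<alpha>\<in>carrier G. \<lambda>m a. if m \<Colon> N \<alpha> \<and> a \<Colon> A then r \<alpha> \<one> m (hom_base a) else undefined)"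

text \<open>The tensor \<open>\<Sum> m e\<^sub>i\<^sup>* \<otimes> e\<^sub>i\<close>, whose contractions are the
  actions of functionals on \<open>m\<close>.\<close>

definition "graded_tensor N r \<alpha> \<beta> m =
  (let V = V (N (\<alpha> \<otimes> \<beta>)) (graded_act N r (\<alpha> \<otimes> \<beta>)); T = tensor k V (H (inv \<beta>))
   in lift T (\<lambda>u e. pure k V (H (inv \<beta>)) (r \<alpha> \<beta> m (scalar_hom (inv \<beta>) u)) e) (dual_basis k (H (inv \<beta>))))"

lemma scalar_hom_closed': "\<lbrakk>\<beta> \<Colon> G; u \<Colon> Hd (inv \<beta>)\<rbrakk> \<Longrightarrow> scalar_hom (inv \<beta>) u \<Colon> hom_comp \<beta>"
  using scalar_hom_closed[of "inv \<beta>" u] by simp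

text \<open>Scalars are central in the convolution ring, which makes the action of every homogeneous element
  \<open>k\<close>-linear.\<close>

lemma hom_mult_scalar:
  assumes b: "\<beta> \<Colon> G" and f: "f \<Colon> hom_comp \<beta>" and c: "c \<Colon> k"
  shows "hom_mult \<one> \<beta> (hom_base (c \<bullet> \<one>\<^bsub>A\<^esub>)) f = hom_mult \<beta> \<one> f (hom_base (c \<bullet> \<one>\<^bsub>A\<^esub>))"
    and "h \<Colon> H (inv \<beta>) \<Longrightarrow> hom_mult \<beta> \<one> f (hom_base (c \<bullet> \<one>\<^bsub>A\<^esub>)) h = c \<bullet> f h"
proof -
  note c1 = scalar_closed[OF c] note i = G_inv_closed[OF b] and fl = hom_comp_lin[OF b f]
  have r: "hom_mult \<beta> \<one> f (hom_base (c \<bullet> \<one>\<^bsub>A\<^esub>)) h = c \<bullet> f h" if "h \<Colon> H (inv \<beta>)" for h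
    unfolding hom_mult_base_right[OF b f c1 that] by (rule scalar_mult(2)[OF c lin_closed[OF fl that]])
  then show "h \<Colon> H (inv \<beta>) \<Longrightarrow> hom_mult \<beta> \<one> f (hom_base (c \<bullet> \<one>\<^bsub>A\<^esub>)) h = c \<bullet> f h" .
  show "hom_mult \<one> \<beta> (hom_base (c \<bullet> \<one>\<^bsub>A\<^esub>)) f = hom_mult \<beta> \<one> f (hom_base (c \<bullet> \<one>\<^bsub>A\<^esub>))"
  proof (rule hom_comp_eqI[where \<alpha> = \<beta>])
    show "hom_mult \<one> \<beta> (hom_base (c \<bullet> \<one>\<^bsub>A\<^esub>)) f \<Colon> hom_comp \<beta>"
      using hom_mult_closed[OF G_one b hom_base_closed[OF c1] f] b by simp
    show "hom_mult \<beta> \<one> f (hom_base (c \<bullet> \<one>\<^bsub>A\<^esub>)) \<Colon> hom_comp \<beta>"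
      using hom_mult_closed[OF b G_one f hom_base_closed[OF c1]] b by simp
    fix h assume h: "h \<Colon> H (inv \<beta>)"
    show "hom_mult \<one> \<beta> (hom_base (c \<bullet> \<one>\<^bsub>A\<^esub>)) f h = hom_mult \<beta> \<one> f (hom_base (c \<bullet> \<one>\<^bsub>A\<^esub>)) h"
      unfolding hom_mult_base_left[OF b f c1 h] r[OF h] twist_scaled[OF i fl h c A_one] twist_one[OF i fl h] by (rule refl)
  qed
qed

context
  fixes N :: "_ \<Rightarrow> 'm ring" and r
  assumes N: "K.component_module N r"
begin

lemmas cm = K.component_moduleD[OF N]

interpretation N: graded_pairing G N hom_comp N r by (rule K.component_moduleD(3)[OF N])

lemma graded_act_value: "\<lbrakk>\<alpha> \<Colon> G; m \<Colon> N \<alpha>; a \<Colon> A\<rbrakk> \<Longrightarrow> graded_act N r \<alpha> m a = r \<alpha> \<one> m (hom_base a)"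
  by (simp add: graded_act_def)

lemma graded_act_left:
  assumes a: "\<alpha> \<Colon> G" and b: "\<beta> \<Colon> G" and m: "m \<Colon> N \<alpha>" and f: "f \<Colon> hom_comp \<beta>" and c: "c \<Colon> A"
  shows "r \<alpha> \<beta> (graded_act N r \<alpha> m c) f = r \<alpha> \<beta> m (hom_mult \<one> \<beta> (hom_base c) f)"
  using cm(4)[OF a G_one b m hom_base_closed[OF c] f] a b by (simp add: graded_act_value m c)

lemma graded_act_right:
  assumes a: "\<alpha> \<Colon> G" and b: "\<beta> \<Colon> G" and m: "m \<Colon> N \<alpha>" and f: "f \<Colon> hom_comp \<beta>" and c: "c \<Colon> A"
  shows "graded_act N r (\<alpha> \<otimes> \<beta>) (r \<alpha> \<beta> m f) c = r \<alpha> \<beta> m (hom_mult \<beta> \<one> f (hom_base c))"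
  using cm(4)[OF a b G_one m f hom_base_closed[OF c]] a b N.pairing_closed[OF a b m f] by (simp add: graded_act_value c)

lemma graded_right_module:
  assumes a: "\<alpha> \<Colon> G" shows "right_module A (N \<alpha>) (graded_act N r \<alpha>)"
proof (intro right_module.intro right_module_axioms.intro A_ring N.L.component_group[OF a])
  note o = G_one and bc = hom_base_closed
  fix m c assume m: "m \<Colon> N \<alpha>" and c: "c \<Colon> A"
  have cl: "r \<alpha> \<one> m (hom_base c) \<Colon> N \<alpha>" using N.pairing_closed[OF a o m bc[OF c]] a by simp
  then show "graded_act N r \<alpha> m c \<Colon> N \<alpha>" by (simp add: graded_act_value a m c)
  show "graded_act N r \<alpha> (m \<oplus>\<^bsub>N \<alpha>\<^esub> n) c = graded_act N r \<alpha> m c \<oplus>\<^bsub>N \<alpha>\<^esub> graded_act N r \<alpha> n c" if n: "n \<Colon> N \<alpha>" for n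
    using N.pairing_add_left[OF a o m n bc[OF c]] a by (simp add: graded_act_value m n c N.L.component_ops)
  fix d assume d: "d \<Colon> A"
  have cd: "c \<oplus>\<^bsub>A\<^esub> d \<Colon> A" "c \<cdot> d \<Colon> A" using ring.ring_simprules(1,5)[OF A_ring c d] by auto
  show "graded_act N r \<alpha> m (c \<oplus>\<^bsub>A\<^esub> d) = graded_act N r \<alpha> m c \<oplus>\<^bsub>N \<alpha>\<^esub> graded_act N r \<alpha> m d"
    using N.pairing_add_right[OF a o m bc[OF c] bc[OF d]] a by (simp add: graded_act_value m c d cd K.base_add)
  show "graded_act N r \<alpha> m (c \<cdot> d) = graded_act N r \<alpha> (graded_act N r \<alpha> m c) d"
    using cm(4)[OF a o o m bc[OF c] bc[OF d]] a cl by (simp add: graded_act_value m c d cd K.base_mult)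
next
  fix m assume m: "m \<Colon> N \<alpha>"
  show "graded_act N r \<alpha> m \<one>\<^bsub>A\<^esub> = m"
    using cm(5)[OF a m] by (simp add: graded_act_value a m A_one hom_unit_base)
qed

abbreviation "W \<alpha> \<equiv> V (N \<alpha>) (graded_act N r \<alpha>)"

lemma W_module: "\<alpha> \<Colon> G \<Longrightarrow> module k (W \<alpha>)" by (rule underlying_is_module[OF graded_right_module])

lemma graded_lin_left:
  assumes a: "\<alpha> \<Colon> G" and b: "\<beta> \<Colon> G" and f: "f \<Colon> hom_comp \<beta>"
  shows "lin k (W \<alpha>) (W (\<alpha> \<otimes> \<beta>)) (\<lambda>m. r \<alpha> \<beta> m f)"
proof (rule linI[OF W_module[OF a] W_module[OF G_mult_closed[OF a b]]])
  fix m assume m: "m \<Colon> W \<alpha>"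
  show "r \<alpha> \<beta> m f \<Colon> W (\<alpha> \<otimes> \<beta>)" using N.pairing_closed[OF a b _ f] m by simp
  show "r \<alpha> \<beta> (m \<oplus>\<^bsub>W \<alpha>\<^esub> n) f = r \<alpha> \<beta> m f \<oplus>\<^bsub>W (\<alpha> \<otimes> \<beta>)\<^esub> r \<alpha> \<beta> n f" if "n \<Colon> W \<alpha>" for n
    using N.pairing_add_left[OF a b _ _ f] m that by simp
  show "r \<alpha> \<beta> (c \<odot>\<^bsub>W \<alpha>\<^esub> m) f = c \<odot>\<^bsub>W (\<alpha> \<otimes> \<beta>)\<^esub> r \<alpha> \<beta> m f" if c: "c \<Colon> k" for c
    using graded_act_left[OF a b _ f scalar_closed[OF c]] graded_act_right[OF a b _ f scalar_closed[OF c]] m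
    by (simp add: hom_mult_scalar(1)[OF b f c])
qed

text \<open>The components of the ring are plain groups, so linearity in the acting element is stated along a family.\<close>

lemma graded_lin_right:
  assumes a: "\<alpha> \<Colon> G" and b: "\<beta> \<Colon> G" and m: "m \<Colon> N \<alpha>" and X: "module k X"
    and c: "\<And>x. x \<Colon> X \<Longrightarrow> \<phi> x \<Colon> hom_comp \<beta>"
    and l: "\<And>h. h \<Colon> H (inv \<beta>) \<Longrightarrow> lin k X A (\<lambda>x. \<phi> x h)"
  shows "lin k X (W (\<alpha> \<otimes> \<beta>)) (\<lambda>x. r \<alpha> \<beta> m (\<phi> x))"
proof (rule linI[OF X W_module[OF G_mult_closed[OF a b]]])
  interpret X: module k X by (rule X)
  fix x assume x: "x \<Colon> X"
  show "r \<alpha> \<beta> m (\<phi> x) \<Colon> W (\<alpha> \<otimes> \<beta>)" using N.pairing_closed[OF a b m c[OF x]] by simp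
  show "r \<alpha> \<beta> m (\<phi> (x \<oplus>\<^bsub>X\<^esub> y)) = r \<alpha> \<beta> m (\<phi> x) \<oplus>\<^bsub>W (\<alpha> \<otimes> \<beta>)\<^esub> r \<alpha> \<beta> m (\<phi> y)" if y: "y \<Colon> X" for y
  proof -
    have "\<phi> (x \<oplus>\<^bsub>X\<^esub> y) = \<phi> x \<oplus>\<^bsub>hom_comp \<beta>\<^esub> \<phi> y"
      by (rule hom_comp_eqI[OF c[OF X.a_closed[OF x y]] hom_comp_add[OF b c[OF x] c[OF y]]])
        (simp add: hom_comp_simps lin_add[OF l] x y)
    then show ?thesis using N.pairing_add_right[OF a b m c[OF x] c[OF y]] by simp
  qed
  show "r \<alpha> \<beta> m (\<phi> (d \<odot>\<^bsub>X\<^esub> x)) = d \<odot>\<^bsub>W (\<alpha> \<otimes> \<beta>)\<^esub> r \<alpha> \<beta> m (\<phi> x)" if d: "d \<Colon> k" for d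
  proof -
    have "hom_mult \<beta> \<one> (\<phi> x) (hom_base (d \<bullet> \<one>\<^bsub>A\<^esub>)) \<Colon> hom_comp \<beta>"
      using hom_mult_closed[OF b G_one c[OF x] hom_base_closed[OF scalar_closed[OF d]]] b by simp
    then have "\<phi> (d \<odot>\<^bsub>X\<^esub> x) = hom_mult \<beta> \<one> (\<phi> x) (hom_base (d \<bullet> \<one>\<^bsub>A\<^esub>))"
      by (rule hom_comp_eqI[OF c[OF X.smult_closed[OF d x]]]) (simp add: hom_mult_scalar(2)[OF b c[OF x] d] lin_smult[OF l] d x)
    then show ?thesis using graded_act_right[OF a b m c[OF x] scalar_closed[OF d]] by simp
  qed
qed

lemma graded_tensor_bil:
  assumes a: "\<alpha> \<Colon> G" and b: "\<beta> \<Colon> G" and m: "m \<Colon> N \<alpha>"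
  shows "bil k (Hd (inv \<beta>)) (H (inv \<beta>)) (tensor k (W (\<alpha> \<otimes> \<beta>)) (H (inv \<beta>)))
    (\<lambda>u e. pure k (W (\<alpha> \<otimes> \<beta>)) (H (inv \<beta>)) (r \<alpha> \<beta> m (scalar_hom (inv \<beta>) u)) e)"
    and "lin k (Hd (inv \<beta>)) (W (\<alpha> \<otimes> \<beta>)) (\<lambda>u. r \<alpha> \<beta> m (scalar_hom (inv \<beta>) u))" (is ?l)
proof -
  note i = G_inv_closed[OF b] note Hb = H_module[OF i]
  show l: ?l
    by (rule graded_lin_right[OF a b m Hd_module[OF i] scalar_hom_closed'[OF b]])
      (simp_all add: scalar_hom_def lin_coeff[OF lin_eval[OF Hb] A_module A_one])
  show "bil k (Hd (inv \<beta>)) (H (inv \<beta>)) (tensor k (W (\<alpha> \<otimes> \<beta>)) (H (inv \<beta>)))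
    (\<lambda>u e. pure k (W (\<alpha> \<otimes> \<beta>)) (H (inv \<beta>)) (r \<alpha> \<beta> m (scalar_hom (inv \<beta>) u)) e)"
    by (rule bil_comp[OF pure_bil[OF W_module[OF G_mult_closed[OF a b]] Hb] l lin_id[OF Hb]])
qed

lemma graded_tensor_lin:
  assumes a: "\<alpha> \<Colon> G" and b: "\<beta> \<Colon> G"
  shows "lin k (W \<alpha>) (tensor k (W (\<alpha> \<otimes> \<beta>)) (H (inv \<beta>))) (graded_tensor N r \<alpha> \<beta>)"
  unfolding graded_tensor_def Let_def
  by (rule lin_lift_param[OF W_module[OF a] dual_basis(1)[OF H_fg[OF G_inv_closed[OF b]]] graded_tensor_bil(1)[OF a b]],
      simp, rule lin_pure_left[OF graded_lin_left[OF a b scalar_hom_closed'[OF b]] H_module[OF G_inv_closed[OF b]]])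

text \<open>The expansion \<open>f = \<Sum> e\<^sub>i\<^sup>* # f(e\<^sub>i)\<close> recovers the action of
  \<open>f\<close> from those of functionals and of \<open>A\<close>.\<close>

lemma pair_graded_tensor:
  assumes a: "\<alpha> \<Colon> G" and b: "\<beta> \<Colon> G" and m: "m \<Colon> N \<alpha>" and f: "f \<Colon> hom_comp \<beta>"
  shows "pair_with (N (\<alpha> \<otimes> \<beta>)) (graded_act N r (\<alpha> \<otimes> \<beta>)) f (graded_tensor N r \<alpha> \<beta> m) = r \<alpha> \<beta> m f"
proof -
  let ?b = "inv \<beta>" let ?c = "dual_basis k (H ?b)" let ?W = "W (\<alpha> \<otimes> \<beta>)" let ?T = "tensor k (Hd ?b) A"
  let ?p = "\<lambda>u e. pure k (Hd ?b) A u (f e)"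
  have ab: "\<alpha> \<otimes> \<beta> \<Colon> G" "?b \<Colon> G" using a b by simp_all
  note rm = graded_right_module[OF ab(1)] note fl = hom_comp_lin[OF b f]
  note c = dual_basis(1)[OF H_fg[OF ab(2)]] note bi = graded_tensor_bil[OF a b m]
  note sl = smash_eval_lift[OF ab(2) fl]
  have sc: "smash_to_hom \<beta> s \<Colon> hom_comp \<beta>" if "s \<Colon> ?T" for s
    unfolding smash_to_hom_def by (rule hom_compI[OF b smash_eval_lin_arg[OF ab(2) that]])
  have L: "lin k ?T ?W (\<lambda>s. r \<alpha> \<beta> m (smash_to_hom \<beta> s))"
    by (rule graded_lin_right[OF a b m tensor_is_module[OF Hd_module[OF ab(2)] A_module] sc])
      (simp_all add: smash_to_hom_def smash_eval_lin[OF ab(2)])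
  have "pair_with (N (\<alpha> \<otimes> \<beta>)) (graded_act N r (\<alpha> \<otimes> \<beta>)) f (graded_tensor N r \<alpha> \<beta> m) =
    lift ?W (\<lambda>u e. pair_with (N (\<alpha> \<otimes> \<beta>)) (graded_act N r (\<alpha> \<otimes> \<beta>)) f (pure k ?W (H ?b) (r \<alpha> \<beta> m (scalar_hom ?b u)) e)) ?c"
    unfolding graded_tensor_def Let_def by (rule lin_of_lift[OF pair_lin[OF rm fl] bi(1) c])
  also have "\<dots> = lift ?W (\<lambda>u e. r \<alpha> \<beta> m (smash_to_hom \<beta> (?p u e))) ?c"
  proof (rule lift_cong[OF _ c])
    show "bil k (Hd ?b) (H ?b) ?W (\<lambda>u e. r \<alpha> \<beta> m (smash_to_hom \<beta> (?p u e)))"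
      by (rule bilI[OF bilD(1,2)[OF sl(1)] W_module[OF ab(1)]]) (rule lin_comp[OF L bil_right[OF sl(1)]], assumption,
        rule lin_comp[OF L bil_left[OF sl(1)]])
    fix u e assume u: "u \<Colon> Hd ?b" and e: "e \<Colon> H ?b"
    note su = scalar_hom_closed'[OF b u] and fe = lin_closed[OF fl e]
    have p: "?p u e \<Colon> ?T" by (rule pure_closed[OF Hd_module[OF ab(2)] A_module u fe])
    have mc: "hom_mult \<beta> \<one> (scalar_hom ?b u) (hom_base (f e)) \<Colon> hom_comp \<beta>"
      using hom_mult_closed[OF b G_one su hom_base_closed[OF fe]] b by simp
    have eq: "hom_mult \<beta> \<one> (scalar_hom ?b u) (hom_base (f e)) = smash_to_hom \<beta> (?p u e)"
    proof (rule hom_comp_eqI[OF mc sc[OF p]])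
      fix h assume h: "h \<Colon> H ?b"
      show "hom_mult \<beta> \<one> (scalar_hom ?b u) (hom_base (f e)) h = smash_to_hom \<beta> (?p u e) h"
        unfolding hom_mult_base_right[OF b su fe h]
        using h by (simp add: scalar_hom_def smash_to_hom_def smash_eval_pure[OF ab(2) h u fe] scalar_mult dual_value[OF u h] fe)
    qed
    show "pair_with (N (\<alpha> \<otimes> \<beta>)) (graded_act N r (\<alpha> \<otimes> \<beta>)) f (pure k ?W (H ?b) (r \<alpha> \<beta> m (scalar_hom ?b u)) e) = r \<alpha> \<beta> m (smash_to_hom \<beta> (?p u e))"
      unfolding pair_with_def lift_pure[OF pair_bil[OF rm fl] lin_closed[OF bi(2) u] e] graded_act_right[OF a b m su fe] eq by (rule refl)
  qed
  also have "\<dots> = r \<alpha> \<beta> m (smash_to_hom \<beta> (lift ?T (\<lambda>u e. ?p u e) ?c))"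
    by (rule lin_of_lift[OF L sl(1) c, symmetric])
  also have "smash_to_hom \<beta> (lift ?T (\<lambda>u e. ?p u e) ?c) = f"
    by (rule hom_comp_eqI[OF sc[OF sl(2)] f]) (simp add: smash_to_hom_def sl(3))
  finally show ?thesis .
qed

end

text \<open>Restriction to the carriers gives the values outside that equality of objects demands.\<close>

definition "graded_hopf N r = \<lparr>hm_group = N, hm_act = graded_act N r,
  hm_coact = (\<lambda>\<alpha> \<beta>. if \<alpha> \<Colon> G \<and> \<beta> \<Colon> G
     then restrict (graded_tensor N r (\<alpha> \<otimes> \<beta>) (inv \<beta>)) (carrier (N (\<alpha> \<otimes> \<beta>))) else undefined)\<rparr>"

context
  fixes N :: "_ \<Rightarrow> 'm ring" and r
  assumes N: "K.component_module N r"
begin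

interpretation N: graded_pairing G N hom_comp N r by (rule K.component_moduleD(3)[OF N])

lemmas rm = graded_right_module[OF N] and Wm = W_module[OF N]

abbreviation "W' \<alpha> \<equiv> V (N \<alpha>) (graded_act N r \<alpha>)"
abbreviation "gact \<equiv> graded_act N r"
abbreviation "pairing \<alpha> \<equiv> pair_with (N \<alpha>) (gact \<alpha>)"
abbreviation "coact \<alpha> \<beta> \<equiv> graded_tensor N r (\<alpha> \<otimes> \<beta>) (inv \<beta>)"

lemma graded_coact_lin: "\<lbrakk>\<alpha> \<Colon> G; \<beta> \<Colon> G\<rbrakk> \<Longrightarrow> lin k (W' (\<alpha> \<otimes> \<beta>)) (tensor k (W' \<alpha>) (H \<beta>)) (coact \<alpha> \<beta>)"
  using graded_tensor_lin[OF N, of "\<alpha> \<otimes> \<beta>" "inv \<beta>"] by simp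

lemma pair_graded_coact:
  "\<lbrakk>\<alpha> \<Colon> G; \<beta> \<Colon> G; m \<Colon> N (\<alpha> \<otimes> \<beta>); f \<Colon> hom_comp (inv \<beta>)\<rbrakk> \<Longrightarrow>
   pairing \<alpha> f (coact \<alpha> \<beta> m) = r (\<alpha> \<otimes> \<beta>) (inv \<beta>) m f"
  using pair_graded_tensor[OF N, of "\<alpha> \<otimes> \<beta>" "inv \<beta>" m f] by simp

lemma graded_coact_counit:
  assumes a: "\<alpha> \<Colon> G" and m: "m \<Colon> N \<alpha>"
  shows "lift (W' \<alpha>) (\<lambda>n h. \<epsilon> h \<odot>\<^bsub>W' \<alpha>\<^esub> n) (coact \<alpha> \<one> m) = m"
proof -
  note o = G_one
  let ?e = "restrict \<epsilon> (carrier (H \<one>))"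
  have t: "coact \<alpha> \<one> m \<Colon> tensor k (W' \<alpha>) (H \<one>)"
    using lin_closed[OF graded_coact_lin[OF a o], of m] m a by simp
  have u: "scalar_hom \<one> ?e = hom_unit"
    unfolding scalar_hom_def hom_unit_def by (rule restrict_ext) simp
  have "lift (W' \<alpha>) (\<lambda>n h. \<epsilon> h \<odot>\<^bsub>W' \<alpha>\<^esub> n) (coact \<alpha> \<one> m) = lift (W' \<alpha>) (\<lambda>n h. ?e h \<odot>\<^bsub>W' \<alpha>\<^esub> n) (coact \<alpha> \<one> m)"
    by (rule lift_cong[OF bil_contract[OF Wm[OF a] H_module[OF o] smash_counit] t]) simp
  also have "\<dots> = r \<alpha> \<one> m hom_unit"
    unfolding contract_pair[OF rm[OF a] o smash_counit t] u
    using pair_graded_coact[OF a o, of m hom_unit] m a K.unit_closed by simp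
  also have "\<dots> = m" by (rule K.component_moduleD(5)[OF N a m])
  finally show ?thesis .
qed

text \<open>Contracted with \<open>f\<close>, both sides are the action of \<open>c # f\<close>, with
  \<open>c\<close> seen in degree \<open>e\<close>.\<close>

lemma graded_coact_act:
  assumes a: "\<alpha> \<Colon> G" and b: "\<beta> \<Colon> G" and m: "m \<Colon> N (\<alpha> \<otimes> \<beta>)" and c: "c \<Colon> A"
  shows "coact \<alpha> \<beta> (gact (\<alpha> \<otimes> \<beta>) m c) = diagonal_act (N \<alpha>) (gact \<alpha>) \<beta> (coact \<alpha> \<beta> m) c"
proof (rule pair_eqI[OF rm[OF a] b])
  have ab: "\<alpha> \<otimes> \<beta> \<Colon> G" "inv \<beta> \<Colon> G" using a b by simp_all
  note cl = lin_closed[OF graded_coact_lin[OF a b], simplified]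
  have mc: "gact (\<alpha> \<otimes> \<beta>) m c \<Colon> N (\<alpha> \<otimes> \<beta>)" by (rule right_module.act_closed[OF rm[OF ab(1)] m c])
  show "coact \<alpha> \<beta> (gact (\<alpha> \<otimes> \<beta>) m c) \<Colon> tensor k (W' \<alpha>) (H \<beta>)" by (rule cl[OF mc])
  show "diagonal_act (N \<alpha>) (gact \<alpha>) \<beta> (coact \<alpha> \<beta> m) c \<Colon> tensor k (W' \<alpha>) (H \<beta>)"
    by (rule diagonal_act(1)[OF rm[OF a] b cl[OF m] c])
  fix f assume f: "f \<Colon> hom_comp (inv \<beta>)"
  have fl: "lin k (H \<beta>) A f" using hom_comp_lin[OF ab(2) f] b by simp
  let ?g = "hom_mult \<one> (inv \<beta>) (hom_base c) f"
  have gc: "?g \<Colon> hom_comp (inv \<beta>)" using hom_mult_closed[OF G_one ab(2) hom_base_closed[OF c] f] b by simp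
  have gl: "lin k (H \<beta>) A ?g" using hom_comp_lin[OF ab(2) gc] b by simp
  have g: "twist \<beta> f h c = ?g h" if "h \<Colon> H \<beta>" for h
    using hom_mult_base_left[OF ab(2) f c, of h] that b by simp
  have "pairing \<alpha> f (coact \<alpha> \<beta> (gact (\<alpha> \<otimes> \<beta>) m c)) = r (\<alpha> \<otimes> \<beta>) (inv \<beta>) m ?g" (is "?l = _")
    unfolding pair_graded_coact[OF a b mc f] by (rule graded_act_left[OF N ab m f c])
  also have "\<dots> = pairing \<alpha> (\<lambda>x. twist \<beta> f x c) (coact \<alpha> \<beta> m)"
    unfolding pair_graded_coact[OF a b m gc, symmetric] by (rule pair_cong[OF rm[OF a] gl cl[OF m] g, symmetric])
  also have "\<dots> = pairing \<alpha> f (diagonal_act (N \<alpha>) (gact \<alpha>) \<beta> (coact \<alpha> \<beta> m) c)"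
    by (rule diagonal_act(2)[OF rm[OF a] b cl[OF m] c fl, symmetric])
  finally show "?l = \<dots>" .
qed

text \<open>Contracted with functionals \<open>f\<close> and \<open>g\<close>, the left side is the action of
  \<open>g # f\<close>, and the right side is the action of \<open>g\<close> followed by that of
  \<open>f\<close>.\<close>

lemma graded_coact_coassoc:
  assumes a: "\<alpha> \<Colon> G" and b: "\<beta> \<Colon> G" and c: "\<gamma> \<Colon> G" and m: "m \<Colon> N (\<alpha> \<otimes> \<beta> \<otimes> \<gamma>)"
    and D: "\<And>x. x \<Colon> N (\<alpha> \<otimes> \<beta>) \<Longrightarrow> D x = coact \<alpha> \<beta> x"
  shows "tensor_assoc k (W' \<alpha>) (H \<beta>) (H \<gamma>) (tensor_map k (W' \<alpha>) (tensor k (H \<beta>) (H \<gamma>)) id (\<Delta> \<beta> \<gamma>) (coact \<alpha> (\<beta> \<otimes> \<gamma>) m)) =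
    tensor_map k (tensor k (W' \<alpha>) (H \<beta>)) (H \<gamma>) D id (coact (\<alpha> \<otimes> \<beta>) \<gamma> m)" (is "?L = ?R")
proof -
  let ?b = "inv \<beta>" and ?c = "inv \<gamma>"
  have G: "\<alpha> \<otimes> \<beta> \<Colon> G" "\<beta> \<otimes> \<gamma> \<Colon> G" "\<alpha> \<otimes> \<beta> \<otimes> \<gamma> \<Colon> G" "?b \<Colon> G" "?c \<Colon> G" using a b c by simp_all
  have e: "\<alpha> \<otimes> (\<beta> \<otimes> \<gamma>) = \<alpha> \<otimes> \<beta> \<otimes> \<gamma>" "inv (\<beta> \<otimes> \<gamma>) = ?c \<otimes> ?b" using a b c by (simp_all add: G_assoc G_inv_mult)
  note Hb = H_module[OF b] and Hc = H_module[OF c] and Wa = Wm[OF a] and Hbc = H_module[OF G(2)]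
  have l1: "lin k (W' (\<alpha> \<otimes> \<beta> \<otimes> \<gamma>)) (tensor k (W' \<alpha>) (H (\<beta> \<otimes> \<gamma>))) (coact \<alpha> (\<beta> \<otimes> \<gamma>))"
    using graded_coact_lin[OF a G(2)] by (simp only: e)
  note l2 = graded_coact_lin[OF G(1) c] and l3 = lin_cong[OF graded_coact_lin[OF a b], simplified, OF D]
  note t1 = lin_closed[OF l1, simplified, OF m] and t2 = lin_closed[OF l2, simplified, OF m]
  have iW: "lin k (W' \<alpha>) (W' \<alpha>) id" and iH: "lin k (H \<gamma>) (H \<gamma>) id" using lin_id[OF Wa] lin_id[OF Hc] by (simp_all add: id_def)
  note tm1 = lin_tensor_map[OF iW comult_lin[OF b c]]
  show ?thesis
  proof (rule tensor_dual_eqI2[OF H_fg[OF b] H_fg[OF c] Wa])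
    show "?L \<Colon> tensor k (tensor k (W' \<alpha>) (H \<beta>)) (H \<gamma>)"
      by (rule lin_closed[OF tensor_assoc_lin[OF Wa Hb Hc] lin_closed[OF tm1 t1]])
    show "?R \<Colon> tensor k (tensor k (W' \<alpha>) (H \<beta>)) (H \<gamma>)" by (rule lin_closed[OF lin_tensor_map[OF l3 iH] t2])
    fix f g assume f: "f \<Colon> Hd \<beta>" and g: "g \<Colon> Hd \<gamma>"
    let ?f = "scalar_hom \<beta> f" and ?g = "scalar_hom \<gamma> g"
    note fc = scalar_hom_closed[OF b f] and gc = scalar_hom_closed[OF c g] and fl = scalar_hom_lin[OF b f] and gl = scalar_hom_lin[OF c g]
    let ?F = "hom_mult ?c ?b ?g ?f"
    let ?con = "\<lambda>u. lift (W' \<alpha>) (\<lambda>n h. f h \<odot>\<^bsub>W' \<alpha>\<^esub> n) u"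
    let ?q = "\<lambda>u z. g z \<odot>\<^bsub>W' \<alpha>\<^esub> ?con u"
    have Fc: "?F \<Colon> hom_comp (inv (\<beta> \<otimes> \<gamma>))" using hom_mult_closed[OF G(5,4) gc fc] by (simp only: e)
    have Fl: "lin k (H (\<beta> \<otimes> \<gamma>)) A ?F" using hom_comp_lin[OF G_inv_closed[OF G(2)] Fc] b c by simp
    have Fv: "?F w = lift A (\<lambda>x y. twist \<beta> ?f x (?g y)) (\<Delta> \<beta> \<gamma> w)" if "w \<Colon> H (\<beta> \<otimes> \<gamma>)" for w
      using hom_mult_value[OF G(5,4), of w] that b c by simp
    note con = lin_lift[OF bil_contract[OF Wa Hb f]] and bc = bil_contract[OF Wa Hb f]
    have q: "bil k (tensor k (W' \<alpha>) (H \<beta>)) (H \<gamma>) (W' \<alpha>) ?q" by (rule bil_comp[OF bil_contract[OF Wa Hc g] con lin_id[OF Hc]])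
    interpret M: right_module A "N \<alpha>" "gact \<alpha>" by (rule rm[OF a])
    note bi = act_bil[OF rm[OF a]]
    have "lift (W' \<alpha>) (\<lambda>u z. ?q u z) ?L = lift (W' \<alpha>) (\<lambda>n w. lift (W' \<alpha>) (\<lambda>h z. ?q (pure k (W' \<alpha>) (H \<beta>) n h) z) w)
       (tensor_map k (W' \<alpha>) (tensor k (H \<beta>) (H \<gamma>)) id (\<Delta> \<beta> \<gamma>) (coact \<alpha> (\<beta> \<otimes> \<gamma>) m))" (is "?l = _")
      by (rule lift_tensor_assoc[OF Wa Hb Hc q lin_closed[OF tm1 t1]])
    also have "\<dots> = lift (W' \<alpha>) (\<lambda>n w. lift (W' \<alpha>) (\<lambda>h z. ?q (pure k (W' \<alpha>) (H \<beta>) (id n) h) z) (\<Delta> \<beta> \<gamma> w)) (coact \<alpha> (\<beta> \<otimes> \<gamma>) m)"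
      by (rule lift_tensor_map[OF iW comult_lin[OF b c] bil_assoc[OF Wa Hb Hc q] t1])
    also have "\<dots> = pairing \<alpha> ?F (coact \<alpha> (\<beta> \<otimes> \<gamma>) m)"
      unfolding pair_with_def
    proof (rule lift_cong[OF pair_bil[OF rm[OF a] Fl] t1])
      fix n w assume n: "n \<Colon> W' \<alpha>" and w: "w \<Colon> H (\<beta> \<otimes> \<gamma>)"
      note d = comult_closed[OF b c w] and pb = product_bil[OF b fl gl]
      have "lift (W' \<alpha>) (\<lambda>h z. ?q (pure k (W' \<alpha>) (H \<beta>) (id n) h) z) (\<Delta> \<beta> \<gamma> w) =
        lift (W' \<alpha>) (\<lambda>x y. gact \<alpha> n (twist \<beta> ?f x (?g y))) (\<Delta> \<beta> \<gamma> w)" (is "?l = _")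
      proof (rule lift_cong[OF _ d])
        show "bil k (H \<beta>) (H \<gamma>) (W' \<alpha>) (\<lambda>x y. gact \<alpha> n (twist \<beta> ?f x (?g y)))"
          by (rule bilI[OF Hb Hc Wa]) (rule lin_comp[OF bil_right[OF bi n] bil_right[OF pb]], assumption,
            rule lin_comp[OF bil_right[OF bi n] bil_left[OF pb]])
        fix x y assume x: "x \<Colon> H \<beta>" and y: "y \<Colon> H \<gamma>"
        have s: "f x \<Colon> k" "g y \<Colon> k" by (rule dual_value[OF f x], rule dual_value[OF g y])
        have "twist \<beta> ?f x (?g y) = g y \<bullet> (f x \<bullet> \<one>\<^bsub>A\<^esub>)"
          using x y twist_scaled[OF b fl x s(2) A_one] twist_one[OF b fl x] by (simp add: scalar_hom_def)
        then show "?q (pure k (W' \<alpha>) (H \<beta>) (id n) x) y = gact \<alpha> n (twist \<beta> ?f x (?g y))"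
          using n x s by (simp add: lift_pure[OF bc, simplified] M.act_mult[symmetric] scalar_closed scalar_mult)
      qed
      also have "\<dots> = gact \<alpha> n (?F w)"
        unfolding Fv[OF w] by (rule lin_of_lift[OF bil_right[OF bi n] pb d, symmetric])
      finally show "?l = \<dots>" .
    qed
    also have "\<dots> = r (\<alpha> \<otimes> \<beta> \<otimes> \<gamma>) (?c \<otimes> ?b) m ?F"
      using pair_graded_coact[OF a G(2) _ Fc, of m] m by (simp only: e)
    also have "\<dots> = r (\<alpha> \<otimes> \<beta>) ?b (r (\<alpha> \<otimes> \<beta> \<otimes> \<gamma>) ?c m ?g) ?f"
      using K.component_moduleD(4)[OF N, of "\<alpha> \<otimes> \<beta> \<otimes> \<gamma>" ?c ?b m ?g ?f] G m gc fc by (simp only: G_cancel(1)[OF G(1) c])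
    also have "\<dots> = r (\<alpha> \<otimes> \<beta>) ?b (lift (W' (\<alpha> \<otimes> \<beta>)) (\<lambda>v z. g z \<odot>\<^bsub>W' (\<alpha> \<otimes> \<beta>)\<^esub> v) (coact (\<alpha> \<otimes> \<beta>) \<gamma> m)) ?f"
      by (simp only: contract_pair[OF rm[OF G(1)] c g t2] pair_graded_coact[OF G(1) c m gc])
    also have "\<dots> = lift (W' \<alpha>) (\<lambda>v z. r (\<alpha> \<otimes> \<beta>) ?b (g z \<odot>\<^bsub>W' (\<alpha> \<otimes> \<beta>)\<^esub> v) ?f) (coact (\<alpha> \<otimes> \<beta>) \<gamma> m)"
      using lin_of_lift[OF graded_lin_left[OF N G(1,4) fc] bil_contract[OF Wm[OF G(1)] Hc g] t2] a b by simp
    also have "\<dots> = lift (W' \<alpha>) (\<lambda>v z. ?q (D v) (id z)) (coact (\<alpha> \<otimes> \<beta>) \<gamma> m)"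
    proof (rule lift_cong[OF bil_comp[OF q l3 iH] t2])
      fix v z assume v: "v \<Colon> W' (\<alpha> \<otimes> \<beta>)" and z: "z \<Colon> H \<gamma>"
      have v': "v \<Colon> N (\<alpha> \<otimes> \<beta>)" using v by simp
      have "?con (D v) = r (\<alpha> \<otimes> \<beta>) ?b v ?f"
        unfolding D[OF v'] contract_pair[OF rm[OF a] b f lin_closed[OF graded_coact_lin[OF a b] v]] by (rule pair_graded_coact[OF a b v' fc])
      then show "r (\<alpha> \<otimes> \<beta>) ?b (g z \<odot>\<^bsub>W' (\<alpha> \<otimes> \<beta>)\<^esub> v) ?f = ?q (D v) (id z)"
        using lin_smult[OF graded_lin_left[OF N G(1,4) fc] dual_value[OF g z] v] a b by simp
    qed
    also have "\<dots> = lift (W' \<alpha>) (\<lambda>u z. ?q u z) ?R" by (rule lift_tensor_map[OF l3 iH q t2, symmetric])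
    finally show "?l = \<dots>" .
  qed
qed

theorem graded_hopf_closed: "graded_hopf N r \<in> hopf_modules G k H \<Delta> \<epsilon> A \<rho>"
proof -
  have hc: "hm_coact (graded_hopf N r) \<alpha> \<beta> m = coact \<alpha> \<beta> m" if "\<alpha> \<Colon> G" "\<beta> \<Colon> G" "m \<Colon> N (\<alpha> \<otimes> \<beta>)" for \<alpha> \<beta> m
    using that by (simp add: graded_hopf_def)
  have hg: "hm_group (graded_hopf N r) = N" "hm_act (graded_hopf N r) = graded_act N r" by (simp_all add: graded_hopf_def)
  show ?thesis
    unfolding hopf_modules_def hg mem_Collect_eq
  proof (intro conjI ballI)
    show "N \<in> extensional (carrier G)" by (rule K.component_moduleD(1)[OF N])
    show "graded_act N r \<in> extensional (carrier G)" by (simp add: graded_act_def)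
    show "extensional2 (carrier G) (carrier G) (hm_coact (graded_hopf N r))" by (simp add: graded_hopf_def extensional2_def)
    fix \<alpha> assume a: "\<alpha> \<Colon> G"
    show "plain_abelian_group (N \<alpha>)" by (rule K.component_moduleD(2)[OF N a])
    show "extensional2 (carrier (N \<alpha>)) (carrier A) (graded_act N r \<alpha>)" using a by (simp add: graded_act_def extensional2_def)
    show "right_module A (N \<alpha>) (graded_act N r \<alpha>)" by (rule rm[OF a])
    show "lift (W' \<alpha>) (\<lambda>n h. \<epsilon> h \<odot>\<^bsub>W' \<alpha>\<^esub> n) (hm_coact (graded_hopf N r) \<alpha> \<one> m) = m" if m: "m \<Colon> N \<alpha>" for m
      using graded_coact_counit[OF a m] hc[OF a G_one, of m] a m by simp
    fix \<beta> assume b: "\<beta> \<Colon> G"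
    show "hm_coact (graded_hopf N r) \<alpha> \<beta> \<in> extensional (carrier (N (\<alpha> \<otimes> \<beta>)))" using a b by (simp add: graded_hopf_def)
    show "hm_coact (graded_hopf N r) \<alpha> \<beta> \<in> linear_maps k (W' (\<alpha> \<otimes> \<beta>)) (tensor k (W' \<alpha>) (H \<beta>))"
      using lin_cong[OF graded_coact_lin[OF a b], of "hm_coact (graded_hopf N r) \<alpha> \<beta>"] hc[OF a b] by (simp add: lin_def)
    show "hm_coact (graded_hopf N r) \<alpha> \<beta> (graded_act N r (\<alpha> \<otimes> \<beta>) m c) =
      (let T = tensor k (W' \<alpha>) (H \<beta>) in lift T (\<lambda>n h. lift T
         (\<lambda>b h'. pure k (W' \<alpha>) (H \<beta>) (graded_act N r \<alpha> n b) (h \<otimes>\<^bsub>H \<beta>\<^esub> h')) (\<rho> \<beta> c)) (hm_coact (graded_hopf N r) \<alpha> \<beta> m))"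
      if m: "m \<Colon> N (\<alpha> \<otimes> \<beta>)" and c: "c \<Colon> A" for m c
      using graded_coact_act[OF a b m c] right_module.act_closed[OF rm[OF G_mult_closed[OF a b]] m c]
      by (simp only: hc[OF a b] m diagonal_act_def)
    fix \<gamma> m assume c: "\<gamma> \<Colon> G" and m: "m \<Colon> N (\<alpha> \<otimes> \<beta> \<otimes> \<gamma>)"
    have e: "hm_coact (graded_hopf N r) \<alpha> (\<beta> \<otimes> \<gamma>) m = coact \<alpha> (\<beta> \<otimes> \<gamma>) m" "hm_coact (graded_hopf N r) (\<alpha> \<otimes> \<beta>) \<gamma> m = coact (\<alpha> \<otimes> \<beta>) \<gamma> m"
      using hc[of \<alpha> "\<beta> \<otimes> \<gamma>" m] hc[of "\<alpha> \<otimes> \<beta>" \<gamma> m] a b c m by (simp_all add: G_assoc)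
    show "tensor_assoc k (W' \<alpha>) (H \<beta>) (H \<gamma>) (tensor_map k (W' \<alpha>) (tensor k (H \<beta>) (H \<gamma>)) id (\<Delta> \<beta> \<gamma>) (hm_coact (graded_hopf N r) \<alpha> (\<beta> \<otimes> \<gamma>) m)) =
      tensor_map k (tensor k (W' \<alpha>) (H \<beta>)) (H \<gamma>) (hm_coact (graded_hopf N r) \<alpha> \<beta>) id (hm_coact (graded_hopf N r) (\<alpha> \<otimes> \<beta>) \<gamma> m)"
      unfolding e by (rule graded_coact_coassoc[OF a b c m hc[OF a b]])
  qed
qed

lemma hopf_action_graded_hopf:
  assumes a: "\<alpha> \<Colon> G" and b: "\<beta> \<Colon> G" and m: "m \<Colon> N \<alpha>" and f: "f \<Colon> hom_comp \<beta>"
  shows "hopf_action (graded_hopf N r) \<alpha> \<beta> m f = r \<alpha> \<beta> m f"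
  using pair_graded_tensor[OF N a b m f] a b m by (simp add: hopf_action_def graded_hopf_def)

end

text \<open>Both records are \<open>undefined\<close> outside the domains, so they are equal and not merely
  isomorphic.\<close>

lemma graded_hopf_hopf_action:
  assumes M: "M \<in> hopf_modules G k H \<Delta> \<epsilon> A \<rho>"
  shows "graded_hopf (hm_group M) (hopf_action M) = M"
proof -
  let ?N = "hm_group M" let ?r = "hopf_action M"
  note D = hopf_modulesD[OF M] note cm = hopf_component_module[OF M]
  have act: "graded_act ?N ?r = hm_act M"
  proof (rule extensionalityI[OF _ D(2)])
    show "graded_act ?N ?r \<in> extensional (carrier G)" by (simp add: graded_act_def)
    fix \<alpha> assume a: "\<alpha> \<Colon> G"
    show "graded_act ?N ?r \<alpha> = hm_act M \<alpha>"
      by (intro ext) (use D(5)[OF a] hopf_action_base[OF M a] a in \<open>auto simp: graded_act_def extensional2_def\<close>)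
  qed
  have "hm_coact (graded_hopf ?N ?r) \<alpha> \<beta> m = hm_coact M \<alpha> \<beta> m" for \<alpha> \<beta> m
  proof (cases "\<alpha> \<Colon> G \<and> \<beta> \<Colon> G")
    case False
    then show ?thesis using D(3) by (auto simp: graded_hopf_def extensional2_def)
  next
    case True
    then have a: "\<alpha> \<Colon> G" and b: "\<beta> \<Colon> G" by auto
    show ?thesis
    proof (cases "m \<Colon> ?N (\<alpha> \<otimes> \<beta>)")
      case False
      then show ?thesis using D(7)[OF a b] a b by (simp add: graded_hopf_def extensional_def)
    next
      case m: True
      have "graded_tensor ?N ?r (\<alpha> \<otimes> \<beta>) (inv \<beta>) m = hm_coact M \<alpha> \<beta> m"
      proof (rule pair_eqI[OF D(6)[OF a] b])
        show "graded_tensor ?N ?r (\<alpha> \<otimes> \<beta>) (inv \<beta>) m \<Colon> tensor k (hm_module A M \<alpha>) (H \<beta>)"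
          using lin_closed[OF graded_coact_lin[OF cm a b]] m by (simp add: act)
        show "hm_coact M \<alpha> \<beta> m \<Colon> tensor k (hm_module A M \<alpha>) (H \<beta>)" using lin_closed[OF D(8)[OF a b]] m by simp
        fix f assume "f \<Colon> hom_comp (inv \<beta>)"
        then show "pair_with (?N \<alpha>) (hm_act M \<alpha>) f (graded_tensor ?N ?r (\<alpha> \<otimes> \<beta>) (inv \<beta>) m) = pair_with (?N \<alpha>) (hm_act M \<alpha>) f (hm_coact M \<alpha> \<beta> m)"
          using pair_graded_coact[OF cm a b m] a b by (simp add: act hopf_action_def)
      qed
      then show ?thesis using a b m by (simp add: graded_hopf_def)
    qed
  qed
  then have "hm_coact (graded_hopf ?N ?r) = hm_coact M" by (intro ext)
  then show ?thesis using act by (intro hopf_module.equality) (simp_all add: graded_hopf_def)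
qed

end

context finite_comodule_algebra
begin

subsection \<open>The isomorphism of categories\<close>

lemma right_linear_lin:
  assumes "right_module A N act" "right_module A N' act'" "f \<in> right_linear_maps A N act N' act'"
  shows "lin k (V N act) (V N' act') f"
  by (rule linI[OF underlying_is_module[OF assms(1)] underlying_is_module[OF assms(2)]])
    (use assms(3) in \<open>auto simp: right_linear_maps_def scalar_closed\<close>)

lemma pair_map:
  assumes M: "right_module A N act" and M': "right_module A N' act'"
    and f: "f \<in> right_linear_maps A N act N' act'" and g: "lin k X A g" and t: "t \<Colon> tensor k (V N act) X"
  shows "pair_with N' act' g (tensor_map k (V N' act') X f id t) = f (pair_with N act g t)"
proof -
  note fl = right_linear_lin[OF M M' f]
  note X = lin_dom[OF g] note p = pair_bil[OF M g] and p' = pair_bil[OF M' g]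
  have iX: "lin k X X id" using lin_id[OF X] by (simp add: id_def)
  have "pair_with N' act' g (tensor_map k (V N' act') X f id t) = lift (V N' act') (\<lambda>n h. act' (f n) (g (id h))) t" (is "?l = _")
    unfolding pair_with_def by (rule lift_tensor_map[OF fl iX p' t])
  also have "\<dots> = lift (V N' act') (\<lambda>n h. f (act n (g h))) t"
  proof (rule lift_cong[OF _ t])
    show "bil k (V N act) X (V N' act') (\<lambda>n h. f (act n (g h)))"
      by (rule bilI[OF bilD(1,2)[OF p] underlying_is_module[OF M']]) (rule lin_comp[OF fl bil_right[OF p]], assumption,
        rule lin_comp[OF fl bil_left[OF p]])
    show "act' (f n) (g (id h)) = f (act n (g h))" if "n \<Colon> V N act" "h \<Colon> X" for n h
      using f that lin_closed[OF g] by (simp add: right_linear_maps_def)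
  qed
  also have "\<dots> = f (pair_with N act g t)" unfolding pair_with_def by (rule lin_of_lift[OF fl p t, symmetric])
  finally show "?l = \<dots>" .
qed

abbreviation "hopf_cat \<equiv> hopf_module_category G k H \<Delta> \<epsilon> A \<rho>"
abbreviation "hopf_objs \<equiv> hopf_modules G k H \<Delta> \<epsilon> A \<rho>"

text \<open>Tested against functionals, compatibility with the coactions is compatibility with the actions, and
  \<open>A\<close>-linearity is the case of degree \<open>e\<close>.\<close>

lemma hopf_hom:
  assumes M: "M \<in> hopf_objs" and M': "M' \<in> hopf_objs"
  shows "Hom hopf_cat M M' = K.component_homs (hm_group M) (hopf_action M) (hm_group M') (hopf_action M')" (is "?H = ?C")
proof (rule equalityI; rule subsetI)
  note D = hopf_modulesD[OF M] and D' = hopf_modulesD[OF M']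
  have mp: "lin k (H \<beta>) A r \<Longrightarrow> m \<Colon> hm_group M (\<alpha> \<otimes> \<beta>) \<Longrightarrow> pair_with (hm_group M' \<alpha>) (hm_act M' \<alpha>) r
      (tensor_map k (hm_module A M' \<alpha>) (H \<beta>) f id (hm_coact M \<alpha> \<beta> m)) = f (pair_with (hm_group M \<alpha>) (hm_act M \<alpha>) r (hm_coact M \<alpha> \<beta> m))"
    if "\<alpha> \<Colon> G" "\<beta> \<Colon> G" "f \<in> right_linear_maps A (hm_group M \<alpha>) (hm_act M \<alpha>) (hm_group M' \<alpha>) (hm_act M' \<alpha>)" for \<alpha> \<beta> f r m
    by (rule pair_map[OF D(6)[OF that(1)] D'(6)[OF that(1)] that(3) _ lin_closed[OF D(8)[OF that(1,2)]]]) simp_all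
  {
    fix f assume "f \<in> ?H"
    then have fP: "f \<in> (\<Pi>\<^sub>E \<alpha>\<in>carrier G. right_linear_maps A (hm_group M \<alpha>) (hm_act M \<alpha>) (hm_group M' \<alpha>) (hm_act M' \<alpha>))"
      and fc: "\<And>\<alpha> \<beta> m. \<lbrakk>\<alpha> \<Colon> G; \<beta> \<Colon> G; m \<Colon> hm_group M (\<alpha> \<otimes> \<beta>)\<rbrakk> \<Longrightarrow>
            hm_coact M' \<alpha> \<beta> (f (\<alpha> \<otimes> \<beta>) m) = tensor_map k (hm_module A M' \<alpha>) (H \<beta>) (f \<alpha>) id (hm_coact M \<alpha> \<beta> m)"
      by (simp_all add: hopf_module_category_def)
    have fr: "f \<alpha> \<in> right_linear_maps A (hm_group M \<alpha>) (hm_act M \<alpha>) (hm_group M' \<alpha>) (hm_act M' \<alpha>)" if "\<alpha> \<Colon> G" for \<alpha>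
      by (rule PiE_mem[OF fP that])
    show "f \<in> ?C"
      unfolding K.component_homs_def
    proof (intro CollectI conjI ballI)
      show "f \<in> (\<Pi>\<^sub>E \<alpha>\<in>carrier G. carrier (hm_group M \<alpha>) \<rightarrow>\<^sub>E carrier (hm_group M' \<alpha>))"
        using fr fP by (simp add: right_linear_maps_def PiE_iff)
      fix \<alpha> assume a: "\<alpha> \<Colon> G"
      show "f \<alpha> (x \<oplus>\<^bsub>hm_group M \<alpha>\<^esub> y) = f \<alpha> x \<oplus>\<^bsub>hm_group M' \<alpha>\<^esub> f \<alpha> y" if "x \<Colon> hm_group M \<alpha>" "y \<Colon> hm_group M \<alpha>" for x y
        using fr[OF a] that by (simp add: right_linear_maps_def)
      fix \<beta> m r assume b: "\<beta> \<Colon> G" and m: "m \<Colon> hm_group M \<alpha>" and r: "r \<Colon> hom_comp \<beta>"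
      have ab: "\<alpha> \<otimes> \<beta> \<Colon> G" "inv \<beta> \<Colon> G" using a b by simp_all
      show "f (\<alpha> \<otimes> \<beta>) (hopf_action M \<alpha> \<beta> m r) = hopf_action M' \<alpha> \<beta> (f \<alpha> m) r"
        using mp[OF ab fr[OF ab(1)] hom_comp_lin[OF b r], of m] fc[OF ab, of m] a b m by (simp add: hopf_action_def)
    qed
  next
    fix f assume f: "f \<in> ?C"
    note fD = K.component_homsD[OF f]
    have fr: "f \<alpha> \<in> right_linear_maps A (hm_group M \<alpha>) (hm_act M \<alpha>) (hm_group M' \<alpha>) (hm_act M' \<alpha>)" if a: "\<alpha> \<Colon> G" for \<alpha>
    proof -
      have "f \<alpha> (hm_act M \<alpha> m c) = hm_act M' \<alpha> (f \<alpha> m) c" if "m \<Colon> hm_group M \<alpha>" "c \<Colon> A" for m c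
        using fD(3)[OF a G_one that(1) hom_base_closed[OF that(2)]] a that fD(1)[OF a that(1)]
        by (simp add: hopf_action_base[OF M a] hopf_action_base[OF M' a])
      moreover have "f \<alpha> \<in> carrier (hm_group M \<alpha>) \<rightarrow>\<^sub>E carrier (hm_group M' \<alpha>)"
        using f a by (simp add: K.component_homs_def PiE_iff)
      ultimately show ?thesis by (simp add: right_linear_maps_def fD(2)[OF a])
    qed
    have "hm_coact M' \<alpha> \<beta> (f (\<alpha> \<otimes> \<beta>) m) = tensor_map k (hm_module A M' \<alpha>) (H \<beta>) (f \<alpha>) id (hm_coact M \<alpha> \<beta> m)"
      if a: "\<alpha> \<Colon> G" and b: "\<beta> \<Colon> G" and m: "m \<Colon> hm_group M (\<alpha> \<otimes> \<beta>)" for \<alpha> \<beta> m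
    proof (rule pair_eqI[OF D'(6)[OF a] b])
      have ab: "\<alpha> \<otimes> \<beta> \<Colon> G" "inv \<beta> \<Colon> G" using a b by simp_all
      have t: "hm_coact M \<alpha> \<beta> m \<Colon> tensor k (hm_module A M \<alpha>) (H \<beta>)" using lin_closed[OF D(8)[OF a b]] m by simp
      have iH: "lin k (H \<beta>) (H \<beta>) id" using lin_id[OF H_module[OF b]] by (simp add: id_def)
      have fl: "lin k (hm_module A M \<alpha>) (hm_module A M' \<alpha>) (f \<alpha>)" by (rule right_linear_lin[OF D(6)[OF a] D'(6)[OF a] fr[OF a]])
      show "hm_coact M' \<alpha> \<beta> (f (\<alpha> \<otimes> \<beta>) m) \<Colon> tensor k (hm_module A M' \<alpha>) (H \<beta>)"
        using lin_closed[OF D'(8)[OF a b]] fD(1)[OF ab(1) m] by simp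
      show "tensor_map k (hm_module A M' \<alpha>) (H \<beta>) (f \<alpha>) id (hm_coact M \<alpha> \<beta> m) \<Colon> tensor k (hm_module A M' \<alpha>) (H \<beta>)"
        by (rule lin_closed[OF lin_tensor_map[OF fl iH] t])
      fix r assume r: "r \<Colon> hom_comp (inv \<beta>)"
      have rl: "lin k (H \<beta>) A r" using hom_comp_lin[OF ab(2) r] b by simp
      show "pair_with (hm_group M' \<alpha>) (hm_act M' \<alpha>) r (hm_coact M' \<alpha> \<beta> (f (\<alpha> \<otimes> \<beta>) m)) =
        pair_with (hm_group M' \<alpha>) (hm_act M' \<alpha>) r (tensor_map k (hm_module A M' \<alpha>) (H \<beta>) (f \<alpha>) id (hm_coact M \<alpha> \<beta> m))"
        using fD(3)[OF ab m r] a b unfolding mp[OF a b fr[OF a] rl m] by (simp add: hopf_action_def)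
    qed
    moreover have "f \<in> extensional (carrier G)" using f by (simp add: K.component_homs_def PiE_iff)
    ultimately show "f \<in> ?H" using fr by (simp add: hopf_module_category_def PiE_iff)
  }
qed

lemma category_hopf: "category hopf_cat"
proof -
  have obj: "Obj hopf_cat = hopf_objs" by (simp add: hopf_module_category_def)
  have id: "Ident hopf_cat M = (\<lambda>\<alpha>\<in>carrier G. \<lambda>m\<in>carrier (hm_group M \<alpha>). m)" for M by (simp add: hopf_module_category_def)
  have comp: "Comp hopf_cat L M N g f = (\<lambda>\<alpha>\<in>carrier G. compose (carrier (hm_group L \<alpha>)) (g \<alpha>) (f \<alpha>))" for L M N f g
    by (simp add: hopf_module_category_def)
  have HD: "\<lbrakk>\<alpha> \<Colon> G; x \<Colon> hm_group M \<alpha>\<rbrakk> \<Longrightarrow> f \<alpha> x \<Colon> hm_group N \<alpha>"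
    "\<alpha> \<Colon> G \<Longrightarrow> f \<alpha> \<in> extensional (carrier (hm_group M \<alpha>))" "f \<in> extensional (carrier G)"
    if "M \<in> hopf_objs" "N \<in> hopf_objs" "f \<in> Hom hopf_cat M N" for M N f \<alpha> x
    using that(3) unfolding hopf_hom[OF that(1,2)] K.component_homs_def by (auto simp: PiE_iff)
  show ?thesis
  proof (rule category.intro; unfold obj)
    fix M assume M: "M \<in> hopf_objs"
    interpret P: graded_pairing G "hm_group M" hom_comp "hm_group M" "hopf_action M"
      by (rule K.component_moduleD(3)[OF hopf_component_module[OF M]])
    show "Ident hopf_cat M \<in> Hom hopf_cat M M"
      unfolding id hopf_hom[OF M M] K.component_homs_def
      by (simp add: P.pairing_closed P.L.component_ops PiE_iff)
  next
    fix L M N f g assume L: "L \<in> hopf_objs" and M: "M \<in> hopf_objs" and N: "N \<in> hopf_objs"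
      and f: "f \<in> Hom hopf_cat L M" and g: "g \<in> Hom hopf_cat M N"
    interpret P: graded_pairing G "hm_group L" hom_comp "hm_group L" "hopf_action L"
      by (rule K.component_moduleD(3)[OF hopf_component_module[OF L]])
    note fD = K.component_homsD[OF f[unfolded hopf_hom[OF L M]]] and gD = K.component_homsD[OF g[unfolded hopf_hom[OF M N]]]
    show "Comp hopf_cat L M N g f \<in> Hom hopf_cat L N"
      unfolding comp hopf_hom[OF L N] K.component_homs_def
      by (simp add: P.pairing_closed P.L.component_ops PiE_iff compose_def fD gD)
  next
    fix M N f assume M: "M \<in> hopf_objs" and N: "N \<in> hopf_objs" and f: "f \<in> Hom hopf_cat M N"
    note fD = HD[OF M N f]
    show "Comp hopf_cat M N N (Ident hopf_cat N) f = f"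
      unfolding comp id
      by (rule extensionalityI[OF restrict_extensional fD(3)], simp, rule extensionalityI[OF compose_extensional fD(2)])
        (simp_all add: compose_def fD)
    show "Comp hopf_cat M M N f (Ident hopf_cat M) = f"
      unfolding comp id
      by (rule extensionalityI[OF restrict_extensional fD(3)], simp, rule extensionalityI[OF compose_extensional fD(2)])
        (simp_all add: compose_def)
  next
    fix L M N P f g h assume L: "L \<in> hopf_objs" and M: "M \<in> hopf_objs" and f: "f \<in> Hom hopf_cat L M"
    show "Comp hopf_cat L N P h (Comp hopf_cat L M N g f) = Comp hopf_cat L M P (Comp hopf_cat M N P h g) f"
      unfolding comp by (rule restrict_ext) (simp add: compose_def HD[OF L M f] cong: restrict_cong)
  qed
qed

lemma graded_hopf_cong:
  fixes N :: "_ \<Rightarrow> 'm ring"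
  assumes N: "K.component_module N r"
    and eq: "\<And>\<alpha> \<beta> m f. \<lbrakk>\<alpha> \<Colon> G; \<beta> \<Colon> G; m \<Colon> N \<alpha>; f \<Colon> hom_comp \<beta>\<rbrakk> \<Longrightarrow> r' \<alpha> \<beta> m f = r \<alpha> \<beta> m f"
  shows "graded_hopf N r' = graded_hopf N r"
proof -
  have act: "graded_act N r' = graded_act N r"
    unfolding graded_act_def by (intro restrict_ext ext) (simp add: eq hom_base_closed)
  have t: "graded_tensor N r' \<alpha> \<beta> m = graded_tensor N r \<alpha> \<beta> m" if a: "\<alpha> \<Colon> G" and b: "\<beta> \<Colon> G" and m: "m \<Colon> N \<alpha>" for \<alpha> \<beta> m
    unfolding graded_tensor_def Let_def act
    by (rule lift_cong[OF graded_tensor_bil(1)[OF N a b m] dual_basis(1)[OF H_fg[OF G_inv_closed[OF b]]]])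
      (simp add: eq[OF a b m scalar_hom_closed'[OF b]])
  have c: "hm_coact (graded_hopf N r') \<alpha> \<beta> = hm_coact (graded_hopf N r) \<alpha> \<beta>" for \<alpha> \<beta>
    by (cases "\<alpha> \<Colon> G \<and> \<beta> \<Colon> G") (auto simp: graded_hopf_def t intro!: restrict_ext)
  then have "hm_coact (graded_hopf N r') = hm_coact (graded_hopf N r)" by (intro ext) simp
  then show ?thesis by (intro hopf_module.equality) (simp_all add: graded_hopf_def act)
qed

theorem hopf_modules_graded_modules:
  "isomorphic_categories
     (hopf_module_category G k H \<Delta> \<epsilon> A \<rho> :: ((_, _, _, 'm) hopf_module, _) category)
     (graded_module_category G (graded_ring_of G hom_comp hom_mult hom_unit hom_base) :: ((_, _, 'm) graded_module, _) category)"
proof (rule isomorphic_categoriesI[where F = "\<lambda>M. \<lparr>gm_group = hm_group M, gm_act = K.total_action (hm_group M) (hopf_action M)\<rparr>"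
    and E = "\<lambda>Y. graded_hopf (gm_group Y) (K.component_action Y)"
    and F\<^sub>1 = "\<lambda>X X' f. K.sum_map (hm_group X) f" and E\<^sub>1 = "\<lambda>Y Y' g. K.component_map (gm_group Y) g"])
  let ?C = "hopf_cat :: ((_, _, _, 'm) hopf_module, _) category"
  let ?D = "graded_module_category G K.R :: ((_, _, 'm) graded_module, _) category"
  let ?F = "\<lambda>M. \<lparr>gm_group = hm_group M, gm_act = K.total_action (hm_group M) (hopf_action M)\<rparr>"
  have obj: "Obj ?C = hopf_objs" "Obj ?D = graded_modules G K.R" by (simp_all add: hopf_module_category_def graded_module_category_def Let_def)
  note cm = hopf_component_module and gm = K.component_module_of_graded
  show "category ?C" by (rule category_hopf)
  show "category ?D" by (rule category_graded_modules)
  {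
    fix X assume "X \<in> Obj ?C"
    then have X: "X \<in> hopf_objs" by (simp only: obj)
    show "?F X \<in> Obj ?D" unfolding obj by (rule K.graded_module_of_components[OF cm[OF X]])
    have "graded_hopf (hm_group X) (K.component_action (?F X)) = graded_hopf (hm_group X) (hopf_action X)"
      by (rule graded_hopf_cong[OF cm[OF X]]) (rule K.component_action_total[OF cm[OF X]])
    then show "graded_hopf (gm_group (?F X)) (K.component_action (?F X)) = X"
      by (simp add: graded_hopf_hopf_action[OF X])
    show "K.sum_map (hm_group X) (Ident ?C X) = Ident ?D (?F X)"
      using K.sum_map_identity[OF cm[OF X]] by (simp add: hopf_module_category_def graded_module_category_def Let_def)
    fix X' f assume "X' \<in> Obj ?C" and f: "f \<in> Hom ?C X X'"
    then have X': "X' \<in> hopf_objs" by (simp only: obj)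
    note f = f[unfolded hopf_hom[OF X X']]
    show "K.sum_map (hm_group X) f \<in> Hom ?D (?F X) (?F X')" by (rule K.sum_map_hom(1)[OF cm[OF X] cm[OF X'] f])
    show "K.component_map (gm_group (?F X)) (K.sum_map (hm_group X) f) = f"
      using K.component_map_sum_map[OF cm[OF X] cm[OF X'] f] by simp
    fix Z g assume "Z \<in> Obj ?C" and g: "g \<in> Hom ?C X' Z"
    then have Z: "Z \<in> hopf_objs" by (simp only: obj)
    note g = g[unfolded hopf_hom[OF X' Z]]
    show "K.sum_map (hm_group X) (Comp ?C X X' Z g f) = Comp ?D (?F X) (?F X') (?F Z) (K.sum_map (hm_group X') g) (K.sum_map (hm_group X) f)"
      using K.sum_map_compose[OF cm[OF X] cm[OF X'] cm[OF Z] f g] by (simp add: hopf_module_category_def graded_module_category_def Let_def)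
  next
    fix Y assume "Y \<in> Obj ?D"
    then have Y: "Y \<in> graded_modules G K.R" by (simp only: obj)
    note c = gm(1)[OF Y]
    let ?E = "\<lambda>Y. graded_hopf (gm_group Y) (K.component_action Y)"
    have E: "?E Y \<in> hopf_objs" by (rule graded_hopf_closed[OF c])
    then show "?E Y \<in> Obj ?C" by (simp only: obj)
    have hg: "hm_group (?E Y) = gm_group Y" for Y by (simp add: graded_hopf_def)
    note ha = hopf_action_graded_hopf[OF c]
    have "K.total_action (gm_group Y) (hopf_action (?E Y)) = K.total_action (gm_group Y) (K.component_action Y)"
      by (rule K.total_action_cong[OF c cm[OF E, unfolded hg] ha])
    then show "?F (?E Y) = Y" using gm(3)[OF Y] by (intro graded_module.equality) (simp_all add: hg)
    fix Y' g assume "Y' \<in> Obj ?D" and g: "g \<in> Hom ?D Y Y'"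
    then have Y': "Y' \<in> graded_modules G K.R" by (simp only: obj)
    note c' = gm(1)[OF Y'] note h = K.component_map_hom[OF Y Y' g]
    show "K.component_map (gm_group Y) g \<in> Hom ?C (?E Y) (?E Y')"
      unfolding hopf_hom[OF E graded_hopf_closed[OF c']] hg
      by (rule K.component_homs_cong[OF ha[symmetric] hopf_action_graded_hopf[OF c', symmetric] h(1)])
    show "K.sum_map (hm_group (?E Y)) (K.component_map (gm_group Y) g) = g" unfolding hg by (rule h(2))
  }
qed

end

theorem theorem10p6:
  fixes G :: "('g, 'x) monoid_scheme" and k :: "('k, 'z) ring_scheme"
    and H :: "'g \<Rightarrow> ('k, 'h) module"
    and \<Delta> :: "'g \<Rightarrow> 'g \<Rightarrow> 'h \<Rightarrow> ('h \<times> 'h \<Rightarrow>\<^sub>0 int) set" and \<epsilon> :: "'h \<Rightarrow> 'k"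
    and S :: "'g \<Rightarrow> 'h \<Rightarrow> 'h"
    and A :: "('k, 'a) module" and \<rho> :: "'g \<Rightarrow> 'a \<Rightarrow> ('a \<times> 'h \<Rightarrow>\<^sub>0 int) set"
  assumes "hopf_group_coalgebra G k H \<Delta> \<epsilon> S"
    and "homogeneously_finite G k H"
    and "comodule_algebra G k H \<Delta> \<epsilon> S A \<rho>"
  shows "graded_A_ring_isomorphic G A
           (left_dual_ring G A (comodule_algebra_coring k H \<Delta> \<epsilon> A \<rho>))
           (smash_product G k H \<Delta> \<epsilon> A \<rho>) \<and>
         isomorphic_categories
           (hopf_module_category G k H \<Delta> \<epsilon> A \<rho> ::
              (('g, 'a, 'h, 'm) hopf_module, 'g \<Rightarrow> 'm \<Rightarrow> 'm) category)
           (graded_module_category G (smash_product G k H \<Delta> \<epsilon> A \<rho>) ::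
              (('g, 'g \<Rightarrow> (('h \<Rightarrow> 'k) \<times> 'a \<Rightarrow>\<^sub>0 int) set, 'm) graded_module,
               ('g \<Rightarrow> 'm) \<Rightarrow> 'g \<Rightarrow> 'm) category)"
proof
  interpret finite_comodule_algebra G k H \<Delta> \<epsilon> S A \<rho>
    by (intro finite_comodule_algebra.intro finite_comodule_algebra_axioms.intro assms(2,3))
  note smash = graded_A_ring_isomorphic_sym[OF smash_product_isomorphic]
  show "graded_A_ring_isomorphic G A (left_dual_ring G A (comodule_algebra_coring k H \<Delta> \<epsilon> A \<rho>)) (smash_product G k H \<Delta> \<epsilon> A \<rho>)"
    by (rule graded_A_ring_isomorphic_trans[OF left_dual_ring_isomorphic smash])
  show "isomorphic_categories (hopf_module_category G k H \<Delta> \<epsilon> A \<rho> :: (('g, 'a, 'h, 'm) hopf_module, 'g \<Rightarrow> 'm \<Rightarrow> 'm) category)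
      (graded_module_category G (smash_product G k H \<Delta> \<epsilon> A \<rho>) ::
              (('g, 'g \<Rightarrow> (('h \<Rightarrow> 'k) \<times> 'a \<Rightarrow>\<^sub>0 int) set, 'm) graded_module, ('g \<Rightarrow> 'm) \<Rightarrow> 'g \<Rightarrow> 'm) category)"
    by (rule isomorphic_categories_trans[OF hopf_modules_graded_modules restriction_of_scalars[OF smash]])
qed

end
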